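(* Let $G$ be a compact Lie group with complexification $G^c$, and let $M$ be a compactification of $G^c$ with finite isotropy subgroup. Assume $M$ is endowed with a $G$-invariant Kähler structure. Consider the $J$-volume functional $\mathrm{Vol}_J$ restricted to the set of $G$-orbits within the dense open $G^c$-orbit. 1. The condition $\mathrm{Ric}<0$ contradicts the compactness of $M$ (i.e. $\mathrm{Ric}<0$ cannot hold on $M$). 2. If $\mathrm{Ric}>0$ then $-\log\mathrm{Vol}_J$ is strictly convex. This implies that $1/\mathrm{Vol}_J$ is strictly convex so, by compactness, $\mathrm{Vol}_J$ has a unique critical point: its maximum. This point (the corresponding $G$-orbit) is also a critical point for $\mathrm{Vol}_J$, viewed as a functional on the space of all totally real submanifolds of $M$.
   Context: Complexification: for a compact Lie group $G$ with Lie algebra $\mathfrak{g}$, $G^c$ is the complex Lie group containing $G$ that is universal for continuous homomorphisms of $G$ into complex Lie groups (each extends uniquely to a holomorphic homomorphism of $G^c$). Its Lie algebra is $\mathfrak{g}\otimes\mathbb{C}=\mathfrak{g}\oplus i\mathfrak{g}$, and $(X,g)\mapsto\exp(iX)g$ is a diffeomorphism $\mathfrak{g}\times G\to G^c$. Compactification: $M$ is a compact complex manifold with a right action of $G^c$ by complex automorphisms having a dense open $G^c$-orbit. "With finite isotropy subgroup" means that the isotropy subgroup in $G^c$ of a point of the dense open orbit is finite; in particular $n:=\dim_{\mathbb{C}}M=\dim_{\mathbb{C}}G^c=\dim_{\mathbb{R}}G$, and the $G$-orbits in the dense open $G^c$-orbit are totally real $n$-dimensional submanifolds. Totally real: a real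 $n$-dimensional submanifold $L$ of a complex $n$-manifold $(M,J)$ is totally real if $T_pM=T_pL\oplus J(T_pL)$ for all $p\in L$. $J$-volume: let $h$ be the Hermitian metric of the Kähler structure ($h=g-i\omega$, with $g$ the Riemannian metric and $\omega$ the Kähler form). For an oriented totally real $L$, and a positive local frame $v_1,\dots,v_n$ of $TL$ with dual frame $v_i^*$, set $\mathrm{vol}_J=\sqrt{\det h(v_i,v_j)}\,v_1^*\wedge\dots\wedge v_n^*$ (independent of the frame), and for compact $L$ set $\mathrm{Vol}_J(L)=\int_L\mathrm{vol}_J$. Convexity: geodesics in $G^c/G$ are the curves $t\mapsto[k\exp(itX)]$ with $k\in G^c$, $X\in\mathfrak{g}$. A function on $G^c/G$ is (strictly) convex if it is (strictly) convex along each such curve (with $X\neq0$ in the strict case). Fixing a point $p$ in the dense open orbit, the $G$-orbits in it are the $pkG$, $k\in G^c$, and functionals on this set of orbits are viewed as functions $[k]\mapsto \mathrm{Vol}_J(pkG)$ etc. on $G^c/G$; convexity does not depend on $p$. Critical points on the set of orbits are understood via this function. Critical point in the space of all totally real submanifolds means that the first variation of $\mathrm{Vol}_J$ vanishes for every smooth variation through totally real submanifolds. $\mathrm{Ric}<0$ (resp. $>0$) means that the Ricci curvature of the Kähler metric on $M$ is negative (resp. positive) definite at each point.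
   Formalization: Vol_J of a G-orbit pkG is taken over G (orbit counted with the order of the isotropy group of pk in G), since the plain volume jumps and is not convex when that order varies; and dim G ≥ 1 is assumed, since Ric<0 is vacuous for finite G. *)

theory Defs
  imports "HOL-Analysis.Analysis" "HOL-Algebra.Coset"
begin

section \<open>Model spaces\<close>

text \<open>Charts take values in a normed space with a multiplication by the imaginary unit.
  The space \<open>complex ^ 'n\<close> is the model for the manifolds of the fixed dimension \<open>CARD('n)\<close>.
  Bounded complex sequences contain complex subspaces of every finite dimension; they are the model
  where all dimensions must be quantified over at once (the universal property of the
  complexification).\<close>

class complex_model = real_normed_vector +
  fixes imul :: "'a \<Rightarrow> 'a"
  assumes imul_add: "imul (x + y) = imul x + imul y"
    and imul_scaleR: "imul (r *\<^sub>R x) = r *\<^sub>R imul x"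
    and imul_imul: "imul (imul x) = - x"
    and norm_imul: "norm (imul x) = norm x"

instantiation complex :: complex_model
begin
definition "imul (z :: complex) = \<i> * z"
instance
  by standard (auto simp: imul_complex_def algebra_simps norm_mult)
end

instantiation vec :: (complex_model, finite) complex_model
begin
definition "imul (x :: 'a ^ 'b) = (\<chi> i. imul (x $ i))"
instance
  by standard (auto simp: imul_vec_def vec_eq_iff imul_add imul_scaleR imul_imul norm_imul norm_vec_def)
end

instantiation prod :: (complex_model, complex_model) complex_model
begin
definition "imul (x :: 'a \<times> 'b) = (imul (fst x), imul (snd x))"
instance
  by standard (auto simp: imul_prod_def imul_add imul_scaleR imul_imul norm_imul norm_prod_def)
end

lemma continuous_on_imul: "continuous_on UNIV (imul :: 'a::complex_model \<Rightarrow> 'a)"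
proof -
  have "bounded_linear (imul :: 'a \<Rightarrow> 'a)"
    by (rule bounded_linear_intro[where K = 1]) (auto simp: imul_add imul_scaleR norm_imul)
  then show ?thesis
    by (rule linear_continuous_on)
qed

lemma imul_bcontfun: "(\<lambda>x. imul (apply_bcontfun f x)) \<in> bcontfun"
  for f :: "'a::topological_space \<Rightarrow>\<^sub>C 'b::complex_model"
proof -
  have f: "apply_bcontfun f \<in> bcontfun"
    by (rule apply_bcontfun)
  have "continuous_on UNIV (\<lambda>x. imul (apply_bcontfun f x))"
    using f continuous_on_compose2[OF continuous_on_imul, of UNIV "apply_bcontfun f"]
    by (auto simp: bcontfun_def)
  moreover have "bounded (range (\<lambda>x. imul (apply_bcontfun f x)))"
    using f by (auto simp: bcontfun_def bounded_iff norm_imul)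
  ultimately show ?thesis
    by (simp add: bcontfun_def)
qed

instantiation bcontfun :: (topological_space, complex_model) complex_model
begin
definition "imul (f :: 'a \<Rightarrow>\<^sub>C 'b) = Bcontfun (\<lambda>x. imul (apply_bcontfun f x))"
instance
proof
  have app: "apply_bcontfun (imul f) x = imul (apply_bcontfun f x)" for f :: "'a \<Rightarrow>\<^sub>C 'b" and x
    by (simp add: imul_bcontfun_def Bcontfun_inverse[OF imul_bcontfun])
  fix x y :: "'a \<Rightarrow>\<^sub>C 'b" and r :: real
  show "imul (x + y) = imul x + imul y"
    by (rule bcontfun_eqI) (simp add: app imul_add plus_bcontfun.rep_eq)
  show "imul (r *\<^sub>R x) = r *\<^sub>R imul x"
    by (rule bcontfun_eqI) (simp add: app imul_scaleR scaleR_bcontfun.rep_eq)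
  show "imul (imul x) = - x"
    by (rule bcontfun_eqI) (simp add: app imul_imul uminus_bcontfun.rep_eq)
  show "norm (imul x) = norm x"
    by (simp add: norm_bcontfun_def dist_bcontfun_def app norm_imul zero_bcontfun.rep_eq)
qed
end

definition complex_model_space :: "'e::complex_model set \<Rightarrow> bool" where
  "complex_model_space V \<longleftrightarrow>
     subspace V \<and> imul ` V \<subseteq> V \<and> (\<exists>B. finite B \<and> span B = V)"

section \<open>Smooth and holomorphic maps between model spaces\<close>

primrec cont_diff :: "nat \<Rightarrow> 'a::real_normed_vector set \<Rightarrow> ('a \<Rightarrow> 'b::real_normed_vector) \<Rightarrow> bool" where
  "cont_diff 0 S f \<longleftrightarrow> continuous_on S f"
| "cont_diff (Suc k) S f \<longleftrightarrow>
     (\<forall>x\<in>S. f differentiable (at x)) \<and> (\<forall>v. cont_diff k S (\<lambda>x. frechet_derivative f (at x) v))"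

text \<open>Used for finite-dimensional domains and open sets only.\<close>

definition smooth_on :: "'a::real_normed_vector set \<Rightarrow> ('a \<Rightarrow> 'b::real_normed_vector) \<Rightarrow> bool" where
  "smooth_on S f \<longleftrightarrow> (\<forall>k. cont_diff k S f)"

text \<open>Complex differentiability on a relatively open subset \<open>S\<close> of the complex space \<open>V\<close>; only the
  restriction of the derivative to \<open>V\<close> is determined by the function.\<close>

definition complex_diff_on ::
    "'e::complex_model set \<Rightarrow> 'e set \<Rightarrow> ('e \<Rightarrow> 'f::complex_model) \<Rightarrow> bool" where
  "complex_diff_on V S f \<longleftrightarrow>
     (\<forall>x\<in>S. \<exists>D. (f has_derivative D) (at x within S) \<and> (\<forall>v\<in>V. D (imul v) = imul (D v)))"

section \<open>Complex manifolds\<close>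

type_synonym ('a, 'e) chart = "'a set \<times> ('a \<Rightarrow> 'e)"

definition chart_image :: "('a, 'e) chart \<Rightarrow> 'e set" where
  "chart_image c = snd c ` fst c"

definition chart_inv :: "('a, 'e) chart \<Rightarrow> 'e \<Rightarrow> 'a" where
  "chart_inv c = inv_into (fst c) (snd c)"

record ('a, 'e) cmfd =
  mtop :: "'a topology"
  model :: "'e set"
  atlas :: "('a, 'e) chart set"

definition is_chart :: "'a topology \<Rightarrow> 'e::topological_space set \<Rightarrow> ('a, 'e) chart \<Rightarrow> bool" where
  "is_chart X V c \<longleftrightarrow>
     openin X (fst c) \<and> openin (top_of_set V) (chart_image c) \<and>
     homeomorphic_map (subtopology X (fst c)) (top_of_set (chart_image c)) (snd c)"

definition holomorphic_map ::
    "('a, 'e::complex_model) cmfd \<Rightarrow> ('b, 'f::complex_model) cmfd \<Rightarrow> ('a \<Rightarrow> 'b) \<Rightarrow> bool" where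
  "holomorphic_map N N' f \<longleftrightarrow>
     continuous_map (mtop N) (mtop N') f \<and>
     (\<forall>c\<in>atlas N. \<forall>c'\<in>atlas N'.
        complex_diff_on (model N) (snd c ` {x \<in> fst c. f x \<in> fst c'}) (snd c' \<circ> f \<circ> chart_inv c))"

text \<open>The last clause says that all changes of charts are holomorphic.\<close>

definition complex_manifold :: "('a, 'e::complex_model) cmfd \<Rightarrow> bool" where
  "complex_manifold N \<longleftrightarrow>
     complex_model_space (model N) \<and> Hausdorff_space (mtop N) \<and> second_countable (mtop N) \<and>
     (\<forall>c\<in>atlas N. is_chart (mtop N) (model N) c) \<and>
     (\<Union>c\<in>atlas N. fst c) = topspace (mtop N) \<and>
     holomorphic_map N N id"

definition prod_cmfd :: "('a, 'e) cmfd \<Rightarrow> ('b, 'f) cmfd \<Rightarrow> ('a \<times> 'b, 'e \<times> 'f) cmfd" where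
  "prod_cmfd N N' =
     \<lparr>mtop = prod_topology (mtop N) (mtop N'), model = model N \<times> model N',
      atlas = {(fst c \<times> fst c', map_prod (snd c) (snd c')) | c c'. c \<in> atlas N \<and> c' \<in> atlas N'}\<rparr>"

section \<open>Complex Lie groups and the complexification of a compact Lie group\<close>

definition complex_lie_group :: "'k monoid \<Rightarrow> ('k, 'e::complex_model) cmfd \<Rightarrow> bool" where
  "complex_lie_group K N \<longleftrightarrow>
     group K \<and> complex_manifold N \<and> topspace (mtop N) = carrier K \<and>
     holomorphic_map (prod_cmfd N N) N (\<lambda>(x, y). x \<otimes>\<^bsub>K\<^esub> y) \<and>
     holomorphic_map N N (\<lambda>x. inv\<^bsub>K\<^esub> x)"

text \<open>The Lie algebra is the tangent space at the identity, written in the coordinates of a fixed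
  chart at the identity, hence equal to \<open>complex ^ 'n\<close>, with complex structure \<^term>\<open>imul\<close>.\<close>

definition one_chart :: "'k monoid \<Rightarrow> ('k, 'e) cmfd \<Rightarrow> ('k, 'e) chart" where
  "one_chart K N = (SOME c. c \<in> atlas N \<and> \<one>\<^bsub>K\<^esub> \<in> fst c)"

definition one_param_subgroup ::
    "'k monoid \<Rightarrow> ('k, complex ^ 'n) cmfd \<Rightarrow> complex ^ 'n \<Rightarrow> (real \<Rightarrow> 'k) \<Rightarrow> bool" where
  "one_param_subgroup K N X \<gamma> \<longleftrightarrow>
     continuous_map euclideanreal (mtop N) \<gamma> \<and> (\<forall>s t. \<gamma> (s + t) = \<gamma> s \<otimes>\<^bsub>K\<^esub> \<gamma> t) \<and>
     ((snd (one_chart K N) \<circ> \<gamma>) has_vector_derivative X) (at 0)"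

definition lie_exp :: "'k monoid \<Rightarrow> ('k, complex ^ 'n) cmfd \<Rightarrow> complex ^ 'n \<Rightarrow> 'k" where
  "lie_exp K N X = (THE \<gamma>. one_param_subgroup K N X \<gamma>) 1"

text \<open>The Lie algebra of a closed subgroup \<open>G\<close>.\<close>

definition lie_algebra :: "'k monoid \<Rightarrow> ('k, complex ^ 'n) cmfd \<Rightarrow> 'k set \<Rightarrow> (complex ^ 'n) set" where
  "lie_algebra K N G = {X. \<forall>t::real. lie_exp K N (t *\<^sub>R X) \<in> G}"

text \<open>Smooth local parametrizations of a subset \<open>L\<close> of a complex manifold of complex dimension
  \<open>CARD('n)\<close>, viewed as a real submanifold of real dimension \<open>CARD('n)\<close>.\<close>

definition local_param ::
    "('a, complex ^ 'n) cmfd \<Rightarrow> 'a set \<Rightarrow> (real ^ 'n) set \<Rightarrow> (real ^ 'n \<Rightarrow> 'a) \<Rightarrow> bool" where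
  "local_param N L U \<psi> \<longleftrightarrow>
     open U \<and> openin (subtopology (mtop N) L) (\<psi> ` U) \<and>
     homeomorphic_map (top_of_set U) (subtopology (mtop N) (\<psi> ` U)) \<psi> \<and>
     (\<forall>c\<in>atlas N.
        smooth_on {x \<in> U. \<psi> x \<in> fst c} (snd c \<circ> \<psi>) \<and>
        (\<forall>x\<in>U. \<psi> x \<in> fst c \<longrightarrow> inj (frechet_derivative (snd c \<circ> \<psi>) (at x))))"

text \<open>Every complex Lie group has at most the cardinality of the continuum and a finite dimension,
  so it has an isomorphic copy whose carrier consists of real numbers and whose charts take values in
  a finite-dimensional complex subspace of the bounded sequences. Quantifying over these copies is
  quantifying over all complex Lie groups.\<close>

definition universal_complexification ::
    "'k monoid \<Rightarrow> ('k, complex ^ 'n) cmfd \<Rightarrow> 'k set \<Rightarrow> bool" where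
  "universal_complexification K N G \<longleftrightarrow>
     (\<forall>(H :: real monoid) (P :: (real, nat \<Rightarrow>\<^sub>C complex) cmfd) \<phi>.
        complex_lie_group H P \<and>
        continuous_map (subtopology (mtop N) G) (mtop P) \<phi> \<and> \<phi> \<in> hom (K\<lparr>carrier := G\<rparr>) H \<longrightarrow>
        (\<exists>\<Phi>. holomorphic_map N P \<Phi> \<and> \<Phi> \<in> hom K H \<and> (\<forall>g\<in>G. \<Phi> g = \<phi> g) \<and>
           (\<forall>\<Phi>'. holomorphic_map N P \<Phi>' \<and> \<Phi>' \<in> hom K H \<and> (\<forall>g\<in>G. \<Phi>' g = \<phi> g) \<longrightarrow>
              (\<forall>x\<in>carrier K. \<Phi>' x = \<Phi> x))))"

text \<open>The map \<open>(X, g) \<mapsto> exp(i X) g\<close> is a diffeomorphism from the product of the Lie algebra of \<open>G\<close>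
  with \<open>G\<close> onto the complex group. Smoothness of the map is tested in a local parametrization
  of \<open>G\<close> and a linear parametrization of the Lie algebra. Since \<open>G\<close> is an embedded submanifold of
  the complex group and its Lie algebra is a linear subspace, smoothness of the inverse is tested in
  the ambient spaces.\<close>

definition polar_map ::
    "'k monoid \<Rightarrow> ('k, complex ^ 'n) cmfd \<Rightarrow> (complex ^ 'n) \<times> 'k \<Rightarrow> 'k" where
  "polar_map K N = (\<lambda>(X, g). lie_exp K N (imul X) \<otimes>\<^bsub>K\<^esub> g)"

definition polar_diffeo :: "'k monoid \<Rightarrow> ('k, complex ^ 'n) cmfd \<Rightarrow> 'k set \<Rightarrow> bool" where
  "polar_diffeo K N G \<longleftrightarrow>
     homeomorphic_map
       (prod_topology (top_of_set (lie_algebra K N G)) (subtopology (mtop N) G)) (mtop N)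
       (polar_map K N) \<and>
     (\<forall>U \<psi> (l :: real ^ 'n \<Rightarrow> complex ^ 'n). \<forall>c\<in>atlas N.
        local_param N G U \<psi> \<and> linear l \<and> range l \<subseteq> lie_algebra K N G \<longrightarrow>
        smooth_on {(a, x). x \<in> U \<and> polar_map K N (l a, \<psi> x) \<in> fst c}
          (\<lambda>(a, x). snd c (polar_map K N (l a, \<psi> x)))) \<and>
     (let q = inv_into (lie_algebra K N G \<times> G) (polar_map K N) in
        \<forall>c\<in>atlas N. smooth_on (chart_image c) (fst \<circ> q \<circ> chart_inv c) \<and>
          (\<forall>c'\<in>atlas N. smooth_on (snd c ` {x \<in> fst c. snd (q x) \<in> fst c'})
             (snd c' \<circ> snd \<circ> q \<circ> chart_inv c)))"

text \<open>A compact subgroup of a Lie group is a compact Lie group in a unique way, and conversely the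
  inclusion of a compact Lie group into its complexification is a topological embedding. So a compact
  Lie group is given together with its complexification as a compact subgroup \<open>G\<close>. The
  last two clauses are the standard description of the complexification, which accompanies its
  universal property.\<close>

definition complexification :: "'k monoid \<Rightarrow> ('k, complex ^ 'n) cmfd \<Rightarrow> 'k set \<Rightarrow> bool" where
  "complexification K N G \<longleftrightarrow>
     complex_lie_group K N \<and> model N = UNIV \<and>
     subgroup G K \<and> compactin (mtop N) G \<and>
     universal_complexification K N G \<and>
     subspace (lie_algebra K N G) \<and>
     (\<forall>Z. \<exists>!(X, Y). X \<in> lie_algebra K N G \<and> Y \<in> lie_algebra K N G \<and> Z = X + imul Y) \<and>
     polar_diffeo K N G"

section \<open>Compactifications\<close>

definition holomorphic_right_action ::
    "'k monoid \<Rightarrow> ('k, 'e::complex_model) cmfd \<Rightarrow> ('m, 'f::complex_model) cmfd \<Rightarrow>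
     ('m \<Rightarrow> 'k \<Rightarrow> 'm) \<Rightarrow> bool" where
  "holomorphic_right_action K N M act \<longleftrightarrow>
     holomorphic_map (prod_cmfd M N) M (\<lambda>(x, k). act x k) \<and>
     (\<forall>x\<in>topspace (mtop M). act x \<one>\<^bsub>K\<^esub> = x \<and>
        (\<forall>k\<in>carrier K. \<forall>l\<in>carrier K. act (act x k) l = act x (k \<otimes>\<^bsub>K\<^esub> l)))"

text \<open>A compactification of the group, together with a point \<open>p\<close> of the dense open orbit whose
  isotropy group is finite.\<close>

definition compactification ::
    "'k monoid \<Rightarrow> ('k, complex ^ 'n) cmfd \<Rightarrow> ('m, complex ^ 'n) cmfd \<Rightarrow>
     ('m \<Rightarrow> 'k \<Rightarrow> 'm) \<Rightarrow> 'm \<Rightarrow> bool" where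
  "compactification K N M act p \<longleftrightarrow>
     complex_manifold M \<and> model M = UNIV \<and> compact_space (mtop M) \<and>
     holomorphic_right_action K N M act \<and>
     p \<in> topspace (mtop M) \<and>
     openin (mtop M) (act p ` carrier K) \<and>
     mtop M closure_of (act p ` carrier K) = topspace (mtop M) \<and>
     finite {k \<in> carrier K. act p k = p}"

section \<open>Kaehler metrics\<close>

text \<open>A metric assigns to a chart \<open>c\<close>, a point \<open>y\<close> of \<^term>\<open>chart_image c\<close> and two
  vectors their inner product in the coordinates of \<open>c\<close>. The following says that \<open>f\<close>
  preserves it; for the identity this is the transformation law under changes of charts.\<close>

type_synonym ('m, 'n) metric =
  "('m, complex ^ 'n) chart \<Rightarrow> complex ^ 'n \<Rightarrow> complex ^ 'n \<Rightarrow> complex ^ 'n \<Rightarrow> real"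

definition preserves_metric ::
    "('m, complex ^ 'n) cmfd \<Rightarrow> ('m, 'n) metric \<Rightarrow> ('m \<Rightarrow> 'm) \<Rightarrow> bool" where
  "preserves_metric M g f \<longleftrightarrow>
     (\<forall>c\<in>atlas M. \<forall>c'\<in>atlas M. \<forall>x\<in>fst c. f x \<in> fst c' \<longrightarrow>
        (let D = frechet_derivative (snd c' \<circ> f \<circ> chart_inv c) (at (snd c x)) in
          \<forall>u v. g c' (snd c' (f x)) (D u) (D v) = g c (snd c x) u v))"

definition kaehler_form ::
    "(complex ^ 'n \<Rightarrow> complex ^ 'n \<Rightarrow> complex ^ 'n \<Rightarrow> real) \<Rightarrow>
     complex ^ 'n \<Rightarrow> complex ^ 'n \<Rightarrow> complex ^ 'n \<Rightarrow> real" where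
  "kaehler_form b y u v = b y (imul u) v"

definition kaehler_metric :: "('m, complex ^ 'n) cmfd \<Rightarrow> ('m, 'n) metric \<Rightarrow> bool" where
  "kaehler_metric M g \<longleftrightarrow>
     preserves_metric M g id \<and>
     (\<forall>c\<in>atlas M.
        (\<forall>u v. smooth_on (chart_image c) (\<lambda>y. g c y u v)) \<and>
        (\<forall>y\<in>chart_image c.
           bilinear (g c y) \<and> (\<forall>u v. g c y u v = g c y v u) \<and> (\<forall>v. v \<noteq> 0 \<longrightarrow> 0 < g c y v v) \<and>
           (\<forall>u v. g c y (imul u) (imul v) = g c y u v) \<and>
           (\<forall>u v w.
              frechet_derivative (\<lambda>y. kaehler_form (g c) y v w) (at y) u +
              frechet_derivative (\<lambda>y. kaehler_form (g c) y w u) (at y) v +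
              frechet_derivative (\<lambda>y. kaehler_form (g c) y u v) (at y) w = 0)))"

text \<open>The Hermitian metric \<open>g - i \<omega>\<close>.\<close>

definition hermitian ::
    "(complex ^ 'n \<Rightarrow> complex ^ 'n \<Rightarrow> complex ^ 'n \<Rightarrow> real) \<Rightarrow>
     complex ^ 'n \<Rightarrow> complex ^ 'n \<Rightarrow> complex ^ 'n \<Rightarrow> complex" where
  "hermitian b y u v = complex_of_real (b y u v) - \<i> * complex_of_real (kaehler_form b y u v)"

text \<open>Levi-Civita connection \<open>\<nabla>\<^sub>u v = D\<^sub>u v + \<Gamma>(u, v)\<close>, Riemann tensor
  \<open>R(u, v) w = \<nabla>\<^sub>u \<nabla>\<^sub>v w - \<nabla>\<^sub>v \<nabla>\<^sub>u w\<close> on constant vector fields, and Ricci tensor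
  \<open>Ric(v, w) = tr (u \<mapsto> R(u, v) w)\<close> of a Riemannian metric \<open>b\<close> on an open subset of a
  Euclidean space. The metric \<open>b\<close> is not the inner product \<open>\<bullet>\<close>, which only serves to take the
  trace.\<close>

definition christoffel :: "('e::euclidean_space \<Rightarrow> 'e \<Rightarrow> 'e \<Rightarrow> real) \<Rightarrow> 'e \<Rightarrow> 'e \<Rightarrow> 'e \<Rightarrow> 'e" where
  "christoffel b y u v =
     (THE z. \<forall>w. b y z w =
        (frechet_derivative (\<lambda>y. b y v w) (at y) u + frechet_derivative (\<lambda>y. b y u w) (at y) v
         - frechet_derivative (\<lambda>y. b y u v) (at y) w) / 2)"

definition riemann :: "('e::euclidean_space \<Rightarrow> 'e \<Rightarrow> 'e \<Rightarrow> real) \<Rightarrow> 'e \<Rightarrow> 'e \<Rightarrow> 'e \<Rightarrow> 'e \<Rightarrow> 'e" where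
  "riemann b y u v w =
     frechet_derivative (\<lambda>y. christoffel b y v w) (at y) u
     - frechet_derivative (\<lambda>y. christoffel b y u w) (at y) v
     + christoffel b y u (christoffel b y v w) - christoffel b y v (christoffel b y u w)"

definition ricci :: "('e::euclidean_space \<Rightarrow> 'e \<Rightarrow> 'e \<Rightarrow> real) \<Rightarrow> 'e \<Rightarrow> 'e \<Rightarrow> 'e \<Rightarrow> real" where
  "ricci b y v w = (\<Sum>e\<in>Basis. riemann b y e v w \<bullet> e)"

definition ricci_positive :: "('m, complex ^ 'n) cmfd \<Rightarrow> ('m, 'n) metric \<Rightarrow> bool" where
  "ricci_positive M g \<longleftrightarrow>
     (\<forall>c\<in>atlas M. \<forall>y\<in>chart_image c. \<forall>v. v \<noteq> 0 \<longrightarrow> 0 < ricci (g c) y v v)"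

definition ricci_negative :: "('m, complex ^ 'n) cmfd \<Rightarrow> ('m, 'n) metric \<Rightarrow> bool" where
  "ricci_negative M g \<longleftrightarrow>
     (\<forall>c\<in>atlas M. \<forall>y\<in>chart_image c. \<forall>v. v \<noteq> 0 \<longrightarrow> ricci (g c) y v v < 0)"

section \<open>Totally real submanifolds and the J-volume\<close>

text \<open>Totally real submanifolds of \<open>M\<close> are given as immersions \<open>\<iota>\<close> of an \<open>n\<close>-dimensional
  manifold \<open>L\<close>, which itself sits as a submanifold in some complex manifold \<open>N\<close>. Embedded
  submanifolds of \<open>M\<close> are the case \<open>N = M\<close>, \<open>\<iota> = id\<close>.\<close>

definition totally_real_immersion ::
    "('a, complex ^ 'n) cmfd \<Rightarrow> 'a set \<Rightarrow> ('m, complex ^ 'n) cmfd \<Rightarrow> ('a \<Rightarrow> 'm) \<Rightarrow> bool" where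
  "totally_real_immersion N L M \<iota> \<longleftrightarrow>
     continuous_map (subtopology (mtop N) L) (mtop M) \<iota> \<and>
     (\<forall>U \<psi>. \<forall>c\<in>atlas M. local_param N L U \<psi> \<longrightarrow>
        smooth_on {x \<in> U. \<iota> (\<psi> x) \<in> fst c} (snd c \<circ> \<iota> \<circ> \<psi>) \<and>
        (\<forall>x\<in>U. \<iota> (\<psi> x) \<in> fst c \<longrightarrow>
           (let D = frechet_derivative (snd c \<circ> \<iota> \<circ> \<psi>) (at x) in
             inj D \<and> (\<forall>w. \<exists>!(u, v). u \<in> range D \<and> v \<in> range D \<and> w = u + imul v))))"

text \<open>The value \<open>\<surd>(det h(\<partial>\<^sub>i f, \<partial>\<^sub>j f))\<close> for a map \<open>f\<close> from an open subset of \<open>\<real>\<^sup>n\<close>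
  to \<open>M\<close>, which does not depend on the chart. The matrix is Hermitian, so its determinant is real.\<close>

definition jvol_density ::
    "('m, complex ^ 'n) cmfd \<Rightarrow> ('m, 'n) metric \<Rightarrow> (real ^ 'n \<Rightarrow> 'm) \<Rightarrow> real ^ 'n \<Rightarrow> real" where
  "jvol_density M g f x =
     (let c = (SOME c. c \<in> atlas M \<and> f x \<in> fst c);
          d = (\<lambda>i. frechet_derivative (snd c \<circ> f) (at x) (axis i 1))
      in sqrt (Re (det (\<chi> i j. hermitian (g c) (snd c (f x)) (d i) (d j)))))"

text \<open>A decomposition of the compact manifold \<open>L\<close> into finitely many disjoint pieces \<open>\<psi> ` B\<close>, each
  contained in the image of a local parametrization.\<close>

definition param_decomposition ::
    "('a, complex ^ 'n) cmfd \<Rightarrow> 'a set \<Rightarrow>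
     ((real ^ 'n) set \<times> (real ^ 'n \<Rightarrow> 'a) \<times> (real ^ 'n) set) set \<Rightarrow> bool" where
  "param_decomposition N L \<D> \<longleftrightarrow>
     finite \<D> \<and>
     (\<forall>(U, \<psi>, B)\<in>\<D>. local_param N L U \<psi> \<and> B \<in> sets borel \<and> bounded B \<and> closure B \<subseteq> U) \<and>
     disjoint_family_on (\<lambda>(U, \<psi>, B). \<psi> ` B) \<D> \<and>
     (\<Union>(U, \<psi>, B)\<in>\<D>. \<psi> ` B) = L"

text \<open>The integral over \<open>L\<close> of the form \<open>vol\<^sub>J\<close> of the immersion \<open>\<iota>\<close>. By the change of variables formula
  it depends neither on the decomposition nor on the orientation.\<close>

definition jvol ::
    "('a, complex ^ 'n) cmfd \<Rightarrow> 'a set \<Rightarrow> ('m, complex ^ 'n) cmfd \<Rightarrow> ('m, 'n) metric \<Rightarrow>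
     ('a \<Rightarrow> 'm) \<Rightarrow> real" where
  "jvol N L M g \<iota> =
     (\<Sum>(U, \<psi>, B)\<in>(SOME \<D>. param_decomposition N L \<D>).
        set_lebesgue_integral lborel B (jvol_density M g (\<iota> \<circ> \<psi>)))"

definition totally_real_variation ::
    "('a, complex ^ 'n) cmfd \<Rightarrow> 'a set \<Rightarrow> ('m, complex ^ 'n) cmfd \<Rightarrow> ('a \<Rightarrow> 'm) \<Rightarrow>
     real \<Rightarrow> (real \<Rightarrow> 'a \<Rightarrow> 'm) \<Rightarrow> bool" where
  "totally_real_variation N L M \<iota> \<epsilon> F \<longleftrightarrow>
     0 < \<epsilon> \<and> (\<forall>x\<in>L. F 0 x = \<iota> x) \<and>
     (\<forall>t. \<bar>t\<bar> < \<epsilon> \<longrightarrow> totally_real_immersion N L M (F t)) \<and>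
     continuous_map (prod_topology (top_of_set {-\<epsilon><..<\<epsilon>}) (subtopology (mtop N) L)) (mtop M)
       (\<lambda>(t, x). F t x) \<and>
     (\<forall>U \<psi>. \<forall>c\<in>atlas M. local_param N L U \<psi> \<longrightarrow>
        smooth_on {(t, x). \<bar>t\<bar> < \<epsilon> \<and> x \<in> U \<and> F t (\<psi> x) \<in> fst c} (\<lambda>(t, x). snd c (F t (\<psi> x))))"

definition jvol_critical ::
    "('a, complex ^ 'n) cmfd \<Rightarrow> 'a set \<Rightarrow> ('m, complex ^ 'n) cmfd \<Rightarrow> ('m, 'n) metric \<Rightarrow>
     ('a \<Rightarrow> 'm) \<Rightarrow> bool" where
  "jvol_critical N L M g \<iota> \<longleftrightarrow>
     totally_real_immersion N L M \<iota> \<and>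
     (\<forall>\<epsilon> F. totally_real_variation N L M \<iota> \<epsilon> F \<longrightarrow>
        ((\<lambda>t. jvol N L M g (F t)) has_real_derivative 0) (at 0))"

section \<open>The J-volume on the set of orbits\<close>

text \<open>The \<open>G\<close>-orbit of \<open>p k\<close> is the submanifold immersed by \<open>x \<mapsto> p k x\<close>, \<open>x \<in> G\<close>. A point of it is
  therefore counted as often as the (finite) isotropy group of \<open>p k\<close> in \<open>G\<close> has elements. The order of
  this group can jump as \<open>k\<close> varies, so counting points once would not give a continuous function.\<close>

definition orbit_immersion ::
    "'k monoid \<Rightarrow> ('m \<Rightarrow> 'k \<Rightarrow> 'm) \<Rightarrow> 'm \<Rightarrow> 'k \<Rightarrow> 'k \<Rightarrow> 'm" where
  "orbit_immersion K act p k = (\<lambda>x. act p (k \<otimes>\<^bsub>K\<^esub> x))"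

definition orbit_jvol ::
    "'k monoid \<Rightarrow> ('k, complex ^ 'n) cmfd \<Rightarrow> 'k set \<Rightarrow> ('m, complex ^ 'n) cmfd \<Rightarrow>
     ('m, 'n) metric \<Rightarrow> ('m \<Rightarrow> 'k \<Rightarrow> 'm) \<Rightarrow> 'm \<Rightarrow> 'k \<Rightarrow> real" where
  "orbit_jvol K N G M g act p k = jvol N G M g (orbit_immersion K act p k)"

text \<open>Functions on the quotient by \<open>G\<close> are represented by functions \<open>f\<close> on the complex group that are
  constant on left cosets of \<open>G\<close>. As the projection is a submersion, the critical points of the
  function on the quotient are the cosets of the critical points of \<open>f\<close>.\<close>

definition strictly_convex_on_line :: "(real \<Rightarrow> real) \<Rightarrow> bool" where
  "strictly_convex_on_line f \<longleftrightarrow>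
     (\<forall>x y a. x \<noteq> y \<and> 0 < a \<and> a < 1 \<longrightarrow> f ((1 - a) * x + a * y) < (1 - a) * f x + a * f y)"

definition geodesically_strictly_convex ::
    "'k monoid \<Rightarrow> ('k, complex ^ 'n) cmfd \<Rightarrow> 'k set \<Rightarrow> ('k \<Rightarrow> real) \<Rightarrow> bool" where
  "geodesically_strictly_convex K N G f \<longleftrightarrow>
     (\<forall>k\<in>carrier K. \<forall>X\<in>lie_algebra K N G. X \<noteq> 0 \<longrightarrow>
        strictly_convex_on_line (\<lambda>t. f (k \<otimes>\<^bsub>K\<^esub> lie_exp K N (t *\<^sub>R imul X))))"

definition critical_point :: "('k, complex ^ 'n) cmfd \<Rightarrow> ('k \<Rightarrow> real) \<Rightarrow> 'k \<Rightarrow> bool" where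
  "critical_point N f k \<longleftrightarrow>
     k \<in> topspace (mtop N) \<and>
     (\<forall>c\<in>atlas N. k \<in> fst c \<longrightarrow> ((f \<circ> chart_inv c) has_derivative (\<lambda>_. 0)) (at (snd c k)))"

definition coset_invariant :: "'k monoid \<Rightarrow> 'k set \<Rightarrow> ('k \<Rightarrow> real) \<Rightarrow> bool" where
  "coset_invariant K G f \<longleftrightarrow> (\<forall>k\<in>carrier K. \<forall>x\<in>G. f (k \<otimes>\<^bsub>K\<^esub> x) = f k)"

end

(* Let A(m) be the derivative at 0 of X |-> m exp X, in a chart, and H = |det A|^2 det h. The function H
   does not depend on the chart, is continuous on M and is positive exactly on the points with discrete
   isotropy. Right translation by x in G multiplies H by |det Ad x|^2; as H is bounded, |det Ad x| = 1.
   Hence H is constant on G-orbits and Vol_J(pkG) = V sqrt(H(pk)) with a constant V.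
   In the complex direction X, log |det A| is harmonic and log det h contributes minus the Ricci form, so
   the second derivatives of log H in the directions X and iX add up to -(Ric(v,v) + Ric(Jv,Jv)). At a
   maximum of H this excludes Ric < 0. If X lies in the Lie algebra of G, the derivative in the direction
   X vanishes, and Ric > 0 makes log H strictly concave along k exp(itX); the polar decomposition then
   shows that the maximal orbit is the only critical one.
   Under a variation with field A(eta) the density |det(A^-1 df)| sqrt(H) changes at first order by
   dH plus the divergence of Re eta in the invariant frame: the remaining terms cancel by unimodularity.
   The divergence integrates to zero by right invariance of the volume, and dH = 0 at the maximum. *)
theory Submission
  imports Defs "HOL-Complex_Analysis.Cauchy_Integral_Formula"
begin

text \<open>The exponential map of the definitions is a definite description, so existence and
  uniqueness of one-parameter subgroups have to be established first. Both come from one limit: if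
  2^n log k_n tends to X, the powers k_n^(2^n) converge to exp X. In coordinates this is the
  iteration of the squaring map near its fixed point 0, where its derivative is multiplication by 2.
  The isotropy group is finite but may be nontrivial, so an orbit occurs both as an immersed copy of
  G and as a subset of M. Both are handled by one equivariant holomorphic map \<iota> from a
  manifold M1 with action, restricted to a G-orbit in M1. The J-volume uses an arbitrarily chosen
  decomposition into parametrized pieces. Right invariance of the integral is proved for a fixed
  decomposition, by cutting each piece along the translates of the others. First derivatives of maps
  into the open orbit are expressed by Lie algebra vectors, through the Maurer-Cartan form. The
  bracket term that unimodularity removes from the first variation is the one in its structure
  equation.\<close>

notation scaleR (infixr "*R" 75)

abbreviation fd :: "('a::real_normed_vector => 'b::real_normed_vector) => 'a => 'a => 'b" where
  "fd f x == frechet_derivative f (at x)"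

abbreviation hasD :: "('a::real_normed_vector => 'b::real_normed_vector) => ('a => 'b) => 'a => bool" where
  "hasD f f' x == (f has_derivative f') (at x)"

abbreviation hasR :: "(real => real) => real => real => bool" where
  "hasR f d x == (f has_real_derivative d) (at x)"

abbreviation (input) lpar where "lpar == local_param"

abbreviation pts where "pts M == topspace (mtop M)"

lemmas hasD_transform = has_derivative_transform_within_open
lemmas cm_in_sub = continuous_map_in_subtopology
lemmas cm_compose = continuous_map_compose
lemmas cont_at_on = continuous_at_imp_continuous_on
lemmas hasD_chain = diff_chain_at
lemmas cont_on_at = continuous_on_eq_continuous_at
lemmas blin_hasD = bounded_linear_imp_has_derivative

section \<open>Calculus\<close>

text \<open>The remainder tends to zero entrywise. Only the boundedness of the assembled derivative
  needs an estimate, by the sum of the entrywise bounds.\<close>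

lemma has_derivative_vec_lambda:
 assumes "!!i. ((%x. f x i) has_derivative (%h. f' h i)) F"
 shows "((%x. \<chi> i. f x i) has_derivative (%h. \<chi> i. f' h i)) F"
proof -
 have bl: "bounded_linear (%h. \<chi> i. f' h i)"
 proof -
  have "bounded_linear (%h. f' h i)" for i using assms has_derivative_bounded_linear by blast
  hence "ALL i. EX K. ALL h. norm (f' h i) <= norm h * K"
   using bounded_linear.bounded by blast
  then obtain K where K: "norm (f' h i) <= norm h * K i" for h i by (auto simp: choice_iff)
  have lin: "linear (%h. f' h i)" for i using assms has_derivative_linear by blast
  show ?thesis
  proof (rule bounded_linear_intro[where K="\<Sum>i\<in>UNIV. K i"])
   fix h
   have "norm (\<chi> i. f' h i) <= (\<Sum>i\<in>UNIV. norm (f' h i))"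
    unfolding norm_vec_def by (rule order_trans[OF L2_set_le_sum]) auto
   also have "... <= (\<Sum>i\<in>UNIV. norm h * K i)" by (intro sum_mono K)
   finally show "norm (\<chi> i. f' h i) <= norm h * (\<Sum>i\<in>UNIV. K i)" by (simp add: sum_distrib_left)
  qed (auto simp: vec_eq_iff linear_add[OF lin] linear_scale[OF lin])
 qed
 show ?thesis unfolding has_derivative_def
 proof (intro conjI bl)
  show "((%y. ((\<chi> i. f y i) - (\<chi> i. f (Lim F (%x. x)) i) - (\<chi> i. f' (y - Lim F (%x. x)) i))
    /\<^sub>R norm (y - Lim F (%x. x))) \<longlongrightarrow> 0) F"
   by (rule vec_tendstoI) (use assms in "simp add: has_derivative_def")
 qed
qed

lemma has_derivative_vec_nth:
 "(f has_derivative f') F ==> ((%x. f x $ i) has_derivative (%h. f' h $ i)) F"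
 by (rule bounded_linear.has_derivative[OF bounded_linear_vec_nth])

lemma has_derivative_vec_iff:
 "(f has_derivative f') F \<longleftrightarrow> (ALL i. ((%x. f x $ i) has_derivative (%h. f' h $ i)) F)"
 using has_derivative_vec_lambda[of "%x i. f x $ i" "%h i. f' h $ i" F] has_derivative_vec_nth[of f f' F]
 by auto

section \<open>Closure properties of k-fold continuous differentiability\<close>

lemma differentiable_frechet: "f differentiable (at x) ==> hasD f (fd f x) x"
 by (simp add: frechet_derivative_works)

lemma fd_eqI: "hasD f D x ==> fd f x = D" by (metis frechet_derivative_at)

text \<open>\<open>frechet_derivative\<close> agrees with the given derivative only on S, so the
  recursive clause needs a congruence rule. It appears as the assumption \<open>cong\<close> because
  the rule itself, \<open>cont_diff_cong\<close>, is proved by an induction that uses this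
  lemma.\<close>

lemma cont_diff_Suc_I:
 assumes "!!x. x : S ==> hasD f (D x) x" "open S"
  and "!!v. cont_diff k S (%x. D x v)"
  and cong: "!!f g. (!!x. x : S ==> f x = g x) ==> cont_diff k S f ==> cont_diff k S (g :: _ => 'b)"
 shows "cont_diff (Suc k) S (f :: _ => 'b::real_normed_vector)"
proof -
 have "fd f x = D x" if "x : S" for x using fd_eqI assms that by blast
 hence "cont_diff k S (%x. fd f x v)" for v using cong[OF _ assms(3)[of v]] by auto
 thus ?thesis using assms(1) by (auto simp: differentiable_def)
qed

lemma cont_diff_cong:
 assumes "open S" "!!x. x : S ==> f x = g x" "cont_diff k S f"
 shows "cont_diff k S g" using assms(2,3)
proof (induction k arbitrary: f g)
 case 0 thus ?case by (auto simp: continuous_on_eq)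
next
 case (Suc k)
 have d: "hasD f (fd f x) x" if "x : S" for x using Suc.prems that by (auto intro: differentiable_frechet)
 have dg: "hasD g (fd f x) x" if "x : S" for x
  using hasD_transform[OF d[OF that] assms(1) that] Suc.prems(1) by auto
 show ?case by (rule cont_diff_Suc_I[where D="%x. fd f x"])
   (use dg assms Suc in "auto intro: Suc.IH")
qed

lemma cont_diff_SucI:
 assumes "open S" "!!x. x : S ==> hasD f (D x) x" "!!v. cont_diff k S (%x. D x v)"
 shows "cont_diff (Suc k) S f" by (rule cont_diff_Suc_I[OF assms(2,1,3)]) (use assms cont_diff_cong in blast)+

lemma cd_SucD:
 assumes "cont_diff (Suc k) S f"
 shows "x : S ==> hasD f (fd f x) x"
  "cont_diff k S (%x. fd f x v)" using assms by (auto intro: differentiable_frechet)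

lemma cont_diff_mono_Suc:
 assumes "cont_diff (Suc k) S f" shows "cont_diff k S f" using assms
proof (induction k arbitrary: f)
 case 0
 thus ?case
  by (auto intro!: differentiable_imp_continuous_on simp: differentiable_on_def differentiable_at_withinI)
qed auto

lemma cont_diff_mono: "cont_diff l S f ==> k <= l ==> cont_diff k S f"
 by (induction l) (use cont_diff_mono_Suc le_Suc_eq in blast)+

lemma cont_diff_continuous: "cont_diff k S f ==> continuous_on S f"
 using cont_diff_mono[of k S f 0] by auto

lemma cont_diff_subset: "cont_diff k S f ==> T \<subseteq> S ==> cont_diff k T f"
 by (induction k arbitrary: f) (auto intro: continuous_on_subset)

lemma cont_diff_const: "cont_diff k S (%x. c)" by (induction k arbitrary: c) auto

lemma cont_diff_linear:
 assumes "open S" "bounded_linear L" "cont_diff k S f"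
 shows "cont_diff k S (%x. L (f x))" using assms(3)
proof (induction k arbitrary: f)
 case 0 thus ?case using assms by (auto intro: bounded_linear.continuous_on)
next
 case (Suc k)
 show ?case
  by (rule cont_diff_SucI[OF assms(1) bounded_linear.has_derivative[OF assms(2) cd_SucD(1)[OF Suc.prems]]])
   (auto intro: Suc.IH cd_SucD(2)[OF Suc.prems])
qed

lemma cont_diff_add:
 assumes "open S" "cont_diff k S f" "cont_diff k S g"
 shows "cont_diff k S (%x. f x + g x)" using assms(2,3)
proof (induction k arbitrary: f g)
 case 0 thus ?case by (auto intro: continuous_on_add)
next
 case (Suc k)
 show ?case
  by (rule cont_diff_SucI[OF assms(1) has_derivative_add[OF cd_SucD(1)[OF Suc.prems(1)] cd_SucD(1)[OF Suc.prems(2)]]])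
   (auto intro: Suc.IH cd_SucD(2)[OF Suc.prems(1)] cd_SucD(2)[OF Suc.prems(2)])
qed

lemma cont_diff_sum:
 assumes "open S" "!!i. i : I ==> cont_diff k S (f i)"
 shows "cont_diff k S (%x. \<Sum>i\<in>I. f i x)"
proof (cases "finite I")
 case True
 thus ?thesis using assms(2) by (induction I) (auto intro!: cont_diff_const cont_diff_add assms(1))
qed (auto intro: cont_diff_const)

lemma cont_diff_bilinear:
 assumes "open S" "bounded_bilinear pr" "cont_diff k S f" "cont_diff k S g"
 shows "cont_diff k S (%x. pr (f x) (g x))" using assms(3,4)
proof (induction k arbitrary: f g)
 case 0 thus ?case using assms by (auto intro: bounded_bilinear.continuous_on)
next
 case (Suc k)
 show ?case
  by (rule cont_diff_SucI[OF assms(1) bounded_bilinear.FDERIV[OF assms(2) cd_SucD(1)[OF Suc.prems(1)] cd_SucD(1)[OF Suc.prems(2)]]])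
   (auto intro!: cont_diff_add assms Suc.IH cd_SucD(2)[OF Suc.prems(1)] cd_SucD(2)[OF Suc.prems(2)]
     intro: cont_diff_mono_Suc[OF Suc.prems(1)] cont_diff_mono_Suc[OF Suc.prems(2)])
qed

lemmas cont_diff_mult = cont_diff_bilinear[OF _ bounded_bilinear_mult]
lemmas cont_diff_scaleR = cont_diff_bilinear[OF _ bounded_bilinear_scaleR]

lemma cont_diff_prod:
 assumes "open S" "!!i. i : I ==> cont_diff k S (f i)"
 shows "cont_diff k S (%x. \<Prod>i\<in>I. f i x :: complex)"
proof (cases "finite I")
 case True
 thus ?thesis using assms(2) by (induction I) (auto intro!: cont_diff_const cont_diff_mult assms(1))
qed (auto intro: cont_diff_const)

lemma cont_diff_det:
 fixes A :: "'a::real_normed_vector => complex ^ 'n ^ 'n"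
 assumes "open S" "!!i j. cont_diff k S (%x. A x $ i $ j)"
 shows "cont_diff k S (%x. det (A x))" unfolding det_def
 by (intro cont_diff_sum cont_diff_mult cont_diff_prod cont_diff_const assms)

lemma norm_axis_eq: "norm (axis i x :: 'b::real_normed_vector ^ 'n) = norm x"
 unfolding norm_vec_def L2_set_def axis_def
 by (simp add: if_distrib[of norm] if_distrib[of "%x. x\<^sup>2"] sum.delta cong: if_cong)

lemma bounded_linear_axis: "bounded_linear (axis i :: 'b::real_normed_vector => 'b ^ 'n)"
 by (rule bounded_linear_intro[where K=1], simp_all add: norm_axis_eq) (auto simp: vec_eq_iff axis_def)

lemma vec_eq_sum_axis: "(x :: 'b::real_normed_vector ^ 'n) = (\<Sum>i\<in>UNIV. axis i (x $ i))"
 by (auto simp: vec_eq_iff axis_def sum.delta if_distrib cong: if_cong)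

lemma cont_diff_vec:
 fixes f :: "'a::real_normed_vector => 'b::real_normed_vector ^ 'n"
 assumes "open S" "!!i. cont_diff k S (%x. f x $ i)"
 shows "cont_diff k S f"
proof -
 have "cont_diff k S (%x. \<Sum>i\<in>UNIV. axis i (f x $ i))"
  by (intro cont_diff_sum cont_diff_linear[OF _ bounded_linear_axis] assms)
 thus ?thesis by (simp flip: vec_eq_sum_axis)
qed

lemma cont_diff_vec_nth:
 assumes "open S" "cont_diff k S f"
 shows "cont_diff k S (%x. f x $ i)" by (rule cont_diff_linear[OF assms(1) bounded_linear_vec_nth assms(2)])

text \<open>\<open>cont_diff\<close> speaks of derivatives in fixed directions only. The chain rule
  produces one in the moving direction u'(x) v, which is therefore expanded in a basis of the middle
  space; the induction hypothesis applies to each basis direction.\<close>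

lemma cont_diff_compose:
 fixes f :: "'b::euclidean_space => 'c::real_normed_vector" and u :: "'a::real_normed_vector => 'b"
 assumes "open S" "open T" "u ` S \<subseteq> T" "cont_diff k T f" "cont_diff k S u"
 shows "cont_diff k S (%x. f (u x))" using assms(4,5)
proof (induction k arbitrary: f)
 case 0 thus ?case using assms by (auto intro: continuous_on_compose2)
next
 case (Suc k)
 let ?f' = "%y. fd f y" and ?u' = "%x. fd u x"
 have d: "hasD (%x. f (u x)) (%v. ?f' (u x) (?u' x v)) x" if "x : S" for x
  using hasD_chain[OF cd_SucD(1)[OF Suc.prems(2) that], of f] cd_SucD(1)[OF Suc.prems(1)] that assms
  by (auto simp: o_def)
 have eq: "(\<Sum>b\<in>Basis. (?u' x v \<bullet> b) *R ?f' (u x) b) = ?f' (u x) (?u' x v)" if "x : S" for x v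
 proof -
  have lin: "linear (?f' (u x))" using cd_SucD(1)[OF Suc.prems(1)] that assms has_derivative_linear by blast
  show ?thesis by (subst euclidean_representation[of "?u' x v", symmetric])
    (simp add: linear_sum[OF lin] linear_scale[OF lin])
 qed
 have inner: "bounded_linear (%y. y \<bullet> b)" for b :: 'b by (rule bounded_linear_inner_left)
 have "cont_diff k S (%x. \<Sum>b\<in>Basis. (?u' x v \<bullet> b) *R ?f' (u x) b)" for v
  by (intro cont_diff_sum cont_diff_scaleR assms cont_diff_linear[OF _ inner] cd_SucD(2)[OF Suc.prems(2)]
    Suc.IH cd_SucD(2)[OF Suc.prems(1)] cont_diff_mono_Suc[OF Suc.prems(2)])
 thus ?case by (intro cont_diff_SucI[OF assms(1) d]) (auto intro: cont_diff_cong[OF assms(1) eq])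
qed

text \<open>The inner derivative is the constant direction l v, so the induction closes without
  expanding in a basis, and f may live on any normed space.\<close>

lemma cont_diff_affine:
 fixes l :: "'a::real_normed_vector => 'b::real_normed_vector"
 assumes "open S" "open T" "bounded_linear l" "!!x. x : S ==> a + l x : T" "cont_diff k T f"
 shows "cont_diff k S (%x. f (a + l x))" using assms(5)
proof (induction k arbitrary: f)
 case 0
 have "continuous_on S (%x. a + l x)" using assms(3) by (intro continuous_intros linear_continuous_on)
 with 0 show ?case using assms(4) by (auto intro: continuous_on_compose2[of T f])
next
 case (Suc k)
 have l: "hasD (%x. a + l x) l x" for x
  using blin_hasD[OF assms(3)] by (auto intro!: derivative_eq_intros)
 have d: "hasD (%x. f (a + l x)) (%v. fd f (a + l x) (l v)) x" if "x : S" for x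
  using hasD_chain[OF l cd_SucD(1)[OF Suc.prems assms(4)[OF that]]] by (simp add: o_def)
 show ?case by (rule cont_diff_SucI[OF assms(1) d]) (auto intro!: Suc.IH cd_SucD(2)[OF Suc.prems])
qed

lemma smooth_hasD:
 "smooth_on S f ==> x : S ==> hasD f (fd f x) x"
 unfolding smooth_on_def using cd_SucD(1) by blast

lemma smooth_on_frechet: "smooth_on S f ==> smooth_on S (%x. fd f x v)"
 unfolding smooth_on_def using cd_SucD(2) by blast

lemma smooth_on_continuous: "smooth_on S f ==> continuous_on S f"
 unfolding smooth_on_def using cont_diff_continuous by blast

lemma smooth_on_cong:
 "smooth_on S f ==> open S ==> (!!x. x : S ==> f x = g x) ==> smooth_on S g"
 unfolding smooth_on_def using cont_diff_cong[of S f g] by blast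

lemma smooth_on_compose:
 fixes f :: "'b::euclidean_space => 'c::real_normed_vector" and u :: "'a::real_normed_vector => 'b"
 assumes "open S" "open T" "u ` S \<subseteq> T" "smooth_on T f" "smooth_on S u"
 shows "smooth_on S (%x. f (u x))" using assms cont_diff_compose unfolding smooth_on_def by blast

lemma smooth_on_subset: "smooth_on S f ==> T \<subseteq> S ==> smooth_on T f"
 unfolding smooth_on_def using cont_diff_subset by blast

text \<open>Point and direction move at once; expanding the direction in the basis separates the two
  dependences.\<close>

lemma continuous_on_frechet2:
 fixes f :: "'a::euclidean_space => 'b::real_normed_vector"
 assumes "cont_diff 1 S f" "!!y. y : T ==> a y : S" "continuous_on T a" "continuous_on T b"
 shows "continuous_on T (%y. fd f (a y) (b y))"
proof -
 have "fd f (a y) (b y) = (\<Sum>e\<in>Basis. (b y \<bullet> e) *R fd f (a y) e)"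
  if "y : T" for y
 proof -
  have lin: "linear (fd f (a y))"
   using cd_SucD(1)[of 0 S f] assms that has_derivative_linear by (metis One_nat_def)
  show ?thesis by (subst euclidean_representation[of "b y", symmetric])
    (simp add: linear_sum[OF lin] linear_scale[OF lin])
 qed
 moreover have "continuous_on T (%y. \<Sum>e\<in>Basis. (b y \<bullet> e) *R fd f (a y) e)"
 proof (intro continuous_intros assms)
  fix e :: 'a
  have "continuous_on S (%x. fd f x e)" using cd_SucD(2)[of 0 S f] assms(1) by simp
  thus "continuous_on T (%y. fd f (a y) e)"
   by (rule continuous_on_compose2[OF _ assms(3)]) (use assms in auto)
 qed
 ultimately show ?thesis by (simp cong: continuous_on_cong)
qed

section \<open>Determinants, second derivatives and convexity\<close>

text \<open>In the differentiated Leibniz sum only the identity permutation survives at the unit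
  matrix, and it contributes the trace. Any other permutation moves at least two points, so one
  off-diagonal zero remains after a factor has been differentiated.\<close>

lemma has_derivative_det_id:
 fixes A :: "'a::real_normed_vector => complex ^ 'n ^ 'n"
 assumes A: "(A has_derivative A') (at x within S)" and id: "A x = mat 1"
 shows "((%y. det (A y)) has_derivative (%h. trace (A' h))) (at x within S)"
proof -
 have ent: "((%y. A y $ i $ j) has_derivative (%h. A' h $ i $ j)) (at x within S)" for i j
  by (intro has_derivative_vec_nth A)
 define P where "P = {p. p permutes (UNIV :: 'n set)}"
 have d: "((%y. det (A y)) has_derivative
   (%h. \<Sum>p\<in>P. of_int (sign p) * (\<Sum>i\<in>UNIV. A' h $ i $ p i * (\<Prod>j\<in>UNIV - {i}. A x $ j $ p j)))) (at x within S)"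
  unfolding det_def P_def by (intro has_derivative_sum has_derivative_mult_right has_derivative_prod ent)
 have "(\<Sum>p\<in>P. of_int (sign p) * (\<Sum>i\<in>UNIV. A' h $ i $ p i * (\<Prod>j\<in>UNIV - {i}. A x $ j $ p j))) = trace (A' h)" for h
 proof -
  have "(\<Sum>p\<in>P. of_int (sign p) * (\<Sum>i\<in>UNIV. A' h $ i $ p i * (\<Prod>j\<in>UNIV - {i}. A x $ j $ p j))) =
   (\<Sum>p\<in>{id}. of_int (sign p) * (\<Sum>i\<in>UNIV. A' h $ i $ p i * (\<Prod>j\<in>UNIV - {i}. A x $ j $ p j)))"
  proof (rule sum.mono_neutral_right)
   show "finite P" unfolding P_def by (simp add: finite_permutations)
   show "{id} \<subseteq> P" by (auto simp: P_def permutes_id)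
   show "ALL p:P - {id}. of_int (sign p) * (\<Sum>i\<in>UNIV. A' h $ i $ p i * (\<Prod>j\<in>UNIV - {i}. A x $ j $ p j)) = 0"
   proof
    fix p assume p: "p : P - {id}"
    have z: "(\<Prod>j\<in>UNIV - {i}. A x $ j $ p j) = 0" for i
    proof -
     obtain a where a: "p a ~= a" using p by fastforce
     have inj: "inj p" using p permutes_inj by (auto simp: P_def)
     \<comment> \<open>Both a and p a are moved, so at least one of them differs from the
       differentiated row i.\<close>
     have "p (p a) ~= p a" using a inj by (auto dest: injD)
     then obtain j where "j ~= i" "p j ~= j" using a by metis
     thus ?thesis by (intro prod_zero) (auto simp: id mat_def intro!: bexI[of _ j])
    qed
    show "of_int (sign p) * (\<Sum>i\<in>UNIV. A' h $ i $ p i * (\<Prod>j\<in>UNIV - {i}. A x $ j $ p j)) = 0"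
     by (simp only: z mult_zero_right sum.neutral_const)
   qed
  qed
  also have "... = trace (A' h)" by (simp add: trace_def id mat_def sign_id)
  finally show ?thesis .
 qed
 with d show ?thesis by simp
qed

lemma has_derivative_matrix_mult_left:
 fixes A :: "'a::real_normed_vector => complex ^ 'n ^ 'n"
 assumes "(A has_derivative A') F"
 shows "((%y. B ** A y) has_derivative (%h. B ** A' h)) F" unfolding matrix_matrix_mult_def
 by (intro has_derivative_vec_lambda has_derivative_sum has_derivative_mult_right has_derivative_vec_nth assms)

text \<open>Jacobi's formula, reduced to the unit matrix by multiplying with the inverse B; det (A
  x) det B = 1 undoes the multiplication.\<close>

lemma has_derivative_det:
 fixes A :: "'a::real_normed_vector => complex ^ 'n ^ 'n"
 assumes A: "(A has_derivative A') (at x within S)" and B: "B ** A x = mat 1"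
 shows "((%y. det (A y)) has_derivative (%h. det (A x) * trace (B ** A' h))) (at x within S)"
proof -
 have "((%y. det (B ** A y)) has_derivative (%h. trace (B ** A' h))) (at x within S)"
  by (rule has_derivative_det_id[OF has_derivative_matrix_mult_left[OF A] B])
 hence "((%y. det (A x) * det (B ** A y)) has_derivative (%h. det (A x) * trace (B ** A' h))) (at x within S)"
  by (rule has_derivative_mult_right)
 moreover have "det (A x) * det B = 1" using arg_cong[OF B, of det] by (simp add: det_mul mult.commute)
 hence "det (A x) * det (B ** A y) = det (A y)" for y by (simp add: det_mul flip: mult.assoc)
 ultimately show ?thesis by simp
qed

lemma det_nonzero_inverse:
 fixes A :: "'a::field ^ 'n ^ 'n"
 assumes "det A ~= 0"
 obtains B where "B ** A = mat 1" "A ** B = mat 1"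
 using assms invertible_det_nz[of A] unfolding invertible_def by auto

lemma det_nonzero_iff_ker:
 fixes A :: "'a::field ^ 'n ^ 'n"
 shows "det A ~= 0 \<longleftrightarrow> (ALL x. A *v x = 0 --> x = 0)"
 using matrix_left_invertible_ker[of A] invertible_det_nz[of A] matrix_left_right_inverse[of A]
 unfolding invertible_def by metis

lemma cont_diff_inverse:
 fixes f :: "'a::real_normed_vector => complex"
 assumes "open S" "cont_diff k S f" "!!x. x : S ==> f x ~= 0"
 shows "cont_diff k S (%x. inverse (f x))" using assms(2)
proof (induction k)
 case 0 thus ?case using assms by (auto intro: continuous_on_inverse)
next
 case (Suc k)
 have d: "hasD (%x. inverse (f x)) (%v. - (inverse (f x) * fd f x v * inverse (f x))) x" if "x : S" for x
  using Deriv.has_derivative_inverse[OF assms(3)[OF that] cd_SucD(1)[OF Suc.prems that]] by simp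
 have neg: "bounded_linear (%z::complex. - z)" by (rule bounded_linear_minus) (rule bounded_linear_ident)
 show ?case by (rule cont_diff_SucI[OF assms(1) d])
   (auto intro!: cont_diff_linear[OF _ neg] cont_diff_mult assms Suc cd_SucD(2) intro: cont_diff_mono_Suc)
qed

text \<open>Cramer's rule writes the solution as a quotient of determinants of the data. This
  supplies the regularity of everything defined implicitly by a linear system: Christoffel symbols,
  the Maurer-Cartan form, the inverse frame of an orbit.\<close>

lemma cont_diff_solve:
 fixes A :: "'a::real_normed_vector => complex ^ 'n ^ 'n"
 assumes "open S" "!!i j. cont_diff k S (%x. A x $ i $ j)" "!!i. cont_diff k S (%x. b x $ i)"
  and nz: "!!x. x : S ==> det (A x) ~= 0" and eq: "!!x. x : S ==> A x *v z x = b x"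
 shows "cont_diff k S z"
proof (rule cont_diff_vec[OF assms(1)])
 fix l
 have "cont_diff k S (%x. det (\<chi> i j. if j = l then b x $ i else A x $ i $ j) * inverse (det (A x)))"
 proof (intro cont_diff_mult cont_diff_det cont_diff_inverse assms(1) assms(2) nz)
  show "cont_diff k S (%x. (\<chi> i j. if j = l then b x $ i else A x $ i $ j) $ i $ j)" for i j
   by (cases "j = l") (auto intro: assms)
 qed
 moreover have "z x $ l = det (\<chi> i j. if j = l then b x $ i else A x $ i $ j) * inverse (det (A x))" if "x : S" for x
  using eq[OF that] cramer[OF nz[OF that], of "z x" "b x"] by (simp add: divide_inverse)
 ultimately show "cont_diff k S (%x. z x $ l)"
  using cont_diff_cong[OF assms(1), where g="%x. z x $ l"] by (auto simp del: cont_diff.simps)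
qed

text \<open>The segment from the unit matrix to h consists of positive definite Hermitian matrices.
  Their determinants are real and nonzero, and equal to 1 at the start, so no sign change can
  occur.\<close>

lemma det_positive_definite:
 fixes h :: "complex ^ 'n ^ 'n"
 assumes herm: "!!i j. h $ i $ j = cnj (h $ j $ i)"
  and pos: "!!v. v ~= 0 ==> 0 < Re (\<Sum>i\<in>UNIV. \<Sum>j\<in>UNIV. v $ i * cnj (v $ j) * h $ i $ j)"
 shows "Im (det h) = 0" "0 < Re (det h)"
proof -
 define Q where "Q t = (\<chi> i j. of_real (1 - t) * (mat 1 :: complex ^ 'n ^ 'n) $ i $ j + of_real t * h $ i $ j)" for t
 have Q1: "Q 1 = h" and Q0: "Q 0 = mat 1" by (auto simp: Q_def vec_eq_iff)
 have real: "Im (det (Q t)) = 0" for t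
 proof -
  have "cnj (det (Q t)) = det (\<chi> i j. cnj (Q t $ i $ j))" unfolding det_def by (simp add: cnj_prod cnj_sum)
  also have "(\<chi> i j. cnj (Q t $ i $ j)) = transpose (Q t)"
   by (auto simp: vec_eq_iff Q_def transpose_def mat_def herm[symmetric])
  finally have "cnj (det (Q t)) = det (Q t)" by simp
  thus ?thesis by (metis Reals_cnj_iff complex_is_Real_iff)
 qed
 have nz: "det (Q t) ~= 0" if t: "0 <= t" "t <= 1" for t unfolding det_nonzero_iff_ker
 proof (intro allI impI)
  fix x assume x: "Q t *v x = 0"
  show "x = 0"
  proof (rule ccontr)
   assume "x ~= 0"
   \<comment> \<open>The form is written as v_i cnj(v_j) h_ij, hence the kernel vector enters
     through its conjugate.\<close>
   define v where "v = (\<chi> i. cnj (x $ i))"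
   have v: "v ~= 0" using \<open>x ~= 0\<close> by (auto simp: v_def vec_eq_iff)
   have "(\<Sum>i\<in>UNIV. v $ i * (Q t *v x) $ i) = 0" by (simp add: x)
   also have "(\<Sum>i\<in>UNIV. v $ i * (Q t *v x) $ i) =
     (\<Sum>i\<in>UNIV. \<Sum>j\<in>UNIV. v $ i * cnj (v $ j) * Q t $ i $ j)"
    by (simp add: matrix_vector_mult_def sum_distrib_left v_def ac_simps)
   also have "... = of_real (1 - t) * (\<Sum>i\<in>UNIV. \<Sum>j\<in>UNIV. v $ i * cnj (v $ j) * (if i = j then 1 else 0)) +
     of_real t * (\<Sum>i\<in>UNIV. \<Sum>j\<in>UNIV. v $ i * cnj (v $ j) * h $ i $ j)"
    by (simp add: Q_def mat_def sum_distrib_left sum.distrib[symmetric] algebra_simps)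
   also have "(\<Sum>i\<in>UNIV. \<Sum>j\<in>UNIV. v $ i * cnj (v $ j) * (if i = j then 1 else 0)) = of_real (\<Sum>i\<in>UNIV. (cmod (v $ i))\<^sup>2)"
    by (simp add: complex_norm_square[symmetric] if_distrib cong: if_cong)
   finally have "0 = (1 - t) * (\<Sum>i\<in>UNIV. (cmod (v $ i))\<^sup>2) + t * Re (\<Sum>i\<in>UNIV. \<Sum>j\<in>UNIV. v $ i * cnj (v $ j) * h $ i $ j)"
    by (auto simp: complex_eq_iff simp del: of_real_sum Re_sum)
   moreover have "0 < (\<Sum>i\<in>UNIV. (cmod (v $ i))\<^sup>2)"
   proof -
    obtain i where "v $ i ~= 0" using v by (auto simp: vec_eq_iff)
    thus ?thesis by (intro sum_pos2[of _ i]) auto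
   qed
   moreover have "0 < Re (\<Sum>i\<in>UNIV. \<Sum>j\<in>UNIV. v $ i * cnj (v $ j) * h $ i $ j)" using pos[OF v] .
   ultimately show False using t by (smt (verit, best) mult_pos_pos mult_nonneg_nonneg)
  qed
 qed
 show "Im (det h) = 0" using real[of 1] by (simp add: Q1)
 show "0 < Re (det h)"
 proof (rule ccontr)
  assume neg: "~ 0 < Re (det h)"
  have "continuous_on {0..1} (%t. Re (det (Q t)))" unfolding det_def Q_def by (intro continuous_intros)
  then obtain t where "0 <= t" "t <= 1" "Re (det (Q t)) = 0"
   using IVT2'[of "%t. Re (det (Q t))" 1 0 0] neg by (auto simp: Q1 Q0)
  with nz[of t] real[of t] show False by (auto simp: complex_eq_iff)
 qed
qed

text \<open>The mean value theorem, first in the direction v and then in w, makes the quotient equal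
  to the iterated derivative at a point of the small parallelogram; continuity of that derivative
  does the rest.\<close>

lemma second_difference_quotient:
 fixes f :: "'a::real_normed_vector => real"
 assumes "open S" "x : S" "cont_diff 2 S f" "0 < e"
 shows "EX d>0. ALL h. 0 < h & h < d -->
  \<bar>(f (x + h *R v + h *R w) - f (x + h *R v) - f (x + h *R w) + f x) / h\<^sup>2
   - fd (%y. fd f y v) x w\<bar> < e"
proof -
 let ?D = "%y. fd f y v"
 let ?D2 = "%y. fd ?D y w"
 have f1: "hasD f (fd f y) y" if "y : S" for y
  using assms(3) that cd_SucD(1)[of 1 S f] by (simp add: numeral_2_eq_2 del: cont_diff.simps)
 have cD: "cont_diff 1 S ?D"
  using assms(3) cd_SucD(2)[of 1 S f] by (simp add: numeral_2_eq_2 del: cont_diff.simps)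
 have f2: "hasD ?D (fd ?D y) y" if "y : S" for y
  using cd_SucD(1)[of 0 S ?D] cD that by (simp del: cont_diff.simps)
 have "continuous_on S ?D2" using cd_SucD(2)[of 0 S ?D w] cD by simp
 hence "isCont ?D2 x" using assms cont_on_at by blast
 then obtain d0 where d0: "d0 > 0" "!!y. dist y x < d0 ==> \<bar>?D2 y - ?D2 x\<bar> < e"
  using assms(4) unfolding continuous_at_eps_delta dist_real_def by metis
 obtain d1 where d1: "d1 > 0" "ball x d1 \<subseteq> S" using assms openE by blast
 \<comment> \<open>With this radius the whole parallelogram with sides h v and h w stays in both
   balls; the summand 1 covers v = w = 0.\<close>
 define d where "d = min d0 d1 / (1 + norm v + norm w)"
 have pos: "0 < 1 + norm v + norm w" by (smt (verit) norm_ge_zero)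
 have d: "d > 0" using d0 d1 pos by (simp add: d_def)
 have near: "dist (x + s *R v + t *R w) x < min d0 d1" if "0 <= s" "s <= h" "0 <= t" "t <= h" "h < d" "0 < h" for s t h
 proof -
  have "dist (x + s *R v + t *R w) x = norm (s *R v + t *R w)" by (simp add: dist_norm add.assoc)
  also have "... <= s * norm v + t * norm w" using that norm_triangle_ineq[of "s *R v" "t *R w"] by simp
  also have "... <= h * norm v + h * norm w" using that by (intro add_mono mult_right_mono) auto
  also have "... < h * (1 + norm v + norm w)" using that by (simp add: algebra_simps)
  also have "... < min d0 d1" using that pos by (simp add: d_def field_simps)
  finally show ?thesis .
 qed
 have inS: "x + s *R v + t *R w : S" if "0 <= s" "s <= h" "0 <= t" "t <= h" "h < d" "0 < h" for s t h
  using near[OF that] d1 by (auto simp: dist_commute)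
 show ?thesis
 proof (intro exI[of _ d] conjI allI impI d)
  fix h assume h: "0 < h & h < d"
  have dq: "hasR (%s. f (x + s *R v + t *R w)) (?D (x + s *R v + t *R w)) s"
   if "0 <= s" "s <= h" "0 <= t" "t <= h" for s t
  proof -
   have "hasD (%s. x + s *R v + t *R w) (%k. k *R v) s"
    by (auto intro!: derivative_eq_intros)
   from hasD_chain[OF this f1[OF inS[OF that]]]
   have "hasD (%s. f (x + s *R v + t *R w)) (%k. fd f (x + s *R v + t *R w) (k *R v)) s"
    using h by (simp add: o_def)
   moreover have "linear (fd f (x + s *R v + t *R w))"
    using f1[OF inS[OF that]] h has_derivative_linear by blast
   ultimately show ?thesis by (simp add: has_field_derivative_def linear_scale mult_commute_abs)
  qed
  have dr: "hasR (%t. ?D (x + s *R v + t *R w)) (?D2 (x + s *R v + t *R w)) t"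
   if "0 <= s" "s <= h" "0 <= t" "t <= h" for s t
  proof -
   have "hasD (%t. x + s *R v + t *R w) (%k. k *R w) t"
    by (auto intro!: derivative_eq_intros)
   from hasD_chain[OF this f2[OF inS[OF that]]]
   have "hasD (%t. ?D (x + s *R v + t *R w)) (%k. fd ?D (x + s *R v + t *R w) (k *R w)) t"
    using h by (simp add: o_def)
   moreover have "linear (fd ?D (x + s *R v + t *R w))"
    using f2[OF inS[OF that]] h has_derivative_linear by blast
   ultimately show ?thesis by (simp add: has_field_derivative_def linear_scale mult_commute_abs)
  qed
  have "EX s. 0 < s & s < h & (f (x + h *R v + h *R w) - f (x + h *R v + 0 *R w)) - (f (x + 0 *R v + h *R w) - f (x + 0 *R v + 0 *R w)) =
   (h - 0) * (?D (x + s *R v + h *R w) - ?D (x + s *R v + 0 *R w))"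
   using h by (intro MVT2[of 0 h "%s. f (x + s *R v + h *R w) - f (x + s *R v + 0 *R w)"
     "%s. ?D (x + s *R v + h *R w) - ?D (x + s *R v + 0 *R w)"] DERIV_diff dq) simp_all
  then obtain s where s: "0 < s" "s < h" and seq: "f (x + h *R v + h *R w) - f (x + h *R v) - f (x + h *R w) + f x =
   h * (?D (x + s *R v + h *R w) - ?D (x + s *R v + 0 *R w))" by (auto simp: algebra_simps)
  have "EX t. 0 < t & t < h & ?D (x + s *R v + h *R w) - ?D (x + s *R v + 0 *R w) = (h - 0) * ?D2 (x + s *R v + t *R w)"
   using h s by (intro MVT2) (auto intro!: dr)
  then obtain t where t: "0 < t" "t < h" "?D (x + s *R v + h *R w) - ?D (x + s *R v + 0 *R w) = h * ?D2 (x + s *R v + t *R w)"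
   by auto
  have "(f (x + h *R v + h *R w) - f (x + h *R v) - f (x + h *R w) + f x) / h\<^sup>2 = ?D2 (x + s *R v + t *R w)"
   unfolding seq t(3) using h by (simp add: power2_eq_square)
  thus "\<bar>(f (x + h *R v + h *R w) - f (x + h *R v) - f (x + h *R w) + f x) / h\<^sup>2 - ?D2 x\<bar> < e"
   using d0(2)[of "x + s *R v + t *R w"] near[of s h t] h s t by simp
 qed
qed

text \<open>The second difference is symmetric in v and w, so one and the same quotient approximates
  both iterated derivatives.\<close>

lemma symmetric_second_derivative_real:
 fixes f :: "'a::real_normed_vector => real"
 assumes "open S" "x : S" "cont_diff 2 S f"
 shows "fd (%y. fd f y v) x w =
  fd (%y. fd f y w) x v" (is "?a = ?b")
proof (rule ccontr)
 assume "?a ~= ?b"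
 hence e: "0 < \<bar>?a - ?b\<bar> / 2" by simp
 obtain d1 where d1: "d1 > 0" "!!h. 0 < h & h < d1 ==>
  \<bar>(f (x + h *R v + h *R w) - f (x + h *R v) - f (x + h *R w) + f x) / h\<^sup>2 - ?a\<bar> < \<bar>?a - ?b\<bar> / 2"
  using second_difference_quotient[OF assms e, of v w] by blast
 obtain d2 where d2: "d2 > 0" "!!h. 0 < h & h < d2 ==>
  \<bar>(f (x + h *R w + h *R v) - f (x + h *R w) - f (x + h *R v) + f x) / h\<^sup>2 - ?b\<bar> < \<bar>?a - ?b\<bar> / 2"
  using second_difference_quotient[OF assms e, of w v] by blast
 define h where "h = min d1 d2 / 2"
 have h: "0 < h" "h < d1" "h < d2" using d1 d2 by (auto simp: h_def)
 define q where "q = (f (x + h *R v + h *R w) - f (x + h *R v) - f (x + h *R w) + f x) / h\<^sup>2"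
 have "\<bar>q - ?a\<bar> < \<bar>?a - ?b\<bar> / 2" unfolding q_def using d1(2)[of h] h by blast
 moreover have "x + h *R w + h *R v = x + h *R v + h *R w" by simp
 hence "\<bar>q - ?b\<bar> < \<bar>?a - ?b\<bar> / 2" unfolding q_def using d2(2)[of h] h by (simp add: algebra_simps)
 ultimately show False by (auto simp: abs_if field_simps split: if_splits)
qed

lemma symmetric_second_derivative:
 fixes f :: "'a::real_normed_vector => 'b::euclidean_space"
 assumes "open S" "x : S" "cont_diff 2 S f"
 shows "fd (%y. fd f y v) x w =
  fd (%y. fd f y w) x v"
proof (rule euclidean_eqI)
 fix b :: 'b assume "b : Basis"
 have bl: "bounded_linear (%y. y \<bullet> b)" by (rule bounded_linear_inner_left)
 have f1: "hasD f (fd f y) y" if "y : S" for y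
  using assms(3) that cd_SucD(1)[of 1 S f] by (simp add: numeral_2_eq_2 del: cont_diff.simps)
 have f2: "hasD (%y. fd f y v) (fd (%y. fd f y v) x) x" for v
  using assms(2,3) cd_SucD(1)[of 0 S, OF cd_SucD(2)[of 1 S f v, simplified One_nat_def]]
  by (simp add: numeral_2_eq_2 del: cont_diff.simps)
 have 1: "fd (%y. f y \<bullet> b) y v = fd f y v \<bullet> b" if "y : S" for y v
  using fd_eqI[OF bounded_linear.has_derivative[OF bl f1[OF that]]] by simp
 have 2: "fd (%y. fd (%y. f y \<bullet> b) y v) x w =
   fd (%y. fd f y v) x w \<bullet> b" for v w
 proof -
  have "hasD (%y. fd (%y. f y \<bullet> b) y v) (%w. fd (%y. fd f y v) x w \<bullet> b) x"
   by (rule hasD_transform[OF bounded_linear.has_derivative[OF bl f2] assms(1,2)]) (simp add: 1)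
  thus ?thesis by (simp add: fd_eqI)
 qed
 show "fd (%y. fd f y v) x w \<bullet> b =
  fd (%y. fd f y w) x v \<bullet> b"
  using symmetric_second_derivative_real[OF assms(1,2) cont_diff_linear[OF assms(1) bl assms(3)], of v w] 2 by simp
qed

text \<open>The derivative f' is assumed differentiable at 0 only, which is the form delivered by
  \<open>second_variation\<close>. If c were positive, f' would be positive just to the right of 0
  and f would increase there.\<close>

lemma second_derivative_le_zero_at_max:
 fixes f :: "real => real"
 assumes "0 < d" "!!t. \<bar>t\<bar> < d ==> hasR f (f' t) t" "hasR f' c 0"
  and max: "!!t. \<bar>t\<bar> < d ==> f t <= f 0"
 shows "c <= 0"
proof (rule ccontr)
 assume "~ c <= 0"
 then obtain d' where d': "d' > 0" "!!h. 0 < h ==> h < d' ==> f' 0 < f' (0 + h)"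
  using DERIV_pos_inc_right[OF assms(3)] by auto
 have f0: "f' 0 = 0" using DERIV_local_max[OF assms(2)[of 0] assms(1)] max assms(1) by auto
 define h where "h = min d d' / 2"
 have h: "0 < h" "h < d" "h < d'" using assms(1) d' by (auto simp: h_def)
 obtain z where "0 < z" "z < h" "f h - f 0 = (h - 0) * f' z" using MVT2[of 0 h f f'] h assms(2) by auto
 with d'(2)[of z] h f0 have "f h - f 0 > 0" by simp
 with max[of h] h show False by simp
qed

text \<open>A positive second derivative makes f' strictly increasing, and the mean value theorem on
  the two sides of the intermediate point compares the two slopes.\<close>

lemma strictly_convex_on_line_second_derivative:
 assumes f: "!!t. hasR f (f' t) t" "!!t. EX c>0. hasR f' c t"
 shows "strictly_convex_on_line f"
proof -
 have mono: "f' s < f' t" if "s < t" for s t using DERIV_pos_imp_increasing[OF that, of f'] f(2) by blast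
 have main: "f ((1 - a) * x + a * y) < (1 - a) * f x + a * f y" if "x < y" "0 < a" "a < 1" for x y a
 proof -
  define z where "z = (1 - a) * x + a * y"
  have zx: "z - x = a * (y - x)" and yz: "y - z = (1 - a) * (y - x)" by (auto simp: z_def algebra_simps)
  have z: "x < z" "z < y"
   using mult_pos_pos[of a "y - x"] mult_pos_pos[of "1 - a" "y - x"] that zx yz by (auto simp del: mult_pos_pos)
  obtain u where u: "x < u" "u < z" "f z - f x = (z - x) * f' u" using MVT2[OF z(1), of f f'] f(1) by auto
  obtain w where w: "z < w" "w < y" "f y - f z = (y - z) * f' w" using MVT2[OF z(2), of f f'] f(1) by auto
  have "f' u < f' w" using mono u w by auto
  hence "0 < (1 - a) * a * (y - x) * (f' w - f' u)" using that by simp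
  also have "... = a * ((y - z) * f' w) - (1 - a) * ((z - x) * f' u)" by (simp add: zx yz algebra_simps)
  also have "... = a * (f y - f z) - (1 - a) * (f z - f x)" using u w by simp
  finally have "f z < (1 - a) * f x + a * f y" by (simp add: algebra_simps)
  thus ?thesis by (simp only: z_def)
 qed
 show ?thesis unfolding strictly_convex_on_line_def
 proof (intro allI impI)
  fix x y a :: real assume "x ~= y & 0 < a & a < 1"
  thus "f ((1 - a) * x + a * y) < (1 - a) * f x + a * f y"
   using main[of x y a] main[of y x "1 - a"] by (cases "x < y") (auto simp: algebra_simps)
 qed
qed

text \<open>Strictness comes from the monotonicity of exp, the remaining inequality from its
  convexity.\<close>

lemma strictly_convex_on_line_exp:
 assumes "strictly_convex_on_line f"
 shows "strictly_convex_on_line (%t. exp (f t))" unfolding strictly_convex_on_line_def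
proof (intro allI impI)
 fix x y a :: real assume a: "x ~= y & 0 < a & a < 1"
 have "exp (f ((1 - a) * x + a * y)) < exp ((1 - a) * f x + a * f y)"
  using assms a by (auto simp: strictly_convex_on_line_def)
 also have "... <= (1 - a) * exp (f x) + a * exp (f y)"
  using convex_onD[OF exp_convex, of a "f x" "f y"] a by auto
 finally show "exp (f ((1 - a) * x + a * y)) < (1 - a) * exp (f x) + a * exp (f y)" .
qed

section \<open>Holomorphic maps of several variables\<close>

definition complex_linear :: "('a::complex_model => 'b::complex_model) => bool" where
 "complex_linear D \<longleftrightarrow> linear D & (ALL v. D (imul v) = imul (D v))"

lemmas clin_def = complex_linear_def

definition cdiff_at :: "('a::complex_model => 'b::complex_model) => 'a => bool" where
 "cdiff_at f x \<longleftrightarrow> (EX D. hasD f D x & (ALL v. D (imul v) = imul (D v)))"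

lemma imul_zero [simp]: "imul (0 :: 'a::complex_model) = 0" using imul_scaleR[of 0 "0::'a"] by simp

lemma imul_minus: "imul (- x) = - imul x" using imul_scaleR[of "-1" x] by simp

lemma bounded_linear_imul: "bounded_linear imul"
 by (rule bounded_linear_intro[where K = 1]) (auto simp: imul_add imul_scaleR norm_imul)

lemma linear_imul: "linear imul" by (rule bounded_linear.linear[OF bounded_linear_imul])

lemma imul_vec_nth [simp]: "imul v $ i = imul (v $ i)" by (simp add: imul_vec_def)

lemma imul_complex: "imul (z :: complex) = \<i> * z" by (simp add: imul_complex_def)

lemma imul_Pair [simp]: "imul (a, b) = (imul a, imul b)" by (simp add: imul_prod_def)

lemma cdiff_fd:
 assumes "cdiff_at f x"
 shows "hasD f (fd f x) x" "complex_linear (fd f x)"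
proof -
 obtain D where D: "hasD f D x" "!!v. D (imul v) = imul (D v)" using assms by (auto simp: cdiff_at_def)
 have "fd f x = D" by (rule fd_eqI[OF D(1)])
 with D show "hasD f (fd f x) x" "complex_linear (fd f x)" by (auto simp: clin_def has_derivative_linear)
qed

lemma cdiff_atI: "hasD f D x ==> (!!v. D (imul v) = imul (D v)) ==> cdiff_at f x"
 by (auto simp: cdiff_at_def)

lemma cdiff_at_isCont: "cdiff_at f x ==> isCont f x"
 using cdiff_fd(1) has_derivative_continuous by blast

lemma cdiff_at_cong_open:
 assumes "cdiff_at f x" "open S" "x : S" "!!y. y : S ==> f y = g y"
 shows "cdiff_at g x" using assms hasD_transform unfolding cdiff_at_def by metis

lemma cdiff_at_compose:
 assumes "cdiff_at f x" "cdiff_at g (f x)"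
 shows "cdiff_at (%y. g (f y)) x"
proof -
 obtain D D' where D: "hasD f D x" "!!v. D (imul v) = imul (D v)"
  "hasD g D' (f x)" "!!v. D' (imul v) = imul (D' v)" using assms by (auto simp: cdiff_at_def)
 show ?thesis by (rule cdiff_atI[OF hasD_chain[OF D(1,3), unfolded o_def]]) (simp add: D)
qed

lemma cdiff_at_const [simp]: "cdiff_at (%x. c) x" by (rule cdiff_atI[OF has_derivative_const]) simp

lemma cdiff_at_ident [simp]: "cdiff_at (%x. x) x" by (rule cdiff_atI[OF has_derivative_ident]) simp

lemma cdiff_at_linear: "complex_linear L ==> bounded_linear L ==> cdiff_at L x"
 by (rule cdiff_atI[OF blin_hasD]) (auto simp: clin_def)

lemma cdiff_at_add: "cdiff_at f x ==> cdiff_at g x ==> cdiff_at (%x. f x + g x) x"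
 by (rule cdiff_atI[OF has_derivative_add[OF cdiff_fd(1) cdiff_fd(1)]]) (auto dest!: cdiff_fd(2) simp: clin_def imul_add)

lemma cdiff_at_minus: "cdiff_at f x ==> cdiff_at (%x. - f x) x"
 by (rule cdiff_atI[OF has_derivative_minus[OF cdiff_fd(1)]]) (auto dest!: cdiff_fd(2) simp: clin_def imul_minus)

lemma cdiff_at_diff: "cdiff_at f x ==> cdiff_at g x ==> cdiff_at (%x. f x - g x) x"
 using cdiff_at_add[OF _ cdiff_at_minus, of f x g] by simp

lemma cdiff_at_Pair: "cdiff_at f x ==> cdiff_at g x ==> cdiff_at (%x. (f x, g x)) x"
 by (rule cdiff_atI[OF has_derivative_Pair[OF cdiff_fd(1) cdiff_fd(1)]])
  (auto dest!: cdiff_fd(2) simp: clin_def)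

lemma cdiff_at_fst: "cdiff_at fst x" and cdiff_at_snd: "cdiff_at snd x"
 by (auto intro!: cdiff_at_linear bounded_linear_fst bounded_linear_snd simp: clin_def linear_fst linear_snd imul_prod_def)

lemma cdiff_at_vec_iff: "cdiff_at f x \<longleftrightarrow> (ALL i. cdiff_at (%y. f y $ i) x)"
proof
 assume "cdiff_at f x"
 then obtain D where D: "hasD f D x" "!!v. D (imul v) = imul (D v)" by (auto simp: cdiff_at_def)
 show "ALL i. cdiff_at (%y. f y $ i) x"
  by (auto intro!: cdiff_atI[OF has_derivative_vec_nth[OF D(1)]] simp: D)
next
 assume "ALL i. cdiff_at (%y. f y $ i) x"
 then obtain D where D: "!!i. hasD (%y. f y $ i) (D i) x" "!!i v. D i (imul v) = imul (D i v)"
  unfolding cdiff_at_def by metis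
 show "cdiff_at f x" by (rule cdiff_atI[where D="%h. \<chi> i. D i h"])
   (use has_derivative_vec_lambda[of "%x i. f x $ i" "%h i. D i h" "at x"] D in "auto simp: vec_eq_iff")
qed

lemma cdiff_at_vec: "(!!i. cdiff_at (%y. f y $ i) x) ==> cdiff_at f x"
 by (simp add: cdiff_at_vec_iff[of f])

lemma cdiff_at_vec_nth: "cdiff_at f x ==> cdiff_at (%y. f y $ i) x"
 by (simp add: cdiff_at_vec_iff[of f])

lemma cdiff_at_mult: "cdiff_at f x ==> cdiff_at g x ==> cdiff_at (%x. f x * g x :: complex) x"
proof -
 assume "cdiff_at f x" "cdiff_at g x"
 then obtain D D' where D: "hasD f D x" "!!v. D (imul v) = imul (D v)"
  "hasD g D' x" "!!v. D' (imul v) = imul (D' v)" by (auto simp: cdiff_at_def)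
 show ?thesis by (rule cdiff_atI[OF has_derivative_mult[OF D(1,3)]]) (simp add: D imul_complex algebra_simps)
qed

lemma cdiff_at_sum: "(!!i. i : I ==> cdiff_at (f i) x) ==> cdiff_at (%x. \<Sum>i\<in>I. f i x) x"
 by (induction I rule: infinite_finite_induct) (auto intro: cdiff_at_add)

lemma cdiff_at_prod: "(!!i. i : I ==> cdiff_at (f i) x) ==> cdiff_at (%x. \<Prod>i\<in>I. f i x :: complex) x"
 by (induction I rule: infinite_finite_induct) (auto intro: cdiff_at_mult)

lemma cdiff_at_det: "cdiff_at A x ==> cdiff_at (%x. det (A x :: complex ^ 'n ^ 'n)) x"
 unfolding det_def by (intro cdiff_at_sum cdiff_at_mult cdiff_at_prod cdiff_at_const cdiff_at_vec_nth)

lemma complex_diff_on_open: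
 assumes "open S" shows "complex_diff_on UNIV S f \<longleftrightarrow> (ALL x:S. cdiff_at f x)"
proof -
 have "(f has_derivative D) (at x within S) \<longleftrightarrow> hasD f D x" if "x : S" for x D
  using at_within_open[OF that assms] by simp
 thus ?thesis by (auto simp: complex_diff_on_def cdiff_at_def)
qed

text \<open>Multiplication by complex scalars; the class \<open>complex_model\<close> itself only
  has real scalars and \<open>imul\<close>.\<close>

definition cscale :: "complex => 'a::complex_model => 'a" where
 "cscale z v = Re z *R v + Im z *R imul v"

lemma cscale_complex [simp]: "cscale z (w::complex) = z * w" by (simp add: cscale_def imul_complex complex_eq_iff)

lemma cscale_vec [simp]: "cscale z (v :: complex ^ 'n) = z *s v"
 by (simp add: cscale_def vec_eq_iff imul_complex complex_eq_iff)

lemma norm_cscale_le: "norm (cscale z v) <= 2 * norm z * norm v"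
proof -
 have "norm (cscale z v) <= \<bar>Re z\<bar> * norm v + \<bar>Im z\<bar> * norm v"
  unfolding cscale_def using norm_triangle_ineq[of "Re z *R v" "Im z *R imul v"] by (simp add: norm_imul)
 also have "... <= norm z * norm v + norm z * norm v"
  by (intro add_mono mult_right_mono abs_Re_le_cmod abs_Im_le_cmod) auto
 finally show ?thesis by (simp add: ac_simps)
qed

lemma bounded_linear_cscale: "bounded_linear (%z. cscale z v)"
proof (rule bounded_linear_intro[where K="2 * norm v"])
 show "norm (cscale z v) <= norm z * (2 * norm v)" for z using norm_cscale_le[of z v] by (simp add: ac_simps)
qed (auto simp: cscale_def algebra_simps)

lemma complex_linear_cscale: "complex_linear (%z. cscale z v)"
 using bounded_linear.linear[OF bounded_linear_cscale]
 by (auto simp: clin_def cscale_def imul_complex imul_add imul_scaleR imul_imul)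

lemma complex_linear_cscale_eq: "complex_linear D ==> D (cscale z v) = cscale z (D v)"
 by (simp add: clin_def cscale_def linear_add linear_scale)

section \<open>Cauchy's formula along complex lines and regularity of holomorphic maps\<close>

lemma field_derivative_scale_line:
 fixes f :: "'a::complex_model => complex"
 assumes "cdiff_at f (x + cscale z v)"
 shows "((%z. f (x + cscale z v)) has_field_derivative fd f (x + cscale z v) v) (at z)"
proof -
 have "hasD (%z. x + cscale z v) (%z. cscale z v) z"
  using blin_hasD[OF bounded_linear_cscale] by (auto intro!: derivative_eq_intros)
 from hasD_chain[OF this cdiff_fd(1)[OF assms]] complex_linear_cscale_eq[OF cdiff_fd(2)[OF assms]]
 show ?thesis by (simp add: has_field_derivative_def o_def mult_commute_abs)
qed

text \<open>Cauchy's formula for z |-> f (x + z v). On the circle dz/z^2 equals 2 pi i dt/z, so the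
  derivative becomes a parameter integral over the unit interval into which x enters only through
  the values of f.\<close>

lemma cauchy_directional_derivative:
 fixes f :: "'a::complex_model => complex"
 assumes r: "0 < r" and f: "!!z. norm z <= r ==> cdiff_at f (x + cscale z v)"
 shows "fd f x v =
  integral (cbox 0 1) (%t. f (x + cscale (circlepath 0 r t) v) * inverse (circlepath 0 r t))"
proof -
 let ?F = "%z. f (x + cscale z v)"
 have d: "(?F has_field_derivative fd f (x + cscale z v) v) (at z)" if "norm z <= r" for z
  by (rule field_derivative_scale_line[OF f[OF that]])
 have "continuous_on (cball 0 r) ?F"
  by (intro cont_at_on ballI DERIV_isCont[OF d]) (simp add: dist_norm)
 moreover have "?F holomorphic_on ball 0 r" unfolding holomorphic_on_def field_differentiable_def
  using d by (meson DERIV_subset UNIV_I less_imp_le mem_ball_0 subsetI has_field_derivative_at_within)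
 moreover have "(0::complex) : ball 0 r" using r by simp
 ultimately have "(?F has_field_derivative (1 / (2 * of_real pi * \<i>) * contour_integral (circlepath 0 r) (%u. ?F u / (u - 0)\<^sup>2))) (at 0)"
  by (rule Cauchy_derivative_integral_circlepath(2))
 hence "fd f x v = 1 / (2 * of_real pi * \<i>) * contour_integral (circlepath 0 r) (%u. ?F u / (u - 0)\<^sup>2)"
  using d[of 0] r by (auto dest: DERIV_unique simp: cscale_def)
 also have "contour_integral (circlepath 0 r) (%u. ?F u / (u - 0)\<^sup>2) =
   integral (cbox 0 1) (%t. ?F (circlepath 0 r t) / (circlepath 0 r t)\<^sup>2 * vector_derivative (circlepath 0 r) (at t))"
  by (simp add: contour_integral_integral)
 also have "... = integral (cbox 0 1) (%t. (2 * of_real pi * \<i>) * (?F (circlepath 0 r t) * inverse (circlepath 0 r t)))"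
 proof (rule integral_cong)
  fix t :: real assume t: "t : cbox 0 1"
  have nz: "circlepath 0 r t ~= 0" using r by (simp add: circlepath_def part_circlepath_def)
  have "vector_derivative (circlepath 0 r) (at t) = 2 * of_real pi * \<i> * circlepath 0 r t"
   by (subst vector_derivative_circlepath) (auto simp: circlepath algebra_simps)
  thus "?F (circlepath 0 r t) / (circlepath 0 r t)\<^sup>2 * vector_derivative (circlepath 0 r) (at t) =
    (2 * of_real pi * \<i>) * (?F (circlepath 0 r t) * inverse (circlepath 0 r t))"
   using nz by (simp add: power2_eq_square field_simps)
 qed
 also have "... = (2 * of_real pi * \<i>) * integral (cbox 0 1) (%t. ?F (circlepath 0 r t) * inverse (circlepath 0 r t))"
  by (rule integral_mult_right)
 finally show ?thesis by simp
qed

lemma cdiff_line_radius: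
 fixes S :: "'a::complex_model set"
 assumes "open S" "x0 : S"
 obtains e r where "0 < e" "0 < r" "!!x z. x : ball x0 e ==> norm z <= r ==> x + cscale z v : S"
proof -
 obtain d where d: "d > 0" "ball x0 d \<subseteq> S" using assms openE by blast
 \<comment> \<open>One factor 2 comes from \<open>norm_cscale_le\<close>, the other because x may
   already be d/2 away from x0.\<close>
 define r where "r = d / (4 * (1 + norm v))"
 have pos: "0 < 1 + norm v" by (smt (verit) norm_ge_zero)
 have "x + cscale z v : S" if x: "x : ball x0 (d/2)" and z: "norm z <= r" for x z
 proof -
  have "norm (cscale z v) <= 2 * r * (1 + norm v)"
   by (rule order_trans[OF norm_cscale_le mult_mono]) (use z pos d in "auto simp: r_def")
  also have "... = d / 2" using pos by (simp add: r_def field_simps)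
  finally have "dist x0 (x + cscale z v) < d"
   using x norm_triangle_ineq4[of "x0 - x" "cscale z v"] by (simp add: dist_norm algebra_simps)
  thus ?thesis using d by auto
 qed
 moreover have "0 < d / 2" "0 < r" using d pos by (auto simp: r_def)
 ultimately show thesis using that by blast
qed

lemma continuous_on_circlepath_param:
 assumes "continuous_on S f" "0 < r" "!!x t. x : U ==> t : {0..1} ==> x + cscale (circlepath 0 r t) v : S"
 shows "continuous_on (U \<times> cbox 0 1) (%(x, t). f (x + cscale (circlepath 0 r t) v) * inverse (circlepath 0 r t) :: complex)"
proof -
 have c: "continuous_on UNIV (circlepath 0 r)"
  unfolding circlepath_def part_circlepath_def by (intro continuous_intros)
 have c1: "continuous_on T (%p. circlepath 0 r (snd p))" for T :: "('a \<times> real) set"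
  by (rule continuous_on_compose2[OF c]) (auto intro: continuous_intros)
 have c2: "continuous_on T (%p. fst p + cscale (circlepath 0 r (snd p)) v)" for T :: "('a \<times> real) set"
  by (intro continuous_intros bounded_linear.continuous_on[OF bounded_linear_cscale] c1)
 have nz: "circlepath 0 r t ~= 0" for t using assms(2) by (simp add: circlepath_def part_circlepath_def)
 show ?thesis unfolding case_prod_beta
  by (intro continuous_on_mult continuous_on_inverse c1 continuous_on_compose2[OF assms(1) c2])
   (use nz assms(3) in auto)
qed

lemma continuous_on_circlepath_line:
 assumes "continuous_on S f" "0 < r" "!!t. x + cscale (circlepath 0 r t) v : S"
 shows "continuous_on (cbox 0 1) (%t. f (x + cscale (circlepath 0 r t) v) * inverse (circlepath 0 r t) :: complex)"
proof -
 have "continuous_on ({x} \<times> cbox 0 1) (%(x, t). f (x + cscale (circlepath 0 r t) v) * inverse (circlepath 0 r t))"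
  by (rule continuous_on_circlepath_param[OF assms(1,2)]) (use assms(3) in auto)
 hence "continuous_on (cbox 0 1) (%t. case (x, t) of (x, t) => f (x + cscale (circlepath 0 r t) v) * inverse (circlepath 0 r t))"
  by (rule continuous_on_compose2) (auto intro: continuous_intros)
 thus ?thesis by simp
qed

text \<open>Only pointwise complex differentiability is given. Continuity of the directional
  derivatives is read off from the integral formula, whose integrand involves f alone and is jointly
  continuous.\<close>

lemma cdiff_frechet_continuous:
 fixes f :: "'a::complex_model => complex"
 assumes S: "open S" and f: "!!x. x : S ==> cdiff_at f x"
 shows "continuous_on S (%x. fd f x v)"
proof (rule cont_at_on, rule ballI)
 fix x0 assume "x0 : S"
 then obtain e r where er: "0 < e" "0 < r" "!!x z. x : ball x0 e ==> norm z <= r ==> x + cscale z v : S"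
  using cdiff_line_radius[OF S] by metis
 have nc: "norm (circlepath 0 r t) = r" for t using er by (simp add: circlepath norm_mult)
 have contf: "continuous_on S f" by (intro cont_at_on ballI cdiff_at_isCont f)
 have "continuous_on (ball x0 e) (%x. integral (cbox 0 1) (%t. f (x + cscale (circlepath 0 r t) v) * inverse (circlepath 0 r t)))"
  by (intro integral_continuous_on_param continuous_on_circlepath_param[OF contf]) (use er nc in auto)
 hence "continuous_on (ball x0 e) (%x. fd f x v)"
 proof (rule continuous_on_eq)
  show "integral (cbox 0 1) (%t. f (x + cscale (circlepath 0 r t) v) * inverse (circlepath 0 r t)) = fd f x v"
   if "x : ball x0 e" for x
   using cauchy_directional_derivative[OF er(2), of f x v] f[OF er(3)[OF that]] by simp
 qed
 moreover have "x0 : ball x0 e" using er(1) by simp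
 ultimately show "isCont (%x. fd f x v) x0" using cont_on_at[OF open_ball] by blast
qed

text \<open>Differentiation under the integral sign in Cauchy's formula; the previous lemma gives
  the joint continuity that this requires. The result is complex linear because the derivative of
  the integrand is.\<close>

lemma cdiff_frechet_complex:
 fixes f :: "'a::{complex_model,euclidean_space} => complex"
 assumes S: "open S" and f: "!!x. x : S ==> cdiff_at f x" and x0: "x0 : S"
 shows "cdiff_at (%x. fd f x v) x0"
proof -
 obtain e r where er: "0 < e" "0 < r" "!!x z. x : ball x0 e ==> norm z <= r ==> x + cscale z v : S"
  using cdiff_line_radius[OF S x0] by metis
 let ?c = "circlepath 0 r"
 let ?D = "%x. fd f x"
 have nc: "norm (?c t) = r" for t using er by (simp add: circlepath norm_mult)
 have cS: "x + cscale (?c t) v : S" if "x : ball x0 e" for x t using er that nc by auto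
 have D: "hasD f (?D x) x" "complex_linear (?D x)" if "x : S" for x using cdiff_fd[OF f[OF that]] by auto
 define fx where "fx x t = Blinfun (%h. ?D (x + cscale (?c t) v) h * inverse (?c t))" for x t
 have fx: "blinfun_apply (fx x t) = (%h. ?D (x + cscale (?c t) v) h * inverse (?c t))" if "x : ball x0 e" for x t
  unfolding fx_def by (rule bounded_linear_Blinfun_apply)
   (intro bounded_linear_mult_const has_derivative_bounded_linear[OF D(1)] cS that)
 have contf: "continuous_on S f" by (intro cont_at_on ballI cdiff_at_isCont f)
 have x0b: "x0 : ball x0 e" using er by simp
 have leib: "((%x. integral (cbox 0 1) (%t. f (x + cscale (?c t) v) * inverse (?c t))) has_derivative
   blinfun_apply (integral (cbox 0 1) (fx x0))) (at x0 within ball x0 e)"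
 proof (rule leibniz_rule)
  fix x t assume x: "x : ball x0 e"
  have "hasD (%x. x + cscale (?c t) v) (%h. h) x" by (auto intro!: derivative_eq_intros)
  from hasD_chain[OF this D(1)[OF cS[OF x]]]
  have "hasD (%x. f (x + cscale (?c t) v) * inverse (?c t)) (%h. ?D (x + cscale (?c t) v) h * inverse (?c t)) x"
   by (intro has_derivative_mult_left) (simp add: o_def)
  thus "((%x. f (x + cscale (?c t) v) * inverse (?c t)) has_derivative blinfun_apply (fx x t)) (at x within ball x0 e)"
   unfolding fx[OF x] by (rule has_derivative_at_withinI)
 next
  fix x assume x: "x : ball x0 e"
  have "continuous_on (cbox 0 1) (%t. f (x + cscale (?c t) v) * inverse (?c t))"
   by (rule continuous_on_circlepath_line[OF contf er(2) cS[OF x]])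
  thus "(%t. f (x + cscale (?c t) v) * inverse (?c t)) integrable_on cbox 0 1"
   by (rule integrable_continuous)
 next
  show "continuous_on (ball x0 e \<times> cbox 0 1) (%(x, t). fx x t)"
  proof (rule continuous_on_blinfun_componentwise)
   fix b :: 'a
   have "continuous_on (ball x0 e \<times> cbox 0 1) (%(x, t). ?D (x + cscale (?c t) v) b * inverse (?c t))"
    by (rule continuous_on_circlepath_param[OF cdiff_frechet_continuous[OF S f]]) (use er cS in auto)
   thus "continuous_on (ball x0 e \<times> cbox 0 1) (%p. blinfun_apply (case p of (x, t) => fx x t) b)"
    by (rule continuous_on_eq) (auto simp: fx)
  qed
 qed (use er in auto)
 have der: "hasD (%x. integral (cbox 0 1) (%t. f (x + cscale (?c t) v) * inverse (?c t))) (blinfun_apply (integral (cbox 0 1) (fx x0))) x0"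
  using leib unfolding at_within_open[OF x0b open_ball] .
 have fxi: "fx x0 integrable_on cbox 0 1"
 proof (rule integrable_continuous, rule continuous_on_blinfun_componentwise)
  fix b :: 'a
  show "continuous_on (cbox 0 1) (%t. blinfun_apply (fx x0 t) b)"
   unfolding fx[OF x0b] by (rule continuous_on_circlepath_line[OF cdiff_frechet_continuous[OF S f] er(2) cS[OF x0b]])
 qed
 have "cdiff_at (%x. integral (cbox 0 1) (%t. f (x + cscale (?c t) v) * inverse (?c t))) x0"
 proof (rule cdiff_atI[OF der])
  fix h
  have "?D (x0 + cscale (?c t) v) (imul h) = \<i> * ?D (x0 + cscale (?c t) v) h" for t
   using D(2)[OF cS[OF x0b, of t]] by (simp add: clin_def imul_complex)
  thus "blinfun_apply (integral (cbox 0 1) (fx x0)) (imul h) = imul (blinfun_apply (integral (cbox 0 1) (fx x0)) h)"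
   unfolding blinfun_apply_integral[OF fxi] fx[OF x0b] imul_complex by (simp only: mult.assoc integral_mult_right)
 qed
 thus ?thesis
 proof (rule cdiff_at_cong_open[of _ _ "ball x0 e"])
  show "integral (cbox 0 1) (%t. f (x + cscale (?c t) v) * inverse (?c t)) = ?D x v" if "x : ball x0 e" for x
   using cauchy_directional_derivative[OF er(2), of f x v] f[OF er(3)[OF that]] by simp
 qed (use er in auto)
qed

lemma cdiff_frechet_vec_nth:
 assumes "cdiff_at f x"
 shows "fd f x v $ i = fd (%y. f y $ i) x v"
 using fd_eqI[OF has_derivative_vec_nth[OF cdiff_fd(1)[OF assms], of i]] by simp

lemma cdiff_frechet:
 fixes f :: "'a::{complex_model,euclidean_space} => complex ^ 'n"
 assumes S: "open S" and f: "!!x. x : S ==> cdiff_at f x" and x0: "x0 : S"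
 shows "cdiff_at (%x. fd f x v) x0"
proof (rule cdiff_at_vec)
 fix i
 have "cdiff_at (%x. fd (%y. f y $ i) x v) x0"
  by (rule cdiff_frechet_complex[OF S _ x0]) (rule cdiff_at_vec_nth[OF f])
 thus "cdiff_at (%x. fd f x v $ i) x0"
  by (rule cdiff_at_cong_open[OF _ S x0]) (simp add: cdiff_frechet_vec_nth f)
qed

text \<open>Directional derivatives of a holomorphic function are again holomorphic, so the
  induction reproduces its own hypothesis.\<close>

lemma cdiff_smooth_complex:
 fixes f :: "'a::{complex_model,euclidean_space} => complex"
 assumes S: "open S" and f: "!!x. x : S ==> cdiff_at f x"
 shows "smooth_on S f" unfolding smooth_on_def
proof
 fix k show "cont_diff k S f" using f
 proof (induction k arbitrary: f)
  case 0
  thus ?case by (auto intro!: cont_at_on cdiff_at_isCont)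
 next
  case (Suc k)
  show ?case by (rule cont_diff_SucI[OF S cdiff_fd(1)[OF Suc.prems]])
    (auto intro!: Suc.IH cdiff_frechet_complex[OF S Suc.prems])
 qed
qed

lemma cdiff_smooth:
 fixes f :: "'a::{complex_model,euclidean_space} => complex ^ 'n"
 assumes S: "open S" and f: "!!x. x : S ==> cdiff_at f x"
 shows "smooth_on S f"
proof -
 have "smooth_on S (%x. f x $ i)" for i by (rule cdiff_smooth_complex[OF S cdiff_at_vec_nth[OF f]])
 thus ?thesis using cont_diff_vec[OF S] unfolding smooth_on_def by blast
qed

lemma complex_linear_matrix:
 fixes D :: "complex ^ 'n => complex ^ 'm"
 assumes "complex_linear D"
 shows "D v = matrix D *v v"
proof (rule matrix_works[symmetric])
 have "D (c *s x) = c *s D x" for c x using complex_linear_cscale_eq[OF assms, of c x] by simp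
 thus "Vector_Spaces.linear (*s) (*s) D"
  using assms by unfold_locales (auto simp: clin_def linear_add vec.scale_right_distrib vec.scale_left_distrib)
qed

section \<open>The Ricci form of a Kaehler metric\<close>

lemma bilinear_simps:
 assumes "bilinear f"
 shows "f (x + y) z = f x z + f y z" "f z (x + y) = f z x + f z y"
  "f (r *R x) y = r *R f x y" "f x (r *R y) = r *R f x y"
  "f (- x) y = - f x y" "f x (- y) = - f x y" "f 0 y = 0" "f x 0 = 0"
 using assms by (auto simp: bilinear_ladd bilinear_radd bilinear_lmul bilinear_rmul bilinear_lneg bilinear_rneg bilinear_lzero bilinear_rzero)

text \<open>The real basis consists of the pairs e, i e. By complex linearity both members of a pair
  contribute the real part of the same diagonal entry.\<close>

lemma complex_linear_trace:
 fixes L :: "complex ^ 'n => complex ^ 'n"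
 assumes "complex_linear L"
 shows "(\<Sum>e\<in>Basis. L e \<bullet> e) = 2 * Re (\<Sum>i\<in>UNIV. L (axis i 1) $ i)"
proof -
 have B: "(Basis :: (complex ^ 'n) set) = (%(i, u). axis i u) ` (UNIV \<times> {1, \<i>})"
  by (auto simp: Basis_vec_def Basis_complex_def)
 have inj: "inj_on (%(i, u). axis i u :: complex ^ 'n) (UNIV \<times> {1, \<i>})"
  by (auto simp: inj_on_def axis_eq_axis)
 have imul_axis: "axis i \<i> = imul (axis i 1 :: complex ^ 'n)" for i
  by (auto simp: vec_eq_iff axis_def imul_complex)
 have "(\<Sum>e\<in>Basis. L e \<bullet> e) = (\<Sum>i\<in>UNIV. \<Sum>u\<in>{1, \<i>}. L (axis i u) \<bullet> axis i u)"
  unfolding B sum.reindex[OF inj] sum.cartesian_product by (simp add: case_prod_beta o_def)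
 also have "... = (\<Sum>i\<in>UNIV. 2 * Re (L (axis i 1) $ i))"
 proof (rule sum.cong[OF refl])
  fix i
  have "L (axis i \<i>) = imul (L (axis i 1))" unfolding imul_axis using assms by (simp add: clin_def)
  thus "(\<Sum>u\<in>{1, \<i>}. L (axis i u) \<bullet> axis i u) = 2 * Re (L (axis i 1) $ i)"
   by (simp add: inner_axis imul_complex inner_complex_def)
 qed
 finally show ?thesis by (simp add: sum_distrib_left)
qed

lemma sum_axis_vec: "(u :: complex ^ 'n) = (\<Sum>i\<in>UNIV. u $ i *s axis i 1)"
 by (auto simp: vec_eq_iff axis_def if_distrib cong: if_cong)

definition gram :: "(complex ^ 'n => complex ^ 'n => complex ^ 'n => real) => complex ^ 'n => complex ^ 'n ^ 'n" where
 "gram b y = (\<chi> i j. hermitian b y (axis i 1) (axis j 1))"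

locale hermitian_form =
 fixes b :: "complex ^ 'n => complex ^ 'n => complex ^ 'n => real" and y :: "complex ^ 'n"
 assumes bil: "bilinear (b y)" and sym: "b y u v = b y v u" and pos: "v ~= 0 ==> 0 < b y v v"
  and Jinv: "b y (imul u) (imul v) = b y u v"
begin

lemmas bs = bilinear_simps[OF bil]

lemma b_imul_left: "b y (imul u) v = - b y u (imul v)" using Jinv[of u "imul v"] by (simp add: imul_imul bs)

lemma herm_simps:
 "hermitian b y (u + u') v = hermitian b y u v + hermitian b y u' v"
 "hermitian b y u (v + v') = hermitian b y u v + hermitian b y u v'"
 "hermitian b y (r *R u) v = r * hermitian b y u v"
 "hermitian b y u (r *R v) = r * hermitian b y u v"
 "hermitian b y (imul u) v = \<i> * hermitian b y u v"
 "hermitian b y u (imul v) = - \<i> * hermitian b y u v"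
 "hermitian b y v u = cnj (hermitian b y u v)"
proof -
 show "hermitian b y v u = cnj (hermitian b y u v)"
  using b_imul_left[of v u] sym by (simp add: hermitian_def kaehler_form_def complex_eq_iff)
qed (auto simp: hermitian_def kaehler_form_def imul_add imul_scaleR imul_imul bs algebra_simps b_imul_left)

lemma herm_scale: "hermitian b y (z *s u) v = z * hermitian b y u v" "hermitian b y u (z *s v) = cnj z * hermitian b y u v"
proof -
 have eq: "z *s u = Re z *R u + Im z *R imul u" for u :: "complex ^ 'n"
  unfolding cscale_vec[symmetric] cscale_def ..
 show "hermitian b y (z *s u) v = z * hermitian b y u v"
  unfolding eq herm_simps(1-6) by (simp add: complex_eq_iff algebra_simps)
 show "hermitian b y u (z *s v) = cnj z * hermitian b y u v"
  unfolding eq herm_simps(1-6) by (simp add: complex_eq_iff algebra_simps)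
qed

lemma herm_zero [simp]: "hermitian b y 0 v = 0" "hermitian b y u 0 = 0"
 by (auto simp: hermitian_def kaehler_form_def bs)

lemma herm_sum: "hermitian b y (\<Sum>i\<in>I. u i) v = (\<Sum>i\<in>I. hermitian b y (u i) v)"
 "hermitian b y v (\<Sum>i\<in>I. u i) = (\<Sum>i\<in>I. hermitian b y v (u i))"
 by (induction I rule: infinite_finite_induct) (auto simp: herm_simps(1,2))

lemma herm_gram_left: "hermitian b y u v = (\<Sum>i\<in>UNIV. u $ i * hermitian b y (axis i 1) v)"
 by (subst sum_axis_vec[of u]) (simp add: herm_sum herm_scale)

lemma herm_gram_right: "hermitian b y u v = (\<Sum>j\<in>UNIV. cnj (v $ j) * hermitian b y u (axis j 1))"
 by (subst sum_axis_vec[of v]) (simp add: herm_sum herm_scale)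

lemma herm_gram: "hermitian b y u v = (\<Sum>i\<in>UNIV. \<Sum>j\<in>UNIV. u $ i * cnj (v $ j) * gram b y $ i $ j)"
 by (subst herm_gram_left, subst herm_gram_right) (simp add: gram_def sum_distrib_left mult.assoc)

lemma det_gram_pos: "Im (det (gram b y)) = 0" "0 < Re (det (gram b y))"
proof -
 have 1: "gram b y $ i $ j = cnj (gram b y $ j $ i)" for i j by (simp add: gram_def herm_simps(7)[of "axis i 1"])
 have 2: "0 < Re (\<Sum>i\<in>UNIV. \<Sum>j\<in>UNIV. v $ i * cnj (v $ j) * gram b y $ i $ j)" if "v ~= 0" for v
  using pos[OF that] unfolding herm_gram[symmetric] by (simp add: hermitian_def)
 show "Im (det (gram b y)) = 0" "0 < Re (det (gram b y))" by (rule det_positive_definite[OF 1 2]; assumption)+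
qed

text \<open>The matrix is the Gram matrix multiplied by P on the left and by its adjoint on the
  right, where P has the rows d i. So the squared J-volume of any frame is that of the coordinate
  frame times a squared modulus.\<close>

lemma det_herm_columns:
 "det (\<chi> i j. hermitian b y (d i) (d j)) = of_real ((cmod (det (\<chi> i j. d j $ i)))\<^sup>2) * det (gram b y)"
proof -
 define P :: "complex ^ 'n ^ 'n" where "P = (\<chi> i k. d i $ k)"
 define Q :: "complex ^ 'n ^ 'n" where "Q = (\<chi> l j. cnj (d j $ l))"
 have "(\<chi> i j. hermitian b y (d i) (d j)) = P ** gram b y ** Q" unfolding vec_eq_iff
  by (subst herm_gram_right, subst herm_gram_left) (simp add: P_def Q_def matrix_matrix_mult_def gram_def mult.commute)
 moreover have "det Q = cnj (det P)"
 proof -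
  have "det Q = det (transpose Q)" by simp
  also have "transpose Q = (\<chi> i k. cnj (P $ i $ k))" by (simp add: Q_def P_def transpose_def)
  also have "det ... = cnj (det P)" unfolding det_def by simp
  finally show ?thesis .
 qed
 moreover have "det (\<chi> i j. d j $ i) = det P" using det_transpose[of P] by (simp add: P_def transpose_def)
 ultimately show ?thesis by (simp only: det_mul complex_norm_square) (simp add: ac_simps)
qed

text \<open>A real functional k is the real part of exactly one conjugate linear functional,
  \<open>C w = k w + \<i> * k (imul w)\<close>. Representing C by the Hermitian form is a square
  complex linear system, to which Cramer's rule applies.\<close>

lemma gram_solve:
 assumes "linear k" and eq: "transpose (gram b y) *v z = (\<chi> j. complex_of_real (k (axis j 1)) + \<i> * complex_of_real (k (imul (axis j 1))))"
 shows "b y z w = k w"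
proof -
 define C where "C w = complex_of_real (k w) + \<i> * complex_of_real (k (imul w))" for w
 have C_scale: "C (a *s w) = cnj a * C w" for a w
 proof -
  have "a *s w = Re a *R w + Im a *R imul w" unfolding cscale_vec[symmetric] cscale_def ..
  thus ?thesis
   using assms(1) by (simp add: C_def linear_add linear_diff linear_scale linear_neg imul_add imul_scaleR imul_imul complex_eq_iff algebra_simps)
 qed
 have C_add: "C (v + w) = C v + C w" for v w using assms(1) by (simp add: C_def linear_add imul_add algebra_simps)
 have C0: "C 0 = 0" using assms(1) by (simp add: C_def linear_0)
 have C_sum: "C (\<Sum>i\<in>I. f i) = (\<Sum>i\<in>I. C (f i))" for I and f :: "'n => _"
  by (induction I rule: infinite_finite_induct) (auto simp: C_add C0)
 have "hermitian b y z (axis j 1) = C (axis j 1)" for j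
 proof -
  have "(transpose (gram b y) *v z) $ j = C (axis j 1)" unfolding eq C_def by simp
  thus ?thesis by (subst herm_gram_left) (simp add: matrix_vector_mult_def transpose_def gram_def mult.commute)
 qed
 hence "hermitian b y z w = C w" by (subst herm_gram_right, subst (3) sum_axis_vec) (simp add: C_sum C_scale)
 thus ?thesis by (simp add: hermitian_def C_def complex_eq_iff)
qed

lemma b_cancel: assumes "!!w. b y z w = b y z' w" shows "z = z'"
proof (rule ccontr)
 assume "z ~= z'"
 hence "0 < b y (z - z') (z - z')" using pos by simp
 moreover have "b y (z - z') w = 0" for w using assms[of w] bs(1)[of z "- z'" w] bs(5)[of z' w] by simp
 ultimately show False by simp
qed

end

locale kaehler_chart =
 fixes b :: "complex ^ 'n => complex ^ 'n => complex ^ 'n => real" and S :: "(complex ^ 'n) set"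
 assumes opS: "open S" and sm: "smooth_on S (%y. b y u v)"
  and form: "y : S ==> hermitian_form b y"
  and closed: "y : S ==>
       fd (%y. kaehler_form b y v w) y u +
       fd (%y. kaehler_form b y w u) y v +
       fd (%y. kaehler_form b y u v) y w = 0"
begin

abbreviation Db where "Db y u v w \<equiv> fd (%y. b y v w) y u"

lemma Db: "y : S ==> hasD (%y. b y v w) (%u. Db y u v w) y"
 using smooth_hasD[OF sm] by simp

lemma Db_cong:
 assumes y: "y : S" and "!!y. y : S ==> (%y. f y) y = b y v w" "hasD f D y"
 shows "Db y u v w = D u"
 using fd_eqI[OF hasD_transform[OF assms(3) opS y]] assms(2) by auto

lemma Db_simps:
 assumes y: "y : S"
 shows "Db y u v w = Db y u w v"
  "Db y (u + u') v w = Db y u v w + Db y u' v w" "Db y (r *R u) v w = r * Db y u v w"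
  "Db y u (v + v') w = Db y u v w + Db y u v' w" "Db y u (r *R v) w = r * Db y u v w"
  "Db y u v (w + w') = Db y u v w + Db y u v w'" "Db y u v (r *R w) = r * Db y u v w"
  "Db y u (imul v) (imul w) = Db y u v w" "Db y u (- v) w = - Db y u v w" "Db y u v (- w) = - Db y u v w"
proof -
 note hs = hermitian_form.bs[OF form] and hsym = hermitian_form.sym[OF form] and hJ = hermitian_form.Jinv[OF form]
 have lin: "linear (%u. Db y u v w)" for v w using Db[OF y] has_derivative_linear by blast
 show "Db y (u + u') v w = Db y u v w + Db y u' v w" "Db y (r *R u) v w = r * Db y u v w"
  using linear_add[OF lin] linear_scale[OF lin] by auto
 show "Db y u v w = Db y u w v" by (rule Db_cong[OF y _ Db[OF y]]) (rule hsym)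
 show "Db y u (v + v') w = Db y u v w + Db y u v' w"
  by (rule Db_cong[OF y _ has_derivative_add[OF Db[OF y] Db[OF y]]]) (simp add: hs)
 show "Db y u (r *R v) w = r * Db y u v w"
  by (rule Db_cong[OF y _ has_derivative_mult_right[OF Db[OF y]]]) (simp add: hs)
 show "Db y u v (w + w') = Db y u v w + Db y u v w'"
  by (rule Db_cong[OF y _ has_derivative_add[OF Db[OF y] Db[OF y]]]) (simp add: hs)
 show "Db y u v (r *R w) = r * Db y u v w"
  by (rule Db_cong[OF y _ has_derivative_mult_right[OF Db[OF y]]]) (simp add: hs)
 show "Db y u (imul v) (imul w) = Db y u v w" by (rule Db_cong[OF y _ Db[OF y]]) (simp add: hJ)
 show "Db y u (- v) w = - Db y u v w" by (rule Db_cong[OF y _ has_derivative_minus[OF Db[OF y]]]) (simp add: hs)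
 show "Db y u v (- w) = - Db y u v w" by (rule Db_cong[OF y _ has_derivative_minus[OF Db[OF y]]]) (simp add: hs)
qed

lemma Db_imul:
 assumes y: "y : S" shows "Db y u (imul v) w = - Db y u v (imul w)"
 using Db_simps(8)[OF y, where u=u and v=v and w="imul w"] Db_simps(10)[OF y, where u=u and v="imul v" and w=w] by (simp add: imul_imul)

text \<open>The right-hand side of the Koszul formula for constant vector fields.\<close>

abbreviation cf where
 "cf y u v w \<equiv> (Db y u v w + Db y v u w - Db y w u v) / 2"

abbreviation \<Gamma> where "\<Gamma> y u v \<equiv> christoffel b y u v"

lemma linear_cf: "y : S ==> linear (cf y u v)"
 by unfold_locales (simp_all add: Db_simps algebra_simps add_divide_distrib diff_divide_distrib)

lemma det_transpose_gram: "y : S ==> det (transpose (gram b y)) ~= 0"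
 using hermitian_form.det_gram_pos(2)[OF form, of y] by (auto simp: complex_eq_iff)

text \<open>\<open>christoffel\<close> is a definite description. Cramer's rule gives existence and
  definiteness of the metric gives uniqueness; the explicit linear system is kept as a conclusion
  because smoothness of \<Gamma> follows from it.\<close>

lemma \<Gamma>_gram:
 assumes y: "y : S"
 shows "transpose (gram b y) *v \<Gamma> y u v = (\<chi> j. complex_of_real (cf y u v (axis j 1)) + \<i> * complex_of_real (cf y u v (imul (axis j 1))))" (is "_ = ?r")
  and \<Gamma>: "b y (\<Gamma> y u v) w = cf y u v w"
proof -
 interpret hermitian_form b y using form[OF y] .
 define z where "z = (\<chi> l. det (\<chi> i j. if j = l then ?r $ i else transpose (gram b y) $ i $ j) / det (transpose (gram b y)))"
 have z: "transpose (gram b y) *v z = ?r" unfolding cramer[OF det_transpose_gram[OF y]] z_def by simp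
 have bz: "b y z w = cf y u v w" for w by (rule gram_solve[OF linear_cf[OF y] z])
 have "\<Gamma> y u v = z" unfolding christoffel_def by (rule the_equality) (use bz b_cancel in metis)+
 thus "transpose (gram b y) *v \<Gamma> y u v = ?r" "b y (\<Gamma> y u v) w = cf y u v w" using z bz by auto
qed

lemma smooth_gram: "cont_diff k S (%y. gram b y $ i $ j)"
proof -
 have bl: "bounded_linear complex_of_real" by (rule bounded_linear_of_real)
 have "cont_diff k S (%y. b y (axis i 1) (axis j 1))" "cont_diff k S (%y. b y (imul (axis i 1)) (axis j 1))"
  using sm by (auto simp: smooth_on_def)
 hence "cont_diff k S (%y. complex_of_real (b y (axis i 1) (axis j 1)) + (- \<i>) * complex_of_real (b y (imul (axis i 1)) (axis j 1)))"
  by (intro cont_diff_add cont_diff_mult cont_diff_const cont_diff_linear[OF opS bl] opS)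
 thus ?thesis by (simp add: gram_def hermitian_def kaehler_form_def del: cont_diff.simps)
qed

lemma smooth_\<Gamma>: "cont_diff k S (%y. \<Gamma> y u v)"
proof (rule cont_diff_solve[OF opS _ _ det_transpose_gram \<Gamma>_gram(1)])
 show "cont_diff k S (%y. transpose (gram b y) $ i $ j)" for i j
  using smooth_gram by (simp add: transpose_def del: cont_diff.simps)
 have bl: "bounded_linear complex_of_real" by (rule bounded_linear_of_real)
 have D: "cont_diff k S (%y. Db y u v w)" for u v w
  using smooth_on_frechet[OF sm] by (auto simp: smooth_on_def)
 have neg: "bounded_linear (%x::real. x / 2)" "bounded_linear (%x::real. - x)"
  by (auto intro: bounded_linear_divide bounded_linear_minus bounded_linear_ident)
 have "cont_diff k S (%y. (Db y u v w + Db y v u w + - Db y w u v) / 2)" for w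
  by (intro cont_diff_linear[OF opS neg(1)] cont_diff_add opS D cont_diff_linear[OF opS neg(2)])
 hence c: "cont_diff k S (%y. cf y u v w)" for w by (simp del: cont_diff.simps)
 show "cont_diff k S (%y. (\<chi> j. complex_of_real (cf y u v (axis j 1)) + \<i> * complex_of_real (cf y u v (imul (axis j 1)))) $ i)" for i
  unfolding vec_lambda_beta by (intro cont_diff_add cont_diff_mult cont_diff_const opS cont_diff_linear[OF opS bl] c)
qed auto

lemma \<Gamma>_sym: "y : S ==> \<Gamma> y u v = \<Gamma> y v u"
 by (rule hermitian_form.b_cancel[OF form]) (auto simp: \<Gamma> Db_simps(1))

text \<open>The complex structure is parallel; this is where closedness of the Kaehler form enters.
  Its instances at (iv, w, iu) and (v, iw, iu) add up to the Koszul terms of \<Gamma> u (iv) - i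
  \<Gamma> u v paired with w.\<close>

lemma \<Gamma>_imul_right:
 assumes y: "y : S" shows "\<Gamma> y u (imul v) = imul (\<Gamma> y u v)"
proof (rule hermitian_form.b_cancel[OF form[OF y]])
 fix w
 interpret hermitian_form b y using form[OF y] .
 have k: "kaehler_form b = (%y u v. b y (imul u) v)" by (auto simp: kaehler_form_def fun_eq_iff)
 have 1: "Db y (imul v) w u - Db y w u (imul v) - Db y (imul u) v w = 0"
  using closed[OF y, of "imul v" w "imul u"] by (simp add: k Db_simps[OF y] imul_imul)
 have 2: "Db y v (imul w) u - Db y (imul w) u v + Db y (imul u) v w = 0"
  using closed[OF y, where u=v and v="imul w" and w="imul u"] Db_imul[OF y, where u="imul u" and v=v and w="imul w"]
   Db_imul[OF y, where u=v and v=w and w=u] Db_simps(1)[OF y, where u=v and v=u and w="imul w"]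
  by (simp add: k imul_imul Db_simps(8-10)[OF y])
 have "b y (imul (\<Gamma> y u v)) w = - cf y u v (imul w)" by (simp add: b_imul_left \<Gamma>[OF y])
 moreover have "cf y u (imul v) w + cf y u v (imul w) = 0"
  using 1 2 Db_imul[OF y, where u=u and v=v and w=w] Db_simps(1)[OF y, where u=v and v="imul w" and w=u] Db_simps(1)[OF y, where u="imul v" and v=w and w=u]
  by ((simp add: field_simps; fail) | (simp add: field_simps, linarith) | argo)
 ultimately show "b y (\<Gamma> y u (imul v)) w = b y (imul (\<Gamma> y u v)) w"
  by (simp only: \<Gamma>[OF y] eq_neg_iff_add_eq_0)
qed

lemma \<Gamma>_imul_left: "y : S ==> \<Gamma> y (imul u) v = imul (\<Gamma> y u v)"
 using \<Gamma>_sym \<Gamma>_imul_right by simp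

lemma \<Gamma>_linear:
 assumes y: "y : S"
 shows "\<Gamma> y u (v + v') = \<Gamma> y u v + \<Gamma> y u v'" "\<Gamma> y u (r *R v) = r *R \<Gamma> y u v"
proof -
 interpret hermitian_form b y using form[OF y] .
 show "\<Gamma> y u (v + v') = \<Gamma> y u v + \<Gamma> y u v'"
  by (rule b_cancel) (simp add: \<Gamma>[OF y] bs Db_simps[OF y] field_simps)
 show "\<Gamma> y u (r *R v) = r *R \<Gamma> y u v"
  by (rule b_cancel) (simp add: \<Gamma>[OF y] bs Db_simps[OF y] field_simps)
qed

lemma complex_linear_\<Gamma>: "y : S ==> complex_linear (\<Gamma> y u)"
 unfolding clin_def using \<Gamma>_linear \<Gamma>_imul_right by (auto intro!: linearI)

lemma \<Gamma>_metric:
 assumes y: "y : S" shows "Db y u v w = b y (\<Gamma> y u v) w + b y v (\<Gamma> y u w)"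
proof -
 interpret hermitian_form b y using form[OF y] .
 show ?thesis
  by (subst sym[of v]) (simp add: \<Gamma>[OF y] Db_simps(1)[OF y, where u=u and v=w and w=v] Db_simps(1)[OF y, where u=v and v=w and w=u] Db_simps(1)[OF y, where u=w and v=v and w=u] field_simps)
qed

lemma gram_derivative:
 assumes y: "y : S"
 shows "hasD (%y. gram b y) (%u. \<chi> i j. hermitian b y (\<Gamma> y u (axis i 1)) (axis j 1) + hermitian b y (axis i 1) (\<Gamma> y u (axis j 1))) y"
 unfolding gram_def
proof (intro has_derivative_vec_lambda)
 fix i j
 have bl: "bounded_linear complex_of_real" by (rule bounded_linear_of_real)
 have "hasD (%y. hermitian b y (axis i 1) (axis j 1)) (%u. complex_of_real (Db y u (axis i 1) (axis j 1)) - \<i> * complex_of_real (Db y u (imul (axis i 1)) (axis j 1))) y"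
  unfolding hermitian_def kaehler_form_def
  by (intro has_derivative_diff has_derivative_mult_right bounded_linear.has_derivative[OF bl] Db y)
 moreover have "complex_of_real (Db y u (axis i 1) (axis j 1)) - \<i> * complex_of_real (Db y u (imul (axis i 1)) (axis j 1)) =
   hermitian b y (\<Gamma> y u (axis i 1)) (axis j 1) + hermitian b y (axis i 1) (\<Gamma> y u (axis j 1))" for u
  by (simp add: \<Gamma>_metric[OF y] hermitian_def kaehler_form_def \<Gamma>_imul_right[OF y] algebra_simps)
 ultimately show "hasD (%y. hermitian b y (axis i 1) (axis j 1)) (%u. hermitian b y (\<Gamma> y u (axis i 1)) (axis j 1) + hermitian b y (axis i 1) (\<Gamma> y u (axis j 1))) y"
  by simp
qed

definition logdet where "logdet y = ln (Re (det (gram b y)))"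

text \<open>By metric compatibility the Gram matrix h has derivative C h + h C', where C' is the
  adjoint of C and C is the matrix of \<Gamma> u. Jacobi's formula turns this into 2 Re tr C, which
  is the real trace of \<Gamma> u.\<close>

lemma logdet_derivative:
 assumes y: "y : S"
 shows "hasD logdet (%u. \<Sum>e\<in>Basis. \<Gamma> y u e \<bullet> e) y"
proof -
 interpret hermitian_form b y using form[OF y] .
 have nz: "det (gram b y) ~= 0" using det_gram_pos by auto
 then obtain B where B: "B ** gram b y = mat 1" "gram b y ** B = mat 1" by (rule det_nonzero_inverse)
 define C where "C u = (\<chi> i k. \<Gamma> y u (axis i 1) $ k)" for u
 define C' where "C' u = (\<chi> k j. cnj (\<Gamma> y u (axis j 1) $ k))" for u
 have D: "(\<chi> i j. hermitian b y (\<Gamma> y u (axis i 1)) (axis j 1) + hermitian b y (axis i 1) (\<Gamma> y u (axis j 1))) = C u ** gram b y + gram b y ** C' u" for u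
  unfolding vec_eq_iff plus_vec_def
  by (subst herm_gram_left, subst (2) herm_gram_right) (simp add: C_def C'_def matrix_matrix_mult_def gram_def mult.commute)
 have "trace (B ** (C u ** gram b y + gram b y ** C' u)) = trace (C u) + trace (C' u)" for u
 proof -
  have "trace (B ** (C u ** gram b y)) = trace (C u)"
   using trace_mul_sym[of B "C u ** gram b y"] B by (simp add: matrix_mul_assoc[symmetric])
  moreover have "trace (B ** (gram b y ** C' u)) = trace (C' u)" using B by (simp add: matrix_mul_assoc)
  ultimately show ?thesis by (simp add: matrix_add_ldistrib trace_add)
 qed
 moreover have "trace (C' u) = cnj (trace (C u))" for u by (simp add: C_def C'_def trace_def)
 ultimately have tr: "trace (B ** (C u ** gram b y + gram b y ** C' u)) = of_real (2 * Re (trace (C u)))" for u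
  by (simp add: complex_eq_iff)
 have "hasD (%y. det (gram b y)) (%u. det (gram b y) * of_real (2 * Re (trace (C u)))) y"
  using has_derivative_det[OF gram_derivative[OF y] B(1)] by (simp only: D tr)
 hence "hasD (%y. Re (det (gram b y))) (%u. Re (det (gram b y)) * (2 * Re (trace (C u)))) y"
  using bounded_linear.has_derivative[OF bounded_linear_Re] by fastforce
 from has_derivative_ln[OF det_gram_pos(2) this]
 have "hasD logdet (%u. Re (det (gram b y)) * (2 * Re (trace (C u))) * inverse (Re (det (gram b y)))) y"
  unfolding logdet_def[abs_def] .
 moreover have "(%u. Re (det (gram b y)) * (2 * Re (trace (C u))) * inverse (Re (det (gram b y)))) = (%u. 2 * Re (trace (C u)))"
  using det_gram_pos(2) by (auto simp: field_simps)
 ultimately have "hasD logdet (%u. 2 * Re (trace (C u))) y" by simp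
 moreover have "2 * Re (trace (C u)) = (\<Sum>e\<in>Basis. \<Gamma> y u e \<bullet> e)" for u
  using complex_linear_trace[OF complex_linear_\<Gamma>[OF y]] by (simp add: C_def trace_def)
 ultimately show ?thesis by simp
qed

abbreviation D\<Gamma> where "D\<Gamma> y a u v \<equiv> fd (%y. \<Gamma> y u v) y a"

lemma D\<Gamma>: "y : S ==> hasD (%y. \<Gamma> y u v) (%a. D\<Gamma> y a u v) y"
 using cd_SucD(1)[OF smooth_\<Gamma>[of "Suc 0"]] by simp

lemma D\<Gamma>_imul:
 assumes y: "y : S"
 shows "D\<Gamma> y a u (imul v) = imul (D\<Gamma> y a u v)" "D\<Gamma> y a (imul u) v = imul (D\<Gamma> y a u v)"
  "D\<Gamma> y a u v = D\<Gamma> y a v u"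
proof -
 have 1: "hasD (%y. imul (\<Gamma> y u v)) (%a. imul (D\<Gamma> y a u v)) y"
  by (rule bounded_linear.has_derivative[OF bounded_linear_imul D\<Gamma>[OF y]])
 show "D\<Gamma> y a u (imul v) = imul (D\<Gamma> y a u v)"
  using fd_eqI[OF hasD_transform[OF 1 opS y]] \<Gamma>_imul_right by metis
 show "D\<Gamma> y a (imul u) v = imul (D\<Gamma> y a u v)"
  using fd_eqI[OF hasD_transform[OF 1 opS y]] \<Gamma>_imul_left by metis
 show "D\<Gamma> y a u v = D\<Gamma> y a v u"
  using fd_eqI[OF hasD_transform[OF D\<Gamma>[OF y] opS y]] \<Gamma>_sym by metis
qed

lemma riemann_eq: "riemann b y u v w = D\<Gamma> y u v w - D\<Gamma> y v u w + \<Gamma> y u (\<Gamma> y v w) - \<Gamma> y v (\<Gamma> y u w)"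
 by (simp add: riemann_def)

text \<open>The terms quadratic in \<open>\<Gamma>\<close> cancel because \<open>\<Gamma>\<close> is symmetric and complex bilinear.\<close>

lemma riemann_sum:
 assumes y: "y : S"
 shows "riemann b y u v v + riemann b y u (imul v) (imul v) = - (D\<Gamma> y v v u + D\<Gamma> y (imul v) (imul v) u)"
proof -
 have neg: "imul (x - z) = imul x - imul z" for x z :: "complex ^ 'n"
  using imul_add[of x "- z"] by (simp add: imul_minus)
 have "riemann b y u (imul v) (imul v) =
  - D\<Gamma> y u v v - imul (D\<Gamma> y (imul v) u v) - \<Gamma> y u (\<Gamma> y v v) + \<Gamma> y v (\<Gamma> y u v)"
  by (simp add: riemann_eq D\<Gamma>_imul(1,2)[OF y] \<Gamma>_imul_left[OF y] \<Gamma>_imul_right[OF y] imul_imul)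
   (metis \<Gamma>_linear(2)[OF y] scaleR_minus1_left)
 thus ?thesis
  unfolding riemann_eq using D\<Gamma>_imul(3)[OF y, where a=v and u=u and v=v] D\<Gamma>_imul(3)[OF y, where a="imul v" and u=u and v=v]
   D\<Gamma>_imul(2)[OF y, where a="imul v" and u=v and v=u] by simp
qed

text \<open>The Ricci form is minus the complex Hessian of log det h; adding the values at v and iv
  gives the Laplacian along the complex line of v. After \<open>riemann_sum\<close> only derivatives
  of \<Gamma> are left, and their traces are second derivatives of \<open>logdet\<close>.\<close>

lemma ricci_logdet:
 assumes y: "y : S"
 shows "ricci b y v v + ricci b y (imul v) (imul v) =
  - (fd (%y. fd logdet y v) y v +
    fd (%y. fd logdet y (imul v)) y (imul v))"
proof -
 have 1: "fd logdet y' v = (\<Sum>e\<in>Basis. \<Gamma> y' v e \<bullet> e)" if "y' : S" for y' v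
  using fd_eqI[OF logdet_derivative[OF that]] by simp
 have "hasD (%y. \<Sum>e\<in>Basis. \<Gamma> y v e \<bullet> e) (%a. \<Sum>e\<in>Basis. D\<Gamma> y a v e \<bullet> e) y" for v
  by (intro has_derivative_sum has_derivative_inner_left D\<Gamma> y)
 hence "hasD (%y. fd logdet y v) (%a. \<Sum>e\<in>Basis. D\<Gamma> y a v e \<bullet> e) y" for v
  by (rule hasD_transform[OF _ opS y]) (simp add: 1)
 note D2 = this
 have 2: "fd (%y. fd logdet y v) y a = (\<Sum>e\<in>Basis. D\<Gamma> y a v e \<bullet> e)" for v a
  by (simp only: fd_eqI[OF D2])
 have "ricci b y v v + ricci b y (imul v) (imul v) = (\<Sum>e\<in>Basis. (riemann b y e v v + riemann b y e (imul v) (imul v)) \<bullet> e)"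
  by (simp add: ricci_def sum.distrib inner_add_left)
 also have "... = - ((\<Sum>e\<in>Basis. D\<Gamma> y v v e \<bullet> e) + (\<Sum>e\<in>Basis. D\<Gamma> y (imul v) (imul v) e \<bullet> e))"
  by (simp add: riemann_sum[OF y] inner_add_left inner_diff_left sum.distrib sum_subtractf sum_negf)
 finally show ?thesis by (simp add: 2)
qed

lemma smooth_logdet: "cont_diff k S logdet"
proof (cases k)
 case 0
 have "continuous_on S logdet"
  by (auto intro!: cont_at_on has_derivative_continuous[OF logdet_derivative])
 with 0 show ?thesis by simp
next
 case (Suc k)
 have "cont_diff k S (%y. \<Sum>e\<in>Basis. \<Gamma> y u e \<bullet> e)" for u
  by (intro cont_diff_sum opS cont_diff_linear[OF opS bounded_linear_inner_left] smooth_\<Gamma>)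
 thus ?thesis unfolding Suc by (intro cont_diff_SucI[OF opS logdet_derivative])
qed

end

lemma cont_diff_local:
 assumes "!!x. x : S ==> EX T. open T & x : T & cont_diff k T f"
 shows "cont_diff k S f" using assms
proof (induction k arbitrary: f)
 case 0
 thus ?case unfolding cont_diff.simps
  by (intro cont_at_on) (metis cont_on_at)
next
 case (Suc k)
 show ?case unfolding cont_diff.simps
 proof (intro conjI ballI allI)
  show "f differentiable at x" if "x : S" for x using Suc.prems[OF that] by auto
  show "cont_diff k S (%x. fd f x v)" for v
  proof (rule Suc.IH)
   fix x assume "x : S"
   then obtain T where "open T" "x : T" "cont_diff (Suc k) T f" using Suc.prems by blast
   thus "EX T. open T & x : T & cont_diff k T (%x. fd f x v)" by auto
  qed
 qed
qed

lemma smooth_on_local: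
 assumes "!!x. x : S ==> EX T. open T & x : T & smooth_on T f"
 shows "smooth_on S f"
 unfolding smooth_on_def by (intro allI cont_diff_local) (use assms in "unfold smooth_on_def, blast")

section \<open>Maps into manifolds\<close>

text \<open>The topological part of a manifold modelled on a whole space. It passes to products
  without any argument about changes of charts.\<close>

definition charted :: "('a, 'e::complex_model) cmfd => bool" where
 "charted N \<longleftrightarrow> model N = UNIV & (ALL c:atlas N. is_chart (mtop N) UNIV c) &
   (\<Union>c\<in>atlas N. fst c) = pts N"

lemma complex_manifold_charted: "complex_manifold N ==> model N = UNIV ==> charted N"
 by (auto simp: complex_manifold_def charted_def)

lemma charted_chart_at: "charted N ==> x : pts N ==> EX c:atlas N. x : fst c"
 by (auto simp: charted_def)

lemma charted_chart:
 fixes c :: "('a, 'e::complex_model) chart"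
 assumes "charted N" "c : atlas N"
 shows chart_openin: "openin (mtop N) (fst c)" and chart_image_open: "open (chart_image c)"
  and chart_inv_chart: "x : fst c ==> chart_inv c (snd c x) = x"
  and chart_chart_inv: "y : chart_image c ==> snd c (chart_inv c y) = y"
  and chart_inv_mem: "y : chart_image c ==> chart_inv c y : fst c"
  and chart_mem_image: "x : fst c ==> snd c x : chart_image c"
  and chart_subset: "fst c \<subseteq> pts N"
  and continuous_map_chart: "continuous_map (subtopology (mtop N) (fst c)) euclidean (snd c)"
  and continuous_map_chart_inv: "continuous_map (top_of_set (chart_image c)) (mtop N) (chart_inv c)"
proof -
 have ch: "is_chart (mtop N) UNIV c" using assms by (auto simp: charted_def)
 thus op: "openin (mtop N) (fst c)" and "open (chart_image c)" by (auto simp: is_chart_def)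
 thus sub: "fst c \<subseteq> pts N" by (simp add: openin_subset)
 have hom: "homeomorphic_map (subtopology (mtop N) (fst c)) (top_of_set (chart_image c)) (snd c)"
  using ch by (auto simp: is_chart_def)
 have inj: "inj_on (snd c) (fst c)" using homeomorphic_imp_injective_map[OF hom] sub by (simp add: Int_absorb1)
 show inv: "chart_inv c (snd c x) = x" if "x : fst c" for x using inj that by (simp add: chart_inv_def)
 show sec: "snd c (chart_inv c y) = y" "chart_inv c y : fst c" if "y : chart_image c" for y
  using that by (auto simp: chart_inv_def chart_image_def f_inv_into_f inv_into_into)
 show "x : fst c ==> snd c x : chart_image c" by (simp add: chart_image_def)
 show "continuous_map (subtopology (mtop N) (fst c)) euclidean (snd c)"
  using homeomorphic_imp_continuous_map[OF hom] by (simp add: cm_in_sub)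
 obtain g where g: "homeomorphic_maps (subtopology (mtop N) (fst c)) (top_of_set (chart_image c)) (snd c) g"
  using hom homeomorphic_map_maps by metis
 have "g y = chart_inv c y" if "y : chart_image c" for y
 proof -
  have "g (snd c (chart_inv c y)) = chart_inv c y" using g sec(2)[OF that] sub by (auto simp: homeomorphic_maps_def)
  thus ?thesis by (simp add: sec that)
 qed
 moreover have "continuous_map (top_of_set (chart_image c)) (mtop N) g"
  using g by (auto simp: homeomorphic_maps_def cm_in_sub)
 ultimately show "continuous_map (top_of_set (chart_image c)) (mtop N) (chart_inv c)"
  by (rule continuous_map_eq[rotated]) auto
qed

lemma open_preimage:
 assumes "continuous_map (top_of_set S) X f" "open S" "openin X W"
 shows "open {x : S. f x : W}"
 using openin_continuous_map_preimage[OF assms(1,3)] assms(2) by (simp add: openin_open_eq)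

lemma charted_prod:
 assumes M: "charted M" and N: "charted N"
 shows "charted (prod_cmfd M N)"
proof -
 have "is_chart (prod_topology (mtop M) (mtop N)) UNIV (fst c \<times> fst d, map_prod (snd c) (snd d))"
  if c: "c : atlas M" and d: "d : atlas N" for c d
 proof -
  have im: "chart_image (fst c \<times> fst d, map_prod (snd c) (snd d)) = chart_image c \<times> chart_image d"
   by (auto simp: chart_image_def map_prod_def)
  have hc: "homeomorphic_map (subtopology (mtop M) (fst c)) (top_of_set (chart_image c)) (snd c)"
   and hd: "homeomorphic_map (subtopology (mtop N) (fst d)) (top_of_set (chart_image d)) (snd d)"
   using M N c d by (auto simp: charted_def is_chart_def)
  obtain g g' where g: "homeomorphic_maps (subtopology (mtop M) (fst c)) (top_of_set (chart_image c)) (snd c) g"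
   "homeomorphic_maps (subtopology (mtop N) (fst d)) (top_of_set (chart_image d)) (snd d) g'"
   using hc hd homeomorphic_map_maps by metis
  hence "homeomorphic_maps (prod_topology (subtopology (mtop M) (fst c)) (subtopology (mtop N) (fst d)))
    (prod_topology (top_of_set (chart_image c)) (top_of_set (chart_image d)))
    (%(x, y). (snd c x, snd d y)) (%(x, y). (g x, g' y))"
   unfolding homeomorphic_maps_prod by blast
  hence "homeomorphic_map (prod_topology (subtopology (mtop M) (fst c)) (subtopology (mtop N) (fst d)))
    (prod_topology (top_of_set (chart_image c)) (top_of_set (chart_image d))) (map_prod (snd c) (snd d))"
   unfolding map_prod_def homeomorphic_map_maps by blast
  moreover have "openin (prod_topology (mtop M) (mtop N)) (fst c \<times> fst d)"
   using chart_openin[OF M c] chart_openin[OF N d] by (simp add: openin_prod_Times_iff)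
  moreover have "open (chart_image c \<times> chart_image d)"
   by (intro open_Times chart_image_open[OF M c] chart_image_open[OF N d])
  ultimately show ?thesis by (simp add: is_chart_def im subtopology_Times prod_topology_subtopology_eu)
 qed
 moreover have "(\<Union>c\<in>atlas (prod_cmfd M N). fst c) = pts M \<times> pts N"
 proof -
  have "atlas (prod_cmfd M N) = (%p. (fst (fst p) \<times> fst (snd p), map_prod (snd (fst p)) (snd (snd p)))) ` (atlas M \<times> atlas N)"
   (is "?A = ?f ` _")
  proof (intro equalityI subsetI)
   fix e assume "e : ?A"
   then obtain c d where "e = ?f (c, d)" "(c, d) : atlas M \<times> atlas N"
    unfolding prod_cmfd_def cmfd.simps mem_Collect_eq by (metis SigmaI fst_conv snd_conv)
   thus "e : ?f ` (atlas M \<times> atlas N)" by (rule image_eqI)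
  next
   fix e assume "e : ?f ` (atlas M \<times> atlas N)"
   then obtain p where "e = ?f p" "fst p : atlas M" "snd p : atlas N" by auto
   thus "e : ?A" unfolding prod_cmfd_def cmfd.simps mem_Collect_eq by blast
  qed
  hence "(\<Union>c\<in>atlas (prod_cmfd M N). fst c) = (\<Union>c\<in>atlas M. fst c) \<times> (\<Union>d\<in>atlas N. fst d)"
   by fastforce
  thus ?thesis using M N by (simp add: charted_def)
 qed
 moreover have "topspace (mtop (prod_cmfd M N)) = pts M \<times> pts N" "model (prod_cmfd M N) = UNIV"
  using M N by (auto simp: charted_def prod_cmfd_def)
 ultimately show ?thesis unfolding charted_def by (auto simp: prod_cmfd_def)
qed

text \<open>Holomorphic maps from an open set of a model space into a manifold. As the source has a
  single chart, the group law and the action can be composed freely, and only the target is tested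
  in charts.\<close>

definition mhol :: "('a, 'e::complex_model) cmfd => 'b::complex_model set => ('b => 'a) => bool" where
 "mhol N S f \<longleftrightarrow> open S & continuous_map (top_of_set S) (mtop N) f &
   (ALL c:atlas N. ALL x:S. f x : fst c --> cdiff_at (%y. snd c (f y)) x)"

lemma mhol_open: "mhol N S f ==> open S"
 and mhol_continuous: "mhol N S f ==> continuous_map (top_of_set S) (mtop N) f"
 and mhol_cdiff: "mhol N S f ==> c : atlas N ==> x : S ==> f x : fst c ==> cdiff_at (%y. snd c (f y)) x"
 by (auto simp: mhol_def)

lemma mhol_topspace: "mhol N S f ==> x : S ==> f x : pts N"
 by (auto simp: mhol_def continuous_map_def)

lemma mhol_open_preimage: "mhol N S f ==> openin (mtop N) W ==> open {x : S. f x : W}"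
 using open_preimage by (auto simp: mhol_def)

lemma mhol_cong:
 assumes "mhol N S f" "!!x. x : S ==> f x = g x" shows "mhol N S g" unfolding mhol_def
proof (intro conjI ballI impI)
 show "open S" using assms by (simp add: mhol_def)
 show "continuous_map (top_of_set S) (mtop N) g"
  by (rule continuous_map_eq[OF mhol_continuous[OF assms(1)]]) (use assms(2) in auto)
 fix c x assume "c : atlas N" "x : S" "g x : fst c"
 thus "cdiff_at (%y. snd c (g y)) x"
  using cdiff_at_cong_open[OF mhol_cdiff[OF assms(1)] \<open>open S\<close>] assms(2) by metis
qed

lemma mhol_const: "open S ==> x : pts N ==> mhol N S (%_. x)"
 by (auto simp: mhol_def)

lemma mhol_reparam:
 assumes "mhol N T f" "open S" "!!x. x : S ==> u x : T" "!!x. x : S ==> cdiff_at u x"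
 shows "mhol N S (%x. f (u x))" unfolding mhol_def
proof (intro conjI ballI impI)
 have "continuous_on S u" by (intro cont_at_on ballI cdiff_at_isCont assms)
 hence "continuous_map (top_of_set S) (top_of_set T) u"
  using assms(3) by (auto simp: cm_in_sub)
 from cm_compose[OF this mhol_continuous[OF assms(1)]]
 show "continuous_map (top_of_set S) (mtop N) (%x. f (u x))" unfolding o_def .
 fix c x assume "c : atlas N" "x : S" "f (u x) : fst c"
 thus "cdiff_at (%y. snd c (f (u y))) x"
  using cdiff_at_compose[OF assms(4) mhol_cdiff[OF assms(1)]] assms(3) by blast
qed (rule assms)

lemma mhol_Pair:
 assumes "mhol M S f" "mhol N S h"
 shows "mhol (prod_cmfd M N) S (%x. (f x, h x))" unfolding mhol_def
proof (intro conjI ballI impI)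
 show "continuous_map (top_of_set S) (mtop (prod_cmfd M N)) (%x. (f x, h x))"
  using assms by (simp add: prod_cmfd_def mhol_def continuous_map_pairedI)
 fix e x assume "e : atlas (prod_cmfd M N)" "x : S" "(f x, h x) : fst e"
 then obtain c d where "c : atlas M" "d : atlas N" "e = (fst c \<times> fst d, map_prod (snd c) (snd d))" "f x : fst c" "h x : fst d"
  by (auto simp: prod_cmfd_def)
 thus "cdiff_at (%y. snd e (f y, h y)) x"
  using cdiff_at_Pair[OF mhol_cdiff[OF assms(1)] mhol_cdiff[OF assms(2)]] \<open>x : S\<close> by simp
qed (use assms in "simp add: mhol_def")

lemma holomorphic_map_continuous: "holomorphic_map N N' f ==> continuous_map (mtop N) (mtop N') f"
 by (simp add: holomorphic_map_def)

lemma holomorphic_map_cdiff: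
 assumes N: "charted N" and N': "charted N'" and g: "holomorphic_map N N' g"
  and c: "c : atlas N" "c' : atlas N'" "y : chart_image c" "g (chart_inv c y) : fst c'"
 shows "cdiff_at (%y. snd c' (g (chart_inv c y))) y"
proof -
 let ?S = "snd c ` {x : fst c. g x : fst c'}"
 have S: "?S = {y : chart_image c. (g \<circ> chart_inv c) y : fst c'}"
  using chart_inv_chart[OF N c(1)] chart_chart_inv[OF N c(1)] chart_inv_mem[OF N c(1)]
  by (auto simp: chart_image_def image_iff)
 have "continuous_map (top_of_set (chart_image c)) (mtop N') (g \<circ> chart_inv c)"
  by (rule cm_compose[OF continuous_map_chart_inv[OF N c(1)] holomorphic_map_continuous[OF g]])
 hence op: "open ?S"
  unfolding S by (rule open_preimage) (auto intro: chart_image_open[OF N c(1)] chart_openin[OF N' c(2)])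
 have "complex_diff_on UNIV ?S (snd c' \<circ> g \<circ> chart_inv c)"
  using g c N by (auto simp: holomorphic_map_def charted_def)
 moreover have "y : ?S" unfolding S using c by simp
 ultimately show ?thesis unfolding complex_diff_on_open[OF op] by (auto simp: o_def)
qed

lemma mhol_map:
 assumes N: "charted N" and N': "charted N'" and g: "holomorphic_map N N' g" and f: "mhol N S f"
 shows "mhol N' S (%x. g (f x))" unfolding mhol_def
proof (intro conjI ballI impI)
 show "open S" using f by (rule mhol_open)
 show "continuous_map (top_of_set S) (mtop N') (%x. g (f x))"
  using cm_compose[OF mhol_continuous[OF f] holomorphic_map_continuous[OF g]] unfolding o_def .
 fix c' x assume c': "c' : atlas N'" "x : S" "g (f x) : fst c'"
 obtain c where c: "c : atlas N" "f x : fst c"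
  using charted_chart_at[OF N mhol_topspace[OF f c'(2)]] by blast
 have inv: "chart_inv c (snd c x') = x'" if "x' : fst c" for x' using chart_inv_chart[OF N c(1) that] .
 have "cdiff_at (%y. snd c' (g (chart_inv c (snd c (f y))))) x"
  by (rule cdiff_at_compose[OF mhol_cdiff[OF f c(1) c'(2) c(2)] holomorphic_map_cdiff[OF N N' g c(1) c'(1)]])
   (use c c' inv chart_mem_image[OF N c(1)] in auto)
 thus "cdiff_at (%y. snd c' (g (f y))) x"
  by (rule cdiff_at_cong_open[OF _ mhol_open_preimage[OF f chart_openin[OF N c(1)]]]) (use c c' inv in auto)
qed

lemma mhol_map2:
 assumes "charted M" "charted N" "charted P" "holomorphic_map (prod_cmfd M N) P g" "mhol M S f" "mhol N S h"
 shows "mhol P S (%x. g (f x, h x))"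
 by (rule mhol_map[OF charted_prod[OF assms(1,2)] assms(3,4) mhol_Pair[OF assms(5,6)]])

lemma mhol_chart_inv:
 assumes "complex_manifold N" "model N = UNIV" "c : atlas N"
 shows "mhol N (chart_image c) (chart_inv c)"
proof -
 have N: "charted N" using assms complex_manifold_charted by blast
 have "holomorphic_map N N id" using assms by (simp add: complex_manifold_def)
 from holomorphic_map_cdiff[OF N N this assms(3)]
 have "cdiff_at (%y. snd c' (chart_inv c y)) y" if "c' : atlas N" "y : chart_image c" "chart_inv c y : fst c'" for c' y
  using that unfolding id_def by blast
 thus ?thesis
  unfolding mhol_def using chart_image_open[OF N assms(3)] continuous_map_chart_inv[OF N assms(3)] by blast
qed

lemma chart_chain_rule:
 assumes N: "charted N" and N': "charted N'" and g: "holomorphic_map N N' g"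
  and f: "open S" "continuous_map (top_of_set S) (mtop N) f" "x : S"
  and c: "c : atlas N" "f x : fst c" "c' : atlas N'" "g (f x) : fst c'"
  and D: "hasD (%y. snd c (f y)) D x"
 shows "hasD (%y. snd c' (g (f y))) (%v. fd (%y. snd c' (g (chart_inv c y))) (snd c (f x)) (D v)) x"
proof -
 have inv: "chart_inv c (snd c x') = x'" if "x' : fst c" for x' using chart_inv_chart[OF N c(1) that] .
 have "cdiff_at (%y. snd c' (g (chart_inv c y))) (snd c (f x))"
  by (rule holomorphic_map_cdiff[OF N N' g c(1,3) chart_mem_image[OF N c(1,2)]]) (simp add: inv c)
 from hasD_chain[OF D cdiff_fd(1)[OF this]]
 show ?thesis unfolding o_def
  by (rule hasD_transform[OF _ open_preimage[OF f(2,1) chart_openin[OF N c(1)]]])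
   (use f c inv in auto)
qed

lemma chart_smooth:
 fixes N :: "('a, complex ^ 'n) cmfd" and N' :: "('b, complex ^ 'n) cmfd" and f :: "'c::real_normed_vector => 'a"
 assumes N: "charted N" and N': "charted N'" and g: "holomorphic_map N N' g"
  and f: "open S" "continuous_map (top_of_set S) (mtop N) f"
  and sm: "!!c. c : atlas N ==> smooth_on {x : S. f x : fst c} (%y. snd c (f y))"
  and c': "c' : atlas N'"
 shows "smooth_on {x : S. g (f x) : fst c'} (%y. snd c' (g (f y)))"
proof -
 let ?S = "{x : S. g (f x) : fst c'}"
 have cgf: "continuous_map (top_of_set S) (mtop N') (%x. g (f x))"
  using cm_compose[OF f(2) holomorphic_map_continuous[OF g]] unfolding o_def .
 have opS: "open ?S" by (rule open_preimage[OF cgf f(1) chart_openin[OF N' c']])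
 have loc: "EX T. open T & x : T & smooth_on T (%y. snd c' (g (f y)))" if x: "x : ?S" for x
 proof -
  have "f x : pts N" using f(2) x by (auto simp: continuous_map_def)
  then obtain c where c: "c : atlas N" "f x : fst c" using charted_chart_at[OF N] by blast
  have inv: "chart_inv c (snd c x') = x'" if "x' : fst c" for x' using chart_inv_chart[OF N c(1) that] .
  define T where "T = {y : S. f y : fst c} \<inter> ?S"
  define R where "R = {y : chart_image c. g (chart_inv c y) : fst c'}"
  have op1: "open {y : S. f y : fst c}" by (rule open_preimage[OF f(2,1) chart_openin[OF N c(1)]])
  have opT: "open T" unfolding T_def using op1 opS by blast
  have "continuous_map (top_of_set (chart_image c)) (mtop N') (%y. g (chart_inv c y))"
   using cm_compose[OF continuous_map_chart_inv[OF N c(1)] holomorphic_map_continuous[OF g]] unfolding o_def .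
  hence opR: "open R"
   unfolding R_def by (rule open_preimage) (auto intro: chart_image_open[OF N c(1)] chart_openin[OF N' c'])
  have "smooth_on R (%y. snd c' (g (chart_inv c y)))"
   by (rule cdiff_smooth[OF opR]) (auto simp: R_def intro: holomorphic_map_cdiff[OF N N' g c(1) c'])
  moreover have "smooth_on T (%y. snd c (f y))"
   by (rule smooth_on_subset[OF sm[OF c(1)]]) (auto simp: T_def)
  moreover have "(%y. snd c (f y)) ` T \<subseteq> R"
   using chart_mem_image[OF N c(1)] inv by (auto simp: T_def R_def)
  ultimately have "smooth_on T (%y. snd c' (g (chart_inv c (snd c (f y)))))"
   using smooth_on_compose[OF opT opR] by blast
  hence "smooth_on T (%y. snd c' (g (f y)))" by (rule smooth_on_cong[OF _ opT]) (auto simp: T_def inv)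
  moreover have "x : T" using x c by (simp add: T_def)
  ultimately show ?thesis using opT by blast
 qed
 thus ?thesis using smooth_on_local by blast
qed

section \<open>Limits of holomorphic maps and iterated doubling\<close>

text \<open>Weierstrass' theorem: by Cauchy's formula the derivatives converge uniformly on a
  smaller ball, so the limit is differentiable. Complex linearity of its derivative survives the
  limit.\<close>

lemma cdiff_uniform_limit_complex:
 fixes f :: "nat => 'a::{complex_model,euclidean_space} => complex"
 assumes S: "open S" and f: "!!n x. x : S ==> cdiff_at (f n) x"
  and lim: "uniform_limit S f g sequentially" and x0: "x0 : S"
 shows "cdiff_at g x0"
proof -
 have contf: "continuous_on S (f n)" for n by (intro cont_at_on ballI cdiff_at_isCont f)
 have contg: "continuous_on S g" by (rule uniform_limit_theorem[OF _ lim]) (auto simp: contf)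
 obtain d where d: "d > 0" "ball x0 d \<subseteq> S" using S x0 openE by blast
 \<comment> \<open>Then \<open>norm_cscale_le\<close> bounds the displacement by 2 r = 2 d / 5, less
   than the room d / 2 that is left around points of the half ball.\<close>
 define r where "r = d / 5"
 let ?B = "ball x0 (d / 2)"
 let ?c = "circlepath 0 r"
 have r: "0 < r" using d by (simp add: r_def)
 have nc: "norm (?c t) = r" for t using r by (simp add: circlepath norm_mult)
 have inS: "x + cscale z b : S" if "x : ?B" "norm z <= r" "b : Basis" for x z b
 proof -
  have "norm (cscale z b) <= 2 * r" using norm_cscale_le[of z b] that by (simp add: norm_Basis)
  hence "dist x0 (x + cscale z b) < d"
   using that norm_triangle_ineq4[of "x0 - x" "cscale z b"] d by (simp add: dist_norm algebra_simps r_def)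
  thus ?thesis using d by auto
 qed
 have cS: "x + cscale (?c t) b : S" if "x : ?B" "b : Basis" for x t b
  using inS[OF that(1) _ that(2), of "?c t"] nc by simp
 let ?D = "%n x. fd (f n) x"
 \<comment> \<open>The candidate for the derivative of g in the direction b: Cauchy's formula
   applied to g, for which continuity is enough.\<close>
 define G where "G x b = integral (cbox 0 1) (%t. g (x + cscale (?c t) b) * inverse (?c t))" for x b
 define g' where "g' x h = (\<Sum>b\<in>Basis. (h \<bullet> b) *R G x b)" for x h
 have DG: "norm (?D n x b - G x b) <= e / r"
  if fg: "!!y. y : S ==> norm (f n y - g y) <= e" and x: "x : ?B" and b: "b : Basis" for n x b e
 proof -
  have int: "(%t. u (x + cscale (?c t) b) * inverse (?c t)) integrable_on cbox 0 1" if "continuous_on S u" for u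
   by (rule integrable_continuous[OF continuous_on_circlepath_line[OF that r cS[OF x b]]])
  have "?D n x b = integral (cbox 0 1) (%t. f n (x + cscale (?c t) b) * inverse (?c t))"
   by (rule cauchy_directional_derivative[OF r]) (rule f[OF inS[OF x _ b]])
  hence "?D n x b - G x b = integral (cbox 0 1) (%t. f n (x + cscale (?c t) b) * inverse (?c t) - g (x + cscale (?c t) b) * inverse (?c t))"
   unfolding G_def by (simp only: integral_diff[OF int[OF contf] int[OF contg]])
  also have "norm ... <= (e / r) * (1 - 0)" unfolding box_real
  proof (rule integral_bound)
   show "continuous_on {0..1} (%t. f n (x + cscale (?c t) b) * inverse (?c t) - g (x + cscale (?c t) b) * inverse (?c t))"
    using continuous_on_diff[OF continuous_on_circlepath_line[OF contf[of n] r cS[OF x b]] continuous_on_circlepath_line[OF contg r cS[OF x b]]]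
    by (simp add: box_real)
   fix t
   have "norm (f n (x + cscale (?c t) b) * inverse (?c t) - g (x + cscale (?c t) b) * inverse (?c t)) =
     norm (f n (x + cscale (?c t) b) - g (x + cscale (?c t) b)) / r"
    by (simp add: left_diff_distrib[symmetric] norm_mult norm_inverse nc divide_inverse)
   also have "... <= e / r" by (intro divide_right_mono fg cS x b) (use r in simp)
   finally show "norm (f n (x + cscale (?c t) b) * inverse (?c t) - g (x + cscale (?c t) b) * inverse (?c t)) <= e / r" .
  qed simp
  finally show ?thesis by simp
 qed
 have D: "hasD (f n) (?D n x) x" "complex_linear (?D n x)" if "x : S" for n x
  using cdiff_fd[OF f[OF that]] by auto
 have BS: "?B \<subseteq> S" using d by (auto simp: subset_iff)
 have conv: "\<forall>\<^sub>F n in sequentially. ALL x:?B. ALL h. norm (?D n x h - g' x h) <= e * norm h" if e: "e > 0" for e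
 proof -
  \<comment> \<open>Each basis direction costs e' / r, and there are DIM('a) of them, so the total
    error is e times the length of h.\<close>
  define e' where "e' = e * r / DIM('a)"
  have e': "e' > 0" using e r by (simp add: e'_def)
  have "\<forall>\<^sub>F n in sequentially. ALL y:S. dist (f n y) (g y) < e'"
   using lim e' by (simp add: uniform_limit_iff)
  thus ?thesis
  proof eventually_elim
   case (elim n)
   have fg: "norm (f n y - g y) <= e'" if "y : S" for y using elim that by (force simp: dist_norm)
   show ?case
   proof (intro ballI allI)
    fix x h assume x: "x : ?B"
    have lin: "linear (?D n x)" using D(2) x BS by (auto simp: clin_def)
    have "?D n x h = (\<Sum>b\<in>Basis. (h \<bullet> b) *R ?D n x b)"
     by (subst euclidean_representation[of h, symmetric]) (simp add: linear_sum[OF lin] linear_scale[OF lin])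
    hence "?D n x h - g' x h = (\<Sum>b\<in>Basis. (h \<bullet> b) *R (?D n x b - G x b))"
     by (simp add: g'_def scaleR_diff_right sum_subtractf)
    also have "norm ... <= (\<Sum>b\<in>(Basis::'a set). norm h * (e' / r))"
    proof (rule sum_norm_le)
     fix b :: 'a assume b: "b : Basis"
     show "norm ((h \<bullet> b) *R (?D n x b - G x b)) <= norm h * (e' / r)"
      unfolding norm_scaleR by (rule mult_mono[OF Basis_le_norm[OF b] DG[OF fg x b]]) auto
    qed
    also have "... = e * norm h" using r by (simp add: e'_def)
    finally show "norm (?D n x h - g' x h) <= e * norm h" .
   qed
  qed
 qed
 have x0B: "x0 : ?B" using d by simp
 have pw: "(%n. f n x) \<longlonglongrightarrow> g x" if "x : S" for x
  using tendsto_uniform_limitI[OF lim that] .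
 have "EX g1. ALL x:?B. (%n. f n x) \<longlonglongrightarrow> g1 x & (g1 has_derivative g' x) (at x within ?B)"
 proof (rule has_derivative_sequence[of ?B f ?D g' x0 "g x0"])
  show "(f n has_derivative ?D n x) (at x within ?B)" if "x : ?B" for n x
   by (rule has_derivative_at_withinI[OF D(1)]) (use that BS in blast)
 qed (rule convex_ball conv x0B pw[OF x0] | assumption)+
 then obtain g1 where g1: "!!x. x : ?B ==> (%n. f n x) \<longlonglongrightarrow> g1 x" "(g1 has_derivative g' x0) (at x0 within ?B)"
  using x0B by blast
 have "g1 x = g x" if "x : ?B" for x using LIMSEQ_unique[OF g1(1)[OF that] pw] that BS by blast
 moreover have "hasD g1 (g' x0) x0" using g1(2) unfolding at_within_open[OF x0B open_ball] .
 ultimately have der: "hasD g (g' x0) x0" using hasD_transform[OF _ open_ball x0B] by blast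
 have limD: "(%n. ?D n x0 h) \<longlonglongrightarrow> g' x0 h" for h
 proof (rule tendstoI)
  fix e :: real assume e: "e > 0"
  define e' where "e' = e / (1 + norm h)"
  have pos: "0 < 1 + norm h" by (simp add: add_pos_nonneg)
  have e': "e' > 0" using e pos by (simp add: e'_def)
  have lt: "e' * norm h < e" using e pos by (simp add: e'_def field_simps)
  show "\<forall>\<^sub>F n in sequentially. dist (?D n x0 h) (g' x0 h) < e" using conv[OF e']
  proof eventually_elim
   case (elim n)
   hence "norm (?D n x0 h - g' x0 h) <= e' * norm h" using x0B by blast
   also note lt
   finally show ?case by (simp add: dist_norm)
  qed
 qed
 show ?thesis
 proof (rule cdiff_atI[OF der])
  fix v
  have "(%n. imul (?D n x0 v)) \<longlonglongrightarrow> imul (g' x0 v)"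
   by (rule bounded_linear.tendsto[OF bounded_linear_imul limD])
  moreover have "?D n x0 (imul v) = imul (?D n x0 v)" for n using D(2)[OF x0] by (simp add: clin_def)
  ultimately show "g' x0 (imul v) = imul (g' x0 v)" using LIMSEQ_unique[OF limD[of "imul v"]] by simp
 qed
qed

lemma cdiff_uniform_limit:
 fixes f :: "nat => 'a::{complex_model,euclidean_space} => complex ^ 'n"
 assumes "open S" "!!n x. x : S ==> cdiff_at (f n) x" "uniform_limit S f g sequentially" "x0 : S"
 shows "cdiff_at g x0"
proof (rule cdiff_at_vec)
 fix i
 show "cdiff_at (%y. g y $ i) x0"
  by (rule cdiff_uniform_limit_complex[OF assms(1) cdiff_at_vec_nth[OF assms(2)]
     bounded_linear.uniform_limit[OF bounded_linear_vec_nth assms(3)] assms(4)])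
qed

text \<open>The map \<open>s\<close> stands for squaring in a group, in coordinates at the identity; \<open>Ex\<close> is the
 exponential map.\<close>

locale doubling =
 fixes s :: "complex ^ 'n => complex ^ 'n" and \<rho> C :: real
 assumes \<rho>: "0 < \<rho>" and C: "0 <= C" "8 * C * \<rho> <= 1" and s0: "s 0 = 0"
  and s_lip: "norm x <= 2 * \<rho> ==> norm y <= 2 * \<rho> ==>
   norm (s x - s y - 2 *R (x - y)) <= C * (norm x + norm y) * norm (x - y)"
  and s_cdiff: "norm x <= 2 * \<rho> ==> cdiff_at s x"
begin

lemma iter0: "(s ^^ j) 0 = 0" by (induction j) (auto simp: s0)

text \<open>Doubling is exact up to relative errors that sum geometrically. With \<tau> = 2^j/2^n
  the j-th iterates have size at most 2 \<rho> \<tau>, so the next step errs by a relative amount of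
  at most \<tau>/4. The bound 1 + \<tau> reproduces itself because (2 + \<tau>/2) (1 + \<tau>) is at
  most 2 (1 + 2 \<tau>).\<close>

lemma iter_lip:
 assumes "norm x <= \<rho> / 2 ^ n" "norm y <= \<rho> / 2 ^ n" "j <= n"
 shows "norm ((s ^^ j) x - (s ^^ j) y) <= 2 ^ j * (1 + 2 ^ j / 2 ^ n) * norm (x - y)" using assms
proof (induction j arbitrary: x y)
 case 0 thus ?case by (simp add: algebra_simps)
next
 case (Suc j)
 define \<tau> :: real where "\<tau> = 2 ^ j / 2 ^ n"
 have "(2::real) ^ Suc j <= 2 ^ n" using Suc.prems by (intro power_increasing) auto
 hence \<tau>: "0 < \<tau>" "\<tau> <= 1 / 2" by (auto simp: \<tau>_def field_simps)
 have bound: "norm ((s ^^ j) z) <= 2 * \<rho> * \<tau>" if z: "norm z <= \<rho> / 2 ^ n" for z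
 proof -
  have "norm ((s ^^ j) z) <= 2 ^ j * (1 + \<tau>) * norm z"
   using Suc.IH[OF z, of 0] Suc.prems \<rho> by (simp add: iter0 \<tau>_def)
  also have "... <= 2 ^ j * 2 * (\<rho> / 2 ^ n)" using z \<tau> by (intro mult_mono) auto
  finally show ?thesis by (simp add: \<tau>_def ac_simps)
 qed
 let ?x = "(s ^^ j) x" and ?y = "(s ^^ j) y"
 have xy: "norm ?x <= 2 * \<rho> * \<tau>" "norm ?y <= 2 * \<rho> * \<tau>" using bound Suc.prems by auto
 have r2: "2 * \<rho> * \<tau> <= 2 * \<rho>" using \<tau> \<rho> by simp
 have "norm (s ?x - s ?y) <= norm (s ?x - s ?y - 2 *R (?x - ?y)) + norm (2 *R (?x - ?y))"
  by (metis diff_add_cancel norm_triangle_ineq)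
 also have "... <= C * (norm ?x + norm ?y) * norm (?x - ?y) + 2 * norm (?x - ?y)"
  using s_lip[of ?x ?y] xy r2 by simp
 also have "... <= C * (4 * \<rho> * \<tau>) * norm (?x - ?y) + 2 * norm (?x - ?y)"
  using xy C by (intro add_mono mult_right_mono mult_left_mono) auto
 also have "... = (2 + 4 * C * \<rho> * \<tau>) * norm (?x - ?y)" by (simp add: algebra_simps)
 also have "... <= (2 + \<tau> / 2) * norm (?x - ?y)"
  using mult_right_mono[OF C(2), of "\<tau> / 2"] \<tau> by (intro mult_right_mono) auto
 also have "... <= (2 + \<tau> / 2) * (2 ^ j * (1 + \<tau>) * norm (x - y))"
  using Suc.IH[of x y] Suc.prems \<tau> by (intro mult_left_mono) (auto simp: \<tau>_def)
 also have "... = 2 ^ j * ((2 + \<tau> / 2) * (1 + \<tau>)) * norm (x - y)" by (simp add: ac_simps)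
 also have "... <= 2 ^ j * (2 * (1 + 2 * \<tau>)) * norm (x - y)"
 proof (intro mult_right_mono mult_left_mono)
  have "\<tau> * \<tau> <= 1 * \<tau>" using \<tau> by (intro mult_right_mono) auto
  thus "(2 + \<tau> / 2) * (1 + \<tau>) <= 2 * (1 + 2 * \<tau>)" using \<tau> by (simp add: algebra_simps)
 qed auto
 also have "... = 2 ^ Suc j * (1 + 2 ^ Suc j / 2 ^ n) * norm (x - y)" by (simp add: \<tau>_def)
 finally show ?case by simp
qed

lemma iter_lip2:
 assumes "norm x <= \<rho> / 2 ^ n" "norm y <= \<rho> / 2 ^ n" "j <= n"
 shows "norm ((s ^^ j) x - (s ^^ j) y) <= 2 * 2 ^ j * norm (x - y)"
proof -
 have "(2::real) ^ j / 2 ^ n <= 1" using assms(3) by (simp add: power_increasing)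
 hence "2 ^ j * (1 + 2 ^ j / 2 ^ n) * norm (x - y) <= 2 ^ j * 2 * norm (x - y)"
  by (intro mult_right_mono mult_left_mono) auto
 with iter_lip[OF assms] show ?thesis by (simp add: ac_simps)
qed

lemma iter_bound:
 assumes "norm x <= \<rho> / 2 ^ n" "j <= n"
 shows "norm ((s ^^ j) x) <= 2 * \<rho>"
proof -
 have "norm ((s ^^ j) x) <= 2 * 2 ^ j * norm x"
  using iter_lip2[OF assms(1) _ assms(2), of 0] \<rho> by (simp add: iter0)
 also have "... <= 2 * 2 ^ n * (\<rho> / 2 ^ n)"
  using assms by (intro mult_mono) (auto simp: power_increasing)
 finally show ?thesis by simp
qed

lemma iter_cdiff:
 assumes "norm x <= \<rho> / 2 ^ n" "j <= n"
 shows "cdiff_at (s ^^ j) x" using assms(2)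
proof (induction j)
 case 0 thus ?case by (simp add: id_def)
next
 case (Suc j)
 have "cdiff_at (%y. s ((s ^^ j) y)) x"
  by (rule cdiff_at_compose) (use Suc iter_bound[OF assms(1), of j] s_cdiff in auto)
 thus ?case by (simp add: o_def)
qed

text \<open>The n-fold doubling approximation to the exponential map, with the coordinate vector
  X/2^n standing in for the logarithm of exp (X/2^n).\<close>

definition En where "En n X = (s ^^ n) ((1 / 2 ^ n) *R X)"

text \<open>The limit of \<open>En\<close>, written as a telescoping series so that the Weierstrass
  test and a quadratic error bound apply directly.\<close>

definition Ex where "Ex X = X + (\<Sum>i. En (Suc i) X - En i X)"

text \<open>One squaring differs from doubling by an error quadratic in X/2^(n+1), of order 4^(-n).
  The n further iterations magnify it by 2^n only, which leaves a geometric series.\<close>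

lemma En_step:
 assumes X: "norm X <= \<rho> / 2"
 shows "norm (En (Suc n) X - En n X) <= C * (norm X)\<^sup>2 / 2 * (1 / 2) ^ n"
proof -
 \<comment> \<open>Both approximations become n-fold iterates, one of s x and the other of 2
   x.\<close>
 define x where "x = (1 / 2 ^ Suc n) *R X"
 have nx: "norm x = norm X / (2 * 2 ^ n)" by (simp add: x_def)
 have "norm X / 2 <= \<rho> / 2 / 2" using X by simp
 hence xb: "norm x <= \<rho> / 4 / 2 ^ n" by (simp add: nx field_simps)
 have "\<rho> / 4 / 2 ^ n <= \<rho> / 4 / 1" using \<rho> by (intro divide_left_mono) auto
 hence x2: "norm x <= 2 * \<rho>" using xb \<rho> by linarith
 have x1: "norm x <= \<rho> / 4" using xb \<open>\<rho> / 4 / 2 ^ n <= \<rho> / 4 / 1\<close> by simp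
 have sx: "norm (s x - 2 *R x) <= C * norm x * norm x" using s_lip[of x 0] x2 \<rho> by (simp add: s0)
 have "norm (s x) <= norm (s x - 2 *R x) + norm (2 *R x)"
  by (metis diff_add_cancel norm_triangle_ineq)
 also have "... <= (C * norm x + 2) * norm x" using sx by (simp add: algebra_simps)
 also have "... <= 4 * norm x"
 proof (rule mult_right_mono)
  have "C * norm x <= C * \<rho>" using x1 C \<rho> by (intro mult_left_mono) auto
  thus "C * norm x + 2 <= 4" using C(2) by linarith
 qed simp
 also have "... <= \<rho> / 2 ^ n" using xb by simp
 finally have b1: "norm (s x) <= \<rho> / 2 ^ n" .
 have X2: "(1 / 2 ^ n) *R X = 2 *R x" by (simp add: x_def)
 have b2: "norm (2 *R x) <= \<rho> / 2 ^ n"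
 proof -
  have "\<rho> / 4 / 2 ^ n * 2 <= \<rho> / 2 ^ n" using \<rho> by (simp add: field_simps)
  thus ?thesis using xb by simp
 qed
 have "En (Suc n) X = (s ^^ n) (s x)" by (simp only: En_def funpow_Suc_right o_def x_def)
 hence "En (Suc n) X - En n X = (s ^^ n) (s x) - (s ^^ n) (2 *R x)" by (simp add: En_def X2)
 also have "norm ... <= 2 * 2 ^ n * norm (s x - 2 *R x)" by (rule iter_lip2[OF b1 b2]) simp
 also have "... <= 2 * 2 ^ n * (C * norm x * norm x)" using sx by simp
 also have "... = C * (norm X)\<^sup>2 / 2 * (1 / 2) ^ n" by (simp add: nx power2_eq_square field_simps)
 finally show ?thesis .
qed

lemma En_uniform_limit: "uniform_limit (cball 0 (\<rho> / 2)) En Ex sequentially"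
proof -
 have "uniform_limit (cball 0 (\<rho> / 2)) (%n X. \<Sum>i<n. En (Suc i) X - En i X) (%X. \<Sum>i. En (Suc i) X - En i X) sequentially"
 proof (rule Weierstrass_m_test)
  fix n X assume "X : cball (0::complex ^ 'n) (\<rho> / 2)"
  hence X: "norm X <= \<rho> / 2" by simp
  have "norm (En (Suc n) X - En n X) <= C * (norm X)\<^sup>2 / 2 * (1 / 2) ^ n" by (rule En_step[OF X])
  also have "... <= C * (\<rho> / 2)\<^sup>2 / 2 * (1 / 2) ^ n"
   using X C by (intro mult_right_mono divide_right_mono mult_left_mono power_mono) auto
  finally show "norm (En (Suc n) X - En n X) <= C * (\<rho> / 2)\<^sup>2 / 2 * (1 / 2) ^ n" .
 qed (intro summable_mult summable_geometric, simp)
 moreover have "uniform_limit (cball 0 (\<rho> / 2)) (%n X. X) (%X. X) sequentially"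
  by (simp add: uniform_limit_iff)
 ultimately
 have "uniform_limit (cball 0 (\<rho> / 2)) (%n X. X + (\<Sum>i<n. En (Suc i) X - En i X)) Ex sequentially"
  using uniform_limit_add unfolding Ex_def[abs_def] by fast
 moreover have "X + (\<Sum>i<n. En (Suc i) X - En i X) = En n X" for n X
  using sum_lessThan_telescope[of "%i. En i X" n] by (simp add: En_def)
 ultimately show ?thesis by simp
qed

lemma En_tendsto: "norm X <= \<rho> / 2 ==> (%n. En n X) \<longlonglongrightarrow> Ex X"
 using tendsto_uniform_limitI[OF En_uniform_limit, of X] by simp

lemma Ex_cdiff:
 assumes "norm X < \<rho> / 2" shows "cdiff_at Ex X"
proof (rule cdiff_uniform_limit[of "ball 0 (\<rho> / 2)" En])
 show "uniform_limit (ball 0 (\<rho> / 2)) En Ex sequentially"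
  by (rule uniform_limit_on_subset[OF En_uniform_limit]) auto
 fix n and X :: "complex ^ 'n" assume "X : ball 0 (\<rho> / 2)"
 hence X: "norm X <= \<rho>" using \<rho> by simp
 have "complex_linear (%X :: complex ^ 'n. (1 / 2 ^ n) *R X)"
  by (auto simp: clin_def imul_scaleR intro!: linearI simp: algebra_simps)
 hence "cdiff_at (%X :: complex ^ 'n. (1 / 2 ^ n) *R X) X"
  by (intro cdiff_at_linear bounded_linear_scaleR_right)
 thus "cdiff_at (En n) X"
  unfolding En_def[abs_def] by (rule cdiff_at_compose) (rule iter_cdiff[of _ n], use X in \<open>auto simp: field_simps\<close>)
qed (use assms in auto)

lemma Ex_near: assumes X: "norm X <= \<rho> / 2" shows "norm (Ex X - X) <= C * (norm X)\<^sup>2"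
proof -
 have "norm (\<Sum>i. En (Suc i) X - En i X) <= (\<Sum>i. C * (norm X)\<^sup>2 / 2 * (1 / 2) ^ i)"
  by (rule norm_suminf_le[OF En_step[OF X]]) (intro summable_mult summable_geometric, simp)
 also have "... = C * (norm X)\<^sup>2" by (subst suminf_mult) (auto simp: suminf_geometric)
 finally show ?thesis by (simp add: Ex_def)
qed

lemma Ex_derivative: "hasD Ex (%X. X) 0"
proof -
 have E0: "Ex 0 = 0" using Ex_near[of 0] \<rho> by simp
 show ?thesis unfolding has_derivative_at2
 proof (intro conjI bounded_linear_ident)
  show "(%y. (1 / norm (y - 0)) *R (Ex y - (Ex 0 + (y - 0)))) \<midarrow>0\<rightarrow> 0"
  proof (rule Lim_null_comparison)
   show "\<forall>\<^sub>F y in at 0. norm ((1 / norm (y - 0)) *R (Ex y - (Ex 0 + (y - 0)))) <= C * norm y"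
    unfolding eventually_at
   proof (intro exI[of _ "\<rho> / 2"] conjI ballI impI)
    fix y :: "complex ^ 'n" assume y: "y ~= 0 & dist y 0 < \<rho> / 2"
    hence "norm (Ex y - y) / norm y <= C * (norm y)\<^sup>2 / norm y"
     by (intro divide_right_mono Ex_near) auto
    thus "norm ((1 / norm (y - 0)) *R (Ex y - (Ex 0 + (y - 0)))) <= C * norm y"
     using y by (simp add: E0 power2_eq_square)
   qed (use \<rho> in simp)
   show "(%y. C * norm y) \<midarrow>0\<rightarrow> 0" by (auto intro!: tendsto_eq_intros)
  qed
 qed
qed

lemma Ex_0 [simp]: "Ex 0 = 0" using Ex_near[of 0] \<rho> by simp

lemma Ex_bound: "norm X <= \<rho> / 2 ==> norm (Ex X) <= 2 * \<rho>"
 using Lim_bounded[OF tendsto_norm[OF En_tendsto], of X 0 "2 * \<rho>"] iter_bound[of "(1 / 2 ^ n) *R X" n n for n] \<rho>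
 by (simp add: En_def field_simps)

text \<open>Only the leading behaviour of x n matters: replacing X/2^n by x n changes the n-th
  iterate by at most 2 |2^n x n - X|. Independence of the scaling in \<open>Exp\<close> and
  uniqueness of one-parameter subgroups rest on this.\<close>

lemma iter_limit:
 assumes X: "norm X < \<rho> / 2" and x: "(%n. 2 ^ n *R x n) \<longlonglongrightarrow> X"
 shows "(%n. (s ^^ n) (x n)) \<longlonglongrightarrow> Ex X" "\<forall>\<^sub>F n in sequentially. norm (x n) <= \<rho> / 2 ^ n"
proof -
 have "\<forall>\<^sub>F n in sequentially. norm (2 ^ n *R x n) < \<rho>"
  using order_tendstoD(2)[OF tendsto_norm[OF x], of \<rho>] X \<rho> by simp
 thus ev: "\<forall>\<^sub>F n in sequentially. norm (x n) <= \<rho> / 2 ^ n"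
  by eventually_elim (simp add: field_simps)
 have "(%n. (s ^^ n) (x n) - En n X) \<longlonglongrightarrow> 0"
 proof (rule Lim_null_comparison)
  show "\<forall>\<^sub>F n in sequentially. norm ((s ^^ n) (x n) - En n X) <= 2 * norm (2 ^ n *R x n - X)"
   using ev
  proof eventually_elim
   case (elim n)
   have "norm ((s ^^ n) (x n) - En n X) <= 2 * 2 ^ n * norm (x n - (1 / 2 ^ n) *R X)"
    unfolding En_def using X \<rho> by (intro iter_lip2[OF elim]) (auto simp: field_simps)
   also have "... = 2 * norm (2 ^ n *R (x n - (1 / 2 ^ n) *R X))" by simp
   finally show ?case by (simp add: scaleR_diff_right)
  qed
  show "(%n. 2 * norm (2 ^ n *R x n - X)) \<longlonglongrightarrow> 0"
   using tendsto_norm[OF tendsto_diff[OF x tendsto_const[of X]]] by (auto intro!: tendsto_eq_intros)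
 qed
 from tendsto_add[OF this En_tendsto[of X]] X show "(%n. (s ^^ n) (x n)) \<longlonglongrightarrow> Ex X"
  by simp
qed

end

lemma lipschitz_at_of_derivative:
 assumes "hasD f D (0::'a::real_normed_vector)"
 shows "EX B>=0. EX d>0. ALL x. norm x < d --> norm (f x - f 0) <= B * norm x"
proof -
 obtain K where K: "!!x. norm (D x) <= norm x * K" "K > 0"
  using bounded_linear.pos_bounded[OF has_derivative_bounded_linear[OF assms]] by blast
 obtain d where d: "d > 0" "!!x. norm (x - 0) < d ==> norm (f x - f 0 - D (x - 0)) <= 1 * norm (x - 0)"
  using assms unfolding has_derivative_at_alt by (metis zero_less_one)
 have "norm (f x - f 0) <= (K + 1) * norm x" if "norm x < d" for x
 proof -
  have "norm (f x - f 0) <= norm (f x - f 0 - D x) + norm (D x)" by (metis diff_add_cancel norm_triangle_ineq)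
  also have "... <= norm x + norm x * K" using d(2)[of x] K(1)[of x] that by (intro add_mono) auto
  finally show ?thesis by (simp add: algebra_simps)
 qed
 thus ?thesis using K d by (intro exI[of _ "K + 1"]) auto
qed

text \<open>The derivative of s is 2 at 0 and depends on the point at a linear rate there, because
  it is itself differentiable. The mean value inequality for s x - 2 x then gives the quadratic
  Lipschitz estimate.\<close>

lemma doubling_exists:
 fixes s :: "complex ^ 'n => complex ^ 'n"
 assumes W: "open W" "0 : W" and cd: "!!x. x : W ==> cdiff_at s x"
  and s0: "s 0 = 0" and D0: "fd s 0 = (%v. 2 *R v)"
 obtains \<rho> C where "doubling s \<rho> C" "cball 0 (2 * \<rho>) \<subseteq> W"
proof -
 let ?D = "%x. fd s x"
 have "EX B>=0. EX d>0. ALL x. norm x < d --> norm (?D x b - ?D 0 b) <= B * norm x" for b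
  by (rule lipschitz_at_of_derivative[OF cdiff_fd(1)[OF cdiff_frechet[OF W(1) cd W(2)]]])
 then obtain B d where Bd: "!!b. B b >= 0" "!!b. d b > 0"
  "!!b x. norm x < d b ==> norm (?D x b - ?D 0 b) <= B b * norm x" by metis
 define C where "C = (\<Sum>b\<in>Basis. B b)"
 have C0: "C >= 0" unfolding C_def by (intro sum_nonneg Bd)
 obtain d1 where d1: "d1 > 0" "ball 0 d1 \<subseteq> W" using W openE by blast
 define m where "m = Min (d ` Basis)"
 have m: "m > 0" "!!b. b : Basis ==> m <= d b" using Bd by (auto simp: m_def)
 \<comment> \<open>Dividing m and d1 by 4 keeps the ball of radius 2 \<rho> inside both domains; the
   other bound gives 8 C \<rho> at most C/(C+1).\<close>
 define \<rho> where "\<rho> = min (min m d1) (1 / (2 * (C + 1))) / 4"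
 have \<rho>: "\<rho> > 0" using m d1 C0 by (simp add: \<rho>_def)
 have r1: "2 * \<rho> < m" "2 * \<rho> < d1" using m d1 \<rho> by (auto simp: \<rho>_def min_def split: if_splits)
 have r2: "8 * C * \<rho> <= 1"
 proof -
  have "\<rho> <= 1 / (2 * (C + 1)) / 4" unfolding \<rho>_def by (intro divide_right_mono min.cobounded2) simp
  hence "8 * (C * \<rho>) <= 8 * (C * (1 / (2 * (C + 1)) / 4))" using C0 by (intro mult_left_mono) auto
  also have "... <= 1" using C0 by (simp add: field_simps)
  finally show ?thesis by simp
 qed
 have inW: "cball 0 (2 * \<rho>) \<subseteq> W" using r1 d1 by auto
 have Dbound: "norm (?D x v - 2 *R v) <= C * norm x * norm v" if x: "norm x <= 2 * \<rho>" for x v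
 proof -
  have "x : W" using x inW by auto
  hence lin: "linear (?D x)" using cdiff_fd(2)[OF cd] by (auto simp: clin_def)
  have "?D x v = (\<Sum>b\<in>Basis. (v \<bullet> b) *R ?D x b)"
   by (subst euclidean_representation[of v, symmetric]) (simp add: linear_sum[OF lin] linear_scale[OF lin])
  moreover have "2 *R v = (\<Sum>b\<in>Basis. (v \<bullet> b) *R ?D 0 b)"
   by (subst euclidean_representation[of v, symmetric]) (simp add: D0 scaleR_sum_right ac_simps)
  ultimately have "?D x v - 2 *R v = (\<Sum>b\<in>Basis. (v \<bullet> b) *R (?D x b - ?D 0 b))"
   by (simp add: scaleR_diff_right sum_subtractf)
  also have "norm ... <= (\<Sum>b\<in>Basis. norm v * (B b * norm x))"
  proof (intro sum_norm_le)
   fix b :: "complex ^ 'n" assume b: "b : Basis"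
   have "norm (?D x b - ?D 0 b) <= B b * norm x" using Bd(3)[of x b] x r1 m(2)[OF b] by simp
   thus "norm ((v \<bullet> b) *R (?D x b - ?D 0 b)) <= norm v * (B b * norm x)"
    using Basis_le_norm[OF b, of v] Bd(1)[of b] by (auto intro!: mult_mono)
  qed
  also have "... = C * norm x * norm v" by (simp add: C_def sum_distrib_left sum_distrib_right ac_simps)
  finally show ?thesis .
 qed
 have "doubling s \<rho> C"
 proof
  fix x y :: "complex ^ 'n" assume x: "norm x <= 2 * \<rho>" and y: "norm y <= 2 * \<rho>"
  let ?g = "%x. s x - 2 *R x"
  \<comment> \<open>The mean value inequality is applied on the ball of this radius: it is convex,
    contains x and y, and all its points have norm at most |x| + |y|.\<close>
  define R where "R = max (norm x) (norm y)"
  have R: "R <= 2 * \<rho>" "R <= norm x + norm y" using x y by (auto simp: R_def)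
  have "norm (?g x - ?g y) <= (C * (norm x + norm y)) * norm (x - y)"
  proof (rule differentiable_bound[of "cball 0 R" ?g "%z v. ?D z v - 2 *R v"])
   fix z assume z: "z : cball (0 :: complex ^ 'n) R"
   hence zW: "z : W" and zR: "norm z <= 2 * \<rho>" using R inW by auto
   show "(?g has_derivative (%v. ?D z v - 2 *R v)) (at z within cball 0 R)"
    by (rule has_derivative_at_withinI[OF has_derivative_diff[OF cdiff_fd(1)[OF cd[OF zW]]
       blin_hasD[OF bounded_linear_scaleR_right]]])
   show "onorm (%v. ?D z v - 2 *R v) <= C * (norm x + norm y)"
   proof (rule onorm_bound)
    have "norm z <= norm x + norm y" using z R(2) by simp
    hence "C * norm z <= C * (norm x + norm y)" using C0 by (rule mult_left_mono)
    thus "norm (?D z v - 2 *R v) <= C * (norm x + norm y) * norm v" for v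
     using order_trans[OF Dbound[OF zR] mult_right_mono[OF _ norm_ge_zero]] by blast
   qed (use C0 in simp)
  qed (auto simp: R_def)
  thus "norm (s x - s y - 2 *R (x - y)) <= C * (norm x + norm y) * norm (x - y)"
   by (simp add: scaleR_diff_right algebra_simps)
 next
  fix x :: "complex ^ 'n" assume "norm x <= 2 * \<rho>"
  thus "cdiff_at s x" using cd inW by auto
 qed (use \<rho> C0 r2 s0 in auto)
 thus thesis using inW by (rule that)
qed

lemma mhol_local:
 assumes "open S" "!!x. x : S ==> EX T. x : T & mhol N T f"
 shows "mhol N S f" unfolding mhol_def
proof (intro conjI ballI impI)
 show "continuous_map (top_of_set S) (mtop N) f" unfolding continuous_map_def
 proof (intro conjI allI impI)
  show "f : topspace (top_of_set S) \<rightarrow> pts N" using assms(2) mhol_topspace by fastforce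
  fix U assume U: "openin (mtop N) U"
  have "open {x : S. f x : U}"
  proof (subst open_subopen, intro ballI)
   fix x assume x: "x : {x : S. f x : U}"
   then obtain T where T: "x : T" "mhol N T f" using assms(2) by blast
   have "open (S \<inter> {x : T. f x : U})" using assms(1) mhol_open_preimage[OF T(2) U] by blast
   thus "EX T. open T & x : T & T \<subseteq> {x : S. f x : U}" using x T by blast
  qed
  thus "openin (top_of_set S) {x : topspace (top_of_set S). f x : U}"
   using assms(1) by (simp add: openin_open_eq)
 qed
 fix c x assume "c : atlas N" "x : S" "f x : fst c"
 thus "cdiff_at (%y. snd c (f y)) x" using assms(2) mhol_cdiff by blast
qed (rule assms(1))

lemma has_derivative_cong_nhds:
 assumes "hasD f D x" "\<forall>\<^sub>F y in nhds x. f y = g y"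
 shows "hasD g D x"
proof -
 obtain S where "open S" "x : S" "!!y. y : S ==> f y = g y"
  using assms(2) unfolding eventually_nhds by blast
 thus ?thesis using hasD_transform[OF assms(1)] by blast
qed

section \<open>The exponential map of a complex Lie group\<close>

locale clg =
 fixes K :: "'k monoid" and N :: "('k, complex ^ 'n) cmfd"
 assumes lie: "complex_lie_group K N" and mdl: "model N = UNIV"

sublocale clg \<subseteq> group K using lie by (simp add: complex_lie_group_def)

context clg
begin

abbreviation kmul (infixl "\<odot>" 70) where "x \<odot> y \<equiv> x \<otimes>\<^bsub>K\<^esub> y"
abbreviation kinv where "kinv x \<equiv> inv\<^bsub>K\<^esub> x"
abbreviation kone where "kone \<equiv> \<one>\<^bsub>K\<^esub>"
abbreviation kpow (infixr "^^^" 80) where "x ^^^ (i::nat) \<equiv> x [^]\<^bsub>K\<^esub> i"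

lemma chN: "charted N" using lie mdl complex_manifold_charted by (auto simp: complex_lie_group_def)

lemma topN: "pts N = carrier K" using lie by (simp add: complex_lie_group_def)

lemma hausdN: "Hausdorff_space (mtop N)" using lie by (simp add: complex_lie_group_def complex_manifold_def)

lemma mhol_kmul: "mhol N S f ==> mhol N S h ==> mhol N S (%x. f x \<odot> h x)"
 using mhol_map2[OF chN chN chN, of "%(x, y). x \<odot> y" S f h] lie by (simp add: complex_lie_group_def)

lemma mhol_kinv: "mhol N S f ==> mhol N S (%x. kinv (f x))"
 using mhol_map[OF chN chN, of kinv S f] lie by (simp add: complex_lie_group_def)

lemma mhol_kpow: "mhol N S f ==> mhol N S (%x. f x ^^^ i)"
proof (induction i)
 case 0 thus ?case by (auto intro: mhol_const mhol_open simp: topN)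
qed (auto intro: mhol_kmul)

lemma continuous_kmul: "continuous_map X (mtop N) f ==> continuous_map X (mtop N) h ==> continuous_map X (mtop N) (%x. f x \<odot> h x)"
proof -
 assume fh: "continuous_map X (mtop N) f" "continuous_map X (mtop N) h"
 have "continuous_map (prod_topology (mtop N) (mtop N)) (mtop N) (%(x, y). x \<odot> y)"
  using lie holomorphic_map_continuous[of "prod_cmfd N N" N] by (auto simp: complex_lie_group_def prod_cmfd_def)
 from cm_compose[OF continuous_map_pairedI[OF fh] this] show ?thesis by (simp add: o_def)
qed

lemma continuous_kpow: "continuous_map (mtop N) (mtop N) (%x. x ^^^ i)"
proof (induction i)
 case 0 thus ?case by (simp add: topN)
next
 case (Suc i) thus ?case using continuous_kmul[OF Suc continuous_map_id[unfolded id_def]] by simp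
qed

section \<open>Coordinates and velocities at the identity\<close>

definition wc where "wc = one_chart K N"

lemma wc: "wc : atlas N" "kone : fst wc"
proof -
 have "EX c. c : atlas N & kone : fst c"
  using charted_chart_at[OF chN, of kone] by (auto simp: topN)
 thus "wc : atlas N" "kone : fst wc"
  using someI_ex unfolding wc_def one_chart_def by (metis (mono_tags, lifting))+
qed

text \<open>The chart at the identity is shifted so that the identity has coordinate 0. On
  \<open>Wd\<close> and the chart domain the maps \<open>cw\<close> and \<open>lw\<close> are
  inverse to each other.\<close>

definition Wd where "Wd = {x. snd wc kone + x : chart_image wc}"
definition cw where "cw x = chart_inv wc (snd wc kone + x)"
definition lw where "lw k = snd wc k - snd wc kone"

lemma Wd_open: "open Wd"
proof -
 have "open ((%x. snd wc kone + x) -` chart_image wc)"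
  by (intro open_vimage chart_image_open[OF chN wc(1)] continuous_intros)
 thus ?thesis by (simp add: Wd_def vimage_def)
qed

lemma Wd_0: "0 : Wd" and cw_0: "cw 0 = kone"
 using chart_mem_image[OF chN wc] chart_inv_chart[OF chN wc] by (auto simp: Wd_def cw_def)

lemma lw_one: "lw kone = 0" by (simp add: lw_def)

lemma cw_mem: "x : Wd ==> cw x : fst wc" and lw_cw: "x : Wd ==> lw (cw x) = x"
 using chart_inv_mem[OF chN wc(1)] chart_chart_inv[OF chN wc(1)] by (auto simp: Wd_def cw_def lw_def)

lemma cw_lw: "k : fst wc ==> cw (lw k) = k"
 using chart_mem_image[OF chN wc(1)] chart_inv_chart[OF chN wc(1)] by (auto simp: Wd_def cw_def lw_def)

lemma wc_carrier: "k : fst wc ==> k : carrier K"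
 using chart_subset[OF chN wc(1)] by (auto simp: topN)

lemma cw_carrier: "x : Wd ==> cw x : carrier K" using cw_mem wc_carrier by blast

lemma mhol_cw: "mhol N Wd cw" unfolding cw_def[abs_def]
proof (rule mhol_reparam[OF mhol_chart_inv Wd_open])
 show "complex_manifold N" using lie by (simp add: complex_lie_group_def)
qed (auto simp: mdl wc Wd_def intro!: cdiff_at_add)

lemma lw_cdiff: "mhol N S f ==> x : S ==> f x : fst wc ==> cdiff_at (%y. lw (f y)) x"
 unfolding lw_def by (intro cdiff_at_diff cdiff_at_const mhol_cdiff[OF _ wc(1)])

definition mu where "mu p = lw (cw (fst p) \<odot> cw (snd p))"
definition Wmu where "Wmu = {p : Wd \<times> Wd. cw (fst p) \<odot> cw (snd p) : fst wc}"

lemma mhol_mu: "mhol N (Wd \<times> Wd) (%p. cw (fst p) \<odot> cw (snd p))"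
 by (intro mhol_kmul mhol_reparam[OF mhol_cw] open_Times Wd_open) (auto intro: cdiff_at_fst cdiff_at_snd)

lemma Wmu_open: "open Wmu" unfolding Wmu_def by (rule mhol_open_preimage[OF mhol_mu chart_openin[OF chN wc(1)]])

lemma Wmu_0: "(0, 0) : Wmu" by (simp add: Wmu_def Wd_0 cw_0 wc)

lemma mu_cdiff: "p : Wmu ==> cdiff_at mu p"
 unfolding mu_def[abs_def] by (rule lw_cdiff[OF mhol_mu]) (auto simp: Wmu_def)

text \<open>On each of the two axes one factor of the product is the identity element, so
  \<open>mu\<close> is the identity map there, and a derivative is determined by its restrictions to
  the axes.\<close>

lemma mu_derivative: "hasD mu (%(a, b). a + b) (0, 0)"
proof -
 let ?D = "fd mu (0, 0)"
 have D: "hasD mu ?D (0, 0)" by (rule cdiff_fd(1)[OF mu_cdiff[OF Wmu_0]])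
 hence lin: "linear ?D" by (rule has_derivative_linear)
 have "hasD (%x. mu (x, 0)) (%a. ?D (a, 0)) 0"
  using hasD_chain[OF has_derivative_Pair[OF has_derivative_ident has_derivative_const] D] by (simp add: o_def)
 hence "hasD (%x. x) (%a. ?D (a, 0)) 0"
  by (rule hasD_transform[OF _ Wd_open Wd_0]) (simp add: mu_def cw_0 cw_carrier lw_cw)
 from fun_cong[OF has_derivative_unique[OF this has_derivative_ident]]
 have 1: "?D (a, 0) = a" for a .
 have "hasD (%x. mu (0, x)) (%b. ?D (0, b)) 0"
  using hasD_chain[OF has_derivative_Pair[OF has_derivative_const has_derivative_ident] D] by (simp add: o_def)
 hence "hasD (%x. x) (%b. ?D (0, b)) 0"
  by (rule hasD_transform[OF _ Wd_open Wd_0]) (simp add: mu_def cw_0 cw_carrier lw_cw)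
 from fun_cong[OF has_derivative_unique[OF this has_derivative_ident]]
 have 2: "?D (0, b) = b" for b .
 have "?D (a, b) = a + b" for a b using linear_add[OF lin, of "(a, 0)" "(0, b)"] 1 2 by simp
 hence "?D = (%(a, b). a + b)" by auto
 with D show ?thesis by simp
qed

text \<open>Velocity at parameter 0 of a curve through the identity. Differentiability at 0 alone is
  demanded; it controls the sequence f (1/2^n), whose 2^n-th powers converge to exp X.\<close>

definition tang :: "(real => 'k) => complex ^ 'n => bool" where
 "tang f X \<longleftrightarrow> f 0 = kone & (\<forall>\<^sub>F t in nhds 0. f t : fst wc) & ((%t. lw (f t)) has_vector_derivative X) (at 0)"

lemma tang_cong: "tang f X ==> (\<forall>\<^sub>F t in nhds 0. f t = g t) ==> tang g X"
 unfolding tang_def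
proof (elim conjE, intro conjI)
 assume a: "f 0 = kone" "\<forall>\<^sub>F t in nhds 0. f t : fst wc" "((%t. lw (f t)) has_vector_derivative X) (at 0)" "\<forall>\<^sub>F t in nhds 0. f t = g t"
 show "g 0 = kone" using a(1) eventually_nhds_x_imp_x[OF a(4)] by simp
 show "\<forall>\<^sub>F t in nhds 0. g t : fst wc" using a(2,4) by eventually_elim simp
 show "((%t. lw (g t)) has_vector_derivative X) (at 0)" using a(3) unfolding has_vector_derivative_def
  by (rule has_derivative_cong_nhds) (use a(4) in eventually_elim, simp)
qed

lemma tang_tendsto:
 assumes "tang f X" shows "((%t. lw (f t)) \<longlongrightarrow> 0) (nhds 0)"
proof -
 have "isCont (%t. lw (f t)) 0"
  using assms unfolding tang_def by (blast intro: has_vector_derivative_continuous)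
 moreover have "lw (f 0) = 0" using assms by (simp add: tang_def lw_one)
 ultimately show ?thesis using tendsto_at_iff_tendsto_nhds[of "%t. lw (f t)" 0] by (simp add: isCont_def)
qed

lemma tang_mult:
 assumes f: "tang f X" and h: "tang h Y"
 shows "tang (%t. f t \<odot> h t) (X + Y)"
proof -
 have "((%t. (lw (f t), lw (h t))) \<longlongrightarrow> (0, 0)) (nhds 0)"
  by (intro tendsto_Pair tang_tendsto[OF f] tang_tendsto[OF h])
 hence "\<forall>\<^sub>F t in nhds 0. (lw (f t), lw (h t)) : Wmu"
  using topological_tendstoD[OF _ Wmu_open Wmu_0] by blast
 moreover have fw: "\<forall>\<^sub>F t in nhds 0. f t : fst wc" "\<forall>\<^sub>F t in nhds 0. h t : fst wc" using f h by (auto simp: tang_def)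
 ultimately have ev: "\<forall>\<^sub>F t in nhds 0. f t \<odot> h t : fst wc & mu (lw (f t), lw (h t)) = lw (f t \<odot> h t)"
  by eventually_elim (simp add: Wmu_def cw_lw mu_def)
 have fh0: "f 0 = kone" "h 0 = kone" using f h by (auto simp: tang_def)
 have "hasD (%t. lw (f t)) (%t. t *R X) 0" "hasD (%t. lw (h t)) (%t. t *R Y) 0"
  using f h by (auto simp: tang_def has_vector_derivative_def)
 note fhD = has_derivative_Pair[OF this]
 have "hasD mu (%(a, b). a + b) (lw (f 0), lw (h 0))" using mu_derivative by (simp add: fh0 lw_one)
 from hasD_chain[OF fhD this]
 have "hasD (%t. mu (lw (f t), lw (h t))) (%t. (%(a, b). a + b) (t *R X, t *R Y)) 0"
  by (simp add: o_def)
 hence "hasD (%t. mu (lw (f t), lw (h t))) (%t. t *R (X + Y)) 0"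
  by (simp add: scaleR_add_right)
 hence "hasD (%t. lw (f t \<odot> h t)) (%t. t *R (X + Y)) 0"
  by (rule has_derivative_cong_nhds) (use ev in eventually_elim, simp)
 moreover have "\<forall>\<^sub>F t in nhds 0. f t \<odot> h t : fst wc" using ev by eventually_elim simp
 ultimately show ?thesis by (simp add: tang_def has_vector_derivative_def fh0)
qed

lemma tang_one: "tang (%t. kone) 0" by (simp add: tang_def wc lw_one)

lemma tang_pow: "tang f X ==> tang (%t. f t ^^^ i) (real i *R X)"
proof (induction i)
 case 0 thus ?case by (simp add: tang_one)
next
 case (Suc i) thus ?case using tang_mult[OF Suc.IH Suc.prems] Suc.prems by (simp add: algebra_simps)
qed

lemma tang_comp_hol:
 assumes f: "tang f X" and S: "mhol N S \<Phi>" "0 : S" "\<Phi> 0 = kone"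
 shows "tang (%t. \<Phi> (lw (f t))) (fd (%y. lw (\<Phi> y)) 0 X)"
proof -
 let ?S = "{x : S. \<Phi> x : fst wc}"
 have "open ?S" by (rule mhol_open_preimage[OF S(1) chart_openin[OF chN wc(1)]])
 moreover have "0 : ?S" using S wc by simp
 ultimately have "\<forall>\<^sub>F t in nhds 0. lw (f t) : ?S"
  using topological_tendstoD[OF tang_tendsto[OF f]] by blast
 hence 1: "\<forall>\<^sub>F t in nhds 0. \<Phi> (lw (f t)) : fst wc" by eventually_elim simp
 have f0: "lw (f 0) = 0" using f by (simp add: tang_def lw_one)
 have "cdiff_at (%y. lw (\<Phi> y)) (lw (f 0))" using lw_cdiff[OF S(1,2)] S(3) wc by (simp add: f0)
 note D = cdiff_fd[OF this]
 have "hasD (%t. lw (f t)) (%t. t *R X) 0"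
  using f by (auto simp: tang_def has_vector_derivative_def)
 from hasD_chain[OF this D(1)]
 have "((%t. lw (\<Phi> (lw (f t)))) has_vector_derivative (fd (%y. lw (\<Phi> y)) 0 X)) (at 0)"
  using D(2) by (simp add: has_vector_derivative_def o_def f0 clin_def linear_scale)
 with 1 show ?thesis by (simp add: tang_def f0 S)
qed

lemma tang_wc: "tang f X ==> \<forall>\<^sub>F t in nhds 0. f t : fst wc"
 and tang_0: "tang f X ==> f 0 = kone" by (auto simp: tang_def)

lemma tang_unique: "tang f X ==> tang f Y ==> X = Y"
 unfolding tang_def using vector_derivative_unique_at by blast

text \<open>Holomorphy of inversion gives some velocity Y, and the constant product with f forces X
  + Y = 0.\<close>

lemma tang_inv:
 assumes f: "tang f X" shows "tang (%t. kinv (f t)) (- X)"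
proof -
 have "tang (%t. kinv (cw (lw (f t)))) (fd (%y. lw (kinv (cw y))) 0 X)" (is "tang _ ?Y")
  by (rule tang_comp_hol[OF f mhol_kinv[OF mhol_cw] Wd_0]) (simp add: cw_0)
 moreover have "\<forall>\<^sub>F t in nhds 0. kinv (cw (lw (f t))) = kinv (f t)"
  using tang_wc[OF f] by eventually_elim (simp add: cw_lw)
 ultimately have i: "tang (%t. kinv (f t)) ?Y" by (rule tang_cong)
 have "\<forall>\<^sub>F t in nhds 0. f t \<odot> kinv (f t) = kone"
  using tang_wc[OF f] by eventually_elim (simp add: wc_carrier)
 from tang_cong[OF tang_mult[OF f i] this] have "X + ?Y = 0" using tang_unique[OF _ tang_one] by blast
 hence "?Y = - X" by (simp add: add_eq_0_iff2 minus_unique)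
 with i show ?thesis by simp
qed

lemma tang_scale:
 assumes f: "tang f X" shows "tang (%t. f (r * t)) (r *R X)"
proof -
 have lim: "((%t. r * t) \<longlongrightarrow> 0) (nhds (0::real))"
  using tendsto_mult_right[OF tendsto_ident_at, of r 0] by (auto intro!: tendsto_eq_intros filterlim_ident)
 have "\<forall>\<^sub>F t in nhds 0. f (r * t) : fst wc"
  using eventually_compose_filterlim[OF tang_wc[OF f] lim] .
 moreover have fD: "hasD (%t. lw (f t)) (%t. t *R X) (r * 0)"
  using f by (simp add: tang_def has_vector_derivative_def)
 from hasD_chain[OF blin_hasD[OF bounded_linear_mult_right] this]
 have "hasD (%t. lw (f (r * t))) (%t. (r * t) *R X) 0" by (simp add: o_def)
 ultimately show ?thesis using tang_0[OF f] by (simp add: tang_def has_vector_derivative_def ac_simps)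
qed

section \<open>Squaring and the global exponential map\<close>

definition sq where "sq x = mu (x, x)"
definition Ws where "Ws = {x : Wd. cw x \<odot> cw x : fst wc}"

lemma Ws: "open Ws" "0 : Ws" "x : Ws ==> cdiff_at sq x" "x : Ws ==> cw (sq x) = cw x \<odot> cw x"
proof -
 show "open Ws"
  unfolding Ws_def by (rule mhol_open_preimage[OF mhol_kmul[OF mhol_cw mhol_cw] chart_openin[OF chN wc(1)]])
 show "0 : Ws" by (simp add: Ws_def Wd_0 cw_0 wc)
 show "x : Ws ==> cdiff_at sq x"
  unfolding sq_def[abs_def] by (rule cdiff_at_compose[OF cdiff_at_Pair mu_cdiff]) (auto simp: Ws_def Wmu_def)
 show "x : Ws ==> cw (sq x) = cw x \<odot> cw x" by (simp add: sq_def mu_def cw_lw Ws_def)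
qed

lemma sq_derivative: "fd sq 0 = (%v. 2 *R v)"
proof (rule fd_eqI)
 have "hasD (%x. (x, x)) (%v. (v, v)) 0" by (intro has_derivative_Pair has_derivative_ident)
 from hasD_chain[OF this mu_derivative] show "hasD sq (%v. 2 *R v) 0"
  by (simp add: o_def sq_def[abs_def] scaleR_2)
qed

lemma doubling_sq: "EX p. doubling sq (fst p) (snd p) & cball 0 (2 * fst p) \<subseteq> Ws"
proof -
 obtain \<rho> C where "doubling sq \<rho> C" "cball 0 (2 * \<rho>) \<subseteq> Ws"
  by (rule doubling_exists[OF Ws(1-3) _ sq_derivative]) (auto simp: sq_def mu_def cw_0 lw_one)
 thus ?thesis by (intro exI[of _ "(\<rho>, C)"]) simp
qed

definition rc where "rc = (SOME p. doubling sq (fst p) (snd p) & cball 0 (2 * fst p) \<subseteq> Ws)"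

lemma rc: "doubling sq (fst rc) (snd rc)" "cball 0 (2 * fst rc) \<subseteq> Ws"
 using someI_ex[OF doubling_sq] unfolding rc_def by auto

abbreviation \<rho> where "\<rho> \<equiv> fst rc"
abbreviation Ex where "Ex \<equiv> doubling.Ex sq"

lemma \<rho>_pos: "0 < \<rho>" by (rule doubling.\<rho>[OF rc(1)])

lemma rc_Wd: "norm x <= 2 * \<rho> ==> x : Wd" and rc_Ws: "norm x <= 2 * \<rho> ==> x : Ws"
 using rc(2) by (auto simp: Ws_def)

lemma Ex_Wd: "norm X <= \<rho> / 2 ==> Ex X : Wd" by (rule rc_Wd[OF doubling.Ex_bound[OF rc(1)]])

lemma iter_pow:
 assumes "norm x <= \<rho> / 2 ^ n" "j <= n"
 shows "cw ((sq ^^ j) x) = cw x ^^^ (2 ^ j)" using assms(2)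
proof (induction j)
 case 0
 have "x : Wd" using doubling.iter_bound[OF rc(1) assms(1), of 0] rc_Wd by simp
 thus ?case by (simp add: cw_carrier)
next
 case (Suc j)
 have x: "cw x : carrier K" using doubling.iter_bound[OF rc(1) assms(1), of 0] rc_Wd cw_carrier by simp
 have "(sq ^^ j) x : Ws" using doubling.iter_bound[OF rc(1) assms(1), of j] Suc.prems rc_Ws by simp
 hence "cw ((sq ^^ Suc j) x) = (cw x ^^^ (2 ^ j)) \<odot> (cw x ^^^ (2 ^ j))" using Suc by (simp add: Ws)
 also have "... = cw x ^^^ (2 ^ Suc j)" using x by (simp add: nat_pow_mult mult_2)
 finally show ?case .
qed

lemma sequence_limit0:
 assumes X: "norm X < \<rho> / 2" and k: "\<forall>\<^sub>F n in sequentially. k n : fst wc" and lim: "(%n. 2 ^ n *R lw (k n)) \<longlonglongrightarrow> X"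
 shows "limitin (mtop N) (%n. k n ^^^ (2 ^ n)) (cw (Ex X)) sequentially"
proof (rule limitin_transform_eventually)
 note il = doubling.iter_limit[OF rc(1) X lim]
 have "limitin (top_of_set Wd) (%n. (sq ^^ n) (lw (k n))) (Ex X) sequentially"
  using il(1) Ex_Wd[of X] X \<rho>_pos Wd_open by (simp add: limitin_canonical_iff_gen)
 from continuous_map_limit[OF mhol_continuous[OF mhol_cw] this]
 show "limitin (mtop N) (%n. cw ((sq ^^ n) (lw (k n)))) (cw (Ex X)) sequentially" by (simp add: o_def)
 show "\<forall>\<^sub>F n in sequentially. cw ((sq ^^ n) (lw (k n))) = k n ^^^ (2 ^ n)"
  using il(2) k by eventually_elim (simp add: iter_pow cw_lw)
qed

lemma scale_exists: "EX m. norm X < 2 ^ m * (\<rho> / 2)"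
proof -
 obtain m where "norm X / (\<rho> / 2) < 2 ^ m" using real_arch_pow[of 2] by auto
 thus ?thesis using \<rho>_pos by (intro exI[of _ m]) (simp add: field_simps)
qed

text \<open>X is scaled into the domain of the local exponential and the result is squared m times.
  That any admissible m gives the same value, \<open>Exp_eq_m\<close>, follows from uniqueness of
  limits, since all of them compute the limit of the same powers.\<close>

definition Exp where "Exp X = (let m = (SOME m. norm X < 2 ^ m * (\<rho> / 2)) in cw (Ex ((1 / 2 ^ m) *R X)) ^^^ (2 ^ m))"

text \<open>Shift the sequence by m: the powers of k (n + m) with exponent 2^n converge locally for
  the vector X/2^m, and raising the limit to the power 2^m restores the exponent 2^(n + m).\<close>

lemma sequence_limit_m:
 assumes X: "norm X < 2 ^ m * (\<rho> / 2)" and k: "\<forall>\<^sub>F n in sequentially. k n : fst wc" and lim: "(%n. 2 ^ n *R lw (k n)) \<longlonglongrightarrow> X"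
 shows "limitin (mtop N) (%n. k n ^^^ (2 ^ n)) (cw (Ex ((1 / 2 ^ m) *R X)) ^^^ (2 ^ m)) sequentially"
proof (rule limitin_sequentially_offset_rev)
 have k': "\<forall>\<^sub>F n in sequentially. k (n + m) : fst wc" by (rule sequentially_offset[OF k])
 have "(%n. (1 / 2 ^ m) *R (2 ^ (n + m) *R lw (k (n + m)))) \<longlonglongrightarrow> (1 / 2 ^ m) *R X"
  by (rule tendsto_scaleR[OF tendsto_const LIMSEQ_ignore_initial_segment[OF lim]])
 hence "(%n. 2 ^ n *R lw (k (n + m))) \<longlonglongrightarrow> (1 / 2 ^ m) *R X" by (simp add: power_add)
 moreover have "norm ((1 / 2 ^ m) *R X) < \<rho> / 2" using X by (simp add: field_simps)
 ultimately have "limitin (mtop N) (%n. k (n + m) ^^^ (2 ^ n)) (cw (Ex ((1 / 2 ^ m) *R X))) sequentially"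
  using sequence_limit0[OF _ k'] by blast
 from continuous_map_limit[OF continuous_kpow this]
 have "limitin (mtop N) (%n. (k (n + m) ^^^ (2 ^ n)) ^^^ (2 ^ m)) (cw (Ex ((1 / 2 ^ m) *R X)) ^^^ (2 ^ m)) sequentially"
  by (simp add: o_def)
 moreover have "\<forall>\<^sub>F n in sequentially. (k (n + m) ^^^ (2 ^ n)) ^^^ (2 ^ m) = k (n + m) ^^^ (2 ^ (n + m))"
  using k' by eventually_elim (simp add: nat_pow_pow wc_carrier power_add)
 ultimately show "limitin (mtop N) (%n. k (n + m) ^^^ (2 ^ (n + m))) (cw (Ex ((1 / 2 ^ m) *R X)) ^^^ (2 ^ m)) sequentially"
  using limitin_transform_eventually by fast
qed

lemma sequence_limit:
 assumes k: "\<forall>\<^sub>F n in sequentially. k n : fst wc" and lim: "(%n. 2 ^ n *R lw (k n)) \<longlonglongrightarrow> X"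
 shows "limitin (mtop N) (%n. k n ^^^ (2 ^ n)) (Exp X) sequentially"
 unfolding Exp_def Let_def by (rule sequence_limit_m[OF someI_ex[OF scale_exists] k lim])

lemma half_powers: "(%n. (1 / 2 ^ n) :: real) \<longlonglongrightarrow> 0"
 using LIMSEQ_realpow_zero[of "1/2 :: real"] by (simp add: power_one_over)

lemma tang_sequence:
 assumes f: "tang f X"
 shows "\<forall>\<^sub>F n in sequentially. f (1 / 2 ^ n) : fst wc" "(%n. 2 ^ n *R lw (f (1 / 2 ^ n))) \<longlonglongrightarrow> X"
proof -
 show "\<forall>\<^sub>F n in sequentially. f (1 / 2 ^ n) : fst wc"
  using eventually_compose_filterlim[OF tang_wc[OF f] half_powers] .
 show "(%n. 2 ^ n *R lw (f (1 / 2 ^ n))) \<longlonglongrightarrow> X"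
 proof (rule LIMSEQ_I)
  fix e :: real assume e: "0 < e"
  have "hasD (%t. lw (f t)) (%t. t *R X) 0"
   using f by (simp add: tang_def has_vector_derivative_def)
  then obtain d where d: "d > 0" "!!y. norm (y - 0) < d ==> norm (lw (f y) - lw (f 0) - (y - 0) *R X) <= (e / 2) * norm (y - 0)"
   unfolding has_derivative_at_alt using e half_gt_zero by blast
  obtain n0 where n0: "!!n. n >= n0 ==> norm (1 / 2 ^ n - 0 :: real) < d"
   using LIMSEQ_D[OF half_powers d(1)] by blast
  have "norm (2 ^ n *R lw (f (1 / 2 ^ n)) - X) < e" if n: "n >= n0" for n
  proof -
   have "norm (lw (f (1 / 2 ^ n)) - (1 / 2 ^ n) *R X) <= (e / 2) * (1 / 2 ^ n)"
    using d(2)[OF n0[OF n]] tang_0[OF f] by (simp add: lw_one)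
   hence "2 ^ n * norm (lw (f (1 / 2 ^ n)) - (1 / 2 ^ n) *R X) <= e / 2" by (simp add: field_simps)
   moreover have "2 ^ n * norm (lw (f (1 / 2 ^ n)) - (1 / 2 ^ n) *R X) = norm (2 ^ n *R (lw (f (1 / 2 ^ n)) - (1 / 2 ^ n) *R X))"
    by simp
   ultimately show ?thesis using e by (simp add: scaleR_diff_right)
  qed
  thus "EX n0. ALL n>=n0. norm (2 ^ n *R lw (f (1 / 2 ^ n)) - X) < e" by blast
 qed
qed

lemma tang_limit:
 assumes "tang f X" shows "limitin (mtop N) (%n. f (1 / 2 ^ n) ^^^ (2 ^ n)) (Exp X) sequentially"
 by (rule sequence_limit[OF tang_sequence[OF assms]])

text \<open>Turns an algebraic identity between dyadic powers of a curve into a value of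
  \<open>Exp\<close>. The rules for multiples and negatives and the uniqueness of one-parameter
  subgroups are obtained in this way.\<close>

lemma tang_limit_eq:
 assumes "tang f X" "!!n. f (1 / 2 ^ n) ^^^ (2 ^ n) = k" "k : carrier K"
 shows "Exp X = k"
proof -
 have "limitin (mtop N) (%n. k) (Exp X) sequentially" using tang_limit[OF assms(1)] by (simp add: assms(2))
 moreover have "limitin (mtop N) (%n. k) k sequentially" using assms(3) by (simp add: topN)
 ultimately show ?thesis using limitin_Hausdorff_unique[OF _ _ _ hausdN] trivial_limit_sequentially by blast
qed

lemma Exp_eq_m:
 assumes X: "norm X < 2 ^ m * (\<rho> / 2)"
 shows "Exp X = cw (Ex ((1 / 2 ^ m) *R X)) ^^^ (2 ^ m)"
proof -
 let ?k = "%n. cw ((1 / 2 ^ n) *R X)"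
 have "(%n. (1 / 2 ^ n) *R X) \<longlonglongrightarrow> 0"
  using tendsto_scaleR[OF half_powers tendsto_const[of X]] by simp
 hence ev: "\<forall>\<^sub>F n in sequentially. (1 / 2 ^ n) *R X : Wd"
  using topological_tendstoD[OF _ Wd_open Wd_0] by blast
 hence 1: "\<forall>\<^sub>F n in sequentially. ?k n : fst wc" by eventually_elim (rule cw_mem)
 have "\<forall>\<^sub>F n in sequentially. X = 2 ^ n *R lw (?k n)"
  using ev by eventually_elim (simp add: lw_cw)
 hence 2: "(%n. 2 ^ n *R lw (?k n)) \<longlonglongrightarrow> X"
  by (rule Lim_transform_eventually[OF tendsto_const])
 show ?thesis using limitin_Hausdorff_unique[OF sequence_limit[OF 1 2] sequence_limit_m[OF X 1 2] _ hausdN] by simp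
qed

lemma Exp_eq: "norm X < \<rho> / 2 ==> Exp X = cw (Ex X)"
 using Exp_eq_m[of X 0] cw_carrier[OF Ex_Wd[of X]] by simp

lemma Exp_lw: "norm X < \<rho> / 2 ==> lw (Exp X) = Ex X" and Exp_wc: "norm X < \<rho> / 2 ==> Exp X : fst wc"
 by (simp_all add: Exp_eq lw_cw Ex_Wd cw_mem)

lemma mhol_Exp: "mhol N UNIV Exp"
proof -
 have loc: "mhol N (ball 0 (2 ^ m * (\<rho> / 2))) Exp" for m
 proof (rule mhol_cong)
  have lin: "complex_linear (%X :: complex ^ 'n. (1 / 2 ^ m) *R X)"
   by (auto simp: clin_def imul_scaleR intro!: linearI simp: algebra_simps)
  have "mhol N (ball 0 (2 ^ m * (\<rho> / 2))) (%X. cw (Ex ((1 / 2 ^ m) *R X)))"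
  proof (rule mhol_reparam[OF mhol_cw open_ball])
   fix X :: "complex ^ 'n" assume "X : ball 0 (2 ^ m * (\<rho> / 2))"
   hence X: "norm ((1 / 2 ^ m) *R X) < \<rho> / 2" by (simp add: field_simps)
   show "Ex ((1 / 2 ^ m) *R X) : Wd" by (rule Ex_Wd) (use X in simp)
   show "cdiff_at (%X. Ex ((1 / 2 ^ m) *R X)) X"
    by (rule cdiff_at_compose[OF cdiff_at_linear[OF lin bounded_linear_scaleR_right] doubling.Ex_cdiff[OF rc(1) X]])
  qed
  thus "mhol N (ball 0 (2 ^ m * (\<rho> / 2))) (%X. cw (Ex ((1 / 2 ^ m) *R X)) ^^^ (2 ^ m))" by (rule mhol_kpow)
 qed (simp add: Exp_eq_m)
 show ?thesis
 proof (rule mhol_local)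
  fix X :: "complex ^ 'n"
  obtain m where "norm X < 2 ^ m * (\<rho> / 2)" using scale_exists by blast
  thus "EX T. X : T & mhol N T Exp" using loc[of m] by (intro exI[of _ "ball 0 (2 ^ m * (\<rho> / 2))"]) simp
 qed simp
qed

lemma Exp_carrier [simp]: "Exp X : carrier K" using mhol_topspace[OF mhol_Exp] by (simp add: topN)

lemma Exp_continuous: "continuous_map euclidean (mtop N) Exp" using mhol_continuous[OF mhol_Exp] by simp

lemma Exp_0 [simp]: "Exp 0 = kone" using Exp_eq[of 0] \<rho>_pos doubling.Ex_0[OF rc(1)] cw_0 by simp

lemma lw_Exp_derivative: "hasD (%X. lw (Exp X)) (%X. X) 0"
 by (rule hasD_transform[OF doubling.Ex_derivative[OF rc(1)], of "ball 0 (\<rho> / 2)"])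
  (use \<rho>_pos in "auto simp: Exp_lw")

lemma tang_Exp: "tang (%t. Exp (t *R X)) X"
proof -
 have lim: "((%t. t *R X) \<longlongrightarrow> 0) (nhds (0::real))"
  by (auto intro!: tendsto_eq_intros filterlim_ident)
 have "\<forall>\<^sub>F t in nhds 0. t *R X : ball 0 (\<rho> / 2)"
  by (rule topological_tendstoD[OF lim]) (use \<rho>_pos in auto)
 hence "\<forall>\<^sub>F t in nhds 0. Exp (t *R X) : fst wc" by eventually_elim (simp add: Exp_wc)
 moreover have "hasD (%X. lw (Exp X)) (%X. X) (0 *R X)" using lw_Exp_derivative by simp
 hence "hasD (%t. lw (Exp (t *R X))) (%t. t *R X) 0"
  using hasD_chain[OF blin_hasD[OF bounded_linear_scaleR_left[of X]]] by (fastforce simp: o_def)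
 ultimately show ?thesis by (simp add: tang_def has_vector_derivative_def)
qed

lemma Exp_half: "Exp ((1 / 2 ^ n) *R X) ^^^ (2 ^ n) = Exp X"
proof -
 obtain m where m: "norm X < 2 ^ m * (\<rho> / 2)" using scale_exists by blast
 have "(1::real) <= 2 ^ n" by simp
 hence "1 * (2 ^ m * (\<rho> / 2)) <= 2 ^ n * (2 ^ m * (\<rho> / 2))" using \<rho>_pos by (intro mult_right_mono) auto
 hence X: "norm X < 2 ^ (n + m) * (\<rho> / 2)" using m by (simp only: power_add mult.assoc mult_1)
 hence Y: "norm ((1 / 2 ^ n) *R X) < 2 ^ m * (\<rho> / 2)" by (simp add: power_add field_simps)
 have c: "cw (Ex ((1 / 2 ^ (n + m)) *R X)) : carrier K"
  by (rule cw_carrier[OF Ex_Wd]) (use X in "simp add: power_add field_simps")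
 have "Exp ((1 / 2 ^ n) *R X) = cw (Ex ((1 / 2 ^ (n + m)) *R X)) ^^^ (2 ^ m)"
  using Exp_eq_m[OF Y] by (simp add: power_add mult.commute)
 thus ?thesis using c by (simp add: Exp_eq_m[OF X] nat_pow_pow power_add mult.commute)
qed

lemma Exp_nat: "Exp (real i *R X) = Exp X ^^^ i"
proof (rule tang_limit_eq[OF tang_pow[OF tang_Exp]])
 fix n
 have "(Exp ((1 / 2 ^ n) *R X) ^^^ i) ^^^ (2 ^ n) = (Exp ((1 / 2 ^ n) *R X) ^^^ (2 ^ n)) ^^^ i"
  by (simp add: nat_pow_pow mult.commute)
 thus "(Exp ((1 / 2 ^ n) *R X) ^^^ i) ^^^ (2 ^ n) = Exp X ^^^ i" by (simp only: Exp_half)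
qed simp

lemma Exp_minus: "Exp (- X) = kinv (Exp X)"
 by (rule tang_limit_eq[OF tang_inv[OF tang_Exp]]) (simp_all only: nat_pow_inv[OF Exp_carrier] Exp_half inv_closed Exp_carrier)

lemma Exp_int: "Exp (real_of_int i *R X) = Exp X [^]\<^bsub>K\<^esub> i"
proof (cases "i >= 0")
 case True
 then obtain j where j: "i = int j" using nonneg_int_cases by blast
 show ?thesis by (simp add: j Exp_nat int_pow_int)
next
 case False
 then obtain j where j: "i = - int j" using that[of "nat (- i)"] by simp
 have "Exp (real_of_int i *R X) = kinv (Exp (real j *R X))" by (simp add: j Exp_minus[symmetric])
 thus ?thesis by (simp only: Exp_nat j int_pow_neg_int[OF Exp_carrier])
qed

text \<open>For dyadic s and t with common denominator 2^n both sides are integer powers of exp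
  (X/2^n). Such pairs are dense, both sides are continuous, and the group is Hausdorff.\<close>

lemma Exp_add: "Exp ((s + t) *R X) = Exp (s *R X) \<odot> Exp (t *R X)"
proof -
 define Q where "Q = {(s, t). EX i j n. s = real_of_int i / 2 ^ n & t = real_of_int j / 2 ^ n}"
 have on_Q: "Exp ((s + t) *R X) = Exp (s *R X) \<odot> Exp (t *R X)" if st: "(s, t) : Q" for s t
 proof -
  obtain i j n where ij: "s = real_of_int i / 2 ^ n" "t = real_of_int j / 2 ^ n" using st by (auto simp: Q_def)
  define Y where "Y = (1 / 2 ^ n) *R X"
  have "s *R X = real_of_int i *R Y" "t *R X = real_of_int j *R Y" "(s + t) *R X = real_of_int (i + j) *R Y"
   by (simp_all add: ij Y_def add_divide_distrib)
  thus ?thesis by (simp only: Exp_int int_pow_mult[OF Exp_carrier])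
 qed
 have dense: "(s, t) : euclidean closure_of Q"
 proof -
  let ?a = "%s n. real_of_int \<lfloor>2 ^ n * s\<rfloor> / 2 ^ n"
  have lim: "(%n. ?a s n) \<longlonglongrightarrow> s" for s
  proof (rule LIMSEQ_I)
   fix r :: real assume "r > 0"
   then obtain n0 where n0: "(1 / 2) ^ n0 < r" using real_arch_pow_inv[of r "1/2"] by auto
   have "norm (?a s n - s) < r" if "n >= n0" for n
   proof -
    have "\<bar>real_of_int \<lfloor>2 ^ n * s\<rfloor> - 2 ^ n * s\<bar> <= 1" by linarith
    hence "\<bar>(real_of_int \<lfloor>2 ^ n * s\<rfloor> - 2 ^ n * s) / 2 ^ n\<bar> <= 1 / 2 ^ n"
     by (simp add: abs_divide divide_right_mono)
    moreover have "(1 / 2 :: real) ^ n <= (1 / 2) ^ n0" using that by (intro power_decreasing) auto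
    ultimately show ?thesis using n0 by (simp add: diff_divide_distrib power_one_over)
   qed
   thus "EX n0. ALL n>=n0. norm (?a s n - s) < r" by blast
  qed
  have "(%n. (?a s n, ?a t n)) \<longlonglongrightarrow> (s, t)" by (intro tendsto_Pair lim)
  moreover have "(?a s n, ?a t n) : Q" for n by (auto simp: Q_def)
  ultimately have "(s, t) : closure Q" unfolding closure_sequential by (intro exI[of _ "%n. (?a s n, ?a t n)"]) simp
  thus ?thesis by simp
 qed
 have c: "continuous_map euclidean (mtop N) (%p. Exp (u p *R X))" if "continuous_on UNIV u" for u :: "real \<times> real => real"
  using cm_compose[OF _ Exp_continuous, of euclidean "%p. u p *R X"] that by (simp add: o_def continuous_on_scaleR continuous_intros)
 have "(%p. Exp ((fst p + snd p) *R X)) (s, t) = (%p. Exp (fst p *R X) \<odot> Exp (snd p *R X)) (s, t)"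
  by (rule forall_in_closure_of_eq[OF dense hausdN]) (auto intro!: c continuous_kmul continuous_intros on_Q)
 thus ?thesis by simp
qed

text \<open>A one-parameter subgroup is assumed differentiable only at 0, but this makes it a curve
  with velocity X. The 2^n-th power of its value at t/2^n is its value at t, so the doubling limit
  determines it.\<close>

lemma one_param_iff: "one_param_subgroup K N X \<gamma> \<longleftrightarrow> \<gamma> = (%t. Exp (t *R X))"
proof
 assume \<gamma>: "one_param_subgroup K N X \<gamma>"
 hence c: "continuous_map euclideanreal (mtop N) \<gamma>" and hom: "!!s t. \<gamma> (s + t) = \<gamma> s \<odot> \<gamma> t"
  and d: "((snd wc \<circ> \<gamma>) has_vector_derivative X) (at 0)" by (auto simp: one_param_subgroup_def wc_def)
 have car: "\<gamma> t : carrier K" for t using c by (auto simp: continuous_map_def topN)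
 have 0: "\<gamma> 0 = kone" using hom[of 0 0] car[of 0] by (simp add: l_cancel_one)
 have "open {t : UNIV. \<gamma> t : fst wc}" by (rule open_preimage[OF _ _ chart_openin[OF chN wc(1)]]) (use c in auto)
 hence "\<forall>\<^sub>F t in nhds 0. \<gamma> t : fst wc" using 0 wc by (auto simp: eventually_nhds)
 moreover have "((%t. lw (\<gamma> t)) has_vector_derivative X) (at 0)"
  unfolding lw_def using has_vector_derivative_diff[OF d[unfolded o_def] has_vector_derivative_const] by simp
 ultimately have t: "tang \<gamma> X" by (simp add: tang_def 0)
 have pow: "\<gamma> (real i * t) = \<gamma> t ^^^ i" for i t
 proof (induction i)
  case (Suc i)
  have "\<gamma> (real (Suc i) * t) = \<gamma> (real i * t) \<odot> \<gamma> t" by (subst hom[symmetric]) (simp add: algebra_simps)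
  thus ?case by (simp add: Suc)
 qed (simp add: 0)
 have "Exp (t *R X) = \<gamma> t" for t
  by (rule tang_limit_eq[OF tang_scale[OF t]]) (use pow[of "2 ^ n" "t * (1 / 2 ^ n)" for n] car in \<open>simp_all\<close>)
 thus "\<gamma> = (%t. Exp (t *R X))" by auto
next
 assume \<gamma>: "\<gamma> = (%t. Exp (t *R X))"
 have "continuous_map euclideanreal (mtop N) (%t. Exp (t *R X))"
  using cm_compose[OF _ Exp_continuous, of euclideanreal "%t. t *R X"] by (simp add: o_def continuous_intros)
 moreover have "((%t. lw (Exp (t *R X)) + snd wc kone) has_vector_derivative (X + 0)) (at 0)"
  by (rule has_vector_derivative_add[OF _ has_vector_derivative_const]) (use tang_Exp in "simp add: tang_def")
 ultimately show "one_param_subgroup K N X \<gamma>"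
  unfolding one_param_subgroup_def \<gamma> wc_def[symmetric] by (auto simp: Exp_add lw_def o_def)
qed

lemma lie_exp_Exp: "lie_exp K N X = Exp X" unfolding lie_exp_def one_param_iff by simp

lemma lie_algebra_iff: "X : lie_algebra K N G \<longleftrightarrow> (ALL t. Exp (t *R X) : G)"
 by (simp add: lie_algebra_def lie_exp_Exp)

text \<open>exp (tX) is a limit of powers of elements of G, and a compact set in a Hausdorff space
  is closed.\<close>

lemma tang_subgroup:
 assumes G: "subgroup G K" "compactin (mtop N) G" and f: "tang f X" "\<forall>\<^sub>F t in nhds 0. f t : G"
 shows "X : lie_algebra K N G" unfolding lie_algebra_iff
proof
 fix t
 have cl: "closedin (mtop N) G" by (rule compactin_imp_closedin[OF hausdN G(2)])
 have "(%n. t * (1 / 2 ^ n) :: real) \<longlonglongrightarrow> 0" using tendsto_mult[OF tendsto_const half_powers] by simp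
 hence "\<forall>\<^sub>F n in sequentially. f (t * (1 / 2 ^ n)) : G"
  using eventually_compose_filterlim[OF f(2)] by blast
 hence "\<forall>\<^sub>F n in sequentially. f (t * (1 / 2 ^ n)) ^^^ (2 ^ n) : G"
 proof eventually_elim
  case (elim n)
  have "k ^^^ i : G" if "k : G" for k i
   by (induction i) (auto simp: subgroup.one_closed[OF G(1)] subgroup.m_closed[OF G(1)] that)
  thus ?case using elim by blast
 qed
 from limitin_closedin[OF tang_limit[OF tang_scale[OF f(1)]] cl this] show "Exp (t *R X) : G" by simp
qed

section \<open>The adjoint representation\<close>

definition Ad where "Ad x = fd (%y. lw (x \<odot> cw y \<odot> kinv x)) 0"

lemma mhol_conj: "x : carrier K ==> mhol N Wd (%y. x \<odot> cw y \<odot> kinv x)"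
 by (intro mhol_kmul mhol_cw mhol_const Wd_open) (auto simp: topN)

lemma Ad_cdiff: "x : carrier K ==> cdiff_at (%y. lw (x \<odot> cw y \<odot> kinv x)) 0"
 by (rule lw_cdiff[OF mhol_conj Wd_0]) (auto simp: cw_0 wc)

lemma Ad_linear: "x : carrier K ==> complex_linear (Ad x)"
 unfolding Ad_def using cdiff_fd[OF Ad_cdiff] by auto

lemma tang_conj:
 assumes x: "x : carrier K" and f: "tang f X"
 shows "tang (%t. x \<odot> f t \<odot> kinv x) (Ad x X)"
proof (rule tang_cong)
 show "tang (%t. x \<odot> cw (lw (f t)) \<odot> kinv x) (Ad x X)"
  unfolding Ad_def by (rule tang_comp_hol[OF f mhol_conj[OF x] Wd_0]) (use x in "simp add: cw_0")
 show "\<forall>\<^sub>F t in nhds 0. x \<odot> cw (lw (f t)) \<odot> kinv x = x \<odot> f t \<odot> kinv x"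
  using tang_wc[OF f] by eventually_elim (simp add: cw_lw)
qed

lemma Ad_mult: "x : carrier K ==> y : carrier K ==> Ad (x \<odot> y) X = Ad x (Ad y X)"
proof -
 assume xy: "x : carrier K" "y : carrier K"
 have "tang (%t. x \<odot> (y \<odot> Exp (t *R X) \<odot> kinv y) \<odot> kinv x) (Ad x (Ad y X))"
  by (intro tang_conj tang_Exp xy)
 moreover have "x \<odot> (y \<odot> Exp (t *R X) \<odot> kinv y) \<odot> kinv x = x \<odot> y \<odot> Exp (t *R X) \<odot> kinv (x \<odot> y)" for t
  using xy by (simp add: m_assoc inv_mult_group)
 ultimately show ?thesis using tang_unique[OF tang_conj[OF _ tang_Exp]] xy by auto
qed

lemma Ad_one: "Ad kone X = X"
 using tang_unique[OF tang_conj[OF one_closed tang_Exp[of X]]] tang_Exp[of X] by (simp add: Exp_carrier)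

lemma Ad_Exp: "Ad (Exp (t *R X)) X = X"
proof -
 have "Exp (t *R X) \<odot> Exp (r *R X) \<odot> kinv (Exp (t *R X)) = Exp (r *R X)" for r
 proof -
  have "Exp (t *R X) \<odot> Exp (r *R X) = Exp (r *R X) \<odot> Exp (t *R X)"
   by (simp add: Exp_add[symmetric] add.commute)
  thus ?thesis by (simp add: m_assoc)
 qed
 thus ?thesis
  using tang_unique[OF tang_conj[OF Exp_carrier tang_Exp[of X], of "t *R X"]] tang_Exp[of X] by simp
qed

end

section \<open>Holomorphic actions\<close>

lemma matrix_complex_linear_comp:
 fixes f :: "complex ^ 'n => complex ^ 'm" and g :: "complex ^ 'k => complex ^ 'n"
 assumes "complex_linear f" "complex_linear g"
 shows "matrix (%v. f (g v)) = matrix f ** matrix g"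
proof -
 have "(%v. f (g v)) = (%v. (matrix f ** matrix g) *v v)"
  using complex_linear_matrix[OF assms(1)] complex_linear_matrix[OF assms(2)]
  by (auto simp: matrix_vector_mul_assoc[symmetric])
 thus ?thesis by simp
qed

lemma complex_linear_comp: "complex_linear f ==> complex_linear g ==> complex_linear (%v. f (g v))"
 by (auto simp: clin_def linear_compose[unfolded o_def])

lemma complex_linear_det_inj:
 fixes f :: "complex ^ 'n => complex ^ 'n"
 assumes "complex_linear f"
 shows "det (matrix f) ~= 0 \<longleftrightarrow> (ALL v. f v = 0 --> v = 0)"
 unfolding det_nonzero_iff_ker using complex_linear_matrix[OF assms] by simp

lemma complex_linear_bij:
 fixes f :: "complex ^ 'n => complex ^ 'n"
 assumes "complex_linear f" "!!v. f v = 0 ==> v = 0"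
 shows "bij f"
proof -
 have lin: "linear f" using assms by (simp add: clin_def)
 have "inj f" using assms(2) linear_injective_0[OF lin] by blast
 thus ?thesis using linear_injective_imp_surjective[OF lin] by (simp add: bij_def)
qed

locale kact = clg K N for K :: "'k monoid" and N :: "('k, complex ^ 'n) cmfd" +
 fixes M :: "('m, complex ^ 'n) cmfd" and act :: "'m => 'k => 'm"
 assumes cmM: "complex_manifold M" and mdlM: "model M = UNIV"
  and ract: "holomorphic_right_action K N M act"
begin

lemma chM: "charted M" using cmM mdlM complex_manifold_charted by blast

lemma mhol_act: "mhol M S f ==> mhol N S h ==> mhol M S (%x. act (f x) (h x))"
 using mhol_map2[OF chM chN chM, of "%(x, k). act x k" S f h] ract by (simp add: holomorphic_right_action_def)

lemma continuous_act:
 assumes fh: "continuous_map X (mtop M) f" "continuous_map X (mtop N) h"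
 shows "continuous_map X (mtop M) (%x. act (f x) (h x))"
proof -
 have "continuous_map (prod_topology (mtop M) (mtop N)) (mtop M) (%(x, k). act x k)"
  using ract holomorphic_map_continuous[of "prod_cmfd M N" M] by (auto simp: holomorphic_right_action_def prod_cmfd_def)
 from cm_compose[OF continuous_map_pairedI[OF fh] this] show ?thesis by (simp add: o_def)
qed

lemma act_closed: "x : pts M ==> k : carrier K ==> act x k : pts M"
 using continuous_act[of "mtop M" "%x. x" "%_. k"] by (auto simp: continuous_map_def topN)

lemma act_one: "x : pts M ==> act x kone = x"
 and act_act: "x : pts M ==> k : carrier K ==> l : carrier K ==> act (act x k) l = act x (k \<odot> l)"
 using ract by (auto simp: holomorphic_right_action_def)

lemma chart_top: "c : atlas M ==> x : fst c ==> x : pts M"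
 using chart_subset[OF chM] by blast

definition Pc where "Pc c p = snd c (act (chart_inv c (fst p)) (cw (snd p)))"

lemma mhol_Pc:
 assumes "c : atlas M"
 shows "mhol M (chart_image c \<times> Wd) (%p. act (chart_inv c (fst p)) (cw (snd p)))"
 by (intro mhol_act mhol_reparam[OF mhol_chart_inv[OF cmM mdlM assms]] mhol_reparam[OF mhol_cw] open_Times Wd_open chart_image_open[OF chM assms])
  (auto intro: cdiff_at_fst cdiff_at_snd)

definition PcS where "PcS c = {p : chart_image c \<times> Wd. act (chart_inv c (fst p)) (cw (snd p)) : fst c}"

lemma PcS_open: "c : atlas M ==> open (PcS c)"
 unfolding PcS_def by (rule mhol_open_preimage[OF mhol_Pc chart_openin[OF chM]])

lemma PcS_0: "c : atlas M ==> y : chart_image c ==> (y, 0) : PcS c"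
 using chart_inv_mem[OF chM] by (simp add: PcS_def Wd_0 cw_0 act_one chart_top)

lemma Pc_cdiff: "c : atlas M ==> p : PcS c ==> cdiff_at (Pc c) p"
 unfolding Pc_def[abs_def] by (rule mhol_cdiff[OF mhol_Pc]) (auto simp: PcS_def)

text \<open>The infinitesimal action, in the chart \<open>c\<close>.\<close>

definition Am where "Am c y v = fd (Pc c) (y, 0) (0, v)"

lemma Am_derivative0:
 assumes c: "c : atlas M" "x : fst c"
 shows "hasD (%v. snd c (act x (cw v))) (Am c (snd c x)) 0"
proof -
 have "hasD (Pc c) (fd (Pc c) (snd c x, 0)) (snd c x, 0)"
  by (rule cdiff_fd(1)[OF Pc_cdiff[OF c(1) PcS_0[OF c(1)]]]) (rule chart_mem_image[OF chM c])
 from hasD_chain[OF has_derivative_Pair[OF has_derivative_const has_derivative_ident] this]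
 show ?thesis by (simp add: o_def Am_def[abs_def] Pc_def chart_inv_chart[OF chM c])
qed

lemma Am_linear:
 assumes "c : atlas M" "y : chart_image c" shows "complex_linear (Am c y)"
proof -
 have D: "complex_linear (fd (Pc c) (y, 0))" by (rule cdiff_fd(2)[OF Pc_cdiff[OF assms(1) PcS_0[OF assms]]])
 have "linear (%v :: complex ^ 'n. (0 :: complex ^ 'n, v))" by (auto intro!: linearI)
 hence "complex_linear (%v :: complex ^ 'n. (0 :: complex ^ 'n, v))" by (simp add: clin_def)
 from complex_linear_comp[OF D this] show ?thesis by (simp add: Am_def[abs_def])
qed

lemma Am_cdiff:
 assumes "c : atlas M" "y : chart_image c" shows "cdiff_at (%y. Am c y v) y"
proof -
 have 1: "cdiff_at (%p. fd (Pc c) p (0, v)) (y, 0)"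
  by (rule cdiff_frechet[OF PcS_open[OF assms(1)] Pc_cdiff[OF assms(1)] PcS_0[OF assms]])
 have 2: "cdiff_at (%y. (y, 0 :: complex ^ 'n)) y" by (intro cdiff_at_Pair) auto
 show ?thesis unfolding Am_def using cdiff_at_compose[OF 2, of "%p. fd (Pc c) p (0, v)"] 1 by simp
qed

lemma act_derivative:
 assumes c: "c : atlas M" "x : fst c" and f: "f t0 = kone" "\<forall>\<^sub>F t in nhds t0. f t : fst wc"
  and D: "hasD (%t. lw (f t)) D t0"
 shows "hasD (%t. snd c (act x (f t))) (%h. Am c (snd c x) (D h)) t0"
proof -
 have "hasD (%v. snd c (act x (cw v))) (Am c (snd c x)) (lw (f t0))"
  using Am_derivative0[OF c] by (simp add: f lw_one)
 from hasD_chain[OF D this]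
 have "hasD (%t. snd c (act x (cw (lw (f t))))) (%h. Am c (snd c x) (D h)) t0" by (simp add: o_def)
 thus ?thesis by (rule has_derivative_cong_nhds) (use f(2) in eventually_elim, simp add: cw_lw)
qed

lemma act_tang:
 assumes c: "c : atlas M" "x : fst c" and f: "tang f X"
 shows "hasD (%t. snd c (act x (f t))) (%t. t *R Am c (snd c x) X) 0"
proof -
 have "hasD (%t. snd c (act x (f t))) (%t. Am c (snd c x) (t *R X)) 0"
  by (rule act_derivative[OF c tang_0[OF f] tang_wc[OF f]]) (use f in "simp add: tang_def has_vector_derivative_def")
 moreover have "linear (Am c (snd c x))"
  using Am_linear[OF c(1) chart_mem_image[OF chM c]] by (simp add: clin_def)
 ultimately show ?thesis by (simp add: linear_scale)
qed

lemma ev_chart: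
 assumes "continuous_map euclidean (mtop M) u" "u t0 : W" "openin (mtop M) W"
 shows "\<forall>\<^sub>F t in nhds t0. u t : W"
proof -
 have "open {t : UNIV. u t : W}" by (rule open_preimage[OF _ _ assms(3)]) (use assms in auto)
 thus ?thesis using assms(2) by (auto simp: eventually_nhds)
qed

lemma continuous_Exp_line: "continuous_map euclidean (mtop N) (%t. Exp (t *R X))"
 using cm_compose[OF _ Exp_continuous, of euclideanreal "%t. t *R X"] by (simp add: o_def continuous_intros)

lemma continuous_act_const: "m : pts M ==> continuous_map X (mtop N) h ==> continuous_map X (mtop M) (%x. act m (h x))"
 by (rule continuous_act) auto

text \<open>The differential of the right translation by x, from the chart c to the chart c'. For x
  = 1 it is the differential of the change of charts, so chart independence becomes a special case
  of equivariance.\<close>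

definition Rd where "Rd c c' x y = fd (%y. snd c' (act (chart_inv c y) x)) y"

lemma R_cdiff:
 assumes "c : atlas M" "c' : atlas M" "m : fst c" "x : carrier K" "act m x : fst c'"
 shows "cdiff_at (%y. snd c' (act (chart_inv c y) x)) (snd c m)"
proof (rule mhol_cdiff[OF _ assms(2)])
 show "mhol M (chart_image c) (%y. act (chart_inv c y) x)"
  by (intro mhol_act mhol_chart_inv cmM mdlM mhol_const chart_image_open[OF chM]) (use assms in "auto simp: topN")
qed (use chart_mem_image[OF chM assms(1,3)] chart_inv_chart[OF chM assms(1,3)] assms(5) in auto)

lemma Rd_linear:
 assumes "c : atlas M" "c' : atlas M" "m : fst c" "x : carrier K" "act m x : fst c'"
 shows "complex_linear (Rd c c' x (snd c m))" unfolding Rd_def by (rule cdiff_fd(2)[OF R_cdiff[OF assms]])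

text \<open>Differentiate m x exp (tv) = (m (x exp (tv) x^-1)) x at t = 0.\<close>

lemma Am_right:
 assumes a: "c : atlas M" "c' : atlas M" "m : fst c" "x : carrier K" "act m x : fst c'"
 shows "Am c' (snd c' (act m x)) v = Rd c c' x (snd c m) (Am c (snd c m) (Ad x v))"
proof -
 have mt: "m : pts M" using chart_top a by blast
 let ?h = "%t. x \<odot> Exp (t *R v) \<odot> kinv x"
 have th: "tang ?h (Ad x v)" by (rule tang_conj[OF a(4) tang_Exp])
 have L: "hasD (%t. snd c' (act (act m x) (Exp (t *R v)))) (%t. t *R Am c' (snd c' (act m x)) v) 0"
  by (rule act_tang[OF a(2,5) tang_Exp])
 have 1: "hasD (%t. snd c (act m (?h t))) (%t. t *R Am c (snd c m) (Ad x v)) 0"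
  by (rule act_tang[OF a(1,3) th])
 have h0: "act m (?h 0) = m" using tang_0[OF th] by (simp add: act_one[OF mt])
 have "hasD (%y. snd c' (act (chart_inv c y) x)) (Rd c c' x (snd c m)) (snd c (act m (?h 0)))"
  unfolding h0 Rd_def by (rule cdiff_fd(1)[OF R_cdiff[OF a]])
 from hasD_chain[OF 1 this]
 have 2: "hasD (%t. snd c' (act (chart_inv c (snd c (act m (?h t)))) x)) (%t. Rd c c' x (snd c m) (t *R Am c (snd c m) (Ad x v))) 0"
  by (simp only: o_def)
 have ch: "continuous_map euclidean (mtop N) ?h"
  by (intro continuous_kmul continuous_Exp_line) (use a(4) in \<open>auto simp: topN\<close>)
 have "\<forall>\<^sub>F t in nhds 0. act m (?h t) : fst c"
  by (rule ev_chart[OF continuous_act_const[OF mt ch] _ chart_openin[OF chM a(1)]]) (simp only: h0 a(3))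
 hence "\<forall>\<^sub>F t in nhds 0. snd c' (act (chart_inv c (snd c (act m (?h t)))) x) = snd c' (act (act m x) (Exp (t *R v)))"
  by eventually_elim (use a(4) mt in \<open>simp add: chart_inv_chart[OF chM a(1)] act_act m_assoc\<close>)
 from has_derivative_unique[OF has_derivative_cong_nhds[OF 2 this] L]
 have "Rd c c' x (snd c m) (1 *R Am c (snd c m) (Ad x v)) = 1 *R Am c' (snd c' (act m x)) v" by (rule fun_cong)
 thus ?thesis by simp
qed

lemma Am_change:
 assumes "c : atlas M" "c' : atlas M" "m : fst c" "m : fst c'"
 shows "Am c' (snd c' m) v = Rd c c' kone (snd c m) (Am c (snd c m) v)"
 using Am_right[OF assms(1-3) one_closed, of v] chart_top[OF assms(1,3)] assms(4) by (simp add: act_one Ad_one)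

definition dA where "dA c y = det (matrix (Am c y))"

lemma dA_right:
 assumes a: "c : atlas M" "c' : atlas M" "m : fst c" "x : carrier K" "act m x : fst c'"
 shows "dA c' (snd c' (act m x)) = det (matrix (Rd c c' x (snd c m))) * dA c (snd c m) * det (matrix (Ad x))"
proof -
 have "Am c' (snd c' (act m x)) = (%v. Rd c c' x (snd c m) (Am c (snd c m) (Ad x v)))"
  using Am_right[OF a] by blast
 thus ?thesis
  using matrix_complex_linear_comp[OF Rd_linear[OF a] complex_linear_comp[OF Am_linear[OF a(1) chart_mem_image[OF chM a(1,3)]] Ad_linear[OF a(4)]]]
   matrix_complex_linear_comp[OF Am_linear[OF a(1) chart_mem_image[OF chM a(1,3)]] Ad_linear[OF a(4)]]
  by (simp add: dA_def det_mul)
qed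

lemma Am_matrix_cdiff: "c : atlas M ==> y : chart_image c ==> cdiff_at (%y. matrix (Am c y)) y"
 unfolding matrix_def by (intro cdiff_at_vec) (simp add: cdiff_at_vec_nth[OF Am_cdiff])

lemma dA_cdiff: "c : atlas M ==> y : chart_image c ==> cdiff_at (dA c) y"
 unfolding dA_def[abs_def] by (rule cdiff_at_det[OF Am_matrix_cdiff])

text \<open>The local exponential differs from the identity map by at most C |Y|^2, and C |Y| is at
  most 1/2 on this ball, so it cannot send a nonzero vector to 0.\<close>

lemma Exp_isolated: "norm Y < \<rho> / 2 ==> Exp Y = kone ==> Y = 0"
proof -
 assume Y: "norm Y < \<rho> / 2" "Exp Y = kone"
 let ?C = "snd rc"
 have "Ex Y = 0" using Exp_lw[OF Y(1)] Y(2) lw_one by simp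
 hence "norm Y <= ?C * (norm Y)\<^sup>2" using doubling.Ex_near[OF rc(1), of Y] Y by simp
 also have "... = ?C * norm Y * norm Y" by (simp add: power2_eq_square)
 also have "... <= (1 / 2) * norm Y"
 proof (rule mult_right_mono)
  have "?C * norm Y <= ?C * \<rho>" using doubling.C(1)[OF rc(1)] Y \<rho>_pos by (intro mult_left_mono) auto
  thus "?C * norm Y <= 1 / 2" using doubling.C(2)[OF rc(1)] by linarith
 qed simp
 finally show "Y = 0" by simp
qed

lemma flow_derivative:
 assumes m: "m : pts M" and c: "c : atlas M" "act m (Exp (t *R X)) : fst c"
 shows "((%t. snd c (act m (Exp (t *R X)))) has_vector_derivative Am c (snd c (act m (Exp (t *R X)))) X) (at t)"
proof -
 have "hasD (%s. snd c (act (act m (Exp (t *R X))) (Exp (s *R X)))) (%s. s *R Am c (snd c (act m (Exp (t *R X)))) X) (t - t)"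
  using act_tang[OF c tang_Exp] by simp
 from hasD_chain[OF has_derivative_diff[OF has_derivative_ident has_derivative_const] this]
 have "hasD (%s. snd c (act (act m (Exp (t *R X))) (Exp ((s - t) *R X)))) (%s. s *R Am c (snd c (act m (Exp (t *R X)))) X) t"
  by (simp add: o_def)
 moreover have "act (act m (Exp (t *R X))) (Exp ((s - t) *R X)) = act m (Exp (s *R X))" for s
  by (simp add: act_act[OF m] Exp_add[symmetric])
 ultimately show ?thesis by (simp add: has_vector_derivative_def)
qed

text \<open>If X acts as zero at m, it acts as zero along its whole flow, because Ad (exp (tX)) X =
  X. The flow is then constant for small t, so all these exp (tX) fix m, and they are pairwise
  distinct by \<open>Exp_isolated\<close>.\<close>

lemma Am_inj:
 assumes m: "c : atlas M" "m : fst c" and fin: "finite {k : carrier K. act m k = m}" and X: "Am c (snd c m) X = 0"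
 shows "X = 0"
proof (rule ccontr)
 assume X0: "X ~= 0"
 have mt: "m : pts M" using chart_top m by blast
 let ?u = "%t. act m (Exp (t *R X))"
 have cu: "continuous_map euclidean (mtop M) ?u" by (rule continuous_act_const[OF mt continuous_Exp_line])
 have "\<forall>\<^sub>F t in nhds 0. ?u t : fst c"
  by (rule ev_chart[OF cu _ chart_openin[OF chM m(1)]]) (use m mt in "simp add: act_one")
 then obtain S :: "real set" where "open S" "0 : S" "!!t. t : S ==> ?u t : fst c"
  by (auto simp: eventually_nhds)
 then obtain d where d: "d > 0" "!!t. \<bar>t\<bar> < d ==> ?u t : fst c"
  using openE by (metis dist_0_norm mem_ball real_norm_def subsetD)
 have z: "((%t. snd c (?u t)) has_vector_derivative 0) (at t)" if t: "\<bar>t\<bar> < d" for t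
 proof -
  have "Am c (snd c (?u t)) X = Rd c c (Exp (t *R X)) (snd c m) (Am c (snd c m) (Ad (Exp (t *R X)) X))"
   by (rule Am_right[OF m(1) m(1) m(2) Exp_carrier d(2)[OF t]])
  also have "... = 0"
   using Rd_linear[OF m(1) m(1) m(2) Exp_carrier d(2)[OF t]] by (simp add: Ad_Exp X clin_def linear_0)
  finally show ?thesis using flow_derivative[OF mt m(1) d(2)[OF t]] by simp
 qed
 have dz: "((%t. snd c (?u t)) has_derivative (%h. 0)) (at t within {-d<..<d})" if t: "t : {-d<..<d}" for t
 proof (rule has_derivative_at_withinI)
  have "\<bar>t\<bar> < d" using t by auto
  from z[OF this] show "hasD (%t. snd c (?u t)) (%h. 0) t"
   unfolding has_vector_derivative_def scaleR_zero_right .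
 qed
 obtain a where a: "!!t. t : {-d<..<d} ==> snd c (?u t) = a"
  using has_derivative_zero_constant[OF convex_real_interval(8) dz] by blast
 have um: "?u t = m" if t: "t : {-d<..<d}" for t
 proof -
  have "snd c (?u t) = snd c (?u 0)" using a[OF t] a[of 0] d by simp
  moreover have 1: "?u t : fst c" using d(2)[of t] t by auto
  moreover have 2: "?u 0 : fst c" using d(2)[of 0] d(1) by simp
  ultimately have "?u t = ?u 0" using chart_inv_chart[OF chM m(1) 1] chart_inv_chart[OF chM m(1) 2] by simp
  thus ?thesis by (simp add: act_one mt)
 qed
 \<comment> \<open>The first bound keeps the flow at m, the second makes t |-> exp (tX) injective on
   the interval.\<close>
 define e where "e = min d (\<rho> / 2 / norm X)"
 have e: "e > 0" using d \<rho>_pos X0 by (simp add: e_def)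
 have "finite ((%t. Exp (t *R X)) ` {0<..<e})"
  by (rule finite_subset[OF _ fin]) (use um in "auto simp: e_def")
 moreover have "infinite {0<..<e}" using e by (simp add: infinite_Ioo)
 moreover have "inj_on (%t. Exp (t *R X)) {0<..<e}"
 proof (rule inj_onI)
  fix s t assume st: "s : {0<..<e}" "t : {0<..<e}" "Exp (s *R X) = Exp (t *R X)"
  have "Exp ((s - t) *R X) = Exp (s *R X) \<odot> Exp ((- t) *R X)"
   by (simp only: diff_conv_add_uminus Exp_add)
  also have "... = kone" by (simp only: st(3) Exp_add[symmetric]) simp
  finally have 1: "Exp ((s - t) *R X) = kone" .
  have "\<bar>s - t\<bar> < \<rho> / 2 / norm X" using st by (auto simp: e_def)
  hence "norm ((s - t) *R X) < \<rho> / 2" unfolding norm_scaleR using X0 by (simp add: field_simps)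
  from Exp_isolated[OF this 1] show "s = t" using X0 by simp
 qed
 ultimately show False using finite_imageD by blast
qed

end

section \<open>The invariant density on the manifold\<close>

text \<open>The velocity \<gamma>1 is required to be differentiable at 0 only. In the first
  derivative both point and direction move, so it is expanded in the basis before the product rule
  is applied.\<close>

lemma gamma_second_derivative:
 fixes P :: "'b::euclidean_space => real" and \<gamma> :: "real => 'b"
 assumes T: "open T" "cont_diff 2 T P" and \<delta>: "0 < \<delta>"
  and g: "!!t. \<bar>t\<bar> < \<delta> ==> \<gamma> t : T" "!!t. \<bar>t\<bar> < \<delta> ==> (\<gamma> has_vector_derivative \<gamma>1 t) (at t)"
  and g1: "(\<gamma>1 has_vector_derivative \<gamma>2) (at 0)"
 shows "\<bar>t\<bar> < \<delta> ==> hasR (%t. P (\<gamma> t)) (fd P (\<gamma> t) (\<gamma>1 t)) t"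
  and "hasR (%t. fd P (\<gamma> t) (\<gamma>1 t)) (fd (%y. fd P y (\<gamma>1 0)) (\<gamma> 0) (\<gamma>1 0) + fd P (\<gamma> 0) \<gamma>2) 0"
proof -
 let ?P = "%y. fd P y"
 have dP: "hasD P (?P y) y" if "y : T" for y
  using T that cd_SucD(1)[of 1 T P] by (simp add: numeral_2_eq_2 del: cont_diff.simps)
 have dP2: "hasD (%y. ?P y b) (fd (%y. ?P y b) y) y" if "y : T" for y b
  using T that cd_SucD(1)[of 0 T, OF cd_SucD(2)[of 1 T P b, simplified One_nat_def]]
  by (simp add: numeral_2_eq_2 del: cont_diff.simps)
 have lin: "linear (?P y)" if "y : T" for y using dP[OF that] has_derivative_linear by blast
 show "hasR (%t. P (\<gamma> t)) (?P (\<gamma> t) (\<gamma>1 t)) t" if t: "\<bar>t\<bar> < \<delta>" for t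
  using hasD_chain[OF g(2)[OF t, unfolded has_vector_derivative_def] dP[OF g(1)[OF t]]] linear_scale[OF lin[OF g(1)[OF t]]]
  by (simp add: has_field_derivative_def o_def mult_commute_abs)
 have rep: "(\<Sum>b\<in>Basis. (v \<bullet> b) * ?P y b) = ?P y v" if "y : T" for y v
  by (subst (2) euclidean_representation[of v, symmetric]) (simp add: linear_sum[OF lin[OF that]] linear_scale[OF lin[OF that]])
 have g0: "\<gamma> 0 : T" using g(1)[of 0] \<delta> by simp
 have "hasR (%t. \<Sum>b\<in>Basis. (\<gamma>1 t \<bullet> b) * ?P (\<gamma> t) b) (\<Sum>b\<in>Basis. (\<gamma>1 0 \<bullet> b) * fd (%y. ?P y b) (\<gamma> 0) (\<gamma>1 0) + (\<gamma>2 \<bullet> b) * ?P (\<gamma> 0) b) 0"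
 proof (rule DERIV_sum)
  fix b :: 'b
  have 1: "hasR (%t. \<gamma>1 t \<bullet> b) (\<gamma>2 \<bullet> b) 0"
   using has_derivative_inner_left[OF g1[unfolded has_vector_derivative_def], of b]
   by (simp add: has_field_derivative_def mult_commute_abs)
  have l2: "linear (fd (%y. ?P y b) (\<gamma> 0))" using dP2[OF g0] has_derivative_linear by blast
  have "(\<gamma> has_vector_derivative \<gamma>1 0) (at 0)" using g(2)[of 0] \<delta> by simp
  from hasD_chain[OF this[unfolded has_vector_derivative_def] dP2[OF g0, of b]] linear_scale[OF l2]
  have 2: "hasR (%t. ?P (\<gamma> t) b) (fd (%y. ?P y b) (\<gamma> 0) (\<gamma>1 0)) 0"
   by (simp add: has_field_derivative_def o_def mult_commute_abs)
  from DERIV_mult[OF 1 2]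
  show "hasR (%t. (\<gamma>1 t \<bullet> b) * ?P (\<gamma> t) b) ((\<gamma>1 0 \<bullet> b) * fd (%y. ?P y b) (\<gamma> 0) (\<gamma>1 0) + (\<gamma>2 \<bullet> b) * ?P (\<gamma> 0) b) 0"
   by (simp add: ac_simps)
 qed
 moreover have "(\<Sum>b\<in>Basis. (\<gamma>1 0 \<bullet> b) * fd (%y. ?P y b) (\<gamma> 0) (\<gamma>1 0)) =
   fd (%y. ?P y (\<gamma>1 0)) (\<gamma> 0) (\<gamma>1 0)"
 proof -
  have "hasD (%y. \<Sum>b\<in>Basis. (\<gamma>1 0 \<bullet> b) * ?P y b) (%h. \<Sum>b\<in>Basis. (\<gamma>1 0 \<bullet> b) * fd (%y. ?P y b) (\<gamma> 0) h) (\<gamma> 0)"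
   by (intro has_derivative_sum has_derivative_mult_right dP2 g0)
  hence "hasD (%y. ?P y (\<gamma>1 0)) (%h. \<Sum>b\<in>Basis. (\<gamma>1 0 \<bullet> b) * fd (%y. ?P y b) (\<gamma> 0) h) (\<gamma> 0)"
   by (rule hasD_transform[OF _ T(1) g0]) (simp add: rep)
  from fd_eqI[OF this] show ?thesis by simp
 qed
 ultimately have d: "hasR (%t. \<Sum>b\<in>Basis. (\<gamma>1 t \<bullet> b) * ?P (\<gamma> t) b) (fd (%y. ?P y (\<gamma>1 0)) (\<gamma> 0) (\<gamma>1 0) + ?P (\<gamma> 0) \<gamma>2) 0"
  by (simp add: sum.distrib rep[OF g0])
 show "hasR (%t. ?P (\<gamma> t) (\<gamma>1 t)) (fd (%y. ?P y (\<gamma>1 0)) (\<gamma> 0) (\<gamma>1 0) + ?P (\<gamma> 0) \<gamma>2) 0"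
  by (rule DERIV_cong_ev[THEN iffD1, OF refl _ refl d])
   (use \<delta> in "auto simp: eventually_nhds_metric dist_real_def intro!: exI[of _ \<delta>] rep g")
qed

declare cscale_vec [simp del]

lemma cscale_cscale: "cscale z (cscale w v) = cscale (z * w) v"
 by (simp add: cscale_def imul_add imul_scaleR imul_imul algebra_simps)

text \<open>Restriction of a holomorphic curve to a real line through 0. The cases w = 1 and w = i
  correspond to the directions X and iX.\<close>

lemma holomorphic_line:
 fixes \<sigma> :: "complex => 'b::complex_model"
 assumes "cdiff_at \<sigma> (of_real t * w)"
 shows "((%t. \<sigma> (of_real t * w)) has_vector_derivative cscale w (fd \<sigma> (of_real t * w) 1)) (at t)"
proof -
 have "hasD (%t. of_real t * w) (%t. of_real t * w) t"
  by (intro blin_hasD bounded_linear_mult_const bounded_linear_of_real)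
 from hasD_chain[OF this cdiff_fd(1)[OF assms]]
 have "hasD (%t. \<sigma> (of_real t * w)) (%s. fd \<sigma> (of_real t * w) (of_real s * w)) t"
  by (simp add: o_def)
 moreover have "fd \<sigma> (of_real t * w) (of_real s * w) = s *R cscale w (fd \<sigma> (of_real t * w) 1)" for s
 proof -
  have "of_real s * w = cscale (of_real s * w) (1::complex)" by simp
  thus ?thesis using complex_linear_cscale_eq[OF cdiff_fd(2)[OF assms], of "of_real s * w" 1]
   by (simp add: cscale_def scaleR_add_right)
 qed
 ultimately show ?thesis by (simp add: has_vector_derivative_def)
qed

locale kmet = kact K N M act for K :: "'k monoid" and N :: "('k, complex ^ 'n) cmfd"
  and M :: "('m, complex ^ 'n) cmfd" and act :: "'m => 'k => 'm" +
 fixes g :: "('m, 'n) metric"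
 assumes kae: "kaehler_metric M g"
begin

lemma form: "c : atlas M ==> y : chart_image c ==> hermitian_form (g c) y"
 using kae unfolding kaehler_metric_def by unfold_locales blast+

lemma kchart:
 assumes c: "c : atlas M" shows "kaehler_chart (g c) (chart_image c)" unfolding kaehler_chart_def
proof (intro conjI allI impI)
 show "open (chart_image c)" by (rule chart_image_open[OF chM c])
 show "smooth_on (chart_image c) (%y. g c y u v)" for u v using kae c by (simp add: kaehler_metric_def)
 show "y : chart_image c ==> hermitian_form (g c) y" for y using form[OF c] .
 show "y : chart_image c ==>
       fd (%y. kaehler_form (g c) y v w) y u +
       fd (%y. kaehler_form (g c) y w u) y v +
       fd (%y. kaehler_form (g c) y u v) y w = 0" for y u v w
  using kae c unfolding kaehler_metric_def by blast
qed

definition hdet where "hdet c y = Re (det (gram (g c) y))"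

lemma hdet_pos: "c : atlas M ==> y : chart_image c ==> 0 < hdet c y"
 unfolding hdet_def by (rule hermitian_form.det_gram_pos(2)[OF form])

lemma det_gram_hdet: "c : atlas M ==> y : chart_image c ==> det (gram (g c) y) = of_real (hdet c y)"
 using hermitian_form.det_gram_pos(1)[OF form] by (simp add: hdet_def complex_eq_iff)

abbreviation isom where "isom x \<equiv> preserves_metric M g (%m. act m x)"

text \<open>The identity and m |-> m 1 agree on the points of M only, so invariance is transferred
  on chart domains. Chart independence of \<open>Hf\<close> thereby becomes the case x = 1 of its
  transformation law.\<close>

lemma isom_one: "isom kone"
proof -
 have id: "preserves_metric M g id" using kae by (simp add: kaehler_metric_def)
 show ?thesis unfolding preserves_metric_def Let_def
 proof (intro ballI impI allI)
  fix c c' x u v assume c: "c : atlas M" "c' : atlas M" "x : fst c" "act x kone : fst c'"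
  have x: "act x kone = x" using chart_top[OF c(1,3)] by (rule act_one)
  have "fd (snd c' \<circ> (%m. act m kone) \<circ> chart_inv c) (snd c x) = fd (snd c' \<circ> id \<circ> chart_inv c) (snd c x)"
  proof (rule frechet_derivative_transform_within_open[OF _ chart_image_open[OF chM c(1)] chart_mem_image[OF chM c(1,3)]])
   show "(snd c' \<circ> (%m. act m kone) \<circ> chart_inv c) differentiable at (snd c x)"
    using cdiff_fd(1)[OF R_cdiff[OF c(1-3) one_closed c(4)]] by (auto simp: o_def differentiable_def)
   show "(snd c' \<circ> (%m. act m kone) \<circ> chart_inv c) y = (snd c' \<circ> id \<circ> chart_inv c) y" if "y : chart_image c" for y
    using chart_top[OF c(1) chart_inv_mem[OF chM c(1) that]] by (simp add: act_one)
  qed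
  thus "g c' (snd c' (act x kone)) (fd (snd c' \<circ> (%m. act m kone) \<circ> chart_inv c) (snd c x) u)
    (fd (snd c' \<circ> (%m. act m kone) \<circ> chart_inv c) (snd c x) v) = g c (snd c x) u v"
   using id c x unfolding preserves_metric_def Let_def by simp
 qed
qed

lemma isom_Rd:
 assumes "isom x" "c : atlas M" "c' : atlas M" "m : fst c" "act m x : fst c'"
 shows "g c' (snd c' (act m x)) (Rd c c' x (snd c m) u) (Rd c c' x (snd c m) v) = g c (snd c m) u v"
 using assms unfolding preserves_metric_def Let_def Rd_def by (simp add: o_def)

lemma hdet_right:
 assumes x: "isom x" "x : carrier K" and c: "c : atlas M" "c' : atlas M" "m : fst c" "act m x : fst c'"
 shows "hdet c (snd c m) = (cmod (det (matrix (Rd c c' x (snd c m)))))\<^sup>2 * hdet c' (snd c' (act m x))"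
proof -
 let ?D = "Rd c c' x (snd c m)" and ?y = "snd c m" and ?y' = "snd c' (act m x)"
 have D: "?D (imul v) = imul (?D v)" for v using Rd_linear[OF c(1-3) x(2) c(4)] by (simp add: clin_def)
 have "hermitian (g c') ?y' (?D u) (?D v) = hermitian (g c) ?y u v" for u v
  using isom_Rd[OF x(1) c, of u v] isom_Rd[OF x(1) c, of "imul u" v] by (simp add: hermitian_def kaehler_form_def D)
 hence "gram (g c) ?y = (\<chi> i j. hermitian (g c') ?y' (?D (axis i 1)) (?D (axis j 1)))"
  by (simp add: gram_def)
 hence "det (gram (g c) ?y) = of_real ((cmod (det (matrix ?D)))\<^sup>2) * det (gram (g c') ?y')"
  using hermitian_form.det_herm_columns[OF form[OF c(2) chart_mem_image[OF chM c(2,4)]], of "%i. ?D (axis i 1)"]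
  by (simp add: matrix_def)
 thus ?thesis by (simp add: hdet_def)
qed

text \<open>The squared \<open>J\<close>-volume of the vectors at \<open>m\<close> generated by a basis of the Lie algebra; it does
 not depend on the chart.\<close>

definition Hf where "Hf m = (let c = (SOME c. c : atlas M & m : fst c) in hdet c (snd c m) * (cmod (dA c (snd c m)))\<^sup>2)"

lemma hdet_dA_right:
 assumes x: "isom x" "x : carrier K" and c: "c : atlas M" "c' : atlas M" "m : fst c" "act m x : fst c'"
 shows "hdet c' (snd c' (act m x)) * (cmod (dA c' (snd c' (act m x))))\<^sup>2 =
  hdet c (snd c m) * (cmod (dA c (snd c m)))\<^sup>2 * (cmod (det (matrix (Ad x))))\<^sup>2"
 unfolding hdet_right[OF x c] dA_right[OF c(1-3) x(2) c(4)] by (simp add: norm_mult power_mult_distrib)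

lemma Ad_one_matrix: "det (matrix (Ad kone)) = 1"
proof -
 have "Ad kone = (%X. X)" using Ad_one by blast
 hence "matrix (Ad kone) = mat 1" by (auto simp: matrix_def mat_def axis_def vec_eq_iff)
 thus ?thesis by simp
qed

lemma Hf_chart:
 assumes c: "c : atlas M" "m : fst c"
 shows "Hf m = hdet c (snd c m) * (cmod (dA c (snd c m)))\<^sup>2"
proof -
 define c' where "c' = (SOME c. c : atlas M & m : fst c)"
 have c': "c' : atlas M & m : fst c'" unfolding c'_def by (rule someI) (use c in blast)
 have m: "act m kone = m" using act_one chart_top c by blast
 show ?thesis
  using hdet_dA_right[OF isom_one one_closed c(1) _ c(2), of c'] c' by (simp add: m Hf_def c'_def[symmetric] Let_def Ad_one_matrix)
qed

lemma Hf_right: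
 assumes x: "isom x" "x : carrier K" and m: "m : pts M"
 shows "Hf (act m x) = Hf m * (cmod (det (matrix (Ad x))))\<^sup>2"
proof -
 obtain c c' where c: "c : atlas M" "m : fst c" "c' : atlas M" "act m x : fst c'"
  using charted_chart_at[OF chM] m act_closed[OF m x(2)] by meson
 show ?thesis unfolding Hf_chart[OF c(1,2)] Hf_chart[OF c(3,4)] by (rule hdet_dA_right[OF x c(1,3,2,4)])
qed

lemma Hf_pos_iff: "c : atlas M ==> m : fst c ==> 0 < Hf m \<longleftrightarrow> dA c (snd c m) ~= 0"
 using hdet_pos[OF _ chart_mem_image[OF chM]] by (simp add: Hf_chart zero_less_mult_iff)

lemma hdet_smooth: "c : atlas M ==> cont_diff k (chart_image c) (hdet c)"
proof -
 assume c: "c : atlas M"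
 interpret kaehler_chart "g c" "chart_image c" by (rule kchart[OF c])
 have "cont_diff k (chart_image c) (%y. Re (det (gram (g c) y)))"
  by (intro cont_diff_linear[OF opS bounded_linear_Re] cont_diff_det smooth_gram opS)
 thus ?thesis by (simp add: hdet_def[abs_def] del: cont_diff.simps)
qed

lemma Hf_chart_continuous: "c : atlas M ==> continuous_on (chart_image c) (%y. hdet c y * (cmod (dA c y))\<^sup>2)"
 by (intro continuous_intros cont_diff_continuous[OF hdet_smooth[of c 0]] cont_at_on ballI cdiff_at_isCont[OF dA_cdiff])

lemma continuous_map_Hf: "continuous_map (mtop M) euclideanreal Hf" unfolding continuous_map_def
proof (intro conjI allI impI)
 fix U :: "real set" assume "openin euclidean U"
 hence U: "open U" by simp
 show "openin (mtop M) {x : pts M. Hf x : U}"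
 proof (subst openin_subopen, intro ballI)
  fix x assume "x : {x : pts M. Hf x : U}"
  then obtain c where c: "c : atlas M" "x : fst c" "Hf x : U" using charted_chart_at[OF chM] by blast
  have "continuous_map (subtopology (mtop M) (fst c)) (top_of_set (chart_image c)) (snd c)"
   using continuous_map_chart[OF chM c(1)] chart_mem_image[OF chM c(1)] by (auto simp: cm_in_sub)
  moreover have "continuous_map (top_of_set (chart_image c)) euclideanreal (%y. hdet c y * (cmod (dA c y))\<^sup>2)"
   using Hf_chart_continuous[OF c(1)] by simp
  ultimately have "continuous_map (subtopology (mtop M) (fst c)) euclideanreal ((%y. hdet c y * (cmod (dA c y))\<^sup>2) \<circ> snd c)"
   by (rule cm_compose)
  hence "continuous_map (subtopology (mtop M) (fst c)) euclideanreal Hf"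
   by (rule continuous_map_eq) (auto simp: Hf_chart[OF c(1)])
  from openin_continuous_map_preimage[OF this, of U] U
  have "openin (subtopology (mtop M) (fst c)) {z : pts M \<inter> fst c. Hf z : U}" by simp
  hence "openin (mtop M) {z : pts M \<inter> fst c. Hf z : U}"
   using openin_trans_full chart_openin[OF chM c(1)] by blast
  thus "EX T. openin (mtop M) T & x : T & T \<subseteq> {x : pts M. Hf x : U}"
   using c chart_top by blast
 qed
qed simp

lemma Hf_max:
 assumes "compact_space (mtop M)" "pts M ~= {}"
 obtains m where "m : pts M" "!!x. x : pts M ==> Hf x <= Hf m"
proof -
 have "compactin euclideanreal (Hf ` pts M)"
  using image_compactin[OF _ continuous_map_Hf] assms(1) by (simp add: compact_space_def)
 hence "compact (Hf ` pts M)" by simp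
 thus thesis using compact_attains_sup[of "Hf ` pts M"] assms(2) that by auto
qed

lemma Ad_power_det: "x : carrier K ==> det (matrix (Ad (x \<odot> y))) = det (matrix (Ad x)) * det (matrix (Ad y))" if "y : carrier K"
proof -
 assume x: "x : carrier K"
 have "Ad (x \<odot> y) = (%X. Ad x (Ad y X))" using Ad_mult[OF x that] by blast
 thus ?thesis using matrix_complex_linear_comp[OF Ad_linear[OF x] Ad_linear[OF that]] by (simp add: det_mul)
qed

text \<open>Were the modulus greater than 1, H would grow geometrically along the points p x^n.
  Applying the resulting inequality to the inverse of x as well leaves equality.\<close>

lemma isom_det_Ad:
 assumes cpt: "compact_space (mtop M)" and p: "p : pts M" "0 < Hf p"
  and G: "subgroup G K" "!!x. x : G ==> isom x" and x: "x : G"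
 shows "cmod (det (matrix (Ad x))) = 1"
proof -
 obtain m where m: "!!x. x : pts M ==> Hf x <= Hf m"
  using Hf_max[OF cpt] p by blast
 have le: "cmod (det (matrix (Ad x))) <= 1" if x: "x : G" for x
 proof (rule ccontr)
  let ?d = "cmod (det (matrix (Ad x)))"
  assume "~ ?d <= 1"
  hence d: "1 < ?d\<^sup>2" by (simp add: one_less_power)
  have xK: "x : carrier K" using subgroup.mem_carrier[OF G(1) x] .
  have pow: "Hf (act p (x ^^^ n)) = Hf p * (?d\<^sup>2) ^ n" for n
  proof (induction n)
   case (Suc n)
   have "Hf (act p (x ^^^ Suc n)) = Hf (act (act p (x ^^^ n)) x)" using p xK by (simp add: act_act)
   also have "... = Hf (act p (x ^^^ n)) * ?d\<^sup>2" by (rule Hf_right[OF G(2)[OF x] xK act_closed]) (use p xK in auto)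
   finally show ?case using Suc by (simp add: ac_simps)
  qed (simp add: act_one p)
  obtain n where "Hf m / Hf p < (?d\<^sup>2) ^ n" using real_arch_pow[OF d] by blast
  hence "Hf m < Hf (act p (x ^^^ n))" unfolding pow using p by (simp add: field_simps)
  moreover have "Hf (act p (x ^^^ n)) <= Hf m" by (rule m[OF act_closed]) (use p xK in auto)
  ultimately show False by simp
 qed
 have xK: "x : carrier K" using subgroup.mem_carrier[OF G(1) x] .
 have "kinv x : G" using subgroup.m_inv_closed[OF G(1) x] .
 have "cmod (det (matrix (Ad x))) * cmod (det (matrix (Ad (kinv x)))) = 1"
  using Ad_power_det[OF inv_closed[OF xK] xK] xK by (simp add: Ad_one_matrix norm_mult[symmetric])
 moreover have "cmod (det (matrix (Ad x))) * cmod (det (matrix (Ad (kinv x)))) <= cmod (det (matrix (Ad x))) * 1"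
  by (rule mult_left_mono[OF le]) (use \<open>kinv x : G\<close> in auto)
 ultimately show ?thesis using le[OF x] by simp
qed

text \<open>The contribution \<open>2 log |det A|\<close> of the infinitesimal action is harmonic and drops out.\<close>

lemma second_variation:
 assumes m: "c : atlas M" "m : fst c" and pos: "0 < Hf m" and v_def: "v = Am c (snd c m) X"
 obtains \<delta> d1 d2 e1 e2 where "0 < (\<delta>::real)"
  "!!t. \<bar>t\<bar> < \<delta> ==> hasR (%t. ln (Hf (act m (Exp (t *R X))))) (d1 t) t"
  "!!t. \<bar>t\<bar> < \<delta> ==> hasR (%t. ln (Hf (act m (Exp (t *R imul X))))) (d2 t) t"
  "!!t. \<bar>t\<bar> < \<delta> ==> 0 < Hf (act m (Exp (t *R X))) & 0 < Hf (act m (Exp (t *R imul X)))"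
  "hasR d1 e1 0" "hasR d2 e2 0"
  "e1 + e2 = - (ricci (g c) (snd c m) v v + ricci (g c) (snd c m) (imul v) (imul v))"
proof -
 have mt: "m : pts M" using chart_top m by blast
 interpret kaehler_chart "g c" "chart_image c" by (rule kchart[OF m(1)])
 \<comment> \<open>The complex one-parameter orbit through m; its real axis runs in the direction X
   and its imaginary axis in the direction iX.\<close>
 let ?F = "%z. act m (Exp (cscale z X))"
 define Z where "Z = {z. ?F z : fst c}"
 define \<sigma> where "\<sigma> z = snd c (?F z)" for z
 have F: "mhol M UNIV ?F" by (intro mhol_act mhol_const mhol_reparam[OF mhol_Exp] open_UNIV UNIV_I mt
    cdiff_at_linear[OF complex_linear_cscale bounded_linear_cscale])
 have Z: "open Z" using mhol_open_preimage[OF F chart_openin[OF chM m(1)]] by (simp add: Z_def)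
 have cs0: "cscale 0 X = 0" by (simp add: cscale_def)
 have Z0: "0 : Z" using m mt by (simp add: Z_def cs0 act_one)
 have \<sigma>0: "\<sigma> 0 = snd c m" using mt by (simp add: \<sigma>_def cs0 act_one)
 have \<sigma>: "cdiff_at \<sigma> z" if "z : Z" for z
  unfolding \<sigma>_def[abs_def] by (rule mhol_cdiff[OF F m(1)]) (use that in "auto simp: Z_def")
 have \<sigma>im: "\<sigma> z : chart_image c" if "z : Z" for z
  using that chart_mem_image[OF chM m(1)] by (simp add: \<sigma>_def Z_def)
 define a where "a z = dA c (\<sigma> z)" for z
 have a: "cdiff_at a z" if "z : Z" for z
  unfolding a_def[abs_def] by (rule cdiff_at_compose[OF \<sigma>[OF that] dA_cdiff[OF m(1) \<sigma>im[OF that]]])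
 have a0: "a 0 ~= 0" using pos Hf_pos_iff[OF m] by (simp add: a_def \<sigma>0)
 \<comment> \<open>Normalized to Q 0 = 1, so that near 0 it stays in the right half plane, where the
   principal logarithm is holomorphic. The real part of that logarithm is log |det A| up to a
   constant.\<close>
 define Q where "Q z = a z / a 0" for z
 have Q: "cdiff_at Q z" if "z : Z" for z
  unfolding Q_def[abs_def] divide_inverse by (intro cdiff_at_mult a that cdiff_at_const)
 define Z' where "Z' = {z : Z. Q z : {w. 0 < Re w}}"
 have "continuous_on Z Q" by (intro cont_at_on ballI cdiff_at_isCont Q)
 hence "open (Z \<inter> Q -` {w. 0 < Re w})" using continuous_open_preimage[OF _ Z open_halfspace_Re_gt] by blast
 hence Z': "open Z'" unfolding Z'_def by (simp add: Int_def vimage_def)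
 have Z'0: "0 : Z'" using Z0 a0 by (simp add: Z'_def Q_def)
 have Z'Z: "z : Z" if "z : Z'" for z using that by (simp add: Z'_def)
 define l where "l z = Ln (Q z)" for z
 have l: "cdiff_at l z" if z: "z : Z'" for z
 proof -
  have "Q z \<notin> \<real>\<^sub>\<le>\<^sub>0" using z by (auto simp: Z'_def complex_nonpos_Reals_iff)
  hence "hasD Ln (%h. inverse (Q z) * h) (Q z)"
   using has_field_derivative_Ln[of "Q z"] by (simp add: has_field_derivative_def)
  hence "cdiff_at Ln (Q z)" by (rule cdiff_atI) (simp add: imul_complex)
  thus ?thesis unfolding l_def[abs_def] by (rule cdiff_at_compose[OF Q[OF Z'Z[OF z]]])
 qed
 have Hpos: "0 < Hf (?F z)" if z: "z : Z'" for z
 proof -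
  have "a z = Q z * a 0" "Q z ~= 0" using a0 z by (auto simp: Q_def Z'_def)
  hence "dA c (snd c (?F z)) ~= 0" using a0 by (simp add: a_def \<sigma>_def)
  thus ?thesis using Hf_pos_iff[OF m(1)] Z'Z[OF z] by (simp add: Z_def)
 qed
 have lnH: "ln (Hf (?F z)) = logdet (\<sigma> z) + 2 * Re (l z) + 2 * ln (cmod (a 0))" if z: "z : Z'" for z
 proof -
  have zZ: "z : Z" using Z'Z[OF z] .
  have Qz: "Q z ~= 0" using z by (auto simp: Z'_def)
  have az: "a z = Q z * a 0" using a0 by (simp add: Q_def)
  have "Hf (?F z) = hdet c (\<sigma> z) * (cmod (a z))\<^sup>2"
   unfolding a_def \<sigma>_def by (rule Hf_chart[OF m(1)]) (use zZ in "simp add: Z_def")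
  also have "ln ... = ln (hdet c (\<sigma> z)) + 2 * ln (cmod (a z))"
   using hdet_pos[OF m(1) \<sigma>im[OF zZ]] Qz a0 by (simp add: ln_mult ln_realpow az)
  also have "ln (cmod (a z)) = ln (cmod (Q z)) + ln (cmod (a 0))" using Qz a0 by (simp add: az norm_mult ln_mult)
  finally show ?thesis using Qz by (simp add: logdet_def hdet_def l_def)
 qed
 obtain r where r: "r > 0" "ball 0 r \<subseteq> Z'" using Z' Z'0 openE by blast
 have line: "of_real t * w : Z'" if "\<bar>t\<bar> < r" "cmod w = 1" for t w
 proof -
  have "of_real t * w : ball 0 r" using that by (simp add: norm_mult)
  thus ?thesis using r by blast
 qed
 define s1 where "s1 z = fd \<sigma> z 1" for z
 define l1 where "l1 z = fd l z 1" for z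
 have s1: "cdiff_at s1 0" unfolding s1_def[abs_def] by (rule cdiff_frechet[OF Z \<sigma> Z0])
 have l1: "cdiff_at l1 0" unfolding l1_def[abs_def] by (rule cdiff_frechet_complex[OF Z' l Z'0])
 define s2 where "s2 = fd s1 0 1"
 define l2 where "l2 = fd l1 0 1"
 have dv: "((%t. cscale w (u (of_real t * w))) has_vector_derivative cscale (w * w) (fd u 0 1)) (at 0)"
  if u: "cdiff_at u 0" for u :: "complex => 'z::complex_model" and w
 proof -
  have "bounded_linear (%x::'z. cscale w x)"
   unfolding cscale_def by (intro bounded_linear_add bounded_linear_const_scaleR bounded_linear_ident bounded_linear_imul)
  from bounded_linear.has_vector_derivative[OF this holomorphic_line[of u 0 w]] u
  show ?thesis by (simp add: cscale_cscale)
 qed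
 define D where "D w t = fd logdet (\<sigma> (of_real t * w)) (cscale w (s1 (of_real t * w))) + 2 * Re (cscale w (l1 (of_real t * w)))" for w t
 define E where "E w = fd (%y. fd logdet y (cscale w (s1 0))) (\<sigma> 0) (cscale w (s1 0))
   + fd logdet (\<sigma> 0) (cscale (w * w) s2) + 2 * Re (cscale (w * w) l2)" for w
 have der: "hasR (%t. ln (Hf (?F (of_real t * w)))) (D w t) t"
  and der2: "hasR (D w) (E w) 0"
  if w: "cmod w = 1" and t: "\<bar>t\<bar> < r" for w t
 proof -
  have gT: "\<sigma> (of_real t * w) : chart_image c" if "\<bar>t\<bar> < r" for t
   using \<sigma>im[OF Z'Z[OF line[OF that w]]] .
  have g1: "((%t. \<sigma> (of_real t * w)) has_vector_derivative cscale w (s1 (of_real t * w))) (at t)" if "\<bar>t\<bar> < r" for t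
   unfolding s1_def by (rule holomorphic_line[OF \<sigma>[OF Z'Z[OF line[OF that w]]]])
  have g2: "((%t. cscale w (s1 (of_real t * w))) has_vector_derivative cscale (w * w) s2) (at 0)"
   unfolding s2_def by (rule dv[OF s1])
  have G1: "hasR (%t. logdet (\<sigma> (of_real t * w))) (fd logdet (\<sigma> (of_real t * w)) (cscale w (s1 (of_real t * w)))) t"
   by (rule gamma_second_derivative(1)[OF opS smooth_logdet r(1) _ _ g2 t]) (rule gT g1; assumption)+
  have G2: "hasR (%t. fd logdet (\<sigma> (of_real t * w)) (cscale w (s1 (of_real t * w)))) (fd (%y. fd logdet y (cscale w (s1 (of_real 0 * w)))) (\<sigma> (of_real 0 * w)) (cscale w (s1 (of_real 0 * w)))
     + fd logdet (\<sigma> (of_real 0 * w)) (cscale (w * w) s2)) 0"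
   by (rule gamma_second_derivative(2)[OF opS smooth_logdet r(1) _ _ g2]) (rule gT g1; assumption)+
  have h1: "((%t. l (of_real t * w)) has_vector_derivative cscale w (l1 (of_real t * w))) (at t)"
   unfolding l1_def by (rule holomorphic_line[OF l[OF line[OF t w]]])
  have h2: "((%t. cscale w (l1 (of_real t * w))) has_vector_derivative cscale (w * w) l2) (at 0)"
   unfolding l2_def by (rule dv[OF l1])
  have Re: "hasR (%t. 2 * Re (f t)) (2 * Re f') t" if "(f has_vector_derivative f') (at t)" for f f' t
   using bounded_linear.has_vector_derivative[OF bounded_linear_Re that]
   by (intro DERIV_cmult) (simp add: has_real_derivative_iff_has_vector_derivative)
  have "hasR (%t. logdet (\<sigma> (of_real t * w)) + 2 * Re (l (of_real t * w)) + 2 * ln (cmod (a 0))) (D w t + 0) t"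
   unfolding D_def by (intro DERIV_add DERIV_const G1 Re h1)
  hence "hasD (%t. logdet (\<sigma> (of_real t * w)) + 2 * Re (l (of_real t * w)) + 2 * ln (cmod (a 0))) ((*) (D w t)) t"
   by (simp add: has_field_derivative_def)
  hence "hasD (%t. ln (Hf (?F (of_real t * w)))) ((*) (D w t)) t"
   by (rule hasD_transform[of _ _ _ _ "{-r<..<r}"]) (use t in "auto intro!: lnH[symmetric] line w")
  thus "hasR (%t. ln (Hf (?F (of_real t * w)))) (D w t) t" by (simp add: has_field_derivative_def)
  from DERIV_add[OF G2 Re[OF h2]]
  show "hasR (D w) (E w) 0" by (simp add: D_def[abs_def] E_def)
 qed
 have s10: "s1 0 = v"
 proof -
  have "((%t. \<sigma> (of_real t * 1)) has_vector_derivative cscale 1 (s1 (of_real 0 * 1))) (at 0)"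
   unfolding s1_def by (rule holomorphic_line) (use \<sigma>[OF Z0] in simp)
  hence "((%t. snd c (act m (Exp (t *R X)))) has_vector_derivative s1 0) (at 0)"
   by (simp add: \<sigma>_def cscale_def)
  moreover have "((%t. snd c (act m (Exp (t *R X)))) has_vector_derivative v) (at 0)"
   unfolding v_def using act_tang[OF m tang_Exp] by (simp add: has_vector_derivative_def)
  ultimately show ?thesis by (rule vector_derivative_unique_at)
 qed
 \<comment> \<open>Terms with a holomorphic second derivative carry the factor w^2. It is 1 for w =
   1 and -1 for w = i, so they cancel in the sum.\<close>
 have neg: "cscale (\<i> * \<i>) x = - x" for x :: "'z::complex_model" by (simp add: cscale_def)
 have lin: "linear (fd logdet (\<sigma> 0))"
  unfolding fd_eqI[OF logdet_derivative[OF \<sigma>im[OF Z0]]]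
  by (rule has_derivative_linear[OF logdet_derivative[OF \<sigma>im[OF Z0]]])
 have sum: "E 1 + E \<i> = - (ricci (g c) (snd c m) v v + ricci (g c) (snd c m) (imul v) (imul v))"
  using ricci_logdet[OF \<sigma>im[OF Z0], of v]
  unfolding E_def neg s10 by (simp add: linear_neg[OF lin[unfolded \<sigma>0]] cscale_def \<sigma>0)
 show thesis
 proof (rule that[of r "D 1" "D \<i>" "E 1" "E \<i>"])
  show "hasR (%t. ln (Hf (act m (Exp (t *R X))))) (D 1 t) t" if "\<bar>t\<bar> < r" for t
   using der[of 1 t] that by (simp add: cscale_def)
  show "hasR (%t. ln (Hf (act m (Exp (t *R imul X))))) (D \<i> t) t" if "\<bar>t\<bar> < r" for t
   using der[of \<i> t] that by (simp add: cscale_def)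
  show "0 < Hf (act m (Exp (t *R X))) & 0 < Hf (act m (Exp (t *R imul X)))" if "\<bar>t\<bar> < r" for t
   using Hpos[OF line[of t 1]] Hpos[OF line[of t \<i>]] that by (simp add: cscale_def)
 qed (use r der2[of _ 0] sum in auto)
qed

theorem not_ricci_negative:
 assumes cpt: "compact_space (mtop M)" and p: "p : pts M" "0 < Hf p"
 shows "~ ricci_negative M g"
proof
 assume neg: "ricci_negative M g"
 obtain m where m: "m : pts M" "!!x. x : pts M ==> Hf x <= Hf m"
  using Hf_max[OF cpt] p by blast
 have pos: "0 < Hf m" using m(2)[OF p(1)] p(2) by simp
 obtain c where c: "c : atlas M" "m : fst c" using charted_chart_at[OF chM m(1)] by blast
 have y: "snd c m : chart_image c" by (rule chart_mem_image[OF chM c])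
 define X :: "complex ^ 'n" where "X = (\<chi> i. 1)"
 define v where "v = Am c (snd c m) X"
 have "X ~= 0" by (simp add: X_def vec_eq_iff)
 hence v0: "v ~= 0"
  using pos Hf_pos_iff[OF c] complex_linear_det_inj[OF Am_linear[OF c(1) y]] by (auto simp: v_def dA_def)
 have iv0: "imul v ~= 0" using v0 norm_imul[of v] by (metis norm_eq_zero)
 obtain \<delta> d1 d2 e1 e2 where s: "0 < (\<delta>::real)"
  "!!t. \<bar>t\<bar> < \<delta> ==> hasR (%t. ln (Hf (act m (Exp (t *R X))))) (d1 t) t"
  "!!t. \<bar>t\<bar> < \<delta> ==> hasR (%t. ln (Hf (act m (Exp (t *R imul X))))) (d2 t) t"
  "!!t. \<bar>t\<bar> < \<delta> ==> 0 < Hf (act m (Exp (t *R X))) & 0 < Hf (act m (Exp (t *R imul X)))"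
  "hasR d1 e1 0" "hasR d2 e2 0"
  "e1 + e2 = - (ricci (g c) (snd c m) v v + ricci (g c) (snd c m) (imul v) (imul v))"
  by (rule second_variation[OF c pos v_def]) blast
 have le: "ln (Hf (act m (Exp Y))) <= ln (Hf m)" if "0 < Hf (act m (Exp Y))" for Y
  using that m(2)[OF act_closed[OF m(1) Exp_carrier[of Y]]] pos by simp
 have "e1 <= 0"
  by (rule second_derivative_le_zero_at_max[OF s(1,2,5)]) (use le s(4) m in \<open>auto simp: act_one\<close>)
 moreover have "e2 <= 0"
  by (rule second_derivative_le_zero_at_max[OF s(1,3,6)]) (use le s(4) m in \<open>auto simp: act_one\<close>)
 moreover have "ricci (g c) (snd c m) v v < 0" "ricci (g c) (snd c m) (imul v) (imul v) < 0"
  using neg c y v0 iv0 by (auto simp: ricci_negative_def)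
 ultimately show False using s(7) by linarith
qed

end

section \<open>Orbits of the compact real form\<close>

locale creal = clg K N for K :: "'k monoid" and N :: "('k, complex ^ 'n) cmfd" +
 fixes G :: "'k set"
 assumes subG: "subgroup G K" and cptG: "compactin (mtop N) G"
  and subspace_lie: "subspace (lie_algebra K N G)"
  and lie_decomp: "!!Z. EX! (X, Y). X : lie_algebra K N G & Y : lie_algebra K N G & Z = X + imul Y"
  and polar_inj: "!!X X' x x'. X : lie_algebra K N G ==> X' : lie_algebra K N G ==> x : G ==> x' : G ==>
   Exp (imul X) \<odot> x = Exp (imul X') \<odot> x' ==> X = X' & x = x'"
  and polar_surj: "!!k. k : carrier K ==> EX X:lie_algebra K N G. EX x:G. k = Exp (imul X) \<odot> x"
begin

abbreviation \<gg> where "\<gg> \<equiv> lie_algebra K N G"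

lemma G_carrier: "x : G ==> x : carrier K" using subgroup.mem_carrier[OF subG] .

lemma Exp_G: "X : \<gg> ==> Exp (t *R X) : G" and Exp_G1: "X : \<gg> ==> Exp X : G"
 using lie_algebra_iff[of X G] by (auto dest: spec[of _ 1])

text \<open>Real and imaginary parts with respect to the splitting of the complex Lie algebra into
  the Lie algebra of G and i times it.\<close>

definition reim where "reim Z = (THE p. fst p : \<gg> & snd p : \<gg> & Z = fst p + imul (snd p))"
definition rep where "rep Z = fst (reim Z)"
definition imp where "imp Z = snd (reim Z)"

lemma rep_imp: "rep Z : \<gg>" "imp Z : \<gg>" "Z = rep Z + imul (imp Z)"
 and rep_imp_eq: "X : \<gg> ==> Y : \<gg> ==> rep (X + imul Y) = X & imp (X + imul Y) = Y"
proof -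
 have ex1: "EX! p. fst p : \<gg> & snd p : \<gg> & Z = fst p + imul (snd p)" for Z
  using lie_decomp[of Z] unfolding case_prod_unfold .
 from theI'[OF ex1] show "rep Z : \<gg>" "imp Z : \<gg>" "Z = rep Z + imul (imp Z)"
  unfolding rep_def imp_def reim_def by auto
 assume "X : \<gg>" "Y : \<gg>"
 hence "reim (X + imul Y) = (X, Y)" unfolding reim_def by (intro the1_equality[OF ex1]) simp
 thus "rep (X + imul Y) = X & imp (X + imul Y) = Y" by (simp add: rep_def imp_def)
qed

lemma linear_rep: "linear rep" and linear_imp: "linear imp"
proof -
 have 1: "rep (Z + W) = rep Z + rep W & imp (Z + W) = imp Z + imp W" for Z W
 proof -
  have "Z + W = (rep Z + rep W) + imul (imp Z + imp W)"
  proof -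
   have "rep Z + rep W + imul (imp Z + imp W) = (rep Z + imul (imp Z)) + (rep W + imul (imp W))"
    by (simp add: imul_add)
   also have "... = Z + W" by (simp only: rep_imp(3)[symmetric])
   finally show ?thesis ..
  qed
  thus ?thesis
   using rep_imp_eq[of "rep Z + rep W" "imp Z + imp W"] rep_imp(1,2) subspace_add[OF subspace_lie] by metis
 qed
 have 2: "rep (r *R Z) = r *R rep Z & imp (r *R Z) = r *R imp Z" for r Z
 proof -
  have "r *R Z = r *R rep Z + imul (r *R imp Z)"
   using arg_cong[OF rep_imp(3)[of Z], of "%x. r *R x"] by (simp add: imul_scaleR scaleR_add_right)
  thus ?thesis
   using rep_imp_eq[of "r *R rep Z" "r *R imp Z"] rep_imp(1,2) subspace_scale[OF subspace_lie] by metis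
 qed
 show "linear rep" "linear imp" using 1 2 by (auto intro!: linearI)
qed

lemma imp_zero_iff: "imp Z = 0 \<longleftrightarrow> Z : \<gg>"
 using rep_imp[of Z] rep_imp_eq[of Z 0] subspace_0[OF subspace_lie] by auto

lemma rep_lie: "Z : \<gg> ==> rep Z = Z"
 using rep_imp_eq[of Z 0] subspace_0[OF subspace_lie] by auto

lemma lie_independent: "X : \<gg> ==> Y : \<gg> ==> X + imul Y = 0 ==> X = 0 & Y = 0"
 using rep_imp_eq[of X Y] rep_imp_eq[of 0 0] subspace_0[OF subspace_lie] by auto

text \<open>Multiplication by i maps the real Lie algebra isomorphically onto a complement, so it
  has half of the real dimension 2n.\<close>

lemma dim_lie: "dim \<gg> = CARD('n)"
proof -
 let ?I = "imul ` \<gg>"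
 have sI: "subspace ?I" by (rule linear_subspace_image[OF linear_imul subspace_lie])
 have inj: "inj_on imul \<gg>" by (rule inj_onI) (metis imul_imul neg_equal_iff_equal)
 have dI: "dim ?I = dim \<gg>"
  by (rule dim_image_eq[OF linear_imul]) (use inj in "simp add: span_eq_iff[THEN iffD2, OF subspace_lie]")
 have "\<gg> \<inter> ?I = {0}"
 proof -
  have "x = 0" if "x : \<gg>" "x = imul y" "y : \<gg>" for x y
   using lie_independent[of x "- y"] that subspace_neg[OF subspace_lie] by (simp add: imul_minus)
  thus ?thesis using subspace_0[OF subspace_lie] subspace_0[OF sI] by auto
 qed
 moreover have "{x + y |x y. x : \<gg> & y : ?I} = UNIV" using rep_imp by blast
 ultimately have "dim \<gg> + dim ?I = dim (UNIV :: (complex ^ 'n) set)"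
  using dim_sums_Int[OF subspace_lie sI] by simp
 thus ?thesis using dI by (simp add: dim_UNIV)
qed

text \<open>A fixed real frame of the Lie algebra of G. In it the invariant volume of an orbit is
  the determinant of a real matrix.\<close>

definition lb where "lb = (SOME l :: real ^ 'n => complex ^ 'n. linear l & inj l & range l = \<gg>)"

lemma lb: "linear lb" "inj lb" "range lb = \<gg>"
proof -
 obtain f g where "linear f" "f ` (UNIV :: (real ^ 'n) set) = \<gg>" "inj f"
 proof (rule isometries_subspaces[OF subspace_UNIV[where 'a="real ^ 'n"] subspace_lie])
  show "dim (UNIV :: (real ^ 'n) set) = dim \<gg>" by (simp add: dim_lie dim_UNIV)
  fix f g assume f: "linear (f :: real ^ 'n => complex ^ 'n)" "f ` UNIV = \<gg>" "!!x. x : UNIV ==> norm (f x) = norm x"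
  have "inj f" using f(3) linear_injective_0[OF f(1)] by (metis UNIV_I norm_eq_zero)
  with f(1,2) show thesis using that by blast
 qed
 hence "EX l :: real ^ 'n => complex ^ 'n. linear l & inj l & range l = \<gg>" by blast
 from someI_ex[OF this] show "linear lb" "inj lb" "range lb = \<gg>" unfolding lb_def by auto
qed

lemma lb_lie [simp]: "lb a : \<gg>" using lb(3) by blast

text \<open>The inverse of \<open>lb\<close> preceded by the projection \<open>rep\<close>, hence
  linear on the whole complex Lie algebra. Applied to a variation field it gives the components of
  its real part, the part tangent to the orbit.\<close>

definition lbi where "lbi Z = inv_into UNIV lb (rep Z)"

lemma lbi: "lbi (lb a) = a" "Z : \<gg> ==> lb (lbi Z) = Z" "linear lbi"
proof -
 show 1: "lbi (lb a) = a" for a by (simp add: lbi_def rep_lie inv_f_f lb)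
 have 2: "lb (inv_into UNIV lb Z) = Z" if "Z : \<gg>" for Z using that lb(3) by (simp add: f_inv_into_f)
 thus "Z : \<gg> ==> lb (lbi Z) = Z" by (simp add: lbi_def rep_lie)
 have L: "lb (lbi Z) = rep Z" for Z by (simp add: lbi_def 2 rep_imp(1))
 have "lbi (x + y) = lbi x + lbi y" for x y
  by (rule injD[OF lb(2)]) (simp add: L linear_add[OF lb(1)] linear_add[OF linear_rep])
 moreover have "lbi (r *R x) = r *R lbi x" for x r
  by (rule injD[OF lb(2)]) (simp add: L linear_scale[OF lb(1)] linear_scale[OF linear_rep])
 ultimately show "linear lbi" by (intro linearI) auto
qed

lemma Ad_lie: "x : G ==> X : \<gg> ==> Ad x X : \<gg>"
 by (rule tang_subgroup[OF subG cptG tang_conj[OF G_carrier tang_Exp]])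
  (auto intro!: always_eventually subgroup.m_closed[OF subG] subgroup.m_inv_closed[OF subG] Exp_G)

end

lemma inj_derivative_of_left_inverse:
 fixes f :: "'a::real_normed_vector => 'b::real_normed_vector" and h :: "'b => 'a"
 assumes "hasD f D x" "hasD h D' (f x)" "\<forall>\<^sub>F y in nhds x. h (f y) = y"
 shows "D' (D v) = v" "inj D"
proof -
 have "hasD (%y. h (f y)) (%v. D' (D v)) x" using hasD_chain[OF assms(1,2)] by (simp add: o_def)
 from has_derivative_unique[OF has_derivative_cong_nhds[OF this assms(3)] has_derivative_ident]
 have *: "D' (D v) = v" for v by (rule fun_cong)
 thus "D' (D v) = v" .
 show "inj D" by (rule injI) (metis *)
qed

locale corb = creal K N G + kact K N M act
 for K :: "'k monoid" and N :: "('k, complex ^ 'n) cmfd" and G :: "'k set"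
  and M :: "('m, complex ^ 'n) cmfd" and act :: "'m => 'k => 'm"
begin

definition fin_stab where "fin_stab q \<longleftrightarrow> q : pts M & finite {k : carrier K. act q k = q}"

lemma fin_stab_act:
 assumes q: "fin_stab q" and k: "k : carrier K" shows "fin_stab (act q k)"
proof -
 have qt: "q : pts M" using q by (simp add: fin_stab_def)
 have "{l : carrier K. act (act q k) l = act q k} \<subseteq> (%l. kinv k \<odot> l \<odot> k) ` {l : carrier K. act q l = q}"
 proof
  fix l assume l: "l : {l : carrier K. act (act q k) l = act q k}"
  have lK: "l : carrier K" using l by blast
  have "act q (k \<odot> l \<odot> kinv k) = act (act (act q k) l) (kinv k)" using lK k qt by (simp add: act_act act_closed)
  also have "act (act q k) l = act q k" using l by simp
  also have "act (act q k) (kinv k) = q" using k qt by (simp add: act_act act_one)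
  finally have "k \<odot> l \<odot> kinv k : {l : carrier K. act q l = q}" using l k by simp
  moreover have "l = kinv k \<odot> (k \<odot> l \<odot> kinv k) \<odot> k" using l k by (simp add: m_assoc) (simp add: m_assoc[symmetric])
  ultimately show "l : (%l. kinv k \<odot> l \<odot> k) ` {l : carrier K. act q l = q}" by blast
 qed
 thus ?thesis using q k by (auto simp: fin_stab_def act_closed intro: finite_subset)
qed

lemma Am_inj': "fin_stab q ==> c : atlas M ==> q : fst c ==> Am c (snd c q) X = 0 ==> X = 0"
 using Am_inj unfolding fin_stab_def by blast

lemma dA_nz: "fin_stab q ==> c : atlas M ==> q : fst c ==> dA c (snd c q) ~= 0"
 unfolding dA_def using complex_linear_det_inj[OF Am_linear[OF _ chart_mem_image[OF chM]]] Am_inj' by blast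

text \<open>Near \<open>q\<close> these are coordinates in which the orbit \<open>q G\<close> is \<open>imp Z = 0\<close>.\<close>

definition \<Theta> where "\<Theta> q Z = act q (Exp (imul (imp Z)) \<odot> Exp (rep Z))"

lemma \<Theta>_lie: "Y : \<gg> ==> \<Theta> q Y = act q (Exp Y)"
 using imp_zero_iff[of Y] by (simp add: \<Theta>_def rep_lie)

lemma \<Theta>_mhol: "q : pts M ==> mhol M UNIV (%p. act q (Exp (fst p) \<odot> Exp (snd p)))"
 by (intro mhol_act mhol_const mhol_kmul mhol_reparam[OF mhol_Exp] cdiff_at_fst cdiff_at_snd) auto

text \<open>The inverse function theorem makes \<Theta> a coordinate system; the point is that
  nearby points of the orbit have imp Z = 0. If \<Theta> q Z lies on the orbit, then exp (i imp Z) y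
  fixes q for some y in G. Finite isotropy leaves finitely many such imp Z, and the nonzero ones are
  avoided by shrinking the neighbourhood.\<close>

lemma local_structure:
 assumes q: "fin_stab q" and c: "c : atlas M" "q : fst c"
 obtains U V h h' where "open U" "0 : U" "open V" "V \<subseteq> chart_image c" "!!Z. Z : U ==> \<Theta> q Z : fst c"
  "homeomorphism U V (%Z. snd c (\<Theta> q Z)) h" "!!y. y : V ==> hasD h (h' y) y"
  "!!Z. Z : U ==> \<Theta> q Z : act q ` G ==> Z : \<gg>"
  "hasD (%Z. snd c (\<Theta> q Z)) (Am c (snd c q)) 0"
proof -
 have qt: "q : pts M" using q by (simp add: fin_stab_def)
 let ?P = "%p. act q (Exp (fst p) \<odot> Exp (snd p))"
 let ?l = "%Z. (imul (imp Z), rep Z)"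
 let ?\<theta> = "%Z. snd c (\<Theta> q Z)"
 have lin: "bounded_linear ?l" by (intro bounded_linear_Pair linear_conv_bounded_linear[THEN iffD1] linear_rep
    linear_compose[OF linear_imp linear_imul, unfolded o_def])
 define T where "T = {p : UNIV. ?P p : fst c}"
 have T: "open T" unfolding T_def by (rule mhol_open_preimage[OF \<Theta>_mhol[OF qt] chart_openin[OF chM c(1)]])
 have cd: "cdiff_at (%p. snd c (?P p)) p" if "p : T" for p
  by (rule mhol_cdiff[OF \<Theta>_mhol[OF qt] c(1)]) (use that in "auto simp: T_def")
 \<comment> \<open>Each X is sent to a chosen isotropy element with polar part exp (iX). Uniqueness
   of the polar decomposition makes this injective, so finiteness carries over.\<close>
 have stab: "finite (fst ` reim ` {}) & finite {X : \<gg>. EX x:G. act q (Exp (imul X) \<odot> x) = q}"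
 proof -
  have "inj_on (%X. SOME k. EX x:G. k = Exp (imul X) \<odot> x & act q k = q) {X : \<gg>. EX x:G. act q (Exp (imul X) \<odot> x) = q}"
  proof (rule inj_onI)
   let ?k = "%X. SOME k. EX x:G. k = Exp (imul X) \<odot> x & act q k = q"
   have k: "EX x:G. ?k X = Exp (imul X) \<odot> x & act q (?k X) = q" if "X : {X : \<gg>. EX x:G. act q (Exp (imul X) \<odot> x) = q}" for X
    by (rule someI_ex) (use that in blast)
   fix X Y assume X: "X : {X : \<gg>. EX x:G. act q (Exp (imul X) \<odot> x) = q}" and Y: "Y : {X : \<gg>. EX x:G. act q (Exp (imul X) \<odot> x) = q}"
    and eq: "?k X = ?k Y"
   obtain x y where "x : G" "y : G" "Exp (imul X) \<odot> x = Exp (imul Y) \<odot> y" using k[OF X] k[OF Y] eq by metis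
   thus "X = Y" using polar_inj X Y by blast
  qed
  moreover have "(%X. SOME k. EX x:G. k = Exp (imul X) \<odot> x & act q k = q) ` {X : \<gg>. EX x:G. act q (Exp (imul X) \<odot> x) = q} \<subseteq> {k : carrier K. act q k = q}"
  proof (rule image_subsetI)
   fix X assume X: "X : {X : \<gg>. EX x:G. act q (Exp (imul X) \<odot> x) = q}"
   have "EX x:G. (SOME k. EX x:G. k = Exp (imul X) \<odot> x & act q k = q) = Exp (imul X) \<odot> x & act q (SOME k. EX x:G. k = Exp (imul X) \<odot> x & act q k = q) = q"
    by (rule someI_ex) (use X in blast)
   thus "(SOME k. EX x:G. k = Exp (imul X) \<odot> x & act q k = q) : {k : carrier K. act q k = q}"
    using G_carrier by auto
  qed
  ultimately show ?thesis using q finite_imageD finite_subset unfolding fin_stab_def by (metis (no_types, lifting) finite.emptyI image_empty)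
 qed
 define B where "B = {X : \<gg>. EX x:G. act q (Exp (imul X) \<odot> x) = q} - {0}"
 have finB: "finite B" using stab by (simp add: B_def)
 \<comment> \<open>Removing the finite set B is what keeps other sheets of the orbit away: on U0 an
   imaginary part that occurs in the isotropy group must be 0.\<close>
 define U0 where "U0 = {Z. ?l Z : T} \<inter> {Z. imp Z : - B}"
 have ci: "continuous_on UNIV imp" by (intro linear_continuous_on linear_conv_bounded_linear[THEN iffD1] linear_imp)
 have "open (- B)" by (rule open_Compl[OF finite_imp_closed[OF finB]])
 hence o2: "open (imp -` (- B))" by (rule open_vimage[OF _ ci])
 have "open (?l -` T)" by (rule open_vimage[OF T linear_continuous_on[OF lin]])
 hence U0: "open U0" using o2 by (auto simp: U0_def vimage_def intro: open_Int)
 have l0: "?l 0 = (0, 0)" using linear_0[OF linear_imp] linear_0[OF linear_rep] by simp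
 have U00: "0 : U0" using c qt linear_0[OF linear_imp] linear_0[OF linear_rep] by (simp add: U0_def T_def act_one B_def)
 have dP: "hasD (%p. snd c (?P p)) (fd (%p. snd c (?P p)) p) p" if "p : T" for p
  by (rule cdiff_fd(1)[OF cd[OF that]])
 define D where "D Z v = fd (%p. snd c (?P p)) (?l Z) (?l v)" for Z v
 have d\<theta>: "hasD ?\<theta> (D Z) Z" if "Z : U0" for Z
 proof -
  have "?l Z : T" using that by (simp add: U0_def)
  from hasD_chain[OF blin_hasD[OF lin] dP[OF this]]
  show ?thesis by (simp add: o_def D_def[abs_def] \<Theta>_def)
 qed
 have cdP: "cont_diff 1 T (%p. snd c (?P p))" using cdiff_smooth[OF T cd] unfolding smooth_on_def by blast
 have bl: "bounded_linear (D Z)" if "Z : U0" for Z using d\<theta>[OF that] has_derivative_bounded_linear by blast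
 have contD: "continuous_on U0 (%Z. Blinfun (D Z))"
 proof (rule continuous_on_blinfun_componentwise)
  fix b :: "complex ^ 'n"
  have "continuous_on U0 (%Z. D Z b)" unfolding D_def
   by (rule continuous_on_frechet2[OF cdP]) (auto simp: U0_def intro: linear_continuous_on[OF lin] continuous_on_const)
  thus "continuous_on U0 (%Z. blinfun_apply (Blinfun (D Z)) b)"
   by (rule continuous_on_eq) (simp add: bounded_linear_Blinfun_apply[OF bl])
 qed
 \<comment> \<open>The product of exponentials in \<Theta> (tv) has velocity i imp v + rep v =
   v.\<close>
 have D0: "D 0 v = Am c (snd c q) v" for v
 proof -
  have t: "tang (%t. Exp (t *R imul (imp v)) \<odot> Exp (t *R rep v)) (imul (imp v) + rep v)"
   by (intro tang_mult tang_Exp)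
  have "hasD (%t. t *R v) (%t. t *R v) 0"
   by (rule blin_hasD[OF bounded_linear_scaleR_left])
  moreover have "hasD ?\<theta> (D 0) (0 *R v)" using d\<theta>[OF U00] by simp
  ultimately have "hasD (%t. ?\<theta> (t *R v)) (%t. D 0 (t *R v)) 0"
   using hasD_chain[of "%t. t *R v"] by (fastforce simp: o_def)
  moreover have "?\<theta> (t *R v) = snd c (act q (Exp (t *R imul (imp v)) \<odot> Exp (t *R rep v)))" for t
   by (simp add: \<Theta>_def linear_scale[OF linear_imp] linear_scale[OF linear_rep] imul_scaleR)
  ultimately have "(%t. D 0 (t *R v)) = (%t. t *R Am c (snd c q) (imul (imp v) + rep v))"
   using has_derivative_unique act_tang[OF c t] by simp
  hence "D 0 (1 *R v) = 1 *R Am c (snd c q) (imul (imp v) + rep v)" by (rule fun_cong)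
  thus ?thesis using rep_imp(3)[of v] by (simp add: add.commute)
 qed
 have cl: "complex_linear (Am c (snd c q))" by (rule Am_linear[OF c(1) chart_mem_image[OF chM c]])
 have bij: "bij (D 0)" using complex_linear_bij[OF cl Am_inj'[OF q c]] by (simp add: D0[abs_def])
 have "linear (inv_into UNIV (D 0))"
  by (rule inj_linear_imp_inv_linear) (use bij bl[OF U00] in "auto simp: bij_def bounded_linear.linear")
 hence bi: "bounded_linear (inv_into UNIV (D 0))" by (rule linear_conv_bounded_linear[THEN iffD1])
 obtain U V h h' where UV: "open U" "U \<subseteq> U0" "0 : U" "open V" "?\<theta> 0 : V" "homeomorphism U V ?\<theta> h"
  "!!y. y : V ==> hasD h (h' y) y"
 proof (rule inverse_function_theorem[OF U0 _ contD U00])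
  show "hasD ?\<theta> (blinfun_apply (Blinfun (D Z))) Z" if "Z : U0" for Z
   using d\<theta>[OF that] by (simp add: bounded_linear_Blinfun_apply[OF bl[OF that]])
  show "Blinfun (inv_into UNIV (D 0)) o\<^sub>L Blinfun (D 0) = id_blinfun"
   by (rule blinfun_eqI) (use bij in "simp add: bounded_linear_Blinfun_apply bl[OF U00] bi bij_def inv_f_f")
 qed blast
 have inc: "\<Theta> q Z : fst c" if "Z : U" for Z using UV(2) that by (auto simp: U0_def T_def \<Theta>_def)
 show thesis
 proof (rule that[OF UV(1,3,4) _ inc UV(6,7)])
  show "V \<subseteq> chart_image c" using UV(6) inc chart_mem_image[OF chM c(1)] by (auto simp: homeomorphism_def)
  show "Z : \<gg>" if Z: "Z : U" "\<Theta> q Z : act q ` G" for Z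
  proof -
   obtain x where x: "x : G" "act q (Exp (imul (imp Z)) \<odot> Exp (rep Z)) = act q x" using Z by (auto simp: \<Theta>_def)
   have xK: "x : carrier K" "kinv x : carrier K" using G_carrier[OF x(1)] by auto
   have "act q (Exp (imul (imp Z)) \<odot> (Exp (rep Z) \<odot> kinv x)) = act (act q (Exp (imul (imp Z)) \<odot> Exp (rep Z))) (kinv x)"
    using xK qt by (simp add: act_act m_assoc)
   also have "... = q" using x(2) xK qt by (simp add: act_act act_one)
   finally have "EX x:G. act q (Exp (imul (imp Z)) \<odot> x) = q"
    using subgroup.m_closed[OF subG Exp_G1[OF rep_imp(1)] subgroup.m_inv_closed[OF subG x(1)]] by blast
   hence "imp Z : B | imp Z = 0" using rep_imp(2) by (simp add: B_def)
   moreover have "imp Z \<notin> B" using Z(1) UV(2) by (auto simp: U0_def)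
   ultimately show ?thesis using imp_zero_iff by blast
  qed
  show "hasD ?\<theta> (Am c (snd c q)) 0" using d\<theta>[OF U00] by (simp add: D0[abs_def])
 qed
qed

end

section \<open>Local parametrizations\<close>

lemma lparD:
 assumes "lpar M L U ps"
 shows "open U" "openin (subtopology (mtop M) L) (ps ` U)"
  "homeomorphic_map (top_of_set U) (subtopology (mtop M) (ps ` U)) ps"
  "c : atlas M ==> smooth_on {x : U. ps x : fst c} (%y. snd c (ps y))"
  "c : atlas M ==> x : U ==> ps x : fst c ==> inj (fd (%y. snd c (ps y)) x)"
 using assms unfolding local_param_def o_def by auto

lemma lpar_cont:
 assumes "lpar M L U ps"
 shows "continuous_map (top_of_set U) (mtop M) ps" "ps ` U \<subseteq> L" "ps ` U \<subseteq> pts M" "inj_on ps U"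
  "continuous_map (subtopology (mtop M) (ps ` U)) (top_of_set U) (inv_into U ps)"
proof -
 note h = lparD(3)[OF assms]
 show "continuous_map (top_of_set U) (mtop M) ps"
  using homeomorphic_imp_continuous_map[OF h] by (simp add: cm_in_sub)
 thus sub: "ps ` U \<subseteq> pts M" by (auto simp: continuous_map_def)
 show "ps ` U \<subseteq> L" using openin_subset[OF lparD(2)[OF assms]] by auto
 show inj: "inj_on ps U" using homeomorphic_imp_injective_map[OF h] by simp
 obtain k where k: "homeomorphic_maps (top_of_set U) (subtopology (mtop M) (ps ` U)) ps k"
  using h homeomorphic_map_maps by metis
 have "k x = inv_into U ps x" if "x : ps ` U" for x
  using that k inj by (auto simp: homeomorphic_maps_def)
 moreover have "continuous_map (subtopology (mtop M) (ps ` U)) (top_of_set U) k"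
  using k by (simp add: homeomorphic_maps_def)
 ultimately show "continuous_map (subtopology (mtop M) (ps ` U)) (top_of_set U) (inv_into U ps)"
  by (rule continuous_map_eq[rotated]) auto
qed

lemma local_param_derivative:
 assumes "lpar M L U ps" "c : atlas M" "x : U" "ps x : fst c"
 shows "hasD (%y. snd c (ps y)) (fd (%y. snd c (ps y)) x) x"
 by (rule smooth_hasD[OF lparD(4)[OF assms(1,2)]]) (use assms in simp)

text \<open>The inverse of a parametrization is only known to be continuous. A linear left inverse
  of the differential turns the parametrization in a chart into a map between spaces of equal
  dimension; the inverse function theorem then writes the lift as k (Lf (u x)) in the chart.\<close>

lemma param_lift:
 fixes M :: "('m, complex ^ 'n) cmfd" and u :: "'a::real_normed_vector => 'm" and ps :: "real ^ 'n => 'm"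
 assumes M: "charted M" and ps: "lpar M L U ps"
  and u: "open S" "x0 : S" "continuous_map (top_of_set S) (mtop M) u" "u ` S \<subseteq> ps ` U"
  and c: "c : atlas M" "u x0 : fst c" and P: "hasD (%x. snd c (u x)) P x0"
 obtains Q where "hasD (%x. inv_into U ps (u x)) Q x0"
  "!!v. fd (%y. snd c (ps y)) (inv_into U ps (u x0)) (Q v) = P v"
proof -
 let ?\<tau> = "%x. inv_into U ps (u x)" and ?\<phi> = "%y. snd c (ps y)"
 define y0 where "y0 = ?\<tau> x0"
 have \<tau>: "?\<tau> x : U" "ps (?\<tau> x) = u x" if "x : S" for x
 proof -
  have "u x : ps ` U" using u(4) that by blast
  thus "?\<tau> x : U" "ps (?\<tau> x) = u x" by (rule inv_into_into, rule f_inv_into_f)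
 qed
 have y0: "y0 : U" "ps y0 = u x0" using \<tau>[OF u(2)] by (auto simp: y0_def)
 define U1 where "U1 = {y : U. ps y : fst c}"
 have U1: "open U1"
  unfolding U1_def by (rule open_preimage[OF lpar_cont(1)[OF ps] lparD(1)[OF ps] chart_openin[OF M c(1)]])
 have y01: "y0 : U1" using y0 c by (simp add: U1_def)
 have sm: "smooth_on U1 ?\<phi>" unfolding U1_def by (rule lparD(4)[OF ps c(1)])
 let ?D = "%y. fd ?\<phi> y"
 have D: "hasD ?\<phi> (?D y) y" if "y : U1" for y by (rule smooth_hasD[OF sm that])
 \<comment> \<open>A linear left inverse at the single point y0; composed with the differential it
   stays invertible nearby.\<close>
 have "inj (?D y0)" using lparD(5)[OF ps c(1)] y0 c by simp
 then obtain Lf where Lf: "linear Lf" "!!v. Lf (?D y0 v) = v"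
  using linear_injective_left_inverse[OF has_derivative_linear[OF D[OF y01]]] by (metis comp_apply id_apply)
 have bLf: "bounded_linear Lf" using Lf(1) by (simp add: linear_conv_bounded_linear)
 define f where "f y = Lf (?\<phi> y)" for y
 define f' where "f' y = Blinfun (%v. Lf (?D y v))" for y
 have bl: "bounded_linear (%v. Lf (?D y v))" if "y : U1" for y
  using bounded_linear_compose[OF bLf has_derivative_bounded_linear[OF D[OF that]]] .
 have f': "blinfun_apply (f' y) = (%v. Lf (?D y v))" if "y : U1" for y
  unfolding f'_def by (rule bounded_linear_Blinfun_apply[OF bl[OF that]])
 have df: "hasD f (blinfun_apply (f' y)) y" if "y : U1" for y
  unfolding f'[OF that] f_def[abs_def] by (rule bounded_linear.has_derivative[OF bLf D[OF that]])
 have cf: "continuous_on U1 f'"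
 proof (rule continuous_on_blinfun_componentwise)
  fix b :: "real ^ 'n"
  have "continuous_on U1 (%y. Lf (?D y b))"
   by (rule bounded_linear.continuous_on[OF bLf smooth_on_continuous[OF smooth_on_frechet[OF sm]]])
  thus "continuous_on U1 (%y. blinfun_apply (f' y) b)" by (rule continuous_on_eq) (simp add: f')
 qed
 obtain U' V k k' where k: "open U'" "U' \<subseteq> U1" "y0 : U'" "open V" "f y0 : V" "homeomorphism U' V f k"
  "!!y. y : V ==> hasD k (k' y) y"
 proof (rule inverse_function_theorem[OF U1 df cf y01])
  show "id_blinfun o\<^sub>L f' y0 = id_blinfun" by (rule blinfun_eqI) (simp add: f'[OF y01] Lf(2))
 next
  fix U' V k k' assume "open U'" "U' \<subseteq> U1" "y0 : U'" "open V" "f y0 : V" "homeomorphism U' V f k"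
   "!!y. y : V ==> hasD k (k' y) y"
  thus thesis by (rule that)
 qed
 have cu: "continuous_map (top_of_set S) (subtopology (mtop M) (ps ` U)) u"
  using u(3,4) by (auto simp: cm_in_sub)
 have c\<tau>: "continuous_map (top_of_set S) (top_of_set U) ?\<tau>"
  using cm_compose[OF cu lpar_cont(5)[OF ps]] by (simp add: o_def)
 have oS: "open {x : S. ?\<tau> x : U'}"
  by (rule open_preimage[OF c\<tau> u(1)]) (use k lparD(1)[OF ps] U1_def in \<open>auto simp: openin_open_eq\<close>)
 have x0S: "x0 : {x : S. ?\<tau> x : U'}" using u(2) k(3) by (simp add: y0_def)
 have eq: "k (Lf (snd c (u x))) = ?\<tau> x" if "x : {x : S. ?\<tau> x : U'}" for x
  using k(6) that \<tau>[of x] by (auto simp: homeomorphism_def f_def)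
 have "hasD (%x. Lf (snd c (u x))) (%v. Lf (P v)) x0"
  by (rule bounded_linear.has_derivative[OF bLf P])
 moreover have "hasD k (k' (f y0)) (Lf (snd c (u x0)))" using k(7)[OF k(5)] by (simp add: f_def y0)
 ultimately have "hasD (%x. k (Lf (snd c (u x)))) (%v. k' (f y0) (Lf (P v))) x0"
  unfolding o_def by (rule hasD_chain[unfolded o_def])
 hence Q: "hasD ?\<tau> (%v. k' (f y0) (Lf (P v))) x0" (is "(_ has_derivative ?Q) _")
  by (rule hasD_transform[OF _ oS x0S eq])
 have "hasD ?\<phi> (?D y0) (?\<tau> x0)" using D[OF y01] by (simp add: y0_def)
 from hasD_chain[OF Q this]
 have "hasD (%x. snd c (ps (?\<tau> x))) (%v. ?D y0 (?Q v)) x0" by (simp add: o_def)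
 hence "hasD (%x. snd c (u x)) (%v. ?D y0 (?Q v)) x0"
  by (rule hasD_transform[OF _ u(1,2)]) (simp add: \<tau>)
 from has_derivative_unique[OF this P] have "?D y0 (?Q v) = P v" for v by (rule fun_cong)
 thus thesis using that[OF Q] by (simp add: y0_def)
qed

lemma param_lift_continuous:
 assumes ps: "lpar M L U ps" and u: "continuous_map (top_of_set S) (mtop M) u" "u ` S \<subseteq> ps ` U"
 shows "continuous_on S (%x. inv_into U ps (u x))"
proof -
 have "continuous_map (top_of_set S) (subtopology (mtop M) (ps ` U)) u"
  using u by (auto simp: cm_in_sub)
 from cm_compose[OF this lpar_cont(5)[OF ps]]
 show ?thesis by (simp add: o_def cm_in_sub)
qed

lemma local_param_image_openin:
 assumes ps: "lpar M L U ps" and W: "open W" "W \<subseteq> U"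
 shows "openin (subtopology (mtop M) L) (ps ` W)"
proof -
 have "openin (subtopology (mtop M) (ps ` U)) (ps ` W)"
  using homeomorphic_map_openness_eq[OF lparD(3)[OF ps], of W] W lparD(1)[OF ps] by (simp add: openin_open_eq)
 hence "openin (subtopology (subtopology (mtop M) L) (ps ` U)) (ps ` W)"
  using lpar_cont(2)[OF ps] by (simp add: subtopology_subtopology Int_absorb1)
 thus ?thesis using openin_trans_full lparD(2)[OF ps] by blast
qed

text \<open>Compactness gives finitely many coordinate balls whose images cover L. Numbering them
  and removing from each the images of its predecessors makes the pieces disjoint. They are Borel
  because images of closed balls are compact, hence closed.\<close>

lemma param_decomposition_exists:
 fixes M :: "('m, complex ^ 'n) cmfd"
 assumes H: "Hausdorff_space (mtop M)" and L: "compactin (mtop M) L"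
  and ex: "!!l. l : L ==> EX U ps y0. lpar M L U ps & y0 : U & ps y0 = l"
 shows "EX \<D>. param_decomposition M L \<D>"
proof -
 have "ALL l. EX U ps y0 r. l : L --> lpar M L U ps & ps y0 = l & 0 < r & cball y0 r \<subseteq> U"
 proof
  fix l show "EX U ps y0 r. l : L --> lpar M L U ps & ps y0 = l & 0 < r & cball y0 r \<subseteq> U"
  proof (cases "l : L")
   case True
   then obtain U ps y0 where *: "lpar M L U ps" "y0 : U" "ps y0 = l" using ex by blast
   then obtain r where "0 < r" "cball y0 r \<subseteq> U" using open_contains_cball lparD(1) by metis
   with * show ?thesis by blast
  qed simp
 qed
 then obtain U ps y0 r where p: "!!l. l : L ==> lpar M L (U l) (ps l) & ps l (y0 l) = l & 0 < r l & cball (y0 l) (r l) \<subseteq> U l"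
  by metis
 define W where "W l = ps l ` ball (y0 l) (r l)" for l
 have oW: "openin (subtopology (mtop M) L) (W l)" if "l : L" for l
  unfolding W_def by (rule local_param_image_openin) (use p[OF that] ball_subset_cball in auto)
 have lW: "l : W l" if "l : L" for l using p[OF that] unfolding W_def by (metis centre_in_ball imageI)
 have cs: "compact_space (subtopology (mtop M) L)" using L by (simp add: compact_space_subtopology)
 have tL: "topspace (subtopology (mtop M) L) = L" using compactin_subset_topspace[OF L] by auto
 have "(ALL V:W ` L. openin (subtopology (mtop M) L) V) & L \<subseteq> \<Union> (W ` L)" using oW lW by blast
 then obtain \<F> where "finite \<F>" "\<F> \<subseteq> W ` L" "L \<subseteq> \<Union> \<F>"
  using cs[unfolded compact_space_alt tL, rule_format, of "W ` L"] by blast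
 moreover from finite_subset_image[OF this(1,2)] obtain F where "F \<subseteq> L" "finite F" "\<F> = W ` F" by blast
 ultimately have F: "finite F" "F \<subseteq> L" "L \<subseteq> (\<Union>l\<in>F. W l)" by simp_all
 obtain e where e: "bij_betw e {0..<card F} F" using ex_bij_betw_nat_finite[OF F(1)] by blast
 have eF: "e i : F" "e i : L" if "i < card F" for i using bij_betwE[OF e] F(2) that by auto
 define C where "C i = ps (e i) ` cball (y0 (e i)) (r (e i))" for i
 \<comment> \<open>The subset of the i-th closed ball whose image avoids all earlier images; a point
   of L goes to the first ball that covers it.\<close>
 define B where "B i = {y : cball (y0 (e i)) (r (e i)). ALL j<i. ps (e i) y \<notin> C j}" for i
 define \<D> where "\<D> = (%i. (U (e i), ps (e i), B i)) ` {0..<card F}"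
 have CB: "(\<Union>i<card F. ps (e i) ` B i) = L"
 proof
  show "(\<Union>i<card F. ps (e i) ` B i) \<subseteq> L"
   using p eF lpar_cont(2) by (fastforce simp: B_def)
  show "L \<subseteq> (\<Union>i<card F. ps (e i) ` B i)"
  proof
   fix x assume "x : L"
   then obtain l where l: "l : F" "x : W l" using F(3) by blast
   have "l : e ` {0..<card F}" using l(1) e by (simp add: bij_betw_def)
   then obtain i0 where i0: "i0 < card F" "e i0 = l" by auto
   have x0: "x : C i0" using l i0 ball_subset_cball by (fastforce simp: W_def C_def)
   define i where "i = (LEAST i. x : C i)"
   have i: "x : C i" "i <= i0"
    unfolding i_def by (rule LeastI[of "%i. x : C i", OF x0], rule Least_le[of "%i. x : C i", OF x0])
   have i': "x \<notin> C j" if "j < i" for j using that unfolding i_def by (rule not_less_Least)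
   obtain y where y: "y : cball (y0 (e i)) (r (e i))" "x = ps (e i) y" using i(1) unfolding C_def by blast
   hence "y : B i" using i' by (simp add: B_def)
   hence "x : ps (e i) ` B i" using y(2) by blast
   thus "x : (\<Union>i<card F. ps (e i) ` B i)" using i(2) i0(1) by force
  qed
 qed
 have closedC: "closedin (mtop M) (C j)" if "j < card F" for j
 proof (rule compactin_imp_closedin[OF H])
  have "compactin (top_of_set (U (e j))) (cball (y0 (e j)) (r (e j)))"
   using p[OF eF(2)[OF that]] by (simp add: compactin_subtopology)
  thus "compactin (mtop M) (C j)"
   unfolding C_def by (rule image_compactin[OF _ lpar_cont(1)]) (use p[OF eF(2)[OF that]] in blast)
 qed
 have borel: "B i : sets borel" if i: "i < card F" for i
 proof -
  have lp: "lpar M L (U (e i)) (ps (e i))" and cb: "cball (y0 (e i)) (r (e i)) \<subseteq> U (e i)"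
   using p[OF eF(2)[OF i]] by auto
  define E where "E j = {y : U (e i). ps (e i) y : pts M - C j}" for j
  have E: "E j : sets borel" if "j < i" for j
  proof -
   have "openin (mtop M) (pts M - C j)" using closedC[of j] that i by (simp add: openin_diff)
   hence "open (E j)" unfolding E_def by (rule open_preimage[OF lpar_cont(1)[OF lp] lparD(1)[OF lp]])
   thus ?thesis by (rule borel_open)
  qed
  have "B i = cball (y0 (e i)) (r (e i)) \<inter> (\<Inter>j\<in>{..<i}. E j)" if "i ~= 0"
  proof -
   have "ps (e i) y : pts M & y : U (e i)" if "y : cball (y0 (e i)) (r (e i))" for y
    using subsetD[OF cb that] lpar_cont(3)[OF lp] by blast
   thus ?thesis using that by (auto simp: B_def E_def)
  qed
  moreover have "B i = cball (y0 (e i)) (r (e i))" if "i = 0" using that by (auto simp: B_def)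
  moreover have "cball (y0 (e i)) (r (e i)) \<inter> (\<Inter>j\<in>{..<i}. E j) : sets borel" if "i ~= 0"
   using that by (intro sets.Int sets.finite_INT) (auto intro: E)
  ultimately show ?thesis by (cases "i = 0") simp_all
 qed
 have disj: "ps (e i) ` B i \<inter> ps (e j) ` B j = {}" if "i < j" for i j
 proof -
  have "B i \<subseteq> cball (y0 (e i)) (r (e i))" by (auto simp: B_def)
  hence "ps (e i) ` B i \<subseteq> C i" unfolding C_def by (rule image_mono)
  moreover have "ps (e j) y \<notin> C i" if "y : B j" for y using that \<open>i < j\<close> by (simp add: B_def)
  hence "ps (e j) ` B j \<inter> C i = {}" by (auto simp del: C_def)
  ultimately show ?thesis by (metis Int_commute disjoint_iff subsetD)
 qed
 have "param_decomposition M L \<D>" unfolding param_decomposition_def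
 proof (intro conjI)
  show "finite \<D>" by (simp add: \<D>_def)
  show "ALL (U, ps, B):\<D>. lpar M L U ps & B : sets borel & bounded B & closure B \<subseteq> U"
  proof (clarsimp simp: \<D>_def)
   fix i assume i: "i < card F"
   have sub: "B i \<subseteq> cball (y0 (e i)) (r (e i))" by (auto simp: B_def)
   hence "closure (B i) \<subseteq> cball (y0 (e i)) (r (e i))" by (intro closure_minimal) auto
   moreover have "bounded (B i)" using sub bounded_subset bounded_cball by blast
   ultimately show "lpar M L (U (e i)) (ps (e i)) & B i : sets borel & bounded (B i) & closure (B i) \<subseteq> U (e i)"
    using p[OF eF(2)[OF i]] borel[OF i] by (meson order_trans)
  qed
  show "disjoint_family_on (%(U, ps, B). ps ` B) \<D>" unfolding disjoint_family_on_def
  proof (intro ballI impI)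
   fix a b assume "a : \<D>" "b : \<D>" "a ~= b"
   obtain i where ai: "a = (U (e i), ps (e i), B i)" using \<open>a : \<D>\<close> unfolding \<D>_def by (rule imageE)
   obtain j where bj: "b = (U (e j), ps (e j), B j)" using \<open>b : \<D>\<close> unfolding \<D>_def by (rule imageE)
   have "i ~= j" using ai bj \<open>a ~= b\<close> by metis
   hence "ps (e i) ` B i \<inter> ps (e j) ` B j = {}"
    using disj[of i j] disj[of j i] by (metis Int_commute linorder_neqE_nat)
   thus "(case a of (U, ps, B) => ps ` B) \<inter> (case b of (U, ps, B) => ps ` B) = {}" by (simp add: ai bj)
  qed
  show "(\<Union>(U, ps, B)\<in>\<D>. ps ` B) = L" using CB by (simp add: \<D>_def atLeast0LessThan)
 qed
 thus ?thesis by blast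
qed

section \<open>Orbits of G as submanifolds\<close>

context corb
begin

lemma orbit_eq: "q' : act q ` G ==> q : pts M ==> act q' ` G = act q ` G"
proof -
 assume q': "q' : act q ` G" and q: "q : pts M"
 then obtain x where x: "x : G" "q' = act q x" by blast
 have "act q' y = act q (x \<odot> y)" if "y : G" for y using x q that G_carrier by (simp add: act_act)
 moreover have "act q y = act q' (kinv x \<odot> y)" if "y : G" for y
 proof -
  have "act q' (kinv x \<odot> y) = act q (x \<odot> (kinv x \<odot> y))" using x q that G_carrier by (simp add: act_act)
  also have "x \<odot> (kinv x \<odot> y) = y" using x that G_carrier by (simp add: m_assoc[symmetric])
  finally show ?thesis by simp
 qed
 ultimately show ?thesis
  using x(1) subgroup.m_closed[OF subG] subgroup.m_inv_closed[OF subG] by (auto simp: image_iff)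
qed

lemma orbit_fin_stab: "fin_stab q ==> q' : act q ` G ==> fin_stab q'"
 using fin_stab_act G_carrier by blast

lemma compactin_orbit: "q : pts M ==> compactin (mtop M) (act q ` G)"
 by (rule image_compactin[OF cptG continuous_act_const]) auto

text \<open>In the coordinates \<Theta> a map into the orbit has vanishing imaginary part near x0,
  hence so has its derivative. The differential of \<Theta> at 0 is the infinitesimal
  action.\<close>

lemma tangent_lie:
 fixes u :: "'a::real_normed_vector => 'm"
 assumes q: "fin_stab q" and c: "c : atlas M" "q : fst c"
  and u: "open S" "x0 : S" "continuous_map (top_of_set S) (mtop M) u" "u ` S \<subseteq> act q ` G" "u x0 = q"
  and P: "hasD (%x. snd c (u x)) P x0"
 obtains \<xi> where "linear \<xi>" "!!v. \<xi> v : \<gg>" "!!v. P v = Am c (snd c q) (\<xi> v)"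
proof -
 have qt: "q : pts M" using q by (simp add: fin_stab_def)
 obtain U V h h' where ls: "open U" "0 : U" "open V" "V \<subseteq> chart_image c" "!!Z. Z : U ==> \<Theta> q Z : fst c"
  "homeomorphism U V (%Z. snd c (\<Theta> q Z)) h" "!!y. y : V ==> hasD h (h' y) y"
  "!!Z. Z : U ==> \<Theta> q Z : act q ` G ==> Z : \<gg>"
  "hasD (%Z. snd c (\<Theta> q Z)) (Am c (snd c q)) 0" using local_structure[OF q c] by metis
 have \<Theta>0: "\<Theta> q 0 = q" using subspace_0[OF subspace_lie] qt by (simp add: \<Theta>_lie act_one)
 have cV: "snd c q : V"
  using imageI[OF ls(2), of "%Z. snd c (\<Theta> q Z)"] ls(6) by (simp add: \<Theta>0 homeomorphism_def)
 have h0: "h (snd c q) = 0" using ls(2,6) \<Theta>0 by (auto simp: homeomorphism_def)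
 define S' where "S' = {x : S. u x : fst c & snd c (u x) : V}"
 have "S' = {x : S. u x : {z : pts M \<inter> fst c. snd c z : V}}"
  using chart_top[OF c(1)] by (auto simp: S'_def)
 moreover have "openin (mtop M) {z : pts M \<inter> fst c. snd c z : V}"
  using openin_continuous_map_preimage[OF continuous_map_chart[OF chM c(1)], of V] ls(3) openin_trans_full chart_openin[OF chM c(1)] by auto
 ultimately have S': "open S'" by (simp only: open_preimage[OF u(3,1)])
 have x0S: "x0 : S'" using u c cV by (simp add: S'_def)
 have hu: "\<Theta> q (h (snd c (u x))) = u x" "h (snd c (u x)) : U" if "x : S'" for x
 proof -
  have x: "snd c (u x) : V" "u x : fst c" using that by (auto simp: S'_def)
  show hU: "h (snd c (u x)) : U" using ls(6) x by (auto simp: homeomorphism_def)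
  have "snd c (\<Theta> q (h (snd c (u x)))) = snd c (u x)" using ls(6) x by (auto simp: homeomorphism_def)
  thus "\<Theta> q (h (snd c (u x))) = u x"
   using chart_inv_chart[OF chM c(1) ls(5)[OF hU]] chart_inv_chart[OF chM c(1) x(2)] by simp
 qed
 have hg: "h (snd c (u x)) : \<gg>" if "x : S'" for x
  by (rule ls(8)) (use hu[OF that] u(4) that in \<open>auto simp: S'_def\<close>)
 let ?\<xi> = "%v. h' (snd c q) (P v)"
 have dh: "hasD h (h' (snd c q)) (snd c (u x0))" using ls(7)[OF cV] u(5) by simp
 have d\<xi>: "hasD (%x. h (snd c (u x))) ?\<xi> x0" using hasD_chain[OF P dh] by (simp add: o_def)
 have "hasD (%x. imp (h (snd c (u x)))) (%v. imp (?\<xi> v)) x0"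
  by (rule bounded_linear.has_derivative[OF _ d\<xi>]) (use linear_imp in "simp add: linear_conv_bounded_linear")
 moreover have "hasD (%x. imp (h (snd c (u x)))) (%v. 0) x0"
  by (rule hasD_transform[OF has_derivative_const[of 0] S' x0S]) (simp add: hg imp_zero_iff)
 ultimately have "imp (?\<xi> v) = 0" for v by (rule has_derivative_unique[THEN fun_cong])
 hence 1: "?\<xi> v : \<gg>" for v using imp_zero_iff by blast
 have "hasD (%Z. snd c (\<Theta> q Z)) (Am c (snd c q)) (h (snd c (u x0)))" using ls(9) h0 u(5) by simp
 from hasD_chain[OF d\<xi> this]
 have "hasD (%x. snd c (\<Theta> q (h (snd c (u x))))) (%v. Am c (snd c q) (?\<xi> v)) x0" by (simp add: o_def)
 hence "hasD (%x. snd c (u x)) (%v. Am c (snd c q) (?\<xi> v)) x0"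
  by (rule hasD_transform[OF _ S' x0S]) (simp add: hu)
 from has_derivative_unique[OF P this] have "P v = Am c (snd c q) (?\<xi> v)" for v by (rule fun_cong)
 with 1 show thesis using that has_derivative_linear[OF d\<xi>] by blast
qed

text \<open>The coordinates \<Theta> restricted to the real Lie algebra.
  \<open>local_structure\<close> shows that every orbit point in the coordinate domain is reached,
  which makes the image relatively open in the orbit.\<close>

lemma param_exists:
 assumes q: "fin_stab q"
 shows "EX U. lpar M (act q ` G) U (%a. act q (Exp (lb a))) & 0 : U"
proof -
 have qt: "q : pts M" using q by (simp add: fin_stab_def)
 obtain c where c: "c : atlas M" "q : fst c" using charted_chart_at[OF chM qt] by blast
 obtain U V h h' where ls: "open U" "0 : U" "open V" "V \<subseteq> chart_image c" "!!Z. Z : U ==> \<Theta> q Z : fst c"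
  "homeomorphism U V (%Z. snd c (\<Theta> q Z)) h" "!!y. y : V ==> hasD h (h' y) y"
  "!!Z. Z : U ==> \<Theta> q Z : act q ` G ==> Z : \<gg>"
  "hasD (%Z. snd c (\<Theta> q Z)) (Am c (snd c q)) 0" using local_structure[OF q c] by metis
 let ?ps = "%a. act q (Exp (lb a))"
 define U1 where "U1 = {a. lb a : U}"
 have bl: "bounded_linear lb" "bounded_linear lbi" using lb(1) lbi(3) by (simp_all add: linear_conv_bounded_linear)
 have U1: "open U1" using open_vimage[OF ls(1) linear_continuous_on[OF bl(1)]] by (simp add: U1_def vimage_def)
 have ps\<Theta>: "?ps a = \<Theta> q (lb a)" for a by (simp add: \<Theta>_lie)
 have hl: "lbi (h (snd c (?ps a))) = a" if "a : U1" for a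
  using ls(6) that by (auto simp: ps\<Theta> U1_def homeomorphism_def lbi)
 have inc: "?ps a : fst c" if "a : U1" for a using ls(5) that by (auto simp: ps\<Theta> U1_def)
 have inV: "snd c (?ps a) : V" if "a : U1" for a using ls(6) that by (auto simp: ps\<Theta> U1_def homeomorphism_def)
 have F: "mhol M UNIV (%Y. act q (Exp Y))" by (intro mhol_act mhol_const mhol_Exp) (auto simp: qt)
 have cont: "continuous_map euclidean (mtop M) ?ps"
  using cm_compose[OF _ mhol_continuous[OF F], of euclidean lb] linear_continuous_on[OF bl(1)] by (simp add: o_def)
 \<comment> \<open>For the inclusion from right to left, the coordinate Z of an orbit point has no
   imaginary part and so lies in the range of \<open>lb\<close>.\<close>
 have img: "?ps ` U1 = act q ` G \<inter> {z : pts M \<inter> fst c. snd c z : V}"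
 proof (intro equalityI subsetI)
  fix z assume "z : ?ps ` U1"
  thus "z : act q ` G \<inter> {z : pts M \<inter> fst c. snd c z : V}"
   using inc inV chart_top[OF c(1)] Exp_G1[OF lb_lie] by auto
 next
  fix z assume z: "z : act q ` G \<inter> {z : pts M \<inter> fst c. snd c z : V}"
  let ?Z = "h (snd c z)"
  have hU: "?Z : U" using ls(6) z by (auto simp: homeomorphism_def)
  have "snd c (\<Theta> q ?Z) = snd c z" using ls(6) z by (auto simp: homeomorphism_def)
  hence eq: "\<Theta> q ?Z = z"
   using chart_inv_chart[OF chM c(1) ls(5)[OF hU]] chart_inv_chart[OF chM c(1), of z] z by simp
  hence Zg: "?Z : \<gg>" using ls(8)[OF hU] z by simp
  have "lbi ?Z : U1" "?ps (lbi ?Z) = z"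
   using hU eq \<Theta>_lie[OF Zg, of q] by (simp_all add: U1_def lbi(2)[OF Zg])
  thus "z : ?ps ` U1" by (metis (no_types, lifting) imageI)
 qed
 have "openin (mtop M) {z : pts M \<inter> fst c. snd c z : V}"
  using openin_continuous_map_preimage[OF continuous_map_chart[OF chM c(1)], of V] ls(3) openin_trans_full chart_openin[OF chM c(1)] by auto
 hence opL: "openin (subtopology (mtop M) (act q ` G)) (?ps ` U1)"
  unfolding img by (auto simp: openin_subtopology)
 have hom: "homeomorphic_map (top_of_set U1) (subtopology (mtop M) (?ps ` U1)) ?ps"
  unfolding homeomorphic_map_maps
 proof (intro exI[of _ "%z. lbi (h (snd c z))"])
  have c1: "continuous_map (top_of_set U1) (subtopology (mtop M) (?ps ` U1)) ?ps"
   using continuous_map_from_subtopology[OF cont, of U1] by (auto simp: cm_in_sub)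
  have s: "continuous_map (subtopology (mtop M) (?ps ` U1)) (top_of_set V) (snd c)"
   using continuous_map_from_subtopology_mono[OF continuous_map_chart[OF chM c(1)], of "?ps ` U1"] inc inV
   by (auto simp: cm_in_sub)
  have "continuous_map (top_of_set V) euclidean (%y. lbi (h y))"
   using ls(6) by (auto simp: homeomorphism_def intro!: bounded_linear.continuous_on[OF bl(2)])
  from cm_compose[OF s this]
  have "continuous_map (subtopology (mtop M) (?ps ` U1)) (top_of_set U1) (%z. lbi (h (snd c z)))"
   using hl by (auto simp: cm_in_sub o_def)
  thus "homeomorphic_maps (top_of_set U1) (subtopology (mtop M) (?ps ` U1)) ?ps (%z. lbi (h (snd c z)))"
   using c1 hl by (auto simp: homeomorphic_maps_def)
 qed
 have "smooth_on {x : U1. ?ps x : fst c'} (snd c' \<circ> ?ps) &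
    (ALL x:U1. ?ps x : fst c' --> inj (fd (snd c' \<circ> ?ps) x))" if c': "c' : atlas M" for c'
 proof -
  define T where "T = {Y : UNIV. act q (Exp Y) : fst c'}"
  have T: "open T" unfolding T_def by (rule mhol_open_preimage[OF F chart_openin[OF chM c']])
  have smT: "smooth_on T (%Y. snd c' (act q (Exp Y)))"
   by (rule cdiff_smooth[OF T mhol_cdiff[OF F c']]) (auto simp: T_def)
  have opU: "open {x : U1. ?ps x : fst c'}"
   by (rule open_preimage[OF continuous_map_from_subtopology[OF cont] U1 chart_openin[OF chM c']])
  have sm: "smooth_on {x : U1. ?ps x : fst c'} (snd c' \<circ> ?ps)" unfolding smooth_on_def
  proof
   fix k
   have "cont_diff k {x : U1. ?ps x : fst c'} (%x. snd c' (act q (Exp (0 + lb x))))"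
    by (rule cont_diff_affine[OF opU T bl(1)]) (use smT in "auto simp: T_def smooth_on_def")
   thus "cont_diff k {x : U1. ?ps x : fst c'} (snd c' \<circ> ?ps)" by (simp add: o_def)
  qed
  moreover have "inj (fd (snd c' \<circ> ?ps) x)" if x: "x : U1" "?ps x : fst c'" for x
  proof -
   have xc: "?ps x : fst c" by (rule inc[OF x(1)])
   have ci: "chart_inv c' (snd c' z) = z" if "z : fst c'" for z using chart_inv_chart[OF chM c' that] .
   let ?h = "%y. lbi (h (snd c (chart_inv c' y)))"
   have "cdiff_at (%y. snd c (chart_inv c' y)) (snd c' (?ps x))"
    by (rule mhol_cdiff[OF mhol_chart_inv[OF cmM mdlM c'] c(1) chart_mem_image[OF chM c' x(2)]]) (simp add: ci x xc)
   note d1 = cdiff_fd(1)[OF this]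
   have "hasD h (h' (snd c (?ps x))) (snd c (chart_inv c' (snd c' (?ps x))))"
    using ls(7)[OF inV[OF x(1)]] by (simp add: ci x)
   from bounded_linear.has_derivative[OF bl(2) hasD_chain[OF d1 this]]
   obtain D' where "hasD ?h D' ((snd c' \<circ> ?ps) x)" by (auto simp: o_def)
   moreover have "\<forall>\<^sub>F y in nhds x. ?h ((snd c' \<circ> ?ps) y) = y"
    unfolding eventually_nhds using opU x by (intro exI[of _ "{x : U1. ?ps x : fst c'}"]) (simp add: ci hl)
   moreover have "hasD (snd c' \<circ> ?ps) (fd (snd c' \<circ> ?ps) x) x"
    by (rule smooth_hasD[OF sm]) (use x in simp)
   ultimately show ?thesis using inj_derivative_of_left_inverse(2) by blast
  qed
  ultimately show ?thesis by blast
 qed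
 hence "lpar M (act q ` G) U1 ?ps" unfolding local_param_def using U1 opL hom by blast
 moreover have "0 : U1" using ls(2) by (simp add: U1_def linear_0[OF lb(1)])
 ultimately show ?thesis by blast
qed

lemma orbit_decomposition:
 assumes q: "fin_stab q" shows "EX \<D>. param_decomposition M (act q ` G) \<D>"
proof (rule param_decomposition_exists)
 have qt: "q : pts M" using q by (simp add: fin_stab_def)
 show "Hausdorff_space (mtop M)" using cmM by (simp add: complex_manifold_def)
 show "compactin (mtop M) (act q ` G)" by (rule compactin_orbit[OF qt])
 fix l assume l: "l : act q ` G"
 have fl: "fin_stab l" by (rule orbit_fin_stab[OF q l])
 hence "act l (Exp (lb 0)) = l" by (simp add: linear_0[OF lb(1)] act_one fin_stab_def)
 thus "EX U ps y0. lpar M (act q ` G) U ps & y0 : U & ps y0 = l"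
  using param_exists[OF fl] unfolding orbit_eq[OF l qt] by blast
qed

end

section \<open>Integration over a parametrized set\<close>

text \<open>The change of variables theorem of the library is stated for well-ordered index types only;
 a copy of the index type carries a well-order.\<close>

typedef ('a::finite) wo = "UNIV :: 'a set" by simp

lemma bij_Rep_wo: "bij (Rep_wo :: 'a::finite wo => 'a)"
 by (rule bijI', simp add: Rep_wo_inject) (metis Abs_wo_inverse UNIV_I)

lemma Abs_Rep_wo [simp]: "Rep_wo (Abs_wo x) = x" "Abs_wo (Rep_wo y) = y"
 by (simp_all add: Abs_wo_inverse Rep_wo_inverse)

lemma inj_to_nat_wo: "EX f :: 'a::finite wo => nat. inj f"
proof -
 obtain f :: "'a => nat" where "inj f" using finite_imp_inj_to_nat_seg[OF finite_class.finite_UNIV] by blast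
 hence "inj (f \<circ> Rep_wo)" using bij_is_inj[OF bij_Rep_wo] by (rule inj_compose)
 thus ?thesis by blast
qed

instantiation wo :: (finite) "{finite, wellorder}"
begin
definition "enum_wo = (SOME f :: 'a wo => nat. inj f)"
definition "less_eq_wo a b \<longleftrightarrow> enum_wo a <= enum_wo (b :: 'a wo)"
definition "less_wo a b \<longleftrightarrow> enum_wo a < enum_wo (b :: 'a wo)"
instance
proof
 have inj: "inj (enum_wo :: 'a wo => nat)" unfolding enum_wo_def by (rule someI_ex[OF inj_to_nat_wo])
 show "finite (UNIV :: 'a wo set)" using finite_imageD[of Rep_wo UNIV] bij_is_inj[OF bij_Rep_wo] by auto
 fix x y z :: "'a wo" and P :: "'a wo => bool"
 show "(x < y) = (x <= y & ~ y <= x)" "x <= x" "x <= y | y <= x" "x <= y ==> y <= z ==> x <= z"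
  by (auto simp: less_eq_wo_def less_wo_def)
 show "x <= y ==> y <= x ==> x = y" using inj by (simp add: less_eq_wo_def inj_eq)
 assume "!!x. (!!y. y < x ==> P y) ==> P x"
 thus "P x" by (rule measure_induct_rule[of enum_wo]) (auto simp: less_wo_def)
qed
end

definition wov :: "real ^ 'n => real ^ 'n wo" where "wov v = (\<chi> i. v $ Rep_wo i)"
definition vwo :: "real ^ 'n wo => real ^ 'n" where "vwo v = (\<chi> i. v $ Abs_wo i)"

lemma wov_vwo [simp]: "wov (vwo v) = v" "vwo (wov u) = u" by (simp_all add: wov_def vwo_def vec_eq_iff)

lemma linear_wov: "linear wov" "linear vwo" by (auto intro!: linearI simp: wov_def vwo_def vec_eq_iff)

lemma bounded_linear_wov: "bounded_linear wov" "bounded_linear vwo"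
 using linear_wov by (simp_all add: linear_conv_bounded_linear)

lemma det_reindex_wo:
 fixes A :: "real ^ 'n ^ 'n"
 shows "det (\<chi> i j. A $ Rep_wo i $ Rep_wo j) = det A"
proof -
 let ?m = "map_permutation UNIV (Abs_wo :: 'n => 'n wo)" and ?k = "map_permutation UNIV (Rep_wo :: 'n wo => 'n)"
 have bA: "bij (Abs_wo :: 'n => 'n wo)" by (rule o_bij[of Rep_wo]) auto
 have m: "?m p permutes UNIV" if "p permutes UNIV" for p :: "'n => 'n"
  by (rule map_permutation_permutes[OF bA that])
 have k: "?k p permutes UNIV" if "p permutes UNIV" for p :: "'n wo => 'n wo"
  by (rule map_permutation_permutes[OF bij_Rep_wo that])
 have ap: "?m p i = Abs_wo (p (Rep_wo i))" for p i
  using map_permutation_apply[OF bij_is_inj[OF bA], of "Rep_wo i" p] by simp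
 have ak: "?k p i = Rep_wo (p (Abs_wo i))" for p i
  using map_permutation_apply[OF bij_is_inj[OF bij_Rep_wo], of "Abs_wo i" p] by simp
 have "det (\<chi> i j. A $ Rep_wo i $ Rep_wo j) =
   (\<Sum>p\<in>{p. p permutes UNIV}. of_int (sign (?m p)) * (\<Prod>i\<in>UNIV. A $ Rep_wo i $ Rep_wo (?m p i)))"
  unfolding det_def
  by (subst sum.reindex_bij_witness[of "{p. p permutes UNIV}" ?k ?m "{p. p permutes UNIV}", symmetric])
   (auto simp: m k ap ak fun_eq_iff)
 also have "... = (\<Sum>p\<in>{p. p permutes UNIV}. of_int (sign p) * (\<Prod>i\<in>UNIV. A $ i $ p i))"
 proof (rule sum.cong[OF refl])
  fix p :: "'n => 'n" assume p: "p : {p. p permutes UNIV}"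
  have "(\<Prod>i\<in>UNIV. A $ Rep_wo i $ Rep_wo (?m p i)) = (\<Prod>i\<in>UNIV. A $ i $ p i)"
   by (rule prod.reindex_bij_witness[of _ Abs_wo Rep_wo]) (auto simp: ap)
  moreover have "sign (?m p) = sign p" by (rule sign_map_permutation) (use p bA bij_is_inj in auto)
  ultimately show "of_int (sign (?m p)) * (\<Prod>i\<in>UNIV. A $ Rep_wo i $ Rep_wo (?m p i)) =
   of_int (sign p) * (\<Prod>i\<in>UNIV. A $ i $ p i)" by simp
 qed
 finally show ?thesis by (simp add: det_def)
qed

lemma prod_Basis_real_vec:
 fixes f :: "real ^ 'n => real" shows "(\<Prod>b\<in>Basis. f b) = (\<Prod>i\<in>UNIV. f (axis i 1))"
proof -
 have B: "(Basis :: (real ^ 'n) set) = range (%i :: 'n. axis i (1::real))" by (auto simp: Basis_vec_def)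
 have "inj (%i :: 'n. axis i (1::real))" by (auto intro!: injI simp: axis_eq_axis)
 from prod.reindex[OF this, of f] show ?thesis unfolding B by simp
qed

lemma lborel_wov: "distr lborel borel wov = (lborel :: (real ^ ('n::finite) wo) measure)"
proof (rule lborel_eqI[symmetric])
 have meas: "wov : borel_measurable borel"
  by (rule borel_measurable_continuous_onI[OF linear_continuous_on[OF bounded_linear_wov(1)]])
 fix l u :: "real ^ 'n wo" assume le: "!!b. b : Basis ==> l \<bullet> b <= u \<bullet> b"
 have le': "vwo l \<bullet> b <= vwo u \<bullet> b" if b: "b : Basis" for b
 proof -
  obtain i where "b = axis i 1" using b by (auto simp: Basis_vec_def)
  thus ?thesis using le[of "axis (Abs_wo i) 1"] by (auto simp: inner_axis vwo_def Basis_vec_def)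
 qed
 have "wov -` box l u = box (vwo l) (vwo u)"
  by (auto simp: mem_box_cart wov_def vwo_def) (metis Abs_Rep_wo(1), metis Abs_Rep_wo(1), metis Abs_Rep_wo(2), metis Abs_Rep_wo(2))
 hence "emeasure (distr lborel borel wov) (box l u) = emeasure lborel (box (vwo l) (vwo u))"
  using emeasure_distr[of wov lborel borel "box l u"] meas by simp
 also have "... = (\<Prod>b\<in>Basis. (vwo u - vwo l) \<bullet> b)" using le' by (simp add: emeasure_lborel_box)
 also have "(\<Prod>b\<in>Basis. (vwo u - vwo l) \<bullet> b) = (\<Prod>i\<in>UNIV. (vwo u - vwo l) $ i)"
  by (simp add: prod_Basis_real_vec inner_axis)
 also have "... = (\<Prod>i\<in>UNIV. (u - l) $ i)"
  by (rule prod.reindex_bij_witness[of _ Rep_wo Abs_wo]) (auto simp: vwo_def)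
 also have "... = (\<Prod>b\<in>Basis. (u - l) \<bullet> b)" by (simp add: prod_Basis_real_vec inner_axis)
 finally show "emeasure (distr lborel borel wov) (box l u) = (\<Prod>b\<in>Basis. (u - l) \<bullet> b)" .
qed simp

lemma set_integral_wov:
 fixes f :: "real ^ 'n => real"
 assumes "S : sets borel" "f : borel_measurable borel"
 shows "set_integrable lborel (vwo -` S) (%z. f (vwo z)) = set_integrable lborel S f"
  "(LINT z:vwo -` S|lborel. f (vwo z)) = (LINT y:S|lborel. f y)"
proof -
 have meas: "wov : borel_measurable borel" "vwo : borel_measurable borel"
  by (auto intro!: borel_measurable_continuous_onI linear_continuous_on bounded_linear_wov)
 have m1: "(%z. indicator (vwo -` S) z *R f (vwo z)) : borel_measurable borel"
  using assms meas(2) measurable_sets_borel[OF meas(2) assms(1)] measurable_compose[OF meas(2) assms(2)]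
  by (intro borel_measurable_scaleR borel_measurable_indicator) auto
 have m2: "wov : lborel \<rightarrow>\<^sub>M borel" using meas(1) by simp
 have eq: "indicator (vwo -` S) (wov y) *R f (vwo (wov y)) = indicator S y *R f y" for y
  by (simp add: indicator_def)
 show "set_integrable lborel (vwo -` S) (%z. f (vwo z)) = set_integrable lborel S f"
  using integrable_distr_eq[OF m2 m1] unfolding set_integrable_def lborel_wov eq .
 show "(LINT z:vwo -` S|lborel. f (vwo z)) = (LINT y:S|lborel. f y)"
  using integral_distr[OF m2 m1] unfolding set_lebesgue_integral_def lborel_wov eq .
qed

lemma set_integral_change_of_variables_wo:
 fixes g :: "real ^ 'n::{finite,wellorder} => real ^ 'n::_"
 assumes S: "S : sets borel" and g: "!!x. x : S ==> (g has_derivative g' x) (at x within S)" "inj_on g S"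
  and i1: "set_integrable lborel (g ` S) f" and i2: "set_integrable lborel S (%x. \<bar>det (matrix (g' x))\<bar> * f (g x))"
 shows "(LINT x:S|lborel. \<bar>det (matrix (g' x))\<bar> * f (g x)) = (LINT z:g ` S|lborel. f z)"
proof -
 have S': "S : sets lebesgue" using S by simp
 have abs: "h absolutely_integrable_on T" if "set_integrable lborel T h" for h :: "real ^ 'n::{finite,wellorder} => real" and T
  using that unfolding set_integrable_def by (simp add: integrable_completion borel_measurable_integrable)
 \<comment> \<open>The change of variables theorem is applied to vector-valued functions, so real
   values are read as vectors of length 1.\<close>
 have v: "(%x. \<bar>det (matrix (g' x))\<bar> *R (vec (f (g x)) :: real ^ 1)) = (%x. vec (\<bar>det (matrix (g' x))\<bar> * f (g x)))"
  by (simp add: fun_eq_iff vec_eq_iff)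
 have "(%z. vec (f z) :: real ^ 1) absolutely_integrable_on (g ` S)"
  using abs[OF i1] by (simp add: absolutely_integrable_on_1_iff)
 hence "integral S (%x. vec (\<bar>det (matrix (g' x))\<bar> * f (g x)) :: real ^ 1) = integral (g ` S) (%z. vec (f z))"
  using has_absolute_integral_change_of_variables[OF S' g(1,2), of "%z. vec (f z) :: real ^ 1" "integral (g ` S) (%z. vec (f z))"]
  unfolding v by blast
 hence "integral S (%x. \<bar>det (matrix (g' x))\<bar> * f (g x)) = integral (g ` S) f"
  by (simp add: integral_on_1_eq)
 thus ?thesis by (simp add: set_borel_integral_eq_integral(2) i1 i2)
qed

lemma set_integral_change_of_variables:
 fixes g :: "real ^ 'n => real ^ 'n"
 assumes S: "S : sets borel" "g ` S : sets borel"
  and g: "!!x. x : S ==> hasD g (g' x) x" "inj_on g S"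
  and i1: "set_integrable lborel (g ` S) f" and i2: "set_integrable lborel S h"
  and h: "!!x. x : S ==> h x = \<bar>det (matrix (g' x))\<bar> * f (g x)"
 shows "(LINT x:S|lborel. h x) = (LINT z:g ` S|lborel. f z)"
proof -
 let ?f = "%z. indicator (g ` S) z * f z" and ?h = "%x. indicator S x * h x"
 have fm: "?f : borel_measurable borel" "?h : borel_measurable borel"
  using borel_measurable_integrable[OF i1[unfolded set_integrable_def]] borel_measurable_integrable[OF i2[unfolded set_integrable_def]] by auto
 let ?S = "vwo -` S" and ?g = "%z. wov (g (vwo z))" and ?g' = "%z v. wov (g' (vwo z) (vwo v))"
 have S': "?S : sets borel"
  by (rule measurable_sets_borel[OF borel_measurable_continuous_onI[OF linear_continuous_on[OF bounded_linear_wov(2)]] S(1)])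
 have img: "?g ` ?S = vwo -` (g ` S)"
 proof (intro equalityI subsetI)
  fix z assume "z : vwo -` (g ` S)"
  then obtain x where x: "x : S" "vwo z = g x" by blast
  hence "z = ?g (wov x)" "wov x : ?S" using wov_vwo(1)[of z] x by simp_all
  thus "z : ?g ` ?S" by blast
 qed auto
 have dg: "hasD ?g (?g' z) z" if "z : ?S" for z
 proof -
  have "hasD g (g' (vwo z)) (vwo z)" using g(1) that by simp
  from hasD_chain[OF blin_hasD[OF bounded_linear_wov(2)] this]
  have "hasD (%z. g (vwo z)) (%v. g' (vwo z) (vwo v)) z" by (simp add: o_def)
  thus ?thesis by (rule bounded_linear.has_derivative[OF bounded_linear_wov(1)])
 qed
 have det: "det (matrix (?g' z)) = det (matrix (g' (vwo z)))" for z
 proof -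
  have ax: "vwo (axis j 1) = axis (Rep_wo j) 1" for j :: "'n wo" by (auto simp: vwo_def axis_def vec_eq_iff)
  have "matrix (?g' z) = (\<chi> i j. matrix (g' (vwo z)) $ Rep_wo i $ Rep_wo j)"
   by (simp add: matrix_def wov_def ax)
  thus ?thesis by (simp add: det_reindex_wo)
 qed
 have injg: "inj_on ?g ?S"
 proof (rule inj_onI)
  fix a b assume "a : ?S" "b : ?S" "?g a = ?g b"
  hence "vwo a = vwo b" using inj_onD[OF g(2), of "vwo a" "vwo b"] by (metis vimageD wov_vwo(2))
  thus "a = b" by (metis wov_vwo(1))
 qed
 have hz: "\<bar>det (matrix (?g' z))\<bar> * ?f (vwo (?g z)) = ?h (vwo z)" if "z : ?S" for z
  using h[of "vwo z"] that by (simp add: det)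
 have e1: "set_integrable lborel T (%x. indicator T x * k x) = set_integrable lborel T k"
  "(LINT x:T|lborel. indicator T x * k x) = (LINT x:T|lborel. k x)" for T and k :: "real ^ 'n => real"
  unfolding set_integrable_def set_lebesgue_integral_def
  by (simp_all add: mult.assoc[symmetric] indicator_inter_arith[symmetric])
 have "(LINT z:?S|lborel. \<bar>det (matrix (?g' z))\<bar> * ?f (vwo (?g z))) = (LINT z:?g ` ?S|lborel. ?f (vwo z))"
 proof (rule set_integral_change_of_variables_wo[OF S' has_derivative_at_withinI[OF dg] injg])
  show "set_integrable lborel (?g ` ?S) (%z. ?f (vwo z))"
   unfolding img set_integral_wov(1)[OF S(2) fm(1)] e1(1) by (rule i1)
  have "set_integrable lborel ?S (%z. ?h (vwo z))"
   unfolding set_integral_wov(1)[OF S(1) fm(2)] e1(1) by (rule i2)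
  thus "set_integrable lborel ?S (%z. \<bar>det (matrix (?g' z))\<bar> * ?f (vwo (?g z)))"
   by (rule set_integrable_cong[THEN iffD1, rotated -1]) (use hz in auto)
 qed
 moreover have "(LINT z:?S|lborel. \<bar>det (matrix (?g' z))\<bar> * ?f (vwo (?g z))) = (LINT z:?S|lborel. ?h (vwo z))"
  by (rule set_lebesgue_integral_cong) (use S' hz in auto)
 ultimately show ?thesis
  unfolding img set_integral_wov(2)[OF S(1) fm(2)] set_integral_wov(2)[OF S(2) fm(1)] e1(2) by simp
qed

section \<open>The Maurer-Cartan form of maps into a homogeneous space\<close>

lemma continuous_on_det:
 fixes A :: "'a::topological_space => real ^ 'n ^ 'n"
 assumes "!!i j. continuous_on S (%x. A x $ i $ j)" shows "continuous_on S (%x. det (A x))"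
 unfolding det_def by (intro continuous_intros assms)

lemma integrable_bounded_piece:
 fixes k :: "real ^ 'n => real"
 assumes "continuous_on U k" "bounded B" "closure B \<subseteq> U" "T : sets borel" "T \<subseteq> B"
 shows "set_integrable lborel T k"
proof (rule set_integrable_subset)
 have "compact (closure B)" using assms(2) by (simp add: compact_closure)
 thus "set_integrable lborel (closure B) k"
  unfolding set_integrable_def by (rule borel_integrable_compact) (rule continuous_on_subset[OF assms(1,3)])
 show "T \<subseteq> closure B" using assms(5) closure_subset by blast
qed (use assms(4) in simp)

context corb
begin

text \<open>The Lie algebra vector whose infinitesimal action at f y is the derivative of f in the
  direction v. The chart is picked by \<open>SOME\<close>; lemma \<open>mcf\<close> gives the
  defining equation in every chart around f y.\<close>

definition mcf :: "('a::real_normed_vector => 'm) => 'a => 'a => complex ^ 'n" where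
 "mcf f y v = (let c = SOME c. c : atlas M & f y : fst c in
   inv_into UNIV (Am c (snd c (f y))) (fd (%y. snd c (f y)) y v))"

lemma chart_change_derivative:
 assumes c: "c : atlas M" "c' : atlas M" "f y : fst c'" "\<forall>\<^sub>F z in nhds y. f z : fst c"
  and P: "hasD (%z. snd c (f z)) P y"
 shows "hasD (%z. snd c' (f z)) (%v. Rd c c' kone (snd c (f y)) (P v)) y"
proof -
 have fc: "f y : fst c" using eventually_nhds_x_imp_x[OF c(4)] .
 have one: "act (f y) kone : fst c'" using c(3) chart_top[OF c(2,3)] by (simp add: act_one)
 note d = cdiff_fd(1)[OF R_cdiff[OF c(1,2) fc one_closed one]]
 have "hasD (%z. snd c' (act (chart_inv c (snd c (f z))) kone)) (%v. Rd c c' kone (snd c (f y)) (P v)) y"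
  unfolding Rd_def using hasD_chain[OF P d] unfolding o_def .
 thus ?thesis by (rule has_derivative_cong_nhds)
   (use c(4) in eventually_elim, simp add: chart_inv_chart[OF chM c(1)] act_one[OF chart_top[OF c(1)]])
qed

lemma mcf:
 assumes q: "fin_stab (f y)" and c: "c : atlas M" "\<forall>\<^sub>F z in nhds y. f z : fst c"
  and P: "hasD (%z. snd c (f z)) P y"
 shows "Am c (snd c (f y)) (mcf f y v) = P v"
proof -
 define c' where "c' = (SOME c. c : atlas M & f y : fst c)"
 have fc: "f y : fst c" using eventually_nhds_x_imp_x[OF c(2)] .
 have "c' : atlas M & f y : fst c'" unfolding c'_def by (rule someI[of _ c]) (use c fc in simp)
 hence c': "c' : atlas M" "f y : fst c'" by auto
 let ?A = "Am c' (snd c' (f y))" and ?R = "Rd c c' kone (snd c (f y))"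
 have bij: "bij ?A" by (rule complex_linear_bij[OF Am_linear[OF c'(1) chart_mem_image[OF chM c']] Am_inj'[OF q c']])
 have "fd (%y. snd c' (f y)) y v = ?R (P v)"
  using fd_eqI[OF chart_change_derivative[OF c(1) c' c(2) P]] by simp
 hence "mcf f y v = inv_into UNIV ?A (?R (P v))" unfolding mcf_def Let_def c'_def[symmetric] by simp
 hence "?A (mcf f y v) = ?R (P v)" using bij by (simp add: f_inv_into_f bij_is_surj)
 hence eq: "?R (Am c (snd c (f y)) (mcf f y v)) = ?R (P v)" by (simp add: Am_change[OF c(1) c'(1) fc c'(2)])
 have one: "act (f y) kone : fst c'" using c' chart_top[OF c'] by (simp add: act_one)
 have "inj ?R"
 proof (rule injI)
  fix a b assume ab: "?R a = ?R b"
  have "bij (Am c (snd c (f y)))"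
   by (rule complex_linear_bij[OF Am_linear[OF c(1) chart_mem_image[OF chM c(1) fc]] Am_inj'[OF q c(1) fc]])
  then obtain a' b' where "a = Am c (snd c (f y)) a'" "b = Am c (snd c (f y)) b'" by (meson bij_pointE)
  hence "?A a' = ?A b'" using ab by (simp add: Am_change[OF c(1) c'(1) fc c'(2)])
  hence "a' = b'" using bij by (simp add: bij_is_inj inj_eq)
  thus "a = b" using \<open>a = _\<close> \<open>b = _\<close> by simp
 qed
 with eq show ?thesis by (simp add: inj_eq)
qed

lemma mcf_unique:
 assumes q: "fin_stab (f y)" and c: "c : atlas M" "\<forall>\<^sub>F z in nhds y. f z : fst c"
  and P: "hasD (%z. snd c (f z)) P y" and Z: "Am c (snd c (f y)) Z = P v"
 shows "mcf f y v = Z"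
proof -
 have fc: "f y : fst c" using eventually_nhds_x_imp_x[OF c(2)] .
 have L: "linear (Am c (snd c (f y)))"
  using Am_linear[OF c(1) chart_mem_image[OF chM c(1) fc]] by (simp add: clin_def)
 have "Am c (snd c (f y)) (mcf f y v - Z) = 0" using mcf[OF q c P, of v] Z by (simp add: linear_diff[OF L])
 thus ?thesis using Am_inj'[OF q c(1) fc] by force
qed

lemma mcf_linear:
 assumes q: "fin_stab (f y)" and c: "c : atlas M" "\<forall>\<^sub>F z in nhds y. f z : fst c"
  and P: "hasD (%z. snd c (f z)) P y"
 shows "linear (mcf f y)"
proof -
 have L: "linear (Am c (snd c (f y)))"
  using Am_linear[OF c(1) chart_mem_image[OF chM c(1) eventually_nhds_x_imp_x[OF c(2)]]] by (simp add: clin_def)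
 note LP = has_derivative_linear[OF P]
 show ?thesis by (intro linearI mcf_unique[OF q c P])
   (simp_all add: linear_add[OF L] linear_scale[OF L] linear_add[OF LP] linear_scale[OF LP] mcf[OF q c P])
qed

text \<open>Locally the form solves the linear system A(f y) Z = df(v) with smooth data and
  invertible matrix.\<close>

lemma mcf_smooth:
 fixes f :: "'a::real_normed_vector => 'm"
 assumes S: "open S" and f: "continuous_map (top_of_set S) (mtop M) f"
  and sm: "!!c. c : atlas M ==> smooth_on {y : S. f y : fst c} (%y. snd c (f y))"
  and q: "!!y. y : S ==> fin_stab (f y)"
 shows "smooth_on S (%y. mcf f y v)"
proof (rule smooth_on_local)
 fix y assume y: "y : S"
 then obtain c where c: "c : atlas M" "f y : fst c" using q charted_chart_at[OF chM] unfolding fin_stab_def by metis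
 let ?T = "{y : S. f y : fst c}"
 have T: "open ?T" by (rule open_preimage[OF f S chart_openin[OF chM c(1)]])
 let ?A = "%z. matrix (Am c (snd c (f z)))" and ?b = "%z. fd (%y. snd c (f y)) z v"
 have ch: "snd c (f z) : chart_image c" if "z : ?T" for z using chart_mem_image[OF chM c(1)] that by simp
 have "cont_diff k ?T (%z. mcf f z v)" for k
 proof (rule cont_diff_solve[OF T, of k ?A ?b])
  fix i j
  have "smooth_on (chart_image c) (%y. Am c y (axis j 1))"
   by (rule cdiff_smooth[OF chart_image_open[OF chM c(1)] Am_cdiff[OF c(1)]])
  hence "smooth_on ?T (%z. Am c (snd c (f z)) (axis j 1))"
   by (rule smooth_on_compose[OF T chart_image_open[OF chM c(1)] _ _ sm[OF c(1)], rotated]) (use ch in auto)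
  hence "cont_diff k ?T (%z. Am c (snd c (f z)) (axis j 1) $ i)"
   by (intro cont_diff_vec_nth[OF T]) (simp add: smooth_on_def)
  thus "cont_diff k ?T (%z. ?A z $ i $ j)" by (simp add: matrix_def)
  show "cont_diff k ?T (%z. ?b z $ i)"
   by (intro cont_diff_vec_nth[OF T]) (use smooth_on_frechet[OF sm[OF c(1)]] in \<open>simp add: smooth_on_def\<close>)
 next
  fix z assume z: "z : ?T"
  show "det (?A z) ~= 0" using dA_nz[OF q c(1)] z by (simp add: dA_def)
  have "fin_stab (f z)" "\<forall>\<^sub>F z in nhds z. f z : fst c" unfolding eventually_nhds using T z q by blast+
  from mcf[OF this(1) c(1) this(2) smooth_hasD[OF sm[OF c(1)] z]]
  have "Am c (snd c (f z)) (mcf f z v) = ?b z" .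
  thus "?A z *v mcf f z v = ?b z" by (simp add: complex_linear_matrix[OF Am_linear[OF c(1) ch[OF z]], symmetric])
 qed
 thus "EX T. open T & y : T & smooth_on T (%y. mcf f y v)"
  using T y c(2) by (intro exI[of _ ?T]) (simp add: smooth_on_def)
qed

lemma param_chart:
 assumes q: "fin_stab q" and ps: "lpar M (act q ` G) U ps" and y: "y : U"
 obtains c where "c : atlas M" "ps y : fst c" "\<forall>\<^sub>F z in nhds y. ps z : fst c"
  "hasD (%z. snd c (ps z)) (fd (%y. snd c (ps y)) y) y"
  "fin_stab (ps y)"
proof -
 have fs: "fin_stab (ps y)" using orbit_fin_stab[OF q] lpar_cont(2)[OF ps] y by blast
 then obtain c where c: "c : atlas M" "ps y : fst c" using charted_chart_at[OF chM] unfolding fin_stab_def by metis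
 have "open {z : U. ps z : fst c}"
  by (rule open_preimage[OF lpar_cont(1)[OF ps] lparD(1)[OF ps] chart_openin[OF chM c(1)]])
 hence "\<forall>\<^sub>F z in nhds y. ps z : fst c" unfolding eventually_nhds using y c by blast
 thus thesis using that c local_param_derivative[OF ps c(1) y c(2)] fs by blast
qed

lemma mcf_param:
 assumes q: "fin_stab q" and ps: "lpar M (act q ` G) U ps" and y: "y : U"
 shows "mcf ps y v : \<gg>" "linear (mcf ps y)" "inj (mcf ps y)"
proof -
 obtain c where c: "c : atlas M" "ps y : fst c" "\<forall>\<^sub>F z in nhds y. ps z : fst c"
  "hasD (%z. snd c (ps z)) (fd (%y. snd c (ps y)) y) y" "fin_stab (ps y)"
  using param_chart[OF q ps y] .
 show lin: "linear (mcf ps y)" by (rule mcf_linear[OF c(5,1,3,4)])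
 have qt: "q : pts M" using q by (simp add: fin_stab_def)
 have L: "ps y : act q ` G" using lpar_cont(2)[OF ps] y by blast
 obtain \<xi> where \<xi>: "!!v. \<xi> v : \<gg>" "!!v. fd (%y. snd c (ps y)) y v = Am c (snd c (ps y)) (\<xi> v)"
  using tangent_lie[OF c(5,1,2) lparD(1)[OF ps] y lpar_cont(1)[OF ps] _ refl c(4)]
   lpar_cont(2)[OF ps] orbit_eq[OF L qt] by metis
 have "mcf ps y v = \<xi> v" by (rule mcf_unique[OF c(5,1,3,4)]) (simp add: \<xi>(2))
 thus "mcf ps y v : \<gg>" using \<xi>(1) by simp
 have "inj (fd (%y. snd c (ps y)) y)" by (rule lparD(5)[OF ps c(1) y c(2)])
 thus "inj (mcf ps y)" unfolding inj_def using mcf[OF c(5,1,3,4)] by metis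
qed

lemma mcf_param_smooth:
 assumes q: "fin_stab q" and ps: "lpar M (act q ` G) U ps"
 shows "smooth_on U (%y. mcf ps y v)"
 by (rule mcf_smooth[OF lparD(1)[OF ps] lpar_cont(1)[OF ps] lparD(4)[OF ps]])
  (use orbit_fin_stab[OF q] lpar_cont(2)[OF ps] in auto)

text \<open>The Maurer-Cartan form of a parametrization in the real frame \<open>lb\<close>.\<close>

definition fr :: "(real ^ 'n => 'm) => real ^ 'n => real ^ 'n => real ^ 'n" where "fr ps y v = lbi (mcf ps y v)"
text \<open>The volume density of the orbit dual to the frame given by the action, in the parametrization \<open>ps\<close>.\<close>

definition dens where "dens ps y = \<bar>det (matrix (fr ps y))\<bar>"

lemma fr:
 assumes q: "fin_stab q" and ps: "lpar M (act q ` G) U ps" and y: "y : U"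
 shows "lb (fr ps y v) = mcf ps y v" "linear (fr ps y)" "inj (fr ps y)" "0 < dens ps y"
proof -
 note m = mcf_param[OF assms]
 show 1: "lb (fr ps y v) = mcf ps y v" for v by (simp add: fr_def lbi(2)[OF m(1)])
 show lin: "linear (fr ps y)" unfolding fr_def[abs_def] using linear_compose[OF m(2) lbi(3)] by (simp add: o_def)
 show "inj (fr ps y)" by (rule injI) (metis 1 injD[OF m(3)])
 thus "0 < dens ps y" using det_nz_iff_inj[OF lin] by (simp add: dens_def)
qed

lemma fr_smooth:
 assumes q: "fin_stab q" and ps: "lpar M (act q ` G) U ps"
 shows "smooth_on U (%y. fr ps y v)" unfolding smooth_on_def fr_def
 using cont_diff_linear[OF lparD(1)[OF ps] _ mcf_param_smooth[OF q ps, unfolded smooth_on_def, rule_format], of lbi] lbi(3)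
 by (simp add: linear_conv_bounded_linear)

lemma dens_continuous:
 assumes q: "fin_stab q" and ps: "lpar M (act q ` G) U ps"
 shows "continuous_on U (dens ps)" unfolding dens_def[abs_def] by (intro continuous_on_rabs continuous_on_det)
  (use smooth_on_continuous[OF fr_smooth[OF assms]] in "simp add: matrix_def continuous_on_component")

text \<open>Right translation by x changes the Maurer-Cartan form by Ad of the inverse of x, whose
  determinant has modulus 1. So the densities differ by the Jacobian of the parameter change alone.
  With x = 1 this is the transformation law of a density.\<close>

lemma dens_transition:
 assumes q: "fin_stab q" and ps: "lpar M (act q ` G) U ps" and ps': "lpar M (act q ` G) U' ps'"
  and x: "x : G" and um: "!!x. x : G ==> \<bar>det (matrix (%v. lbi (Ad x (lb v))))\<bar> = 1"
  and y: "y : U" "act (ps y) x : ps' ` U'"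
 obtains Q where "hasD (%y. inv_into U' ps' (act (ps y) x)) Q y"
  "dens ps y = \<bar>det (matrix Q)\<bar> * dens ps' (inv_into U' ps' (act (ps y) x))"
proof -
 let ?u = "%y. act (ps y) x" and ?\<tau> = "%y. inv_into U' ps' (act (ps y) x)" and ?ix = "kinv x"
 have xK: "x : carrier K" "?ix : G" "?ix : carrier K"
  using x G_carrier subgroup.m_inv_closed[OF subG] by auto
 obtain c where c: "c : atlas M" "ps y : fst c" "\<forall>\<^sub>F z in nhds y. ps z : fst c"
  "hasD (%z. snd c (ps z)) (fd (%y. snd c (ps y)) y) y" "fin_stab (ps y)"
  using param_chart[OF q ps y(1)] .
 define y' where "y' = ?\<tau> y"
 have y': "y' : U'" "ps' y' = ?u y" using inv_into_into[OF y(2)] f_inv_into_f[OF y(2)] by (simp_all add: y'_def)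
 obtain c' where c': "c' : atlas M" "ps' y' : fst c'" "\<forall>\<^sub>F z in nhds y'. ps' z : fst c'"
  "hasD (%z. snd c' (ps' z)) (fd (%y. snd c' (ps' y)) y') y'" "fin_stab (ps' y')"
  using param_chart[OF q ps' y'(1)] .
 have uc: "?u y : fst c'" using c'(2) y'(2) by simp
 let ?R = "Rd c c' x (snd c (ps y))"
 let ?P = "%v. ?R (fd (%y. snd c (ps y)) y v)"
 have "hasD (%z. snd c' (act (chart_inv c (snd c (ps z))) x)) ?P y"
  unfolding Rd_def using hasD_chain[OF c(4) cdiff_fd(1)[OF R_cdiff[OF c(1) c'(1) c(2) xK(1) uc]]] unfolding o_def .
 hence dP: "hasD (%z. snd c' (?u z)) ?P y"
  by (rule has_derivative_cong_nhds) (use c(3) in eventually_elim, simp add: chart_inv_chart[OF chM c(1)])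
 define S where "S = {z : U. ?u z : ps' ` U'}"
 have cu: "continuous_map (top_of_set U) (mtop M) ?u"
  by (rule continuous_act[OF lpar_cont(1)[OF ps]]) (use xK in "simp add: topN")
 have orb: "?u z : act q ` G" if "z : U" for z
 proof -
  obtain a where "a : G" "ps z = act q a" using lpar_cont(2)[OF ps] \<open>z : U\<close> by blast
  hence "?u z = act q (a \<odot> x)" "a \<odot> x : G"
   using q xK(1) x G_carrier subgroup.m_closed[OF subG] by (auto simp: act_act fin_stab_def)
  thus ?thesis by blast
 qed
 hence "continuous_map (top_of_set U) (subtopology (mtop M) (act q ` G)) ?u"
  using cu by (auto simp: cm_in_sub)
 hence S: "open S" unfolding S_def by (rule open_preimage[OF _ lparD(1)[OF ps] lparD(2)[OF ps']])
 have yS: "y : S" using y by (simp add: S_def)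
 have cuS: "continuous_map (top_of_set S) (mtop M) ?u"
  by (rule continuous_map_from_subtopology_mono[OF cu]) (auto simp: S_def)
 obtain Q where Q: "hasD ?\<tau> Q y"
  "!!v. fd (%y. snd c' (ps' y)) (?\<tau> y) (Q v) = ?P v"
  by (rule param_lift[OF chM ps' S yS cuS _ c'(1) uc dP]) (use S_def in auto)
 \<comment> \<open>Both sides come from the differential of y |-> ps y x. The infinitesimal action
   at the translated point is the translate of that at ps y, twisted by Ad x.\<close>
 have key: "mcf ps' y' (Q v) = Ad ?ix (mcf ps y v)" for v
 proof (rule mcf_unique[OF c'(5,1,3,4)])
  have "Am c' (snd c' (?u y)) (Ad ?ix (mcf ps y v)) = ?R (Am c (snd c (ps y)) (Ad x (Ad ?ix (mcf ps y v))))"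
   by (rule Am_right[OF c(1) c'(1) c(2) xK(1) uc])
  also have "Ad x (Ad ?ix (mcf ps y v)) = mcf ps y v" using xK by (simp add: Ad_mult[symmetric] Ad_one)
  also have "?R (Am c (snd c (ps y)) (mcf ps y v)) = ?P v" by (simp add: mcf[OF c(5,1,3,4)])
  also have "... = fd (%y. snd c' (ps' y)) y' (Q v)" using Q(2) by (simp add: y'_def)
  finally show "Am c' (snd c' (ps' y')) (Ad ?ix (mcf ps y v)) = fd (%y. snd c' (ps' y)) y' (Q v)"
   by (simp add: y'(2))
 qed
 let ?Ad = "%v. lbi (Ad ?ix (lb v))"
 have eq: "(%v. fr ps' y' (Q v)) = (%v. ?Ad (fr ps y v))"
  by (simp add: fun_eq_iff fr(1)[OF q ps y(1)]) (simp add: fr_def key)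
 have lAd: "linear ?Ad"
  using linear_compose[OF linear_compose[OF lb(1)] lbi(3)] Ad_linear[OF xK(3)] by (simp add: o_def clin_def)
 have "matrix (fr ps' y') ** matrix Q = matrix ?Ad ** matrix (fr ps y)"
  using matrix_compose[OF has_derivative_linear[OF Q(1)] fr(2)[OF q ps' y'(1)]] matrix_compose[OF fr(2)[OF q ps y(1)] lAd]
  by (simp add: o_def eq)
 hence "det (matrix (fr ps' y')) * det (matrix Q) = det (matrix ?Ad) * det (matrix (fr ps y))"
  by (metis det_mul)
 from arg_cong[OF this, of abs] have "dens ps' y' * \<bar>det (matrix Q)\<bar> = dens ps y"
  using um[OF xK(2)] by (simp add: abs_mult dens_def)
 thus thesis using that[OF Q(1)] by (simp add: y'_def mult.commute)
qed

end

section \<open>Invariance of the volume of an orbit\<close>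

lemma borel_preimage_on_open:
 fixes \<tau> :: "'a::euclidean_space => 'b::euclidean_space"
 assumes "open S" "continuous_on S \<tau>" "B : sets borel"
 shows "{y : S. \<tau> y : B} : sets borel"
proof -
 have "\<tau> -` B \<inter> space (restrict_space borel S) : sets (restrict_space borel S)"
  by (rule measurable_sets[OF borel_measurable_continuous_on_restrict[OF assms(2)] assms(3)])
 moreover have "\<tau> -` B \<inter> space (restrict_space borel S) = {y : S. \<tau> y : B}" by (auto simp: space_restrict_space)
 ultimately show ?thesis using assms(1) by (simp add: sets_restrict_space_iff)
qed

lemma param_decompositionD:
 assumes "param_decomposition N L \<D>"
 shows "finite \<D>" "(U, ps, B) : \<D> ==> lpar N L U ps" "(U, ps, B) : \<D> ==> B : sets borel"
  "(U, ps, B) : \<D> ==> bounded B" "(U, ps, B) : \<D> ==> closure B \<subseteq> U" "(U, ps, B) : \<D> ==> B \<subseteq> U"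
  "(U, ps, B) : \<D> ==> (U', ps', B') : \<D> ==> l : ps ` B ==> l : ps' ` B' ==> (U, ps, B) = (U', ps', B')"
  "l : L ==> EX U ps B. (U, ps, B) : \<D> & l : ps ` B"
proof -
 note a = assms[unfolded param_decomposition_def disjoint_family_on_def]
 show "finite \<D>" using a by blast
 assume e: "(U, ps, B) : \<D>"
 have e': "lpar N L U ps & B : sets borel & bounded B & closure B \<subseteq> U" using a e by auto
 thus "lpar N L U ps" "B : sets borel" "bounded B" "closure B \<subseteq> U" by auto
 thus "B \<subseteq> U" using closure_subset by blast
 assume "(U', ps', B') : \<D>" "l : ps ` B" "l : ps' ` B'"
 moreover have "(U, ps, B) ~= (U', ps', B') --> (case (U, ps, B) of (U, ps, B) => ps ` B) \<inter> (case (U', ps', B') of (U, ps, B) => ps ` B) = {}"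
  by (rule bspec[OF bspec[OF a[THEN conjunct2, THEN conjunct2, THEN conjunct1] e] \<open>(U', ps', B') : \<D>\<close>])
 ultimately show "(U, ps, B) = (U', ps', B')" unfolding prod.case by blast
next
 assume "l : L"
 hence "l : (\<Union>(U, ps, B)\<in>\<D>. ps ` B)" using assms by (simp add: param_decomposition_def)
 thus "EX U ps B. (U, ps, B) : \<D> & l : ps ` B" by force
qed

text \<open>Dominated convergence: on the bounded set B the difference quotients are bounded by the
  constant C, which is integrable there.\<close>

lemma bounded_piece_integral_derivative:
 fixes k :: "real => real ^ 'n => real"
 assumes \<epsilon>: "0 < \<epsilon>" and B: "B : sets borel" "bounded B" "closure B \<subseteq> U"
  and D: "!!t y. \<bar>t\<bar> < \<epsilon> ==> y : B ==> hasR (%t. k t y) (k' t y) t"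
  and k: "!!t. \<bar>t\<bar> < \<epsilon> ==> continuous_on U (k t)" and k': "continuous_on U (k' 0)"
  and C: "!!t y. \<bar>t\<bar> < \<epsilon> ==> y : B ==> \<bar>k' t y\<bar> <= C"
 shows "hasR (%t. LINT y:B|lborel. k t y) (LINT y:B|lborel. k' 0 y) 0"
proof -
 have int: "set_integrable lborel B (k t)" if "\<bar>t\<bar> < \<epsilon>" for t
  by (rule integrable_bounded_piece[OF k[OF that] B(2,3,1)]) simp
 have int': "set_integrable lborel B (k' 0)" by (rule integrable_bounded_piece[OF k' B(2,3,1)]) simp
 have intC: "set_integrable lborel B (%y. C)" by (rule integrable_bounded_piece[OF continuous_on_const B(2,3,1)]) simp
 have lip: "\<bar>(k t y - k 0 y) / t\<bar> <= C" if t: "\<bar>t\<bar> < \<epsilon>" "t ~= 0" and y: "y : B" for t y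
 proof -
  have "norm (k t y - k 0 y) <= C * norm (t - 0)"
   by (rule field_differentiable_bound[of "{-\<bar>t\<bar>..\<bar>t\<bar>}" "%t. k t y" "%t. k' t y"])
    (use t y in "auto intro!: has_field_derivative_at_within[OF D] C")
  thus ?thesis using t(2) by (simp add: abs_divide divide_le_eq)
 qed
 have "((%t. ((LINT y:B|lborel. k t y) - (LINT y:B|lborel. k 0 y)) / (t - 0)) \<longlongrightarrow> (LINT y:B|lborel. k' 0 y)) (at 0)"
  unfolding tendsto_at_iff_sequentially
 proof (intro allI impI)
  fix X :: "nat => real" assume X: "ALL i. X i : UNIV - {0}" "X \<longlonglongrightarrow> 0"
  have "\<forall>\<^sub>F i in sequentially. \<bar>X i\<bar> < \<epsilon>"
   using tendstoD[OF X(2) \<epsilon>] by (simp add: dist_real_def)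
  \<comment> \<open>Drop the first terms of the sequence, since the bounds hold for parameters below
    \<epsilon> only.\<close>
  then obtain n where n: "!!i. \<bar>X (i + n)\<bar> < \<epsilon>" unfolding eventually_sequentially by (metis le_add2)
  have X0: "X i ~= 0" for i using X(1) by auto
  let ?s = "%i y. indicator B y *R ((k (X (i + n)) y - k 0 y) / X (i + n))"
  have intq: "set_integrable lborel B (%y. (k (X (i + n)) y - k 0 y) / X (i + n))" for i
   using set_integral_diff(1)[OF int[OF n] int[of 0]] \<epsilon> by (intro set_integrable_divide) auto
  have lim: "(%i. integral\<^sup>L lborel (?s i)) \<longlonglongrightarrow> integral\<^sup>L lborel (%y. indicator B y *R k' 0 y)"
  proof (rule integral_dominated_convergence[where w = "%y. indicator B y *R C"])
   show "(%y. indicator B y *R k' 0 y) : borel_measurable lborel"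
    using int' by (simp add: set_integrable_def borel_measurable_integrable)
   show "?s i : borel_measurable lborel" for i
    using intq by (simp add: set_integrable_def borel_measurable_integrable)
   show "integrable lborel (%y. indicator B y *R C)" using intC by (simp add: set_integrable_def)
   have "(%i. ?s i y) \<longlonglongrightarrow> indicator B y *R k' 0 y" for y
   proof (cases "y : B")
    case True
    have "((%t. (k t y - k 0 y) / (t - 0)) \<longlongrightarrow> k' 0 y) (at 0)"
     using D[of 0 y] True \<epsilon> by (simp add: has_field_derivative_iff)
    hence "(%i. (k (X i) y - k 0 y) / X i) \<longlonglongrightarrow> k' 0 y"
     unfolding tendsto_at_iff_sequentially using X by (simp add: o_def)
    from LIMSEQ_ignore_initial_segment[OF this, of n] show ?thesis using True by simp
   qed simp
   thus "AE y in lborel. (%i. ?s i y) \<longlonglongrightarrow> indicator B y *R k' 0 y" by simp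
   have "norm (?s i y) <= indicator B y *R C" for i y using lip[OF n X0] by (simp add: indicator_def)
   thus "AE y in lborel. norm (?s i y) <= indicator B y *R C" for i by simp
  qed
  have eq: "integral\<^sup>L lborel (?s i) = ((LINT y:B|lborel. k (X (i + n)) y) - (LINT y:B|lborel. k 0 y)) / (X (i + n) - 0)" for i
  proof -
   have "integral\<^sup>L lborel (?s i) = (LINT y:B|lborel. (k (X (i + n)) y - k 0 y) / X (i + n))"
    by (simp add: set_lebesgue_integral_def)
   also have "... = (LINT y:B|lborel. k (X (i + n)) y - k 0 y) / X (i + n)" by (rule set_integral_divide_zero)
   finally show ?thesis using set_integral_diff(2)[OF int[OF n] int[of 0]] \<epsilon> by simp
  qed
  have "(%i. ((LINT y:B|lborel. k (X (i + n)) y) - (LINT y:B|lborel. k 0 y)) / (X (i + n) - 0)) \<longlonglongrightarrow> (LINT y:B|lborel. k' 0 y)"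
   using lim unfolding eq set_lebesgue_integral_def[where f = "k' 0"] .
  thus "((%t. ((LINT y:B|lborel. k t y) - (LINT y:B|lborel. k 0 y)) / (t - 0)) \<circ> X) \<longlonglongrightarrow> (LINT y:B|lborel. k' 0 y)"
   unfolding o_def by (rule LIMSEQ_offset)
 qed
 thus ?thesis by (simp add: has_field_derivative_iff)
qed

text \<open>An orbit with one fixed decomposition. The invariance results below hold for each such
  choice, in particular for the one made inside \<open>jvol\<close>.\<close>

locale orbint = corb K N G M act
 for K :: "'k monoid" and N :: "('k, complex ^ 'n) cmfd" and G :: "'k set"
  and M :: "('m, complex ^ 'n) cmfd" and act :: "'m => 'k => 'm" +
 fixes q :: 'm and \<D> :: "((real ^ 'n) set \<times> (real ^ 'n => 'm) \<times> (real ^ 'n) set) set"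
 assumes fsq: "fin_stab q" and dec: "param_decomposition M (act q ` G) \<D>"
  and unimod: "!!x. x : G ==> \<bar>det (matrix (%v. lbi (Ad x (lb v))))\<bar> = 1"
begin

abbreviation L where "L \<equiv> act q ` G"

lemma qt: "q : pts M" using fsq by (simp add: fin_stab_def)

lemma L_act: "l : L ==> x : G ==> act l x : L"
proof -
 assume "l : L" "x : G"
 then obtain a where "a : G" "l = act q a" by blast
 hence "act l x = act q (a \<odot> x)" "a \<odot> x : G"
  using qt \<open>x : G\<close> G_carrier subgroup.m_closed[OF subG] by (auto simp: act_act)
 thus ?thesis by blast
qed

lemma L_top: "l : L ==> l : pts M" using act_closed[OF qt G_carrier] by blast

lemma L_act_inv: "l : L ==> x : G ==> act (act l x) (kinv x) = l" "l : L ==> x : G ==> act (act l (kinv x)) x = l"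
 using L_top G_carrier by (simp_all add: act_act act_one)

abbreviation contL :: "('m => real) => bool" where "contL h \<equiv> continuous_map (subtopology (mtop M) L) euclideanreal h"

lemma contL_act: "contL h ==> x : G ==> contL (%l. h (act l x))"
proof -
 assume h: "contL h" and x: "x : G"
 have "continuous_map (subtopology (mtop M) L) (mtop M) (%l. act l x)"
  by (rule continuous_act) (use x G_carrier in "auto simp: topN continuous_map_from_subtopology")
 hence "continuous_map (subtopology (mtop M) L) (subtopology (mtop M) L) (%l. act l x)"
  using L_act x by (auto simp: cm_in_sub)
 from cm_compose[OF this h] show ?thesis unfolding o_def .
qed

lemma contL_param: "contL h ==> lpar M L U ps ==> continuous_on U (%y. h (ps y))"
proof -
 assume h: "contL h" and ps: "lpar M L U ps"
 have "continuous_map (top_of_set U) (subtopology (mtop M) L) ps"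
  using lpar_cont(1,2)[OF ps] by (auto simp: cm_in_sub)
 from cm_compose[OF this h] show ?thesis by (simp add: o_def)
qed

lemma contL_bounded: "contL h ==> EX C. ALL l:L. \<bar>h l\<bar> <= C"
proof -
 assume h: "contL h"
 have "compactin (subtopology (mtop M) L) L" using compactin_orbit[OF qt] by (simp add: compactin_subtopology)
 from image_compactin[OF this h] have "bounded (h ` L)" by (simp add: compact_imp_bounded)
 thus ?thesis by (auto simp: bounded_iff)
qed

lemma integrable_piece:
 assumes h: "contL h" and e: "(U, ps, B) : \<D>" and T: "T : sets borel" "T \<subseteq> B"
 shows "set_integrable lborel T (%y. h (ps y) * dens ps y)"
proof -
 note d = param_decompositionD[OF dec]
 show ?thesis by (rule integrable_bounded_piece[OF _ d(4)[OF e] d(5)[OF e] T])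
   (intro continuous_on_mult contL_param[OF h] dens_continuous[OF fsq] d(2)[OF e])
qed

text \<open>The integral over the orbit against the density \<open>dens\<close>. When the action is
  right multiplication of the group and the orbit is G, this is a Haar integral, by
  \<open>Jint_act\<close>.\<close>

definition Jint where "Jint h = (\<Sum>(U, ps, B)\<in>\<D>. LINT y:B|lborel. h (ps y) * dens ps y)"

lemma piece_borel:
 assumes e: "(U, ps, B) : \<D>" "(U', ps', B') : \<D>" and x: "x : G"
 shows "{y : B. act (ps y) x : ps' ` B'} : sets borel"
  and "open {y : U. act (ps y) x : ps' ` U'}"
proof -
 note d = param_decompositionD[OF dec]
 note ps = d(2)[OF e(1)] and ps' = d(2)[OF e(2)]
 have cu: "continuous_map (top_of_set U) (mtop M) (%y. act (ps y) x)"
  by (rule continuous_act[OF lpar_cont(1)[OF ps]]) (use x G_carrier in "simp add: topN")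
 have "continuous_map (top_of_set U) (subtopology (mtop M) L) (%y. act (ps y) x)"
  using cu L_act[OF _ x] lpar_cont(2)[OF ps] by (auto simp: cm_in_sub)
 thus S: "open {y : U. act (ps y) x : ps' ` U'}" (is "open ?S")
  by (rule open_preimage[OF _ lparD(1)[OF ps] lparD(2)[OF ps']])
 have c\<tau>: "continuous_on ?S (%y. inv_into U' ps' (act (ps y) x))"
  by (rule param_lift_continuous[OF ps' continuous_map_from_subtopology_mono[OF cu]]) auto
 have "{y : B. act (ps y) x : ps' ` B'} = B \<inter> {y : ?S. inv_into U' ps' (act (ps y) x) : B'}"
 proof (intro equalityI subsetI)
  fix y assume "y : {y : B. act (ps y) x : ps' ` B'}"
  then obtain z where z: "y : B" "z : B'" "act (ps y) x = ps' z" by blast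
  have "z : U'" "y : U" using z d(6)[OF e(1)] d(6)[OF e(2)] by auto
  thus "y : B \<inter> {y : ?S. inv_into U' ps' (act (ps y) x) : B'}"
   using z inv_into_f_f[OF lpar_cont(4)[OF ps']] by simp
 next
  fix y assume "y : B \<inter> {y : ?S. inv_into U' ps' (act (ps y) x) : B'}"
  hence y: "y : B" "act (ps y) x : ps' ` U'" "inv_into U' ps' (act (ps y) x) : B'" by auto
  from imageI[OF y(3), of ps'] f_inv_into_f[OF y(2)] have "act (ps y) x : ps' ` B'" by simp
  thus "y : {y : B. act (ps y) x : ps' ` B'}" using y(1) by blast
 qed
 thus "{y : B. act (ps y) x : ps' ` B'} : sets borel"
  using borel_preimage_on_open[OF S c\<tau> d(3)[OF e(2)]] d(3)[OF e(1)] by simp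
qed

lemma integral_piece_split:
 fixes k :: "real ^ 'n => real"
 assumes k: "set_integrable lborel B k" and e: "(U, ps, B) : \<D>" and x: "x : G"
 shows "(LINT y:B|lborel. k y) = (\<Sum>(U', ps', B')\<in>\<D>. LINT y:{y : B. act (ps y) x : ps' ` B'}|lborel. k y)"
proof -
 note d = param_decompositionD[OF dec]
 define A where "A e' = {y : B. act (ps y) x : fst (snd e') ` snd (snd e')}"
  for e' :: "(real ^ 'n) set \<times> (real ^ 'n => 'm) \<times> (real ^ 'n) set"
 have mA: "A e' : sets lborel" if "e' : \<D>" for e'
  using piece_borel(1)[OF e _ x, of "fst e'" "fst (snd e')" "snd (snd e')"] that by (simp add: A_def)
 have "B = (\<Union>e'\<in>\<D>. A e')"
 proof (intro equalityI subsetI)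
  fix y assume y: "y : B"
  hence "ps y : L" using lpar_cont(2)[OF d(2)[OF e]] d(6)[OF e] by blast
  then obtain U' ps' B' where "(U', ps', B') : \<D>" "act (ps y) x : ps' ` B'" using d(8)[OF L_act[OF _ x]] by metis
  thus "y : (\<Union>e'\<in>\<D>. A e')" using y by (intro UN_I[of "(U', ps', B')"]) (auto simp: A_def)
 qed (auto simp: A_def)
 hence "(LINT y:B|lborel. k y) = (LINT y:(\<Union>e'\<in>\<D>. A e')|lborel. k y)" by simp
 also have "... = (\<Sum>e'\<in>\<D>. LINT y:A e'|lborel. k y)"
 proof (rule set_integral_finite_Union[OF d(1)])
  show "disjoint_family_on A \<D>" unfolding disjoint_family_on_def
  proof (intro ballI impI)
   fix m n assume mn: "m : \<D>" "n : \<D>" "m ~= n"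
   hence "l \<notin> fst (snd n) ` snd (snd n)" if "l : fst (snd m) ` snd (snd m)" for l
    using d(7)[of "fst m" "fst (snd m)" "snd (snd m)" "fst n" "fst (snd n)" "snd (snd n)" l] that by (auto simp: prod_eq_iff)
   thus "A m \<inter> A n = {}" unfolding A_def by blast
  qed
  show "set_integrable lborel (A e') k" if "e' : \<D>" for e'
   by (rule set_integrable_subset[OF k mA[OF that]]) (simp add: A_def)
 qed (rule mA)
 finally show ?thesis by (simp add: A_def case_prod_unfold)
qed

text \<open>The change of parameters y |-> (ps')^-1 (ps y x) is a bijection between the two sets;
  its inverse is built from the translation by the inverse of x, and \<open>dens_transition\<close>
  supplies the Jacobian.\<close>

lemma integral_piece_transition:
 assumes h: "contL h" and e: "(U, ps, B) : \<D>" "(U', ps', B') : \<D>" and x: "x : G"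
 shows "(LINT y:{y : B. act (ps y) x : ps' ` B'}|lborel. h (act (ps y) x) * dens ps y) =
  (LINT z:{z : B'. act (ps' z) (kinv x) : ps ` B}|lborel. h (ps' z) * dens ps' z)"
proof -
 note d = param_decompositionD[OF dec]
 note ps = d(2)[OF e(1)] and ps' = d(2)[OF e(2)]
 have ix: "kinv x : G" using x subgroup.m_inv_closed[OF subG] by blast
 let ?S = "{y : B. act (ps y) x : ps' ` B'}" and ?T = "{z : B'. act (ps' z) (kinv x) : ps ` B}"
 let ?\<tau> = "%y. inv_into U' ps' (act (ps y) x)"
 have psL: "ps y : L" if "y : B" for y using that lpar_cont(2)[OF ps] d(6)[OF e(1)] by blast
 have ps'L: "ps' y : L" if "y : B'" for y using that lpar_cont(2)[OF ps'] d(6)[OF e(2)] by blast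
 have \<tau>: "?\<tau> y : B' & ps' (?\<tau> y) = act (ps y) x" if y: "y : ?S" for y
 proof -
  obtain z where z: "z : B'" "act (ps y) x = ps' z" using y by blast
  hence "?\<tau> y = z" using inv_into_f_f[OF lpar_cont(4)[OF ps']] d(6)[OF e(2)] by auto
  with z show ?thesis by simp
 qed
 have inj: "inj_on ?\<tau> ?S"
 proof (rule inj_onI)
  fix a b assume a: "a : ?S" and b: "b : ?S" and ab: "?\<tau> a = ?\<tau> b"
  hence "act (ps a) x = act (ps b) x" using \<tau>[OF a] \<tau>[OF b] by metis
  hence "ps a = ps b" using L_act_inv(1)[OF psL x] a b by (metis (no_types, lifting) mem_Collect_eq)
  thus "a = b" using inj_onD[OF lpar_cont(4)[OF ps]] a b d(6)[OF e(1)] by blast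
 qed
 have img: "?\<tau> ` ?S = ?T"
 proof (intro equalityI subsetI)
  fix z assume "z : ?\<tau> ` ?S"
  then obtain y where y: "y : ?S" "z = ?\<tau> y" by blast
  hence "act (ps' z) (kinv x) = ps y" using \<tau>[OF y(1)] L_act_inv(1)[OF psL x] by simp
  thus "z : ?T" using y \<tau>[OF y(1)] by auto
 next
  fix z assume z: "z : ?T"
  then obtain y where y: "y : B" "act (ps' z) (kinv x) = ps y" by blast
  hence eq: "act (ps y) x = ps' z" using L_act_inv(2)[OF ps'L x, of z] z by simp
  hence "y : ?S" using y z by blast
  moreover have "?\<tau> y = z" using eq inv_into_f_f[OF lpar_cont(4)[OF ps']] d(6)[OF e(2)] z by auto
  ultimately show "z : ?\<tau> ` ?S" by blast
 qed
 have "EX Q. y : ?S --> hasD ?\<tau> Q y & dens ps y = \<bar>det (matrix Q)\<bar> * dens ps' (?\<tau> y)" for y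
 proof (cases "y : ?S")
  case True
  hence "y : U" "act (ps y) x : ps' ` U'" using d(6)[OF e(1)] d(6)[OF e(2)] by blast+
  note y = this
  obtain Q where "hasD ?\<tau> Q y" "dens ps y = \<bar>det (matrix Q)\<bar> * dens ps' (?\<tau> y)"
   by (rule dens_transition[OF fsq ps ps' x _ y]) (rule unimod, assumption, rule that)
  thus ?thesis by (intro exI[of _ Q] impI conjI)
 qed blast
 hence "ALL y. EX Q. y : ?S --> hasD ?\<tau> Q y & dens ps y = \<bar>det (matrix Q)\<bar> * dens ps' (?\<tau> y)" ..
 from choice[OF this] obtain Q where
  QQ: "ALL y. y : ?S --> hasD ?\<tau> (Q y) y & dens ps y = \<bar>det (matrix (Q y))\<bar> * dens ps' (?\<tau> y)" ..
 have Q: "hasD ?\<tau> (Q y) y" "dens ps y = \<bar>det (matrix (Q y))\<bar> * dens ps' (?\<tau> y)" if "y : ?S" for y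
  using QQ[rule_format, OF that] by blast+
 have "(LINT y:?S|lborel. h (act (ps y) x) * dens ps y) = (LINT z:?\<tau> ` ?S|lborel. h (ps' z) * dens ps' z)"
 proof (rule set_integral_change_of_variables[OF piece_borel(1)[OF e x] _ Q(1) inj])
  show "?\<tau> ` ?S : sets borel" unfolding img by (rule piece_borel(1)[OF e(2,1) ix])
  show "set_integrable lborel (?\<tau> ` ?S) (%z. h (ps' z) * dens ps' z)"
   unfolding img by (rule integrable_piece[OF h e(2) piece_borel(1)[OF e(2,1) ix]]) auto
  show "set_integrable lborel ?S (%y. h (act (ps y) x) * dens ps y)"
   by (rule integrable_piece[OF contL_act[OF h x] e(1) piece_borel(1)[OF e x]]) auto
  show "h (act (ps y) x) * dens ps y = \<bar>det (matrix (Q y))\<bar> * (h (ps' (?\<tau> y)) * dens ps' (?\<tau> y))" if "y : ?S" for y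
   using Q(2)[OF that] \<tau>[OF that] by simp
 qed
 thus ?thesis unfolding img .
qed

text \<open>Every piece is cut according to the piece in which the translated point lies. A change
  of variables on each intersection and an interchange of the two sums reassemble the pieces for the
  inverse translation.\<close>

lemma Jint_act:
 assumes h: "contL h" and x: "x : G"
 shows "Jint (%l. h (act l x)) = Jint h"
proof -
 note d = param_decompositionD[OF dec]
 have ix: "kinv x : G" using x subgroup.m_inv_closed[OF subG] by blast
 let ?S = "%e x e'. {y : snd (snd e). act (fst (snd e) y) x : fst (snd e') ` snd (snd e')}"
 have "Jint (%l. h (act l x)) = (\<Sum>e\<in>\<D>. \<Sum>e'\<in>\<D>. LINT y:?S e x e'|lborel. h (act (fst (snd e) y) x) * dens (fst (snd e)) y)"
  unfolding Jint_def case_prod_unfold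
 proof (rule sum.cong[OF refl])
  fix e assume "e : \<D>"
  hence e: "(fst e, fst (snd e), snd (snd e)) : \<D>" by simp
  show "(LINT y:snd (snd e)|lborel. h (act (fst (snd e) y) x) * dens (fst (snd e)) y) =
    (\<Sum>e'\<in>\<D>. LINT y:?S e x e'|lborel. h (act (fst (snd e) y) x) * dens (fst (snd e)) y)"
   using integral_piece_split[OF integrable_piece[OF contL_act[OF h x] e d(3)[OF e]] e x] by (simp add: case_prod_unfold)
 qed
 also have "... = (\<Sum>e\<in>\<D>. \<Sum>e'\<in>\<D>. LINT z:?S e' (kinv x) e|lborel. h (fst (snd e') z) * dens (fst (snd e')) z)"
 proof (intro sum.cong refl)
  fix e e' assume "e : \<D>" "e' : \<D>"
  hence e: "(fst e, fst (snd e), snd (snd e)) : \<D>" "(fst e', fst (snd e'), snd (snd e')) : \<D>" by simp_all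
  show "(LINT y:?S e x e'|lborel. h (act (fst (snd e) y) x) * dens (fst (snd e)) y) =
   (LINT z:?S e' (kinv x) e|lborel. h (fst (snd e') z) * dens (fst (snd e')) z)"
   by (rule integral_piece_transition[OF h e x])
 qed
 also have "... = (\<Sum>e'\<in>\<D>. \<Sum>e\<in>\<D>. LINT z:?S e' (kinv x) e|lborel. h (fst (snd e') z) * dens (fst (snd e')) z)"
  by (rule sum.swap)
 also have "... = Jint h" unfolding Jint_def case_prod_unfold
 proof (rule sum.cong[OF refl])
  fix e assume "e : \<D>"
  hence e: "(fst e, fst (snd e), snd (snd e)) : \<D>" by simp
  show "(\<Sum>e'\<in>\<D>. LINT y:?S e (kinv x) e'|lborel. h (fst (snd e) y) * dens (fst (snd e)) y) =
    (LINT y:snd (snd e)|lborel. h (fst (snd e) y) * dens (fst (snd e)) y)"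
   using integral_piece_split[OF integrable_piece[OF h e d(3)[OF e]] e ix] by (simp add: case_prod_unfold)
 qed
 finally show ?thesis .
qed

text \<open>The integral of l |-> h (l exp (sX)) does not depend on s, so its derivative at 0, taken
  under the integral, vanishes.\<close>

lemma Jint_derivative_zero:
 assumes h: "contL h" and h': "contL h'" and X: "X : \<gg>"
  and D: "!!l. l : L ==> hasR (%s. h (act l (Exp (s *R X)))) (h' l) 0"
 shows "Jint h' = 0"
proof -
 note d = param_decompositionD[OF dec]
 obtain C where C: "!!l. l : L ==> \<bar>h' l\<bar> <= C" using contL_bounded[OF h'] by blast
 \<comment> \<open>The derivative at a general parameter s is the one at 0, taken at the point l exp
   (sX), which is again on the orbit.\<close>
 have Ds: "hasR (%s. h (act l (Exp (s *R X)))) (h' (act l (Exp (s *R X)))) s" if l: "l : L" for l s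
 proof -
  have "act (act l (Exp (s *R X))) (Exp (r *R X)) = act l (Exp ((r + s) *R X))" for r
   using L_top[OF l] Exp_add[of s r X] by (simp add: act_act add.commute)
  hence "hasR (%r. h (act l (Exp ((r + s) *R X)))) (h' (act l (Exp (s *R X)))) 0"
   using D[OF L_act[OF l Exp_G[OF X]], of s] by simp
  thus ?thesis using DERIV_shift[of "%s. h (act l (Exp (s *R X)))" _ 0 s] by simp
 qed
 have "hasR (%s. Jint (%l. h (act l (Exp (s *R X))))) (Jint h') 0"
  unfolding Jint_def case_prod_unfold
 proof (rule DERIV_sum)
  fix e assume "e : \<D>"
  hence e: "(fst e, fst (snd e), snd (snd e)) : \<D>" by simp
  let ?U = "fst e" and ?ps = "fst (snd e)" and ?B = "snd (snd e)"
  note ps = d(2)[OF e]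
  have psL: "?ps y : L" if "y : ?U" for y using that lpar_cont(2)[OF ps] by blast
  have BU: "y : ?U" if "y : ?B" for y using that d(6)[OF e] by blast
  have "compact (closure ?B)" using d(4)[OF e] by (simp add: compact_closure)
  from compact_imp_bounded[OF compact_continuous_image[OF continuous_on_subset[OF dens_continuous[OF fsq ps] d(5)[OF e]] this]]
  obtain C' where C'': "ALL z:dens ?ps ` closure ?B. norm z <= C'" unfolding bounded_iff by blast
  have C': "dens ?ps y <= C'" if "y : closure ?B" for y using bspec[OF C'' imageI[OF that]] by simp
  have "hasR (%s. LINT y:?B|lborel. h (act (?ps y) (Exp (s *R X))) * dens ?ps y) (LINT y:?B|lborel. h' (act (?ps y) (Exp (0 *R X))) * dens ?ps y) 0"
  proof (rule bounded_piece_integral_derivative[OF zero_less_one d(3-5)[OF e], where C = "C * C'"])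
   fix t :: real
   show "continuous_on ?U (%y. h (act (?ps y) (Exp (t *R X))) * dens ?ps y)"
    by (intro continuous_on_mult contL_param[OF contL_act[OF h Exp_G[OF X]]] dens_continuous[OF fsq] ps)
   show "continuous_on ?U (%y. h' (act (?ps y) (Exp (0 *R X))) * dens ?ps y)"
    by (intro continuous_on_mult contL_param[OF contL_act[OF h' Exp_G[OF X]]] dens_continuous[OF fsq] ps)
   fix y assume y: "y : ?B"
   show "hasR (%s. h (act (?ps y) (Exp (s *R X))) * dens ?ps y) (h' (act (?ps y) (Exp (t *R X))) * dens ?ps y) t"
    using DERIV_cmult_right[OF Ds[OF psL[OF BU[OF y]]]] .
   have "\<bar>h' (act (?ps y) (Exp (t *R X)))\<bar> <= C" by (rule C[OF L_act[OF psL[OF BU[OF y]] Exp_G[OF X]]])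
   moreover have "0 < dens ?ps y" "dens ?ps y <= C'"
    using fr(4)[OF fsq ps BU[OF y]] C' closure_subset y by blast+
   ultimately show "\<bar>h' (act (?ps y) (Exp (t *R X))) * dens ?ps y\<bar> <= C * C'"
    unfolding abs_mult by (intro mult_mono) auto
  qed
  moreover have "(LINT y:?B|lborel. h' (act (?ps y) (Exp (0 *R X))) * dens ?ps y) = (LINT y:?B|lborel. h' (?ps y) * dens ?ps y)"
   by (rule set_lebesgue_integral_cong) (use d(3)[OF e] L_top[OF psL[OF BU]] in \<open>auto simp: act_one\<close>)
  ultimately show "hasR (%s. LINT y:?B|lborel. h (act (?ps y) (Exp (s *R X))) * dens ?ps y) (LINT y:?B|lborel. h' (?ps y) * dens ?ps y) 0" by simp
 qed
 hence "hasR (%s. Jint h) (Jint h') 0" by (simp add: Jint_act[OF h Exp_G[OF X]])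
 thus ?thesis using DERIV_unique[OF _ DERIV_const] by blast
qed

text \<open>The density is positive, so a zero integral would make every piece a null set. Then a
  nonempty open parameter domain would be covered by finitely many differentiable images of null
  sets.\<close>

lemma Jint_one_pos: "0 < Jint (%_. 1)"
proof -
 note d = param_decompositionD[OF dec]
 have nn: "0 <= (LINT y:B|lborel. 1 * dens ps y)" for B ps
  unfolding set_lebesgue_integral_def by (rule integral_nonneg_AE) (auto simp: dens_def)
 have "0 <= Jint (%_. 1)" unfolding Jint_def by (rule sum_nonneg) (simp only: case_prod_unfold nn)
 moreover have "Jint (%_. 1) ~= 0"
 proof
  assume "Jint (%_. 1) = 0"
  hence z: "(LINT y:B|lborel. 1 * dens ps y) = 0" if "(U, ps, B) : \<D>" for U ps B
   using that unfolding Jint_def by (subst (asm) sum_nonneg_eq_0_iff[OF d(1)]) (auto simp only: case_prod_unfold nn prod.sel)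
  have null: "negligible B" if e: "(U, ps, B) : \<D>" for U ps B
  proof -
   have "integrable lborel (%y. indicator B y *R (1 * dens ps y))"
    using integrable_piece[of "%_. 1", OF _ e d(3)[OF e]] by (simp add: set_integrable_def)
   hence "AE y in lborel. indicator B y *R (1 * dens ps y) = 0"
    using z[OF e] unfolding set_lebesgue_integral_def
    by (subst (asm) integral_nonneg_eq_0_iff_AE) (auto simp: dens_def)
   hence "AE y in lborel. y \<notin> B"
    by eventually_elim (use fr(4)[OF fsq d(2)[OF e]] d(6)[OF e] in \<open>force simp: indicator_def split: if_splits\<close>)
   hence "B : null_sets lborel" using d(3)[OF e] by (simp add: AE_iff_null_sets)
   thus ?thesis by (simp add: negligible_iff_null_sets null_sets_completionI)
  qed
  obtain U0 where U0: "lpar M L U0 (%a. act q (Exp (lb a)))" "0 : U0" using param_exists[OF fsq] by blast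
  let ?ps = "%a. act q (Exp (lb a))"
  \<comment> \<open>Parameter changes from the pieces to one parametrization around q. Acting by the
    identity element puts them in the form of \<open>dens_transition\<close>, which yields their
    differentiability.\<close>
  let ?W = "%(U, ps, B). (%y. inv_into U0 ?ps (act (ps y) kone)) ` {y : B. act (ps y) kone : ?ps ` U0}"
  have "negligible (?W e)" if eD: "e : \<D>" for e
  proof -
   obtain U ps B where e: "(U, ps, B) : \<D>" "e = (U, ps, B)" using eD by (cases e) auto
   let ?S = "{y : B. act (ps y) kone : ?ps ` U0}"
   have "negligible ?S" by (rule negligible_subset[OF null[OF e(1)]]) blast
   moreover have "(%y. inv_into U0 ?ps (act (ps y) kone)) differentiable_on ?S"
    unfolding differentiable_on_def
   proof
    fix y assume "y : ?S"
    hence "y : U" "act (ps y) kone : ?ps ` U0" using d(6)[OF e(1)] by auto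
    note y = this
    obtain Q where "hasD (%y. inv_into U0 ?ps (act (ps y) kone)) Q y"
     by (rule dens_transition[OF fsq d(2)[OF e(1)] U0(1) subgroup.one_closed[OF subG] _ y]) (rule unimod, assumption, rule that)
    from has_derivative_at_withinI[OF this]
    show "(%y. inv_into U0 ?ps (act (ps y) kone)) differentiable (at y within ?S)"
     by (rule differentiableI)
   qed
   ultimately show ?thesis unfolding e(2) prod.case by (rule negligible_differentiable_image_negligible[OF order_refl])
  qed
  hence "negligible (\<Union>(?W ` \<D>))" using d(1) by (intro negligible_Union) auto
  moreover have "U0 \<subseteq> \<Union>(?W ` \<D>)"
  proof
   fix a assume a: "a : U0"
   hence aL: "?ps a : L" using lpar_cont(2)[OF U0(1)] by blast
   obtain U ps B where e: "(U, ps, B) : \<D>" "?ps a : ps ` B" using d(8)[OF aL] by blast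
   then obtain y where y': "y : B" "?ps a = ps y" by blast
   have y: "y : B" "act (ps y) kone = ?ps a" using y' act_one[OF L_top[OF aL]] by simp_all
   hence "inv_into U0 ?ps (act (ps y) kone) = a" using inv_into_f_f[OF lpar_cont(4)[OF U0(1)] a] by simp
   hence "a : ?W (U, ps, B)" using y a by force
   thus "a : \<Union>(?W ` \<D>)" using e(1) by blast
  qed
  ultimately have "negligible U0" using negligible_subset by blast
  thus False using open_not_negligible[OF lparD(1)[OF U0(1)]] U0(2) by blast
 qed
 ultimately show ?thesis by simp
qed

end

section \<open>Divergence and unimodularity\<close>

context creal
begin

text \<open>The frame \<open>lb\<close> as the columns of a complex matrix: a real basis of the Lie
  algebra of G is a complex basis of its complexification.\<close>

definition LM :: "complex ^ 'n ^ 'n" where "LM = (\<chi> i j. lb (axis j 1) $ i)"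

lemma lb_sum: "lb a = (\<Sum>j\<in>UNIV. a $ j *R lb (axis j 1))"
proof -
 have "lb (\<Sum>j\<in>UNIV. a $ j *R axis j 1) = (\<Sum>j\<in>UNIV. a $ j *R lb (axis j 1))"
  by (simp add: linear_sum[OF lb(1)] linear_scale[OF lb(1)])
 moreover have "(\<Sum>j\<in>UNIV. a $ j *R axis j 1) = a"
  by (simp add: vec_eq_iff axis_def if_distrib cong: if_cong)
 ultimately show ?thesis by simp
qed

lemma LM_mult: "LM *v z = lb (\<chi> i. Re (z $ i)) + imul (lb (\<chi> i. Im (z $ i)))" by (subst (1 2) lb_sum)
  (simp add: vec_eq_iff LM_def matrix_vector_mult_def imul_vec_def imul_complex_def sum.distrib[symmetric] sum_distrib_left
   complex_eq_iff algebra_simps)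

lemma lbi_LM: "lbi (LM *v z) = (\<chi> i. Re (z $ i))"
 unfolding LM_mult lbi_def using rep_imp_eq[OF lb_lie lb_lie] by (simp add: inv_f_f lb)

lemma det_LM: "det LM ~= 0"
proof -
 have "z = 0" if "LM *v z = 0" for z
 proof -
  have "lb (\<chi> i. Re (z $ i)) = 0 & lb (\<chi> i. Im (z $ i)) = 0"
   using lie_independent[OF lb_lie lb_lie] that unfolding LM_mult .
  hence "(\<chi> i. Re (z $ i)) = 0 & (\<chi> i. Im (z $ i)) = 0"
   using injD[OF lb(2), of _ 0] linear_0[OF lb(1)] by metis
  thus "z = 0" by (simp add: vec_eq_iff complex_eq_iff)
 qed
 thus ?thesis by (simp add: det_nonzero_iff_ker)
qed

lemma det_of_real: "det (\<chi> i j. complex_of_real (A $ i $ j)) = complex_of_real (det A)" by (simp add: det_def)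

lemma LM_columns:
 assumes "!!j. W j : \<gg>"
 shows "(\<chi> i j. W j $ i) = LM ** (\<chi> i j. complex_of_real (lbi (W j) $ i))"
proof -
 have "W j = LM *v (\<chi> i. complex_of_real (lbi (W j) $ i))" for j
  using lbi(2)[OF assms[of j]] linear_0[OF lb(1)] by (simp add: LM_mult zero_vec_def[symmetric] linear_0[OF linear_imul])
 hence "W j $ i = (LM *v (\<chi> i. complex_of_real (lbi (W j) $ i))) $ i" for i j by metis
 thus ?thesis by (simp add: vec_eq_iff matrix_matrix_mult_def matrix_vector_mult_def)
qed

text \<open>In the complex basis \<open>LM\<close> the map D has a real matrix, namely that of its
  restriction to the real Lie algebra.\<close>

lemma det_real_form:
 assumes D: "complex_linear D" "!!X. X : \<gg> ==> D X : \<gg>"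
 shows "det (matrix D) = complex_of_real (det (matrix (%v. lbi (D (lb v)))))"
proof -
 have "(\<chi> i j. D (lb (axis j 1)) $ i) = matrix D ** LM"
  by (simp add: vec_eq_iff matrix_matrix_mult_def complex_linear_matrix[OF D(1)] matrix_vector_mult_def LM_def)
 moreover have "(\<chi> i j. D (lb (axis j 1)) $ i) = LM ** (\<chi> i j. complex_of_real (lbi (D (lb (axis j 1))) $ i))"
  by (rule LM_columns) (simp add: D(2))
 ultimately have "det (matrix D) * det LM = det LM * det (\<chi> i j. complex_of_real (lbi (D (lb (axis j 1))) $ i))"
  by (metis det_mul)
 moreover have "(\<chi> i j. complex_of_real (lbi (D (lb (axis j 1))) $ i)) = (\<chi> i j. complex_of_real (matrix (%v. lbi (D (lb v))) $ i $ j))"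
  by (simp add: matrix_def)
 ultimately show ?thesis using det_LM by (simp add: det_of_real)
qed

lemma det_Ad_real: "x : G ==> det (matrix (Ad x)) = complex_of_real (det (matrix (%v. lbi (Ad x (lb v)))))"
 by (rule det_real_form[OF Ad_linear[OF G_carrier] Ad_lie])

end

context orbint
begin

lemma contLI:
 assumes "!!U ps. lpar M L U ps ==> continuous_on U (%y. h (ps y))"
 shows "contL h" unfolding continuous_map_eq_topcontinuous_at topcontinuous_at_def
proof (intro ballI conjI allI impI)
 fix l assume "l : topspace (subtopology (mtop M) L)"
 hence l: "l : L" by simp
 fix V assume V: "openin euclideanreal V & h l : V"
 have fl: "fin_stab l" by (rule orbit_fin_stab[OF fsq l])
 obtain U where U: "lpar M L U (%a. act l (Exp (lb a)))" "0 : U"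
  using param_exists[OF fl] unfolding orbit_eq[OF l qt] by blast
 let ?ps = "%a. act l (Exp (lb a))"
 have ps0: "?ps 0 = l" by (simp add: linear_0[OF lb(1)] act_one[OF L_top[OF l]])
 let ?W = "{y : U. h (?ps y) : V}"
 have "open ?W"
  by (rule open_preimage[of U euclideanreal "%y. h (?ps y)"]) (use assms[OF U(1)] lparD(1)[OF U(1)] V in auto)
 hence "openin (subtopology (mtop M) L) (?ps ` ?W)" by (rule local_param_image_openin[OF U(1)]) auto
 moreover have "0 : ?W" using U(2) V ps0 by simp
 hence "l : ?ps ` ?W" using ps0 by (metis (no_types, lifting) imageI)
 moreover have "ALL y:?ps ` ?W. h y : V" by blast
 ultimately show "EX W. openin (subtopology (mtop M) L) W & l : W & (ALL y:W. h y : V)" by blast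
qed simp_all

text \<open>The flow of X is lifted to the parameter domain. The lift starts at y, and its velocity
  is the unique v with mcf ps y v = X, so the chain rule applies.\<close>

lemma derivative_along:
 fixes \<phi> :: "'m => 'b::real_normed_vector"
 assumes ps: "lpar M L U ps" and y: "y : U" and v: "mcf ps y v = X"
  and D: "hasD (%y. \<phi> (ps y)) D y"
 shows "((%s. \<phi> (act (ps y) (Exp (s *R X)))) has_vector_derivative D v) (at 0)"
proof -
 let ?u = "%s. act (ps y) (Exp (s *R X))"
 have X: "X : \<gg>" using mcf_param(1)[OF fsq ps y, of v] v by simp
 have yL: "ps y : L" using lpar_cont(2)[OF ps] y by blast
 obtain c where c: "c : atlas M" "ps y : fst c" "\<forall>\<^sub>F z in nhds y. ps z : fst c"
  "hasD (%z. snd c (ps z)) (fd (%y. snd c (ps y)) y) y" "fin_stab (ps y)"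
  using param_chart[OF fsq ps y] .
 have u0: "?u 0 = ps y" using L_top[OF yL] by (simp add: act_one)
 have cu: "continuous_map euclidean (mtop M) ?u" by (rule continuous_act_const[OF L_top[OF yL] continuous_Exp_line])
 hence "continuous_map (top_of_set UNIV) (subtopology (mtop M) L) ?u"
  using L_act[OF yL Exp_G[OF X]] by (auto simp: cm_in_sub)
 from open_preimage[OF this open_UNIV lparD(2)[OF ps]] have S: "open {s. ?u s : ps ` U}" by simp
 have 0: "0 : {s. ?u s : ps ` U}" using y u0 by (metis imageI mem_Collect_eq)
 have P: "hasD (%s. snd c (?u s)) (%s. s *R Am c (snd c (ps y)) X) 0"
  by (rule act_tang[OF c(1,2) tang_Exp])
 have i0: "inv_into U ps (?u 0) = y" using inv_into_f_f[OF lpar_cont(4)[OF ps] y] u0 by metis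
 obtain Q where Q: "hasD (%s. inv_into U ps (?u s)) Q 0"
  "!!s. fd (%y. snd c (ps y)) (inv_into U ps (?u 0)) (Q s) = s *R Am c (snd c (ps y)) X"
 proof (rule param_lift[OF chM ps S 0 continuous_map_from_subtopology[OF cu] _ c(1) _ P])
  show "?u 0 : fst c" unfolding u0 by (rule c(2))
 qed auto
 have "mcf ps y (Q 1) = X" by (rule mcf_unique[OF c(5,1,3,4)]) (use Q(2)[of 1] in \<open>unfold i0, simp\<close>)
 hence Q1: "Q 1 = v" using injD[OF mcf_param(3)[OF fsq ps y]] v by blast
 have "hasD (%y. \<phi> (ps y)) D (inv_into U ps (?u 0))" unfolding i0 by (rule D)
 from hasD_chain[OF Q(1) this]
 have "hasD (%s. \<phi> (ps (inv_into U ps (?u s)))) (%s. D (Q s)) 0" unfolding o_def .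
 hence "hasD (%s. \<phi> (?u s)) (%s. D (Q s)) 0"
  by (rule hasD_transform[OF _ S 0]) (simp add: f_inv_into_f)
 moreover have "(%s. D (Q s)) = (%s. s *R D v)"
 proof
  fix s
  have "Q s = s *R v" using linear_scale[OF has_derivative_linear[OF Q(1)], of s 1] Q1 by simp
  thus "D (Q s) = s *R D v" by (simp add: linear_scale[OF has_derivative_linear[OF D]])
 qed
 ultimately show ?thesis by (simp add: has_vector_derivative_def)
qed

text \<open>The divergence of the vector field on the orbit whose components in the frame
  \<open>lb\<close> of the action are \<phi>: each component is differentiated along the flow of its
  own frame vector.\<close>

definition divL :: "('m => real ^ 'n) => 'm => real" where
 "divL \<phi> l = (\<Sum>j\<in>UNIV. vector_derivative (%s. \<phi> (act l (Exp (s *R lb (axis j 1)))) $ j) (at 0))"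

definition invfr where "invfr ps y = inv_into UNIV (fr ps y)"

lemma invfr:
 assumes "lpar M L U ps" "y : U"
 shows "fr ps y (invfr ps y v) = v" "mcf ps y (invfr ps y v) = lb v" "linear (invfr ps y)"
proof -
 note f = fr[OF fsq assms]
 have "bij (fr ps y)" using f(2,3) by (simp add: bij_def linear_injective_imp_surjective)
 thus 1: "fr ps y (invfr ps y v) = v" for v by (simp add: invfr_def f_inv_into_f bij_is_surj)
 show "mcf ps y (invfr ps y v) = lb v" by (simp add: f(1)[symmetric] 1)
 show "linear (invfr ps y)"
  by (rule linearI; rule injD[OF f(3)]) (simp_all add: 1 linear_add[OF f(2)] linear_scale[OF f(2)])
qed

lemma divL_terms:
 assumes ps: "lpar M L U ps" and y: "y : U" and sm: "smooth_on U (%y. \<phi> (ps y))"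
 shows "((%s. \<phi> (act (ps y) (Exp (s *R lb a))) $ j) has_vector_derivative
  fd (%y. \<phi> (ps y)) y (invfr ps y a) $ j) (at 0)"
proof -
 have "hasD (%y. \<phi> (ps y) $ j) (%v. fd (%y. \<phi> (ps y)) y v $ j) y"
  by (rule has_derivative_vec_nth[OF smooth_hasD[OF sm y]])
 from derivative_along[OF ps y invfr(2)[OF ps y], of "%l. \<phi> l $ j", OF this] show ?thesis .
qed

lemma divL_param:
 assumes ps: "lpar M L U ps" and y: "y : U" and sm: "smooth_on U (%y. \<phi> (ps y))"
 shows "divL \<phi> (ps y) = (\<Sum>j\<in>UNIV. fd (%y. \<phi> (ps y)) y (invfr ps y (axis j 1)) $ j)"
 unfolding divL_def by (intro sum.cong refl vector_derivative_at divL_terms[OF assms])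

text \<open>Each summand of the divergence is a derivative along a flow by right translations, so
  \<open>Jint_derivative_zero\<close> applies to it separately.\<close>

lemma Jint_divL:
 assumes sm: "!!U ps. lpar M L U ps ==> smooth_on U (%y. \<phi> (ps y))"
 shows "Jint (divL \<phi>) = 0"
proof -
 note d = param_decompositionD[OF dec]
 define h where "h j l = vector_derivative (%s. \<phi> (act l (Exp (s *R lb (axis j 1)))) $ j) (at 0)" for j l
 have hp: "h j (ps y) = fd (%y. \<phi> (ps y)) y (invfr ps y (axis j 1)) $ j"
  if "lpar M L U ps" "y : U" for U ps y j
  unfolding h_def by (rule vector_derivative_at[OF divL_terms[OF that sm[OF that(1)]]])
 have ch: "contL (h j)" for j
 proof (rule contLI)
  fix U ps assume ps: "lpar M L U ps"
  have oU: "open U" by (rule lparD(1)[OF ps])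
  have inv: "continuous_on U (%y. invfr ps y (axis j 1))"
  proof -
   \<comment> \<open>\<open>cont_diff_solve\<close> works over the complex numbers, so the real
     system for the inverse frame is embedded there.\<close>
   let ?A = "%y. \<chi> i j. complex_of_real (matrix (fr ps y) $ i $ j)"
   have "cont_diff 0 U (%y. (\<chi> i. complex_of_real (invfr ps y (axis j 1) $ i)) :: complex ^ 'n)"
   proof (rule cont_diff_solve[OF oU, of 0 ?A "%y. \<chi> i. complex_of_real (axis j 1 $ i)"])
    show "cont_diff 0 U (%y. ?A y $ i $ k)" for i k
     using smooth_on_continuous[OF fr_smooth[OF fsq ps, of "axis k 1"]]
     by (auto simp: matrix_def intro!: continuous_intros continuous_on_component)
    fix y assume y: "y : U"
    show "det (?A y) ~= 0" using fr(4)[OF fsq ps y] by (simp add: det_of_real dens_def)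
    have "matrix (fr ps y) *v invfr ps y (axis j 1) = axis j 1"
     using matrix_vector_mul(2)[OF fr(2)[OF fsq ps y], THEN fun_cong] invfr(1)[OF ps y] by simp
    hence "(matrix (fr ps y) *v invfr ps y (axis j 1)) $ i = axis j 1 $ i" for i by simp
    from arg_cong[OF this, of complex_of_real]
    show "?A y *v (\<chi> i. complex_of_real (invfr ps y (axis j 1) $ i)) = (\<chi> i. complex_of_real (axis j 1 $ i))"
     by (simp add: vec_eq_iff matrix_vector_mult_def)
   qed simp
   hence c0: "continuous_on U (%y. (\<chi> i. complex_of_real (invfr ps y (axis j 1) $ i)) :: complex ^ 'n)" by simp
   have "continuous_on U (%y. invfr ps y (axis j 1) $ i)" for i
    using continuous_on_Re[OF continuous_on_component[OF c0, of i]] by simp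
   hence "continuous_on U (%y. \<chi> i. invfr ps y (axis j 1) $ i)" by (rule continuous_on_vec_lambda)
   thus ?thesis by simp
  qed
  have "continuous_on U (%y. fd (%y. \<phi> (ps y)) y (invfr ps y (axis j 1)))"
   by (rule continuous_on_frechet2[of U]) (use sm[OF ps] inv in "auto simp: smooth_on_def continuous_intros simp del: cont_diff.simps")
  hence "continuous_on U (%y. fd (%y. \<phi> (ps y)) y (invfr ps y (axis j 1)) $ j)"
   by (rule continuous_on_component)
  thus "continuous_on U (%y. h j (ps y))" by (rule continuous_on_eq) (simp add: hp[OF ps])
 qed
 have c\<phi>: "contL (%l. \<phi> l $ j)" for j
  by (rule contLI) (intro continuous_on_component smooth_on_continuous sm)
 have z: "Jint (h j) = 0" for j
 proof (rule Jint_derivative_zero[OF c\<phi> ch lb_lie])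
  fix l assume l: "l : L"
  obtain U where U: "lpar M L U (%a. act l (Exp (lb a)))" "0 : U"
   using param_exists[OF orbit_fin_stab[OF fsq l]] unfolding orbit_eq[OF l qt] by blast
  have "act l (Exp (lb 0)) = l" by (simp add: linear_0[OF lb(1)] act_one[OF L_top[OF l]])
  thus "hasR (%s. \<phi> (act l (Exp (s *R lb (axis j 1)))) $ j) (h j l) 0"
   using divL_terms[OF U sm[OF U(1)], of "axis j 1" j] hp[OF U, of j] by (simp add: has_real_derivative_iff_has_vector_derivative)
 qed
 have "Jint (divL \<phi>) = (\<Sum>j\<in>UNIV. Jint (h j))"
 proof -
  have "(LINT y:B|lborel. divL \<phi> (ps y) * dens ps y) = (\<Sum>j\<in>UNIV. LINT y:B|lborel. h j (ps y) * dens ps y)"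
   if e: "(U, ps, B) : \<D>" for U and ps :: "real ^ 'n => 'm" and B
  proof -
   have "(LINT y:B|lborel. divL \<phi> (ps y) * dens ps y) = (LINT y:B|lborel. (\<Sum>j\<in>UNIV. h j (ps y) * dens ps y))"
    by (simp add: divL_def h_def sum_distrib_right)
   also have "... = (\<Sum>j\<in>UNIV. LINT y:B|lborel. h j (ps y) * dens ps y)"
    unfolding set_lebesgue_integral_def scaleR_sum_right
    by (rule Bochner_Integration.integral_sum) (use integrable_piece[OF ch e d(3)[OF e]] in \<open>simp add: set_integrable_def\<close>)
   finally show ?thesis .
  qed
  from this[of "fst e" "fst (snd e)" "snd (snd e)" for e]
  have "Jint (divL \<phi>) = (\<Sum>e\<in>\<D>. \<Sum>j\<in>UNIV. LINT y:snd (snd e)|lborel. h j (fst (snd e) y) * dens (fst (snd e)) y)"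
   unfolding Jint_def case_prod_unfold by (intro sum.cong refl) simp
  thus ?thesis unfolding Jint_def by (simp add: case_prod_unfold sum.swap[of _ \<D>])
 qed
 thus ?thesis by (simp add: z)
qed

end

lemma trace_scaleR: "trace (B ** (t *R A)) = t *R trace (B ** A)" "trace (t *R A) = t *R trace A"
 for A B :: "complex ^ 'n ^ 'n" by (simp_all add: trace_def matrix_matrix_mult_def scaleR_sum_right)

lemma trace_imul: "trace (B ** (P + imul Q)) = trace (B ** P) + \<i> * trace (B ** Q)"
 for B P Q :: "complex ^ 'n ^ 'n"
 by (simp add: trace_def matrix_matrix_mult_def imul_vec_def imul_complex_def sum.distrib[symmetric] sum_distrib_left algebra_simps)

context corb
begin

text \<open>With \<open>R\<^sub>t\<close> the right translation by \<open>exp (t Z)\<close> for \<open>Z\<close> in the real Lie algebra,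
 \<open>det A (m exp (t Z)) = det R\<^sub>t det A(m)\<close> by unimodularity; the logarithmic derivative at \<open>t = 0\<close>
 is the trace identity.\<close>

lemma unimod_trace:
 assumes um: "!!x. x : G ==> \<bar>det (matrix (%v. lbi (Ad x (lb v))))\<bar> = 1"
  and m: "fin_stab m" and c: "c : atlas M" "m : fst c" and B: "B ** matrix (Am c (snd c m)) = mat 1"
 shows "trace (matrix (%w. fd (%y. Am c y Z) (snd c m) w)) =
  trace (B ** fd (%y. matrix (Am c y)) (snd c m) (Am c (snd c m) Z))"
proof -
 have mt: "m : pts M" using m by (simp add: fin_stab_def)
 let ?y = "snd c m"
 have yc: "?y : chart_image c" by (rule chart_mem_image[OF chM c])
 let ?A = "%y. matrix (Am c y)"
 note dA' = cdiff_fd[OF Am_matrix_cdiff[OF c(1) yc]]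
 note dZ = cdiff_fd[OF Am_cdiff[OF c(1) yc]]
 let ?l = "%Z. trace (matrix (%w. fd (%y. Am c y Z) ?y w))"
 let ?r = "%Z. trace (B ** fd ?A ?y (Am c ?y Z))"
 \<comment> \<open>For vectors of the real Lie algebra the group elements exp (tZ) lie in G, where
   Ad is known to be unimodular.\<close>
 have real: "?l Z = ?r Z" if Z: "Z : \<gg>" for Z
 proof -
  let ?F = "%p. act (chart_inv c (fst p)) (Exp (snd p))"
  define T where "T = {p : chart_image c \<times> UNIV. ?F p : fst c}"
  have oc: "open (chart_image c)" by (rule chart_image_open[OF chM c(1)])
  have F: "mhol M (chart_image c \<times> UNIV) ?F"
   by (intro mhol_act mhol_reparam[OF mhol_chart_inv[OF cmM mdlM c(1)]] mhol_reparam[OF mhol_Exp] cdiff_at_fst cdiff_at_snd open_Times oc) auto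
  have T: "open T" unfolding T_def by (rule mhol_open_preimage[OF F chart_openin[OF chM c(1)]])
  let ?H = "%p. snd c (?F p)"
  have cd: "cdiff_at ?H p" if "p : T" for p
   by (rule mhol_cdiff[OF F c(1)]) (use that in "auto simp: T_def")
  have smH: "smooth_on T ?H" by (rule cdiff_smooth[OF T cd])
  have Fm: "?F (?y, Y) = act m (Exp Y)" for Y by (simp add: chart_inv_chart[OF chM c])
  have p0: "(?y, 0) : T" using yc c(2) by (simp add: T_def Fm[of 0, simplified] chart_inv_chart[OF chM c] act_one[OF mt])
  have dH: "hasD ?H (fd ?H p) p" if "p : T" for p by (rule cdiff_fd(1)[OF cd[OF that]])
  \<comment> \<open>The Jacobian at m of the right translation by exp (tZ), in the chart c.\<close>
  let ?M = "%t. matrix (%v. fd ?H (?y, t *R Z) (v, 0))"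
  have H0: "fd ?H (y, 0) (0, Z) = Am c y Z" if "(y, 0) : T" for y
  proof -
   let ?m = "chart_inv c y"
   have ym: "?m : fst c" "snd c ?m = y" "y : chart_image c"
    using that chart_inv_mem[OF chM c(1)] chart_chart_inv[OF chM c(1)] by (auto simp: T_def)
   have d0: "hasD (%t. (y, t *R Z)) (%t. (0, t *R Z)) 0"
    by (intro derivative_eq_intros) auto
   have "hasD ?H (fd ?H (y, 0)) (y, 0 *R Z)" using dH[OF that] by simp
   from hasD_chain[OF d0 this]
   have "hasD (%t. snd c (act ?m (Exp (t *R Z)))) (%t. fd ?H (y, 0) (0, t *R Z)) 0"
    by (simp add: o_def)
   from has_derivative_unique[OF this act_tang[OF c(1) ym(1) tang_Exp], THEN fun_cong, of 1]
   show ?thesis by (simp add: ym(2))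
  qed
  have M': "hasD ?M (%t. t *R matrix (%w. fd (%y. Am c y Z) ?y w)) 0"
   unfolding matrix_def has_derivative_vec_iff
  proof (intro allI)
   fix i j :: 'n
   let ?e = "axis j 1 :: complex ^ 'n"
   have "smooth_on T (%p. fd ?H p (?e, 0))" by (rule smooth_on_frechet[OF smH])
   from smooth_hasD[OF this p0]
   have d1: "hasD (%p. fd ?H p (?e, 0)) (fd (%p. fd ?H p (?e, 0)) (?y, 0)) (?y, 0 *R Z)"
    by simp
   have d0: "hasD (%t. (?y, t *R Z)) (%t. (0, t *R Z)) 0"
    by (intro derivative_eq_intros) auto
   \<comment> \<open>Interchanging the derivatives in t and y turns the t-derivative of the Jacobian
     into the y-derivative of the vector field generated by Z.\<close>
   have sym: "fd (%p. fd ?H p (?e, 0)) (?y, 0) (0, Z) =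
     fd (%p. fd ?H p (0, Z)) (?y, 0) (?e, 0)"
    by (rule symmetric_second_derivative[OF T p0]) (use smH in "simp add: smooth_on_def del: cont_diff.simps")
   have "fd (%p. fd ?H p (0, Z)) (?y, 0) (?e, 0) = fd (%y. Am c y Z) ?y ?e"
   proof -
    have "hasD (%p. fd ?H p (0, Z)) (fd (%p. fd ?H p (0, Z)) (?y, 0)) (?y, 0)"
     by (rule smooth_hasD[OF smooth_on_frechet[OF smH] p0])
    moreover have "hasD (%y. (y, 0 :: complex ^ 'n)) (%v. (v, 0)) ?y" by (intro derivative_eq_intros) auto
    ultimately have "hasD (%y. fd ?H (y, 0) (0, Z)) (%v. fd (%p. fd ?H p (0, Z)) (?y, 0) (v, 0)) ?y"
     using hasD_chain[of "%y. (y, 0)"] unfolding o_def by blast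
    moreover have oT: "open {y. (y, 0) : T}"
     using open_vimage[OF T, of "%y. (y, 0)"] by (simp add: vimage_def continuous_intros)
    ultimately have "hasD (%y. Am c y Z) (%v. fd (%p. fd ?H p (0, Z)) (?y, 0) (v, 0)) ?y"
     by (rule hasD_transform) (use p0 H0 in auto)
    from fd_eqI[OF this] show ?thesis by simp
   qed
   hence eq: "fd (%p. fd ?H p (?e, 0)) (?y, 0) (0, t *R Z) = t *R fd (%y. Am c y Z) ?y ?e" for t
    using linear_scale[OF has_derivative_linear[OF d1], of t "(0, Z)"] sym by simp
   have "hasD (%t. fd ?H (?y, t *R Z) (?e, 0)) (%t. t *R fd (%y. Am c y Z) ?y ?e) 0"
    using hasD_chain[OF d0 d1] unfolding o_def eq .
   from has_derivative_vec_nth[OF this, of i]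
   show "hasD (%t. (\<chi> i j. fd ?H (?y, t *R Z) (axis j 1, 0) $ i) $ i $ j) (%t. (t *R (\<chi> i j. fd (%y. Am c y Z) ?y (axis j 1) $ i)) $ i $ j) 0" by simp
  qed
  have M0: "?M 0 = mat 1"
  proof -
   have "fd ?H (?y, 0) (v, 0) = v" for v
   proof -
    have "hasD (%y. (y, 0 :: complex ^ 'n)) (%v. (v, 0)) ?y" by (intro derivative_eq_intros) auto
    from hasD_chain[OF this dH[OF p0]]
    have "hasD (%y. ?H (y, 0)) (%v. fd ?H (?y, 0) (v, 0)) ?y" by (simp add: o_def)
    hence "hasD (%y. y) (%v. fd ?H (?y, 0) (v, 0)) ?y"
     by (rule hasD_transform[OF _ oc yc])
      (simp add: act_one chart_top[OF c(1) chart_inv_mem[OF chM c(1)]] chart_chart_inv[OF chM c(1)])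
    from has_derivative_unique[OF this has_derivative_ident] show ?thesis by (rule fun_cong)
   qed
   thus ?thesis by (simp add: matrix_def mat_def vec_eq_iff axis_def)
  qed
  have dM: "hasD (%t. det (?M t)) (%t. t *R ?l Z) 0"
  proof -
   have B1: "mat 1 ** ?M 0 = mat 1" unfolding M0 by simp
   show ?thesis using has_derivative_det[OF M' B1] unfolding M0 by (simp only: matrix_mul_lid trace_scaleR(2) det_I mult_1)
  qed
  let ?u = "%t. act m (Exp (t *R Z))"
  have du: "hasD (%t. snd c (?u t)) (%t. t *R Am c ?y Z) 0" by (rule act_tang[OF c tang_Exp])
  have "hasD ?A (fd ?A ?y) (snd c (?u 0))" using dA'(1) by (simp add: act_one[OF mt])
  note dA0 = hasD_chain[OF du this, unfolded o_def]
  have B': "B ** ?A (snd c (?u 0)) = mat 1" using B by (simp add: act_one[OF mt])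
  have dD: "hasD (%t. dA c (snd c (?u t))) (%t. dA c ?y * (t *R ?r Z)) 0"
   using has_derivative_det[OF dA0 B'] unfolding linear_scale[OF has_derivative_linear[OF dA'(1)]] trace_scaleR(1)
   by (simp add: dA_def act_one[OF mt])
  have ev: "\<forall>\<^sub>F t in nhds 0. ?u t : fst c"
   by (rule ev_chart[OF continuous_act_const[OF mt continuous_Exp_line] _ chart_openin[OF chM c(1)]]) (simp add: act_one[OF mt] c(2))
  have nz: "dA c ?y ~= 0" by (rule dA_nz[OF m c])
  \<comment> \<open>Unimodularity fixes this real determinant only up to sign. Near t = 0 the value
    -1 is excluded by continuity: with it the sum of the two quantities compared below would vanish,
    while it tends to twice det A(m).\<close>
  define s where "s t = det (matrix (%v. lbi (Ad (Exp (t *R Z)) (lb v))))" for t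
  have s1: "s t = 1 | s t = - 1" for t using um[OF Exp_G[OF Z], of t] by (auto simp: s_def abs_if split: if_splits)
  have key: "\<forall>\<^sub>F t in nhds 0. dA c (snd c (?u t)) = det (?M t) * dA c ?y * complex_of_real (s t)"
   using ev
  proof eventually_elim
   case (elim t)
   have "(?y, t *R Z) : T" using yc elim by (simp add: T_def chart_inv_chart[OF chM c])
   have "hasD (%y. (y, t *R Z)) (%v. (v, 0)) ?y" by (intro derivative_eq_intros) auto
   from hasD_chain[OF this dH[OF \<open>(?y, t *R Z) : T\<close>]]
   have "hasD (%y. snd c (act (chart_inv c y) (Exp (t *R Z)))) (%v. fd ?H (?y, t *R Z) (v, 0)) ?y"
    by (simp add: o_def)
   from fd_eqI[OF this] have "Rd c c (Exp (t *R Z)) ?y = (%v. fd ?H (?y, t *R Z) (v, 0))"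
    by (simp add: Rd_def)
   thus ?case
    using dA_right[OF c(1) c(1) c(2) Exp_carrier elim] det_Ad_real[OF Exp_G[OF Z]] by (simp add: s_def)
  qed
  have cM: "(%t. det (?M t)) \<midarrow>0\<rightarrow> 1" using has_derivative_continuous[OF dM] by (simp add: isCont_def M0[unfolded scaleR_zero_left])
  have cD: "(%t. dA c (snd c (?u t))) \<midarrow>0\<rightarrow> dA c ?y" using has_derivative_continuous[OF dD] by (simp add: isCont_def act_one[OF mt])
  have "((%t. dA c (snd c (?u t)) + det (?M t) * dA c ?y) \<longlongrightarrow> dA c ?y + 1 * dA c ?y) (at 0)"
   by (intro tendsto_add tendsto_mult cM cD tendsto_const)
  moreover have "dA c ?y + 1 * dA c ?y ~= 0" using nz by simp
  ultimately have "\<forall>\<^sub>F t in at 0. dA c (snd c (?u t)) + det (?M t) * dA c ?y ~= 0" by (rule tendsto_imp_eventually_ne)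
  hence "\<forall>\<^sub>F t in nhds 0. dA c (snd c (?u t)) + det (?M t) * dA c ?y ~= 0"
   using nz by (simp add: eventually_nhds_conv_at M0[unfolded scaleR_zero_left] act_one[OF mt])
  with key have "\<forall>\<^sub>F t in nhds 0. dA c (snd c (?u t)) = det (?M t) * dA c ?y"
   by eventually_elim (use s1 in force)
  from has_derivative_cong_nhds[OF dD this]
  have "hasD (%t. det (?M t) * dA c ?y) (%t. dA c ?y * (t *R ?r Z)) 0" .
  from has_derivative_unique[OF this has_derivative_mult_left[OF dM, of "dA c ?y"], THEN fun_cong, of 1]
  show ?thesis using nz by simp
 qed
 \<comment> \<open>Both traces are complex linear in Z, so the identity extends from the real Lie
   algebra to its complexification.\<close>
 obtain X Y where XY: "X : \<gg>" "Y : \<gg>" "Z = X + imul Y" using rep_imp by blast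
 have "Am c y Z = Am c y X + imul (Am c y Y)" if "y : chart_image c" for y
  using Am_linear[OF c(1) that] XY(3) by (simp add: clin_def linear_add)
 note AZ = this
 have "?l Z = ?l X + \<i> * ?l Y"
 proof -
  have "hasD (%y. Am c y X + imul (Am c y Y)) (%w. fd (%y. Am c y X) ?y w + imul (fd (%y. Am c y Y) ?y w)) ?y"
   by (intro has_derivative_add bounded_linear.has_derivative[OF bounded_linear_imul] cdiff_fd(1)[OF Am_cdiff[OF c(1) yc]])
  hence "hasD (%y. Am c y Z) (%w. fd (%y. Am c y X) ?y w + imul (fd (%y. Am c y Y) ?y w)) ?y"
   by (rule hasD_transform[OF _ chart_image_open[OF chM c(1)] yc]) (simp add: AZ)
  from fd_eqI[OF this] show ?thesis
   by (simp add: trace_def matrix_def imul_vec_def imul_complex_def sum.distrib sum_distrib_left)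
 qed
 moreover have "?r Z = ?r X + \<i> * ?r Y"
  using dA'(2) by (simp add: AZ[OF yc] clin_def linear_add trace_imul)
 ultimately show ?thesis using real[OF XY(1)] real[OF XY(2)] by simp
qed

end

section \<open>The structure equation\<close>

lemma bounded_bilinear_matrix_vector: "bounded_bilinear ((*v) :: complex ^ 'n ^ 'n => complex ^ 'n => complex ^ 'n)"
 unfolding bilinear_conv_bounded_bilinear[symmetric] bilinear_def
 by (auto intro!: linearI simp: vec_eq_iff matrix_vector_mult_def algebra_simps sum.distrib scaleR_sum_right)

context corb
begin

lemma mcf_compose:
 assumes q: "fin_stab (f (a x))" and c: "c : atlas M" "\<forall>\<^sub>F z in nhds (a x). f z : fst c"
  and P: "hasD (%z. snd c (f z)) P (a x)" and a: "hasD a a' x"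
 shows "mcf (%x. f (a x)) x v = mcf f (a x) (a' v)"
proof (rule mcf_unique[where f = "%x. f (a x)" and P = "%v. P (a' v)", OF q c(1)])
 have "isCont a x" by (rule has_derivative_continuous[OF a])
 hence "filterlim a (nhds (a x)) (nhds x)" by (simp add: isCont_def tendsto_at_iff_tendsto_nhds)
 thus "\<forall>\<^sub>F z in nhds x. f (a z) : fst c" using c(2) unfolding filterlim_iff by blast
 show "hasD (%z. snd c (f (a z))) (%v. P (a' v)) x" using hasD_chain[OF a P] unfolding o_def .
 show "Am c (snd c (f (a x))) (mcf f (a x) (a' v)) = P (a' v)" by (rule mcf[OF q c P])
qed

text \<open>The structure equation, traced. The two mixed derivatives of the Maurer-Cartan form
  differ by a bracket with \<eta> = mcf f z u, which here appears as C M1 A - C M2 acting on the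
  frame. Its trace is zero by \<open>unimod_trace\<close>.\<close>

lemma mc_trace:
 fixes f :: "'a::real_normed_vector => 'm" and e :: "'n => 'a"
 assumes um: "!!x. x : G ==> \<bar>det (matrix (%v. lbi (Ad x (lb v))))\<bar> = 1"
  and W: "open W" "continuous_map (top_of_set W) (mtop M) f" "z : W"
  and sm: "!!c. c : atlas M ==> smooth_on {y : W. f y : fst c} (%y. snd c (f y))"
  and q: "!!y. y : W ==> fin_stab (f y)"
  and B: "B ** (\<chi> i j. mcf f z (e j) $ i) = mat 1"
 shows "trace (B ** (\<chi> i j. fd (%y. mcf f y (e j)) z u $ i)) =
  trace (B ** (\<chi> i j. fd (%y. mcf f y u) z (e j) $ i))"
proof -
 obtain c where c: "c : atlas M" "f z : fst c" using q[OF W(3)] charted_chart_at[OF chM] unfolding fin_stab_def by metis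
 let ?T = "{y : W. f y : fst c}" and ?y = "snd c (f z)" and ?h = "%y. snd c (f y)"
 have T: "open ?T" by (rule open_preimage[OF W(2,1) chart_openin[OF chM c(1)]])
 have zT: "z : ?T" using W(3) c(2) by simp
 have yc: "?y : chart_image c" by (rule chart_mem_image[OF chM c])
 let ?A = "%y. matrix (Am c y)" and ?P = "%v x. fd ?h x v"
 let ?dA = "fd ?A ?y" and ?\<eta> = "mcf f z u"
 let ?d = "%v. fd (%y. mcf f y v) z"
 have dA: "hasD ?A ?dA ?y" by (rule cdiff_fd(1)[OF Am_matrix_cdiff[OF c(1) yc]])
 have Av: "Am c y v = ?A y *v v" if "y : chart_image c" for y v
  by (rule complex_linear_matrix[OF Am_linear[OF c(1) that]])
 have dAv: "hasD (%y. Am c y v) (%w. ?dA w *v v) ?y" for v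
 proof (rule hasD_transform[OF _ chart_image_open[OF chM c(1)] yc])
  show "hasD (%y. ?A y *v v) (%w. ?dA w *v v) ?y"
   using bounded_bilinear.FDERIV[OF bounded_bilinear_matrix_vector dA has_derivative_const[of v]] by simp
 qed (simp add: Av)
 have dh: "hasD ?h (fd ?h y) y" if "y : ?T" for y by (rule smooth_hasD[OF sm[OF c(1)] that])
 have mcP: "Am c (snd c (f y)) (mcf f y v) = ?P v y" if "y : ?T" for y v
  by (rule mcf[OF q c(1) _ dh[OF that]]) (use that T in "auto simp: eventually_nhds")
 have dm: "hasD (%y. mcf f y v) (?d v) z" for v
  by (rule smooth_hasD[OF mcf_smooth[OF W(1,2) sm q] W(3)])
 have dP: "fd (?P v) z w = ?dA (?P w z) *v mcf f z v + ?A ?y *v ?d v w" for v w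
 proof -
  have "hasD (%y. ?A (?h y) *v mcf f y v) (%w. ?A ?y *v ?d v w + ?dA (?P w z) *v mcf f z v) z"
   by (rule bounded_bilinear.FDERIV[OF bounded_bilinear_matrix_vector hasD_chain[OF dh[OF zT] dA, unfolded o_def] dm])
  hence "hasD (?P v) (%w. ?A ?y *v ?d v w + ?dA (?P w z) *v mcf f z v) z"
   by (rule hasD_transform[OF _ T zT])
    (use mcP Av chart_mem_image[OF chM c(1)] in auto)
  from fd_eqI[OF this] show ?thesis by simp
 qed
 have sym: "fd (?P v) z w = fd (?P w) z v" for v w
  by (rule symmetric_second_derivative[OF T zT]) (use sm[OF c(1)] in \<open>simp add: smooth_on_def del: cont_diff.simps\<close>)
 obtain C where C: "C ** ?A ?y = mat 1" "?A ?y ** C = mat 1"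
  using det_nonzero_inverse[of "?A ?y"] dA_nz[OF q[OF W(3)] c] unfolding dA_def by metis
 let ?M1 = "matrix (%w. ?dA w *v ?\<eta>)" and ?M2 = "?dA (Am c ?y ?\<eta>)" and ?\<Xi> = "\<chi> i j. mcf f z (e j) $ i"
 have cl: "complex_linear (%w. ?dA w *v ?\<eta>)"
  using cdiff_fd(2)[OF Am_cdiff[OF c(1) yc, of ?\<eta>]] fd_eqI[OF dAv[of ?\<eta>]] by simp
 \<comment> \<open>Differentiate A(f) mcf f = df once more by the product rule. The second
   derivatives of f agree by symmetry, and the terms in which A is differentiated remain.\<close>
 have col: "?d (e j) u = ?d u (e j) + C *v (?M1 *v (?A ?y *v mcf f z (e j))) - C *v (?M2 *v mcf f z (e j))" for j
 proof -
  have "?dA (?P u z) *v mcf f z (e j) + ?A ?y *v ?d (e j) u = ?dA (?P (e j) z) *v ?\<eta> + ?A ?y *v ?d u (e j)"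
   using sym[of "e j" u] unfolding dP .
  hence "?A ?y *v ?d (e j) u = ?A ?y *v ?d u (e j) + ?M1 *v (?A ?y *v mcf f z (e j)) - ?M2 *v mcf f z (e j)"
   by (simp add: complex_linear_matrix[OF cl, symmetric] Av[OF yc, symmetric] mcP[OF zT] algebra_simps)
  from arg_cong[OF this, of "%v. C *v v"] show ?thesis
   by (simp add: matrix_vector_mul_assoc matrix_vector_right_distrib matrix_vector_mult_diff_distrib C(1) matrix_mul_assoc)
 qed
 let ?X = "\<chi> i j. ?d (e j) u $ i" and ?Y = "\<chi> i j. ?d u (e j) $ i"
 have cm: "(\<chi> i j. (L *v mcf f z (e j)) $ i) = L ** ?\<Xi>" for L :: "complex ^ 'n ^ 'n"
  by (simp add: vec_eq_iff matrix_matrix_mult_def matrix_vector_mult_def)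
 have tr: "trace (B ** (Y + P - Q)) = trace (B ** Y) + trace (B ** P) - trace (B ** Q)" for Y P Q :: "complex ^ 'n ^ 'n"
  by (simp add: trace_def matrix_matrix_mult_def algebra_simps sum.distrib sum_subtractf)
 have "?X = ?Y + (C ** ?M1 ** ?A ?y) ** ?\<Xi> - (C ** ?M2) ** ?\<Xi>"
  unfolding cm[symmetric] by (simp add: col vec_eq_iff matrix_vector_mul_assoc matrix_mul_assoc)
 hence "trace (B ** ?X) = trace (B ** ?Y) + trace (B ** ((C ** ?M1 ** ?A ?y) ** ?\<Xi>)) - trace (B ** ((C ** ?M2) ** ?\<Xi>))"
  by (simp only: tr)
 moreover have "trace (B ** (L ** ?\<Xi>)) = trace L" for L
 proof -
  have "?\<Xi> ** B = mat 1" using B matrix_left_right_inverse by blast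
  hence "L ** ?\<Xi> ** B = L" by (simp add: matrix_mul_assoc[symmetric])
  thus ?thesis by (metis trace_mul_sym)
 qed
 moreover have "trace (C ** ?M1 ** ?A ?y) = trace ?M1"
  using trace_mul_sym[of "C ** ?M1" "?A ?y"] C(2) by (simp add: matrix_mul_assoc)
 moreover have "trace ?M1 = trace (C ** ?M2)"
  using unimod_trace[OF um q[OF W(3)] c C(1), of ?\<eta>] fd_eqI[OF dAv[of ?\<eta>]] by simp
 ultimately show ?thesis by simp
qed

end

section \<open>The volume functional on orbits\<close>

locale khom = corb K N G M act + kmet K N M act g
 for K :: "'k monoid" and N :: "('k, complex ^ 'n) cmfd" and G :: "'k set"
  and M :: "('m, complex ^ 'n) cmfd" and act :: "'m => 'k => 'm" and g :: "('m, 'n) metric" +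
 fixes p :: 'm
 assumes cptM: "compact_space (mtop M)" and fsp: "fin_stab p"
  and openO: "openin (mtop M) (act p ` carrier K)"
  and denseO: "mtop M closure_of (act p ` carrier K) = pts M"
  and isoG: "!!x. x : G ==> isom x"
begin

abbreviation \<O> where "\<O> \<equiv> act p ` carrier K"

lemma fin_stab_O: "m : \<O> ==> fin_stab m" using fin_stab_act[OF fsp] by blast

lemma pt: "p : pts M" using fsp by (simp add: fin_stab_def)

lemma act_O: "m : \<O> ==> x : carrier K ==> act m x : \<O>"
proof -
 assume "m : \<O>" and x: "x : carrier K"
 then obtain k where k: "k : carrier K" "m = act p k" by blast
 hence "act m x = act p (k \<odot> x)" using x pt by (simp add: act_act)
 thus ?thesis using k(1) x by simp
qed

lemma Hf_pos: "fin_stab m ==> 0 < Hf m"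
proof -
 assume m: "fin_stab m"
 then obtain c where "c : atlas M" "m : fst c" using charted_chart_at[OF chM] unfolding fin_stab_def by blast
 thus ?thesis using Hf_pos_iff dA_nz[OF m] by blast
qed

lemma det_Ad_G: "x : G ==> cmod (det (matrix (Ad x))) = 1"
 by (rule isom_det_Ad[OF cptM pt Hf_pos[OF fsp] subG isoG])

lemma unimod_G: "x : G ==> \<bar>det (matrix (%v. lbi (Ad x (lb v))))\<bar> = 1"
 using det_Ad_G[of x] by (simp add: det_Ad_real)

lemma Hf_G: "m : pts M ==> x : G ==> Hf (act m x) = Hf m"
 using Hf_right[OF isoG G_carrier] by (simp add: det_Ad_G)

text \<open>Since df = A mcf, the determinant of df in a chart is det A times that of the
  Maurer-Cartan frame. The factors |det A|^2 and det h combine to \<open>Hf\<close>.\<close>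

lemma jvol_density_mcf:
 fixes h :: "real ^ 'n => 'm"
 assumes q: "fin_stab (h y)" and ev: "!!c. c : atlas M ==> h y : fst c ==> \<forall>\<^sub>F z in nhds y. h z : fst c"
  and d: "!!c. c : atlas M ==> h y : fst c ==> (%z. snd c (h z)) differentiable (at y)"
 shows "jvol_density M g h y = sqrt (Hf (h y)) * cmod (det (\<chi> i j. mcf h y (axis j 1) $ i))"
proof -
 define c where "c = (SOME c. c : atlas M & h y : fst c)"
 have "EX c. c : atlas M & h y : fst c" using q charted_chart_at[OF chM] unfolding fin_stab_def by metis
 from someI_ex[OF this] have c: "c : atlas M" "h y : fst c" unfolding c_def by auto
 let ?P = "fd (%z. snd c (h z)) y" and ?y = "snd c (h y)" and ?\<Xi> = "\<chi> i j. mcf h y (axis j 1) $ i"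
 have yc: "?y : chart_image c" by (rule chart_mem_image[OF chM c])
 interpret hermitian_form "g c" ?y by (rule form[OF c(1) yc])
 have "mcf h y v = mcf h y v ==> ?P v = matrix (Am c ?y) *v mcf h y v" for v
  using mcf[OF q c(1) ev[OF c] differentiable_frechet[OF d[OF c]], of v] complex_linear_matrix[OF Am_linear[OF c(1) yc]] by metis
 hence "(\<chi> i j. ?P (axis j 1) $ i) = matrix (Am c ?y) ** ?\<Xi>"
  by (simp add: vec_eq_iff matrix_matrix_mult_def matrix_vector_mult_def)
 hence "det (\<chi> i j. ?P (axis j 1) $ i) = dA c ?y * det ?\<Xi>" by (simp add: det_mul dA_def)
 hence "jvol_density M g h y = sqrt ((cmod (dA c ?y * det ?\<Xi>))\<^sup>2 * hdet c ?y)"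
  using det_herm_columns[of "%i. ?P (axis i 1)"] det_gram_hdet[OF c(1) yc]
  unfolding jvol_density_def c_def[symmetric] Let_def o_def by simp
 also have "... = sqrt (Hf (h y) * (cmod (det ?\<Xi>))\<^sup>2)" by (simp add: Hf_chart[OF c] norm_mult power_mult_distrib mult_ac)
 finally show ?thesis by (simp add: real_sqrt_mult)
qed

lemma Hf_smooth_chart: "c : atlas M ==> cont_diff k (chart_image c) (%y. hdet c y * (cmod (dA c y))\<^sup>2)"
proof -
 assume c: "c : atlas M"
 note o = chart_image_open[OF chM c]
 have d: "cont_diff k (chart_image c) (dA c)"
  using cdiff_smooth_complex[OF o dA_cdiff[OF c]] by (simp add: smooth_on_def)
 show ?thesis unfolding cmod_power2 unfolding power2_eq_square
  by (intro cont_diff_mult cont_diff_add cont_diff_linear[OF o bounded_linear_Re] cont_diff_linear[OF o bounded_linear_Im] hdet_smooth o c d)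
qed

lemma Hf_smooth:
 fixes f :: "'a::real_normed_vector => 'm"
 assumes W: "open W" "continuous_map (top_of_set W) (mtop M) f"
  and sm: "!!c. c : atlas M ==> smooth_on {y : W. f y : fst c} (%y. snd c (f y))"
 shows "cont_diff k W (%y. Hf (f y))"
proof (rule cont_diff_local)
 fix y assume y: "y : W"
 hence "f y : pts M" using W(2) by (auto simp: continuous_map_def)
 then obtain c where c: "c : atlas M" "f y : fst c" using charted_chart_at[OF chM] by blast
 let ?T = "{y : W. f y : fst c}"
 have T: "open ?T" by (rule open_preimage[OF W(2,1) chart_openin[OF chM c(1)]])
 have "cont_diff k ?T (%y. hdet c (snd c (f y)) * (cmod (dA c (snd c (f y))))\<^sup>2)"
  by (rule cont_diff_compose[OF T chart_image_open[OF chM c(1)] _ Hf_smooth_chart[OF c(1)]])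
   (use sm[OF c(1)] chart_mem_image[OF chM c(1)] in \<open>auto simp: smooth_on_def\<close>)
 hence "cont_diff k ?T (%y. Hf (f y))"
  by (rule cont_diff_cong[OF T, rotated]) (simp add: Hf_chart[OF c(1)])
 thus "EX T. open T & y : T & cont_diff k T (%y. Hf (f y))" using T y c(2) by (intro exI[of _ ?T]) auto
qed

end

section \<open>First variation\<close>

text \<open>The common setting of the two immersions of an orbit: either M1 is the group acting on
  itself, q is 1 and \<iota> is x |-> p k x, or M1 is M, q is p k and \<iota> is the identity. The
  assumption \<open>dec_some\<close> fixes the decomposition to be the one chosen inside
  \<open>jvol\<close>.\<close>

locale orbvar = khom K N G M act g p + A: orbint K N G M1 act1 q \<D>
 for K :: "'k monoid" and N :: "('k, complex ^ 'n) cmfd" and G :: "'k set"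
  and M :: "('m, complex ^ 'n) cmfd" and act :: "'m => 'k => 'm" and g :: "('m, 'n) metric" and p :: 'm
  and M1 :: "('l, complex ^ 'n) cmfd" and act1 :: "'l => 'k => 'l" and q :: 'l
  and \<D> :: "((real ^ 'n) set \<times> (real ^ 'n => 'l) \<times> (real ^ 'n) set) set" +
 fixes \<iota> :: "'l => 'm"
 assumes hol: "holomorphic_map M1 M \<iota>"
  and equivariant: "!!l x. l : pts M1 ==> x : carrier K ==> \<iota> (act1 l x) = act (\<iota> l) x"
  and \<iota>q: "\<iota> q : \<O>" and dec_some: "\<D> = (SOME \<D>. param_decomposition M1 (act1 q ` G) \<D>)"
begin

lemma \<iota>_L: "l : A.L ==> \<iota> l : \<O>"
 using equivariant[OF A.qt G_carrier] act_O[OF \<iota>q G_carrier] by auto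

lemma Hf_\<iota>: "l : A.L ==> Hf (\<iota> l) = Hf (\<iota> q)"
 using equivariant[OF A.qt G_carrier] Hf_G[of "\<iota> q"] fin_stab_O[OF \<iota>q] by (auto simp: fin_stab_def)

lemma mcf_cong: "(\<forall>\<^sub>F z in nhds y. f z = f' z) ==> mcf f y v = mcf f' y v"
proof -
 assume ev: "\<forall>\<^sub>F z in nhds y. f z = f' z"
 have e: "\<forall>\<^sub>F z in nhds y. snd c (f z) = snd c (f' z)" "\<forall>\<^sub>F z in nhds y. snd c (f' z) = snd c (f z)" for c :: "('m, complex ^ 'n) chart"
  using ev by (eventually_elim, simp)+
 have "hasD (%z. snd c (f z)) D y = hasD (%z. snd c (f' z)) D y" for c :: "('m, complex ^ 'n) chart" and D
  by (rule iffI; erule has_derivative_cong_nhds, rule e)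
 hence "fd (%z. snd c (f z)) y = fd (%z. snd c (f' z)) y" for c :: "('m, complex ^ 'n) chart"
  unfolding frechet_derivative_def by simp
 thus ?thesis unfolding mcf_def using eventually_nhds_x_imp_x[OF ev] by simp
qed

text \<open>Because \<iota> intertwines the flows of exp (sX), its differential carries the
  infinitesimal action on M1 to that on M, so the same Lie algebra vector solves both defining
  equations.\<close>

lemma mcf_\<iota>:
 fixes h :: "'a::real_normed_vector => 'l"
 assumes S: "open S" "continuous_map (top_of_set S) (mtop M1) h" "y : S"
  and fs: "A.fin_stab (h y)" "fin_stab (\<iota> (h y))"
  and c1: "c1 : atlas M1" "h y : fst c1" and P: "hasD (%z. snd c1 (h z)) P y"
 shows "mcf (%z. \<iota> (h z)) y v = A.mcf h y v"
proof -
 obtain c where c: "c : atlas M" "\<iota> (h y) : fst c" using fs(2) charted_chart_at[OF chM] unfolding fin_stab_def by blast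
 let ?R = "fd (%y. snd c (\<iota> (chart_inv c1 y))) (snd c1 (h y))"
 have D: "hasD (%z. snd c (\<iota> (h z))) (%v. ?R (P v)) y"
  by (rule chart_chain_rule[OF A.chM chM hol S c1 c P])
 have ht: "h y : pts M1" using fs(1) by (simp add: A.fin_stab_def)
 have RA: "?R (A.Am c1 (snd c1 (h y)) X) = Am c (snd c (\<iota> (h y))) X" for X
 proof -
  let ?u = "%s. act1 (h y) (Exp (s *R X))"
  have u0: "?u 0 = h y" by (simp add: A.act_one[OF ht])
  have cu: "continuous_map (top_of_set UNIV) (mtop M1) ?u" using A.continuous_act_const[OF ht continuous_Exp_line] by simp
  have "hasD (%s. snd c (\<iota> (?u s))) (%s. fd (%y. snd c (\<iota> (chart_inv c1 y))) (snd c1 (?u 0)) (s *R A.Am c1 (snd c1 (h y)) X)) 0"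
   by (rule chart_chain_rule[OF A.chM chM hol open_UNIV cu UNIV_I c1(1) _ c(1) _ A.act_tang[OF c1 tang_Exp]]) (simp_all only: u0 c1(2) c(2))
  hence "hasD (%s. snd c (act (\<iota> (h y)) (Exp (s *R X)))) (%s. ?R (s *R A.Am c1 (snd c1 (h y)) X)) 0"
   by (simp add: equivariant[OF ht] A.act_one[OF ht])
  from has_derivative_unique[OF this act_tang[OF c tang_Exp], THEN fun_cong, of 1] show ?thesis by simp
 qed
 have ev1: "\<forall>\<^sub>F z in nhds y. h z : fst c1"
  unfolding eventually_nhds using open_preimage[OF S(2,1) chart_openin[OF A.chM c1(1)]] S(3) c1(2) by blast
 have "continuous_map (top_of_set S) (mtop M) (%z. \<iota> (h z))"
  using cm_compose[OF S(2) holomorphic_map_continuous[OF hol]] unfolding o_def .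
 hence ev: "\<forall>\<^sub>F z in nhds y. \<iota> (h z) : fst c"
  unfolding eventually_nhds using open_preimage[OF _ S(1) chart_openin[OF chM c(1)]] S(3) c(2) by blast
 show ?thesis
  by (rule mcf_unique[where f = "%z. \<iota> (h z)", OF fs(2) c(1) ev D]) (simp add: RA[symmetric] A.mcf[OF fs(1) c1(1) ev1 P])
qed

lemma \<iota>_smooth:
 "lpar M1 A.L U ps ==> c : atlas M ==> smooth_on {y : U. \<iota> (ps y) : fst c} (%y. snd c (\<iota> (ps y)))"
 by (rule chart_smooth[OF A.chM chM hol lparD(1) lpar_cont(1) lparD(4)])

lemma \<iota>_param_open:
 "lpar M1 A.L U ps ==> c : atlas M ==> open {y : U. \<iota> (ps y) : fst c}"
 by (rule open_preimage[OF cm_compose[OF lpar_cont(1) holomorphic_map_continuous[OF hol], unfolded o_def]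
    lparD(1) chart_openin[OF chM]])

lemma \<iota>_param:
 assumes ps: "lpar M1 A.L U ps" and y: "y : U"
 shows "fin_stab (\<iota> (ps y))" "mcf (%y. \<iota> (ps y)) y v = lb (A.fr ps y v)"
  "c : atlas M ==> \<iota> (ps y) : fst c ==> fd (%y. snd c (\<iota> (ps y))) y v = Am c (snd c (\<iota> (ps y))) (lb (A.fr ps y v))"
proof -
 have L: "ps y : A.L" using lpar_cont(2)[OF ps] y by blast
 show fs: "fin_stab (\<iota> (ps y))" by (rule fin_stab_O[OF \<iota>_L[OF L]])
 obtain c1 where c1: "c1 : atlas M1" "ps y : fst c1" "\<forall>\<^sub>F z in nhds y. ps z : fst c1"
  "hasD (%z. snd c1 (ps z)) (fd (%y. snd c1 (ps y)) y) y" "A.fin_stab (ps y)"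
  using A.param_chart[OF A.fsq ps y] .
 show m: "mcf (%y. \<iota> (ps y)) y v = lb (A.fr ps y v)"
  using mcf_\<iota>[OF lparD(1)[OF ps] lpar_cont(1)[OF ps] y c1(5) fs c1(1,2,4)] A.fr(1)[OF A.fsq ps y] by simp
 assume c: "c : atlas M" "\<iota> (ps y) : fst c"
 have "\<forall>\<^sub>F z in nhds y. \<iota> (ps z) : fst c" unfolding eventually_nhds using \<iota>_param_open[OF ps c(1)] y c(2) by blast
 moreover have "hasD (%y. snd c (\<iota> (ps y))) (fd (%y. snd c (\<iota> (ps y))) y) y"
  by (rule smooth_hasD[OF \<iota>_smooth[OF ps c(1)]]) (use y c in simp)
 ultimately show "fd (%y. snd c (\<iota> (ps y))) y v = Am c (snd c (\<iota> (ps y))) (lb (A.fr ps y v))"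
  using mcf[where f = "%y. \<iota> (ps y)", OF fs c(1)] by (simp add: m[symmetric])
qed

text \<open>The tangent space is the image of the real Lie algebra under the bijective complex
  linear map A, which carries the splitting into real and imaginary parts over to the tangent space
  of M.\<close>

lemma totally_real_\<iota>: "totally_real_immersion M1 A.L M \<iota>" unfolding totally_real_immersion_def
proof (intro conjI allI ballI impI)
 show "continuous_map (subtopology (mtop M1) A.L) (mtop M) \<iota>"
  by (rule continuous_map_from_subtopology[OF holomorphic_map_continuous[OF hol]])
 fix U ps c assume c: "c : atlas M" and ps: "lpar M1 A.L U ps"
 show "smooth_on {x : U. \<iota> (ps x) : fst c} (snd c \<circ> \<iota> \<circ> ps)" using \<iota>_smooth[OF ps c] by (simp add: o_def)
 fix y assume y: "y : U" "\<iota> (ps y) : fst c"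
 let ?D = "fd (snd c \<circ> \<iota> \<circ> ps) y" and ?A = "Am c (snd c (\<iota> (ps y)))"
 have fs: "fin_stab (\<iota> (ps y))" by (rule \<iota>_param(1)[OF ps y(1)])
 have A: "complex_linear ?A" by (rule Am_linear[OF c chart_mem_image[OF chM c y(2)]])
 have bij: "bij ?A" by (rule complex_linear_bij[OF A Am_inj'[OF fs c y(2)]])
 have D: "?D v = ?A (lb (A.fr ps y v))" for v using \<iota>_param(3)[OF ps y(1) c y(2)] by (simp add: o_def)
 have "inj ?D"
  by (rule injI) (use D bij_is_inj[OF bij] lb(2) A.fr(3)[OF A.fsq ps y(1)] in \<open>metis injD\<close>)
 moreover have "EX! (u, v). u : range ?D & v : range ?D & w = u + imul v" for w
 proof -
  obtain Z where Z: "w = ?A Z" using bij by (meson bij_pointE)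
  have r: "?A X : range ?D" if "X : \<gg>" for X
   using D[of "A.invfr ps y (lbi X)"] A.invfr(1)[OF ps y(1)] lbi(2)[OF that] by (metis rangeI)
  have add: "?A X + imul (?A Y) = ?A (X + imul Y)" for X Y using A by (simp add: clin_def linear_add)
  show ?thesis
  proof (rule ex1I[of _ "(?A (rep Z), ?A (imp Z))"])
   show "case (?A (rep Z), ?A (imp Z)) of (u, v) => u : range ?D & v : range ?D & w = u + imul v"
    using r[OF rep_imp(1)] r[OF rep_imp(2)] by (simp add: add rep_imp(3)[symmetric] Z)
   fix uv assume "case uv of (u, v) => u : range ?D & v : range ?D & w = u + imul v"
   then obtain a b where ab: "uv = (?D a, ?D b)" "w = ?D a + imul (?D b)" by (cases uv) auto
   hence "?A Z = ?A (lb (A.fr ps y a) + imul (lb (A.fr ps y b)))" by (simp add: D add Z)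
   hence "Z = lb (A.fr ps y a) + imul (lb (A.fr ps y b))" by (rule injD[OF bij_is_inj[OF bij]])
   thus "uv = (?A (rep Z), ?A (imp Z))" using rep_imp_eq[OF lb_lie lb_lie] by (simp add: ab(1) D)
  qed
 qed
 ultimately show "let D = ?D in inj D & (ALL w. EX! (u, v). u : range D & v : range D & w = u + imul v)" unfolding Let_def by blast
qed

lemma frame_det:
 assumes ps: "lpar M1 A.L U ps" and y: "y : U"
 shows "(\<chi> i j. mcf (%y. \<iota> (ps y)) y (axis j 1) $ i) = LM ** (\<chi> i j. complex_of_real (matrix (A.fr ps y) $ i $ j))"
  "cmod (det (\<chi> i j. mcf (%y. \<iota> (ps y)) y (axis j 1) $ i)) = cmod (det LM) * A.dens ps y"
proof -
 show 1: "(\<chi> i j. mcf (%y. \<iota> (ps y)) y (axis j 1) $ i) = LM ** (\<chi> i j. complex_of_real (matrix (A.fr ps y) $ i $ j))"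
  using LM_columns[of "%j. lb (A.fr ps y (axis j 1))"] by (simp add: \<iota>_param(2)[OF assms] lbi(1) matrix_def)
 show "cmod (det (\<chi> i j. mcf (%y. \<iota> (ps y)) y (axis j 1) $ i)) = cmod (det LM) * A.dens ps y"
  unfolding 1 by (simp add: det_mul det_of_real norm_mult A.dens_def)
qed

text \<open>The constant involves M1, its orbit and the decomposition, but not \<iota>. All orbits
  of G in the open orbit are immersed copies of the same G, so one constant serves them all.\<close>

definition vol where "vol = cmod (det LM) * A.Jint (%_. 1)"

lemma jvol_\<iota>: "jvol M1 A.L M g \<iota> = vol * sqrt (Hf (\<iota> q))"
proof -
 have d: "jvol_density M g (\<iota> \<circ> ps) y = sqrt (Hf (\<iota> q)) * cmod (det LM) * (1 * A.dens ps y)"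
  if ps: "lpar M1 A.L U ps" and y: "y : U" for U ps y
 proof -
  have "jvol_density M g (%y. \<iota> (ps y)) y = sqrt (Hf (\<iota> (ps y))) * cmod (det (\<chi> i j. mcf (%y. \<iota> (ps y)) y (axis j 1) $ i))"
  proof (rule jvol_density_mcf[where h = "%y. \<iota> (ps y)", OF \<iota>_param(1)[OF that]])
   fix c assume c: "c : atlas M" "\<iota> (ps y) : fst c"
   show "\<forall>\<^sub>F z in nhds y. \<iota> (ps z) : fst c" unfolding eventually_nhds using \<iota>_param_open[OF ps c(1)] y c(2) by blast
   show "(%z. snd c (\<iota> (ps z))) differentiable (at y)"
    by (rule differentiableI[OF smooth_hasD[OF \<iota>_smooth[OF ps c(1)]]]) (use y c in simp)
  qed
  thus ?thesis using Hf_\<iota> lpar_cont(2)[OF ps] y by (auto simp: frame_det(2)[OF that] o_def)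
 qed
 note pd = param_decompositionD[OF A.dec]
 have "jvol M1 A.L M g \<iota> = (\<Sum>(U, ps, B)\<in>\<D>. LINT y:B|lborel. jvol_density M g (\<iota> \<circ> ps) y)"
  unfolding jvol_def dec_some[symmetric] ..
 also have "... = (\<Sum>(U, ps, B)\<in>\<D>. sqrt (Hf (\<iota> q)) * cmod (det LM) * (LINT y:B|lborel. 1 * A.dens ps y))"
 proof (rule sum.cong[OF refl], clarify)
  fix U ps B assume e: "(U, ps, B) : \<D>"
  have "(LINT y:B|lborel. jvol_density M g (\<iota> \<circ> ps) y) = (LINT y:B|lborel. sqrt (Hf (\<iota> q)) * cmod (det LM) * (1 * A.dens ps y))"
   by (rule set_lebesgue_integral_cong) (use pd(3)[OF e] d[OF pd(2)[OF e]] pd(6)[OF e] in auto)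
  thus "(LINT y:B|lborel. jvol_density M g (\<iota> \<circ> ps) y) = sqrt (Hf (\<iota> q)) * cmod (det LM) * (LINT y:B|lborel. 1 * A.dens ps y)"
   by (simp only: set_integral_mult_right)
 qed
 also have "... = vol * sqrt (Hf (\<iota> q))"
  unfolding vol_def A.Jint_def by (simp add: sum_distrib_left case_prod_unfold mult_ac)
 finally show ?thesis .
qed

lemma vol_pos: "0 < vol" using A.Jint_one_pos det_LM by (simp add: vol_def)

end

locale orbvarF = orbvar K N G M act g p M1 act1 q \<D> \<iota>
 for K :: "'k monoid" and N :: "('k, complex ^ 'n) cmfd" and G :: "'k set"
  and M :: "('m, complex ^ 'n) cmfd" and act :: "'m => 'k => 'm" and g :: "('m, 'n) metric" and p :: 'm
  and M1 :: "('l, complex ^ 'n) cmfd" and act1 :: "'l => 'k => 'l" and q :: 'l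
  and \<D> :: "((real ^ 'n) set \<times> (real ^ 'n => 'l) \<times> (real ^ 'n) set) set" and \<iota> :: "'l => 'm" +
 fixes \<epsilon> :: real and F :: "real => 'l => 'm"
 assumes F: "totally_real_variation M1 A.L M \<iota> \<epsilon> F"
begin

text \<open>The components, in the frame of the action, of the real part of the variation
  field.\<close>

definition \<phi>F :: "'l => real ^ 'n" where "\<phi>F l = lbi (mcf (%t. F t l) 0 (1::real))"
definition fF where "fF ps z = F (fst z) (ps (snd z))"
text \<open>A variation may leave the open orbit, outside of which the infinitesimal action can
  degenerate. This open set contains the slice t = 0, and on it the Maurer-Cartan form is
  available.\<close>

definition SF where "SF U ps = {z : {-\<epsilon><..<\<epsilon>} \<times> U. fF ps z : \<O>}"

lemma \<epsilon>_pos: "0 < \<epsilon>" using F by (simp add: totally_real_variation_def)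

lemma fF:
 assumes ps: "lpar M1 A.L U ps"
 shows "open (SF U ps)" "continuous_map (top_of_set (SF U ps)) (mtop M) (fF ps)"
  "c : atlas M ==> smooth_on {z : SF U ps. fF ps z : fst c} (%z. snd c (fF ps z))"
  "z : SF U ps ==> fin_stab (fF ps z)" "y : U ==> fF ps (0, y) = \<iota> (ps y)" "y : U ==> (0, y) : SF U ps"
proof -
 have psL: "ps y : A.L" if "y : U" for y using lpar_cont(2)[OF ps] that by blast
 let ?S = "{-\<epsilon><..<\<epsilon>} \<times> U"
 have "continuous_map (top_of_set ?S) (subtopology (mtop M1) A.L) (%z. ps (snd z))"
 proof -
  have "continuous_map (top_of_set ?S) (top_of_set U) snd" by (auto simp: cm_in_sub continuous_on_snd)
  from cm_compose[OF this lpar_cont(1)[OF ps]] psL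
  show ?thesis by (auto simp: cm_in_sub o_def)
 qed
 moreover have "continuous_map (top_of_set ?S) (top_of_set {-\<epsilon><..<\<epsilon>}) fst"
  by (auto simp: cm_in_sub continuous_on_fst)
 ultimately have "continuous_map (top_of_set ?S) (prod_topology (top_of_set {-\<epsilon><..<\<epsilon>}) (subtopology (mtop M1) A.L)) (%z. (fst z, ps (snd z)))"
  by (simp add: continuous_map_pairedI)
 moreover have "continuous_map (prod_topology (top_of_set {-\<epsilon><..<\<epsilon>}) (subtopology (mtop M1) A.L)) (mtop M) (%z. F (fst z) (snd z))"
  using F by (simp add: totally_real_variation_def case_prod_unfold)
 ultimately have c: "continuous_map (top_of_set ?S) (mtop M) (fF ps)"
  unfolding fF_def[abs_def] using cm_compose by (fastforce simp: o_def)
 show "open (SF U ps)" unfolding SF_def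
  by (rule open_preimage[OF c open_Times[OF open_greaterThanLessThan lparD(1)[OF ps]] openO])
 show "continuous_map (top_of_set (SF U ps)) (mtop M) (fF ps)"
  by (rule continuous_map_from_subtopology_mono[OF c]) (auto simp: SF_def)
 show "smooth_on {z : SF U ps. fF ps z : fst c} (%z. snd c (fF ps z))" if "c : atlas M"
 proof (rule smooth_on_subset)
  show "smooth_on {(t, x). \<bar>t\<bar> < \<epsilon> & x : U & F t (ps x) : fst c} (%z. snd c (fF ps z))"
   using F that ps by (simp add: totally_real_variation_def fF_def case_prod_unfold)
 qed (auto simp: SF_def fF_def)
 show "z : SF U ps ==> fin_stab (fF ps z)" by (rule fin_stab_O) (simp add: SF_def)
 show f0: "y : U ==> fF ps (0, y) = \<iota> (ps y)" using F psL unfolding totally_real_variation_def by (simp only: fF_def fst_conv snd_conv)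
 show "y : U ==> (0, y) : SF U ps" using f0 \<iota>_L[OF psL] \<epsilon>_pos by (simp add: SF_def)
qed

lemma fF_chart:
 assumes ps: "lpar M1 A.L U ps" and z: "z : SF U ps" and c: "c : atlas M" "fF ps z : fst c"
 shows "\<forall>\<^sub>F z in nhds z. fF ps z : fst c"
  "hasD (%z. snd c (fF ps z)) (fd (%z. snd c (fF ps z)) z) z"
proof -
 show "\<forall>\<^sub>F z in nhds z. fF ps z : fst c"
  unfolding eventually_nhds using open_preimage[OF fF(2,1)[OF ps] chart_openin[OF chM c(1)]] z c(2) by blast
 show "hasD (%z. snd c (fF ps z)) (fd (%z. snd c (fF ps z)) z) z"
  by (rule smooth_hasD[OF fF(3)[OF ps c(1)]]) (use z c(2) in simp)
qed

lemma fF_slice: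
 assumes ps: "lpar M1 A.L U ps" and z: "a x : SF U ps" and a: "hasD a a' x"
 shows "mcf (%x. fF ps (a x)) x v = mcf (fF ps) (a x) (a' v)"
proof -
 note fs = fF(4)[OF ps z]
 obtain c where c: "c : atlas M" "fF ps (a x) : fst c" using fs charted_chart_at[OF chM] unfolding fin_stab_def by blast
 show ?thesis by (rule mcf_compose[OF fs c(1) fF_chart[OF ps z c] a])
qed

lemma fF_mcf_smooth: "lpar M1 A.L U ps ==> smooth_on (SF U ps) (%z. mcf (fF ps) z w)"
 by (rule mcf_smooth[OF fF(1,2) fF(3) fF(4)])

lemma \<phi>F_param:
 assumes ps: "lpar M1 A.L U ps" and y: "y : U"
 shows "\<phi>F (ps y) = lbi (mcf (fF ps) (0, y) (1, 0))"
proof -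
 have "hasD (%t. (t, y)) (%t. (t, 0)) (0::real)" by (intro derivative_eq_intros) auto
 from fF_slice[OF ps fF(6)[OF ps y] this, of 1] show ?thesis by (simp add: \<phi>F_def fF_def)
qed

lemma \<eta>_smooth:
 assumes ps: "lpar M1 A.L U ps"
 shows "cont_diff k U (%y. mcf (fF ps) (0, y) (1, 0))"
proof -
 have "cont_diff k U (%y. mcf (fF ps) ((0, 0) + (0, y)) (1, 0))"
  by (rule cont_diff_affine[OF lparD(1)[OF ps] fF(1)[OF ps]])
   (use fF(6)[OF ps] fF_mcf_smooth[OF ps] in \<open>auto simp: smooth_on_def bounded_linear_Pair bounded_linear_zero bounded_linear_ident\<close>)
 thus ?thesis by simp
qed

lemma \<phi>F_smooth:
 assumes ps: "lpar M1 A.L U ps"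
 shows "smooth_on U (%y. \<phi>F (ps y))" unfolding smooth_on_def
proof
 fix k
 have "cont_diff k U (%y. lbi (mcf (fF ps) (0, y) (1, 0)))"
  by (rule cont_diff_linear[OF lparD(1)[OF ps] _ \<eta>_smooth[OF ps]]) (use lbi(3) in \<open>simp add: linear_conv_bounded_linear\<close>)
 thus "cont_diff k U (%y. \<phi>F (ps y))"
  by (rule cont_diff_cong[OF lparD(1)[OF ps], rotated]) (simp add: \<phi>F_param[OF ps])
qed

definition XiF :: "(real ^ 'n => 'l) => real \<times> (real ^ 'n) => complex ^ 'n ^ 'n" where
 "XiF ps z = (\<chi> i j. mcf (fF ps) z (0, axis j 1) $ i)"

lemma XiF_0:
 assumes ps: "lpar M1 A.L U ps" and y: "y : U"
 shows "XiF ps (0, y) = LM ** (\<chi> i j. complex_of_real (matrix (A.fr ps y) $ i $ j))"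
  "cmod (det (XiF ps (0, y))) = cmod (det LM) * A.dens ps y"
proof -
 have d: "hasD (%y. (0::real, y)) (%v. (0, v)) y" by (intro derivative_eq_intros) auto
 have ev: "\<forall>\<^sub>F y' in nhds y. fF ps (0, y') = \<iota> (ps y')"
  unfolding eventually_nhds using lparD(1)[OF ps] y fF(5)[OF ps] by blast
 have "mcf (fF ps) (0, y) (0, v) = mcf (%y. \<iota> (ps y)) y v" for v
  using fF_slice[OF ps fF(6)[OF ps y] d, of v] mcf_cong[OF ev, of v] by simp
 thus "XiF ps (0, y) = LM ** (\<chi> i j. complex_of_real (matrix (A.fr ps y) $ i $ j))"
  "cmod (det (XiF ps (0, y))) = cmod (det LM) * A.dens ps y"
  using frame_det[OF ps y] by (simp_all add: XiF_def)
qed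

lemma XiF_smooth:
 assumes ps: "lpar M1 A.L U ps"
 shows "cont_diff k (SF U ps) (%z. XiF ps z $ i $ j)" "cont_diff k (SF U ps) (%z. det (XiF ps z))"
proof -
 show *: "cont_diff k (SF U ps) (%z. XiF ps z $ i $ j)" for i j
  unfolding XiF_def using cont_diff_vec_nth[OF fF(1)[OF ps], of k "%z. mcf (fF ps) z (0, axis j 1)" i] fF_mcf_smooth[OF ps]
  by (simp add: smooth_on_def)
 show "cont_diff k (SF U ps) (%z. det (XiF ps z))" by (rule cont_diff_det[OF fF(1)[OF ps] *])
qed

lemma density_F:
 assumes ps: "lpar M1 A.L U ps" and z: "(t, y) : SF U ps"
 shows "jvol_density M g (F t \<circ> ps) y = sqrt (Hf (fF ps (t, y)) * (cmod (det (XiF ps (t, y))))\<^sup>2)"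
proof -
 have d: "hasD (%y. (t, y)) (%v. (0, v)) y" by (intro derivative_eq_intros) auto
 have cont: "filterlim (%y. (t, y)) (nhds (t, y)) (nhds y)"
  using has_derivative_continuous[OF d] by (simp add: isCont_def tendsto_at_iff_tendsto_nhds)
 have "jvol_density M g (%y. fF ps (t, y)) y = sqrt (Hf (fF ps (t, y))) * cmod (det (\<chi> i j. mcf (%y. fF ps (t, y)) y (axis j 1) $ i))"
 proof (rule jvol_density_mcf[where h = "%y. fF ps (t, y)", OF fF(4)[OF ps z]])
  fix c assume c: "c : atlas M" "fF ps (t, y) : fst c"
  note fc = fF_chart[OF ps z c]
  show "\<forall>\<^sub>F y in nhds y. fF ps (t, y) : fst c" using cont fc(1) unfolding filterlim_iff by blast
  show "(%y. snd c (fF ps (t, y))) differentiable (at y)"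
   using hasD_chain[OF d fc(2)] unfolding o_def by (rule differentiableI)
 qed
 thus ?thesis using fF_slice[OF ps z d] by (simp add: XiF_def fF_def o_def real_sqrt_mult)
qed

end

section \<open>Derivative of the density at a maximal orbit\<close>

context orbvarF
begin

text \<open>At t = 0 the frame is \<open>LM\<close> times a real matrix, so B is a real matrix times
  the inverse of \<open>LM\<close>. Taking the real part therefore replaces the variation field by
  its components \<phi>F, and what is left is the trace defining their divergence.\<close>

lemma trace_divergence:
 assumes ps: "lpar M1 A.L U ps" and y: "y : U" and B: "B ** XiF ps (0, y) = mat 1"
 shows "Re (trace (B ** (\<chi> i j. fd (%z. mcf (fF ps) z (1, 0)) (0, y) (0, axis j 1) $ i))) = A.divL \<phi>F (ps y)"
proof -
 let ?D = "%v. fd (%z. mcf (fF ps) z (1, 0)) (0, y) (0, v)"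
 have bl: "bounded_linear lbi" using lbi(3) by (simp add: linear_conv_bounded_linear)
 have "hasD (%y. (0::real, y)) (%v. (0, v)) y" by (intro derivative_eq_intros) auto
 from hasD_chain[OF this smooth_hasD[OF fF_mcf_smooth[OF ps] fF(6)[OF ps y]]]
 have "hasD (%y. mcf (fF ps) (0, y) (1, 0)) ?D y" unfolding o_def .
 from bounded_linear.has_derivative[OF bl this]
 have "hasD (%y. \<phi>F (ps y)) (%v. lbi (?D v)) y"
  by (rule hasD_transform[OF _ lparD(1)[OF ps] y]) (simp add: \<phi>F_param[OF ps])
 note D\<phi> = fd_eqI[OF this] and lin = has_derivative_linear[OF this]
 obtain Li where Li: "Li ** LM = mat 1" "LM ** Li = mat 1" using det_nonzero_inverse[OF det_LM] by blast
 let ?i = "A.invfr ps y" and ?f = "A.fr ps y"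
 let ?Fi = "\<chi> i j. complex_of_real (matrix ?i $ i $ j)" and ?Fc = "\<chi> i j. complex_of_real (matrix ?f $ i $ j)"
 note fr = A.fr[OF A.fsq ps y] and inv = A.invfr[OF ps y]
 have fi: "?i (?f v) = v" for v by (rule injD[OF fr(3)]) (rule inv(1))
 have "matrix (%v :: real ^ 'n. v) = mat 1" by (simp add: matrix_def mat_def vec_eq_iff axis_def)
 hence "matrix ?i ** matrix ?f = mat 1" using matrix_compose[OF fr(2) inv(3)] by (simp add: o_def fi)
 hence "?Fi ** ?Fc = mat 1"
  by (simp add: vec_eq_iff matrix_matrix_mult_def mat_def flip: of_real_mult of_real_sum)
 hence "(?Fi ** Li) ** XiF ps (0, y) = mat 1"
 proof -
  assume F: "?Fi ** ?Fc = mat 1"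
  have "(?Fi ** Li) ** (LM ** ?Fc) = ?Fi ** (Li ** LM) ** ?Fc" by (simp only: matrix_mul_assoc)
  thus ?thesis unfolding XiF_0(1)[OF ps y] by (simp add: Li(1) F)
 qed
 hence "XiF ps (0, y) ** (?Fi ** Li) = mat 1" using matrix_left_right_inverse by blast
 hence BF: "B = ?Fi ** Li" using matrix_mul_assoc[of B "XiF ps (0, y)" "?Fi ** Li"] B by simp
 let ?w = "%j. Li *v ?D (axis j 1)"
 have w: "lbi (?D (axis j 1)) $ k = Re (?w j $ k)" for j k
  using lbi_LM[of "?w j"] by (simp add: matrix_vector_mul_assoc Li(2))
 have "trace (B ** (\<chi> i j. ?D (axis j 1) $ i)) = (\<Sum>i\<in>UNIV. \<Sum>k\<in>UNIV. complex_of_real (?i (axis k 1) $ i) * ?w i $ k)"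
  unfolding BF matrix_mul_assoc[symmetric]
  by (simp add: trace_def matrix_matrix_mult_def[of ?Fi] matrix_def) (simp add: matrix_matrix_mult_def matrix_vector_mult_def)
 hence "Re (trace (B ** (\<chi> i j. ?D (axis j 1) $ i))) = (\<Sum>i\<in>UNIV. \<Sum>k\<in>UNIV. ?i (axis k 1) $ i * lbi (?D (axis i 1)) $ k)"
  by (simp add: w)
 also have "... = (\<Sum>k\<in>UNIV. \<Sum>i\<in>UNIV. ?i (axis k 1) $ i * lbi (?D (axis i 1)) $ k)" by (rule sum.swap)
 also have "... = (\<Sum>k\<in>UNIV. lbi (?D (?i (axis k 1))) $ k)"
 proof (rule sum.cong[OF refl])
  fix k
  let ?a = "?i (axis k 1)"
  have a: "(\<Sum>i\<in>UNIV. ?a $ i *R axis i 1) = ?a"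
   by (simp add: vec_eq_iff axis_def if_distrib cong: if_cong)
  have "lbi (?D (\<Sum>i\<in>UNIV. ?a $ i *R axis i 1)) = (\<Sum>i\<in>UNIV. ?a $ i *R lbi (?D (axis i 1)))"
   unfolding linear_sum[OF lin] linear_scale[OF lin] ..
  hence "lbi (?D ?a) = (\<Sum>i\<in>UNIV. ?a $ i *R lbi (?D (axis i 1)))" unfolding a .
  thus "(\<Sum>i\<in>UNIV. ?a $ i * lbi (?D (axis i 1)) $ k) = lbi (?D ?a) $ k" by simp
 qed
 finally show ?thesis unfolding A.divL_param[OF ps y \<phi>F_smooth[OF ps]] D\<phi> .
qed

text \<open>The square of the J-volume density. It is smooth even where the determinant vanishes,
  and the root is taken only where it is positive.\<close>

definition EF where "EF ps z = Hf (fF ps z) * (cmod (det (XiF ps z)))\<^sup>2"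

lemma EF_smooth:
 assumes ps: "lpar M1 A.L U ps" shows "cont_diff k (SF U ps) (EF ps)"
 unfolding EF_def[abs_def] cmod_power2 unfolding power2_eq_square
 by (intro cont_diff_mult cont_diff_add cont_diff_linear[OF fF(1)[OF ps] bounded_linear_Re] cont_diff_linear[OF fF(1)[OF ps] bounded_linear_Im]
   XiF_smooth(2)[OF ps] Hf_smooth[OF fF(1,2)[OF ps] fF(3)[OF ps]] fF(1)[OF ps])

lemma EF_t:
 assumes ps: "lpar M1 A.L U ps" and z: "(t, y) : SF U ps"
 shows "hasR (%t. EF ps (t, y)) (fd (EF ps) (t, y) (1, 0)) t"
proof -
 have d: "hasD (%t. (t, y)) (%h. (h, 0)) t" by (intro derivative_eq_intros) auto
 have E: "hasD (EF ps) (fd (EF ps) (t, y)) (t, y)"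
  by (rule cd_SucD(1)[OF EF_smooth[OF ps, of "Suc 0"] z])
 have "fd (EF ps) (t, y) (h, 0) = fd (EF ps) (t, y) (1, 0) * h" for h
  using linear_scale[OF has_derivative_linear[OF E], of h "(1, 0)"] by (simp add: mult.commute)
 hence "(%h. fd (EF ps) (t, y) (h, 0)) = (*) (fd (EF ps) (t, y) (1, 0))" by (rule ext)
 thus ?thesis using hasD_chain[OF d E] unfolding has_field_derivative_def o_def by (simp only:)
qed

text \<open>At a maximum the factor H contributes nothing to first order. Jacobi's formula
  differentiates the determinant, and the structure equation moves the t-derivative of the frame
  onto the variation field.\<close>

lemma EF_dt_0:
 assumes max: "!!m. m : pts M ==> Hf m <= Hf (\<iota> q)" and ps: "lpar M1 A.L U ps" and y: "y : U"
 shows "fd (EF ps) (0, y) (1, 0) = 2 * EF ps (0, y) * A.divL \<phi>F (ps y)"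
proof -
 note z = fF(6)[OF ps y]
 have L: "ps y : A.L" using lpar_cont(2)[OF ps] y by blast
 have d: "hasD (%t. (t, y)) (%h. (h, 0)) (0::real)" by (intro derivative_eq_intros) auto
 let ?X = "XiF ps" and ?a = "%t. Hf (fF ps (t, y))"
 have aF: "hasD (%z. Hf (fF ps z)) (fd (%z. Hf (fF ps z)) (0, y)) (0, y)"
  by (rule cd_SucD(1)[OF Hf_smooth[OF fF(1,2)[OF ps] fF(3)[OF ps], where k = "Suc 0"] z])
 obtain a' where a': "hasR ?a a' 0" using has_real_derivative[OF hasD_chain[OF d aF, unfolded o_def]] .
 have o: "open {t : UNIV. (t, y) : SF U ps}"
  by (rule open_preimage[where X = euclidean]) (auto simp: fF(1)[OF ps] continuous_intros)
 then obtain r where r: "0 < r" "!!t. \<bar>t\<bar> < r ==> (t, y) : SF U ps"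
  using z unfolding open_dist by (auto simp: dist_real_def)
 have a0: "?a 0 = Hf (\<iota> q)" using fF(5)[OF ps y] Hf_\<iota>[OF L] by simp
 \<comment> \<open>H has a global maximum on the orbit, so along the variation t = 0 is a local
   maximum.\<close>
 have "a' = 0"
  by (rule DERIV_local_max[OF a' r(1)]) (use r(2) fF(4)[OF ps] max in \<open>auto simp: a0 fin_stab_def\<close>)
 with a' have a: "hasR ?a 0 0" by simp
 have det0: "det (?X (0, y)) ~= 0" using XiF_0(2)[OF ps y] det_LM A.fr(4)[OF A.fsq ps y] by auto
 then obtain B where B: "B ** ?X (0, y) = mat 1" using det_nonzero_inverse by blast
 define X' where "X' = (\<chi> i j. fd (%z. mcf (fF ps) z (0, axis j 1)) (0, y) (1, 0) $ i)"
 have dX: "hasD (%t. ?X (t, y)) (%t. t *R X') 0"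
  unfolding XiF_def X'_def has_derivative_vec_iff
 proof (intro allI)
  fix i j :: 'n
  have D: "hasD (%z. mcf (fF ps) z (0, axis j 1)) (fd (%z. mcf (fF ps) z (0, axis j 1)) (0, y)) (0, y)"
   by (rule smooth_hasD[OF fF_mcf_smooth[OF ps] z])
  have "fd (%z. mcf (fF ps) z (0, axis j 1)) (0, y) (t, 0) = t *R fd (%z. mcf (fF ps) z (0, axis j 1)) (0, y) (1, 0)" for t
   using linear_scale[OF has_derivative_linear[OF D], of t "(1, 0)"] by simp
  hence "(%t. fd (%z. mcf (fF ps) z (0, axis j 1)) (0, y) (t, 0)) = (%t. t *R fd (%z. mcf (fF ps) z (0, axis j 1)) (0, y) (1, 0))"
   by (rule ext)
  note d1 = hasD_chain[OF d D, unfolded o_def this]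
  from has_derivative_vec_nth[OF d1, of i]
  show "hasD (%t. (\<chi> i j. mcf (fF ps) (t, y) (0, axis j 1) $ i) $ i $ j) (%t. (t *R (\<chi> i j. fd (%z. mcf (fF ps) z (0, axis j 1)) (0, y) (1, 0) $ i)) $ i $ j) 0"
   by simp
 qed
 let ?b = "det (?X (0, y))" and ?\<tau> = "trace (B ** X')"
 have "((%t. det (?X (t, y))) has_vector_derivative ?b * ?\<tau>) (at 0)"
  using has_derivative_det[OF dX B] by (simp add: has_vector_derivative_def trace_scaleR)
 note b = this
 have re: "hasR (%t. Re (det (?X (t, y)))) (Re (?b * ?\<tau>)) 0"
  and im: "hasR (%t. Im (det (?X (t, y)))) (Im (?b * ?\<tau>)) 0"
  using bounded_linear.has_vector_derivative[OF bounded_linear_Re b] bounded_linear.has_vector_derivative[OF bounded_linear_Im b]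
  by (simp_all add: has_real_derivative_iff_has_vector_derivative)
 have "hasR (%t. EF ps (t, y)) (?a 0 * (2 * (Re ?b * Re (?b * ?\<tau>) + Im ?b * Im (?b * ?\<tau>)))) 0"
  using DERIV_mult[OF a DERIV_add[OF DERIV_power[OF re, of 2] DERIV_power[OF im, of 2]]]
  unfolding EF_def cmod_power2 by (simp add: algebra_simps)
 moreover have "Re ?b * Re (?b * ?\<tau>) + Im ?b * Im (?b * ?\<tau>) = (cmod ?b)\<^sup>2 * Re ?\<tau>"
  unfolding cmod_power2 by (simp add: algebra_simps power2_eq_square)
 ultimately have "fd (EF ps) (0, y) (1, 0) = 2 * EF ps (0, y) * Re ?\<tau>"
  using DERIV_unique[OF EF_t[OF ps z]] by (simp add: EF_def)
 \<comment> \<open>Here the t-derivative of the parameter directions is exchanged for the parameter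
   derivatives of the t-direction; the bracket is traceless.\<close>
 moreover have "?\<tau> = trace (B ** (\<chi> i j. fd (%z. mcf (fF ps) z (1, 0)) (0, y) (0, axis j 1) $ i))"
  unfolding X'_def by (rule mc_trace[OF unimod_G fF(1,2)[OF ps] z fF(3)[OF ps] fF(4)[OF ps]]) (use B in "simp_all add: XiF_def")
 ultimately show ?thesis using trace_divergence[OF ps y B] by simp
qed

text \<open>The root of \<open>EF\<close> is differentiated under the integral. This needs
  \<open>EF\<close> positive and the derivative bounded, uniformly for small t, and both come from
  compactness of the closure of B.\<close>

lemma piece_derivative:
 assumes max: "!!m. m : pts M ==> Hf m <= Hf (\<iota> q)" and e: "(U, ps, B) : \<D>"
 shows "hasR (%t. LINT y:B|lborel. jvol_density M g (F t \<circ> ps) y) (sqrt (Hf (\<iota> q)) * cmod (det LM) * (LINT y:B|lborel. A.divL \<phi>F (ps y) * A.dens ps y)) 0"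
proof -
 note pd = param_decompositionD[OF A.dec]
 note ps = pd(2)[OF e] and B = pd(3-6)[OF e]
 \<comment> \<open>Where the frame is invertible; there \<open>EF\<close> is positive and its root
   is smooth.\<close>
 define W where "W = {z : SF U ps. det (XiF ps z) : - {0}}"
 have W: "open W" unfolding W_def by (rule open_preimage[where X = euclidean])
   (use fF(1)[OF ps] cont_diff_continuous[OF XiF_smooth(2)[OF ps, of 0]] in auto)
 have Hp: "0 < Hf (fF ps z)" if "z : SF U ps" for z by (rule Hf_pos[OF fF(4)[OF ps that]])
 have EW: "0 < EF ps z" if "z : W" for z using that Hp[of z] by (auto simp: W_def EF_def)
 have WS: "z : SF U ps" if "z : W" for z using that by (simp add: W_def)
 have W0: "(0, y) : W" if "y : U" for y
  using fF(6)[OF ps that] XiF_0(2)[OF ps that] det_LM A.fr(4)[OF A.fsq ps that] by (auto simp: W_def)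
 have cB: "compact (closure B)" using B(2) by (simp add: compact_closure)
 \<comment> \<open>A compact slice inside an open set has a neighbourhood of uniform thickness,
   which yields one interval of parameters t for all of B.\<close>
 have "{0} \<times> closure B \<subseteq> W" using B(3) W0 by auto
 then obtain r where r: "0 < r" "(\<Union>z\<in>{0} \<times> closure B. ball z r) \<subseteq> W"
  by (rule compact_subset_open_imp_ball_epsilon_subset[OF compact_Times[OF compact_sing cB] W])
 define \<delta> where "\<delta> = r / 2"
 have tW: "(t, y) : W" if "\<bar>t\<bar> <= \<delta>" "y : closure B" for t y
 proof -
  have "(t, y) : ball (0, y) r" using that r(1) by (simp add: dist_Pair_Pair \<delta>_def dist_real_def)
  thus ?thesis using r(2) that(2) by blast
 qed
 define k where "k t y = sqrt (EF ps (t, y))" for t y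
 define k' where "k' t y = fd (EF ps) (t, y) (1, 0) / (2 * sqrt (EF ps (t, y)))" for t y
 have cE: "continuous_on W (EF ps)"
  by (rule continuous_on_subset[OF cont_diff_continuous[OF EF_smooth[OF ps, of 0]]]) (auto simp: W_def)
 have cE': "continuous_on W (%z. fd (EF ps) z (1, 0))"
  using cont_diff_continuous[OF cd_SucD(2)[OF EF_smooth[OF ps, of "Suc 0"], of "(1, 0)"]]
  by (rule continuous_on_subset) (auto simp: W_def)
 have ck': "continuous_on W (%z. k' (fst z) (snd z))"
  unfolding k'_def prod.collapse using EW by (intro continuous_intros cE cE') force
 have sl: "continuous_on (closure B) (%y. f (t, y))" if "continuous_on W f" "\<bar>t\<bar> <= \<delta>" for f :: "real \<times> (real ^ 'n) => real" and t
  by (rule continuous_on_compose2[OF that(1)]) (use tW that(2) in \<open>auto intro!: continuous_intros\<close>)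
 have "compact ({-\<delta>..\<delta>} \<times> closure B)" by (intro compact_Times cB compact_Icc)
 moreover have "{-\<delta>..\<delta>} \<times> closure B \<subseteq> W" using tW by auto
 ultimately have "bounded ((%z. k' (fst z) (snd z)) ` ({-\<delta>..\<delta>} \<times> closure B))"
  using compact_continuous_image continuous_on_subset[OF ck'] compact_imp_bounded by blast
 then obtain C where C: "ALL x:(%z. k' (fst z) (snd z)) ` ({-\<delta>..\<delta>} \<times> closure B). norm x <= C" unfolding bounded_iff by blast
 have "hasR (%t. LINT y:B|lborel. k t y) (LINT y:B|lborel. k' 0 y) 0"
 proof (rule bounded_piece_integral_derivative[OF _ B(1,2) order_refl])
  show "0 < \<delta>" using r(1) by (simp add: \<delta>_def)
  show "continuous_on (closure B) (k' 0)" using sl[OF ck', of 0] \<open>0 < \<delta>\<close> by simp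
  fix t :: real assume t: "\<bar>t\<bar> < \<delta>"
  show "continuous_on (closure B) (k t)" unfolding k_def[abs_def] using sl[OF cE, of t] t by (auto intro: continuous_on_real_sqrt)
  fix y assume y: "y : B"
  have yc: "y : closure B" using y closure_subset by blast
  have tyW: "(t, y) : W" using tW[OF _ yc] t by simp
  show "hasR (%t. k t y) (k' t y) t" unfolding k_def k'_def
   by (rule DERIV_cong[OF DERIV_chain2[OF DERIV_real_sqrt[OF EW[OF tyW]] EF_t[OF ps WS[OF tyW]]]]) (simp add: field_simps)
  have "k' t y = (%z. k' (fst z) (snd z)) (t, y)" by simp
  moreover have "(t, y) : {-\<delta>..\<delta>} \<times> closure B" using t yc by (auto simp: abs_less_iff)
  ultimately show "\<bar>k' t y\<bar> <= C" using C by (metis (no_types, lifting) imageI real_norm_def)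
 qed
 moreover have "(LINT y:B|lborel. k' 0 y) = (LINT y:B|lborel. sqrt (Hf (\<iota> q)) * cmod (det LM) * (A.divL \<phi>F (ps y) * A.dens ps y))"
 proof (rule set_lebesgue_integral_cong)
  show "B : sets lborel" using B(1) by simp
  have "k' 0 y = sqrt (Hf (\<iota> q)) * cmod (det LM) * (A.divL \<phi>F (ps y) * A.dens ps y)" if y: "y : U" for y
  proof -
   have "ps y : A.L" using lpar_cont(2)[OF ps] y by blast
   hence s: "sqrt (EF ps (0, y)) = sqrt (Hf (\<iota> q)) * (cmod (det LM) * A.dens ps y)"
    using fF(5)[OF ps y] Hf_\<iota> by (simp add: EF_def real_sqrt_mult XiF_0(2)[OF ps y, symmetric])
   have E0: "0 < EF ps (0, y)" by (rule EW[OF W0[OF y]])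
   have dt: "fd (EF ps) (0, y) (1, 0) = 2 * EF ps (0, y) * A.divL \<phi>F (ps y)"
    by (rule EF_dt_0[OF _ ps y]) (rule max)
   have "k' 0 y = EF ps (0, y) / sqrt (EF ps (0, y)) * A.divL \<phi>F (ps y)"
    unfolding k'_def dt by simp
   also have "EF ps (0, y) / sqrt (EF ps (0, y)) = sqrt (EF ps (0, y))" using E0 by (simp add: real_div_sqrt)
   finally show ?thesis by (simp add: s mult_ac)
  qed
  thus "ALL y. y : B --> k' 0 y = sqrt (Hf (\<iota> q)) * cmod (det LM) * (A.divL \<phi>F (ps y) * A.dens ps y)" using B(4) by blast
 qed
 ultimately have "hasR (%t. LINT y:B|lborel. k t y) (sqrt (Hf (\<iota> q)) * cmod (det LM) * (LINT y:B|lborel. A.divL \<phi>F (ps y) * A.dens ps y)) 0"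
  by (simp only: set_integral_mult_right)
 thus ?thesis unfolding has_field_derivative_def
 proof (rule has_derivative_cong_nhds)
  have "(LINT y:B|lborel. k t y) = (LINT y:B|lborel. jvol_density M g (F t \<circ> ps) y)" if "\<bar>t\<bar> < \<delta>" for t
  proof (rule set_lebesgue_integral_cong)
   show "ALL y. y : B --> k t y = jvol_density M g (F t \<circ> ps) y"
    using density_F[OF ps WS[OF tW]] that closure_subset[of B] by (auto simp: k_def EF_def)
  qed (use B(1) in simp)
  thus "\<forall>\<^sub>F t in nhds 0. (LINT y:B|lborel. k t y) = (LINT y:B|lborel. jvol_density M g (F t \<circ> ps) y)"
   unfolding eventually_nhds_metric using r(1) by (intro exI[of _ \<delta>]) (simp add: \<delta>_def dist_real_def)
 qed
qed

lemma first_variation: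
 assumes max: "!!m. m : pts M ==> Hf m <= Hf (\<iota> q)"
 shows "hasR (%t. jvol M1 A.L M g (F t)) 0 0"
proof -
 let ?s = "sqrt (Hf (\<iota> q)) * cmod (det LM)"
 have "hasR (%t. \<Sum>(U, ps, B)\<in>\<D>. LINT y:B|lborel. jvol_density M g (F t \<circ> ps) y) (\<Sum>(U, ps, B)\<in>\<D>. ?s * (LINT y:B|lborel. A.divL \<phi>F (ps y) * A.dens ps y)) 0"
  unfolding case_prod_unfold
 proof (rule DERIV_sum)
  fix e assume "e : \<D>"
  hence "(fst e, fst (snd e), snd (snd e)) : \<D>" by simp
  note e = this
  show "hasR (%t. LINT y:snd (snd e)|lborel. jvol_density M g (F t \<circ> fst (snd e)) y) (?s * (LINT y:snd (snd e)|lborel. A.divL \<phi>F (fst (snd e) y) * A.dens (fst (snd e)) y)) 0"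
   by (rule piece_derivative[OF _ e]) (rule max)
 qed
 moreover have "(\<Sum>(U, ps, B)\<in>\<D>. ?s * (LINT y:B|lborel. A.divL \<phi>F (ps y) * A.dens ps y)) = ?s * A.Jint (A.divL \<phi>F)"
  by (simp add: A.Jint_def sum_distrib_left case_prod_unfold)
 ultimately show ?thesis using A.Jint_divL[OF \<phi>F_smooth] unfolding jvol_def dec_some[symmetric] by simp
qed

end

lemma (in orbvar) jvol_critical_\<iota>:
 assumes max: "!!m. m : pts M ==> Hf m <= Hf (\<iota> q)"
 shows "jvol_critical M1 A.L M g \<iota>" unfolding jvol_critical_def
proof (intro conjI allI impI totally_real_\<iota>)
 fix \<epsilon> F assume F: "totally_real_variation M1 A.L M \<iota> \<epsilon> F"
 interpret orbvarF K N G M act g p M1 act1 q \<D> \<iota> \<epsilon> F by unfold_locales (rule F)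
 show "hasR (%t. jvol M1 A.L M g (F t)) 0 0" by (rule first_variation) (rule max)
qed

section \<open>Convexity and critical points\<close>

context khom
begin

abbreviation "jv == orbit_jvol K N G M g act p"

lemma kact_group: "kact K N N (\<otimes>\<^bsub>K\<^esub>)"
 using lie mdl by unfold_locales (auto simp: complex_lie_group_def holomorphic_right_action_def topN m_assoc)

lemma corb_group: "corb K N G N (\<otimes>\<^bsub>K\<^esub>)" using kact_group creal_axioms by (simp add: corb_def)

lemma orbvarI:
 assumes c: "corb K N G M1 act1" and q: "corb.fin_stab K M1 act1 q"
  and \<iota>: "holomorphic_map M1 M \<iota>" "!!l x. l : pts M1 ==> x : carrier K ==> \<iota> (act1 l x) = act (\<iota> l) x" "\<iota> q : \<O>"
 shows "orbvar K N G M act g p M1 act1 q (SOME \<D>. param_decomposition M1 (act1 q ` G) \<D>) \<iota>"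
proof -
 interpret c: corb K N G M1 act1 by (rule c)
 have "param_decomposition M1 (act1 q ` G) (SOME \<D>. param_decomposition M1 (act1 q ` G) \<D>)"
  by (rule someI_ex[OF c.orbit_decomposition[OF q]])
 hence "orbint K N G M1 act1 q (SOME \<D>. param_decomposition M1 (act1 q ` G) \<D>)"
  using q unimod_G by (intro orbint.intro c orbint_axioms.intro)
 thus ?thesis using \<iota> by (intro orbvar.intro khom_axioms orbvar_axioms.intro refl)
qed

abbreviation orbmap where "orbmap k \<equiv> orbit_immersion K act p k"
abbreviation \<D>\<^sub>G where "\<D>\<^sub>G \<equiv> SOME \<D>. param_decomposition N ((\<otimes>\<^bsub>K\<^esub>) kone ` G) \<D>"

lemma kone_G: "(\<otimes>\<^bsub>K\<^esub>) kone ` G = G" using G_carrier by force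

lemma orbmap_one: "k : carrier K ==> orbmap k kone = act p k" by (simp add: orbit_immersion_def)

lemma mhol_orbmap: "k : carrier K ==> mhol N S h ==> mhol M S (%z. orbmap k (h z))"
 unfolding orbit_immersion_def by (intro mhol_act mhol_kmul mhol_const) (auto simp: topN pt mhol_open)

lemma holomorphic_orbmap:
 assumes k: "k : carrier K" shows "holomorphic_map N M (orbmap k)" unfolding holomorphic_map_def mdl
proof (intro conjI ballI)
 show "continuous_map (mtop N) (mtop M) (orbmap k)" unfolding orbit_immersion_def[abs_def]
  by (intro continuous_act_const[OF pt] continuous_kmul) (use k in "auto simp: topN")
 fix c c' assume c: "c : atlas N" "c' : atlas M"
 let ?S = "{y : chart_image c. orbmap k (chart_inv c y) : fst c'}"
 have cN: "complex_manifold N" using lie by (simp add: complex_lie_group_def)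
 have h: "mhol M (chart_image c) (%y. orbmap k (chart_inv c y))"
  by (rule mhol_orbmap[OF k mhol_chart_inv[OF cN mdl c(1)]])
 have "snd c ` {x : fst c. orbmap k x : fst c'} = ?S"
  using chart_inv_chart[OF chN c(1)] chart_chart_inv[OF chN c(1)] chart_inv_mem[OF chN c(1)] chart_mem_image[OF chN c(1)]
  by (auto simp: image_iff) metis
 moreover have "open ?S" by (rule mhol_open_preimage[OF h chart_openin[OF chM c(2)]])
 moreover have "cdiff_at (snd c' \<circ> orbmap k \<circ> chart_inv c) y" if "y : ?S" for y
  using mhol_cdiff[OF h c(2)] that by (simp add: o_def)
 ultimately show "complex_diff_on UNIV (snd c ` {x : fst c. orbmap k x : fst c'}) (snd c' \<circ> orbmap k \<circ> chart_inv c)"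
  by (simp add: complex_diff_on_open)
qed

lemma orbvar_group:
 assumes k: "k : carrier K"
 shows "orbvar K N G M act g p N (\<otimes>\<^bsub>K\<^esub>) kone \<D>\<^sub>G (orbmap k)"
proof (rule orbvarI[OF corb_group])
 have "{l : carrier K. kone \<odot> l = kone} = {kone}" by auto
 thus "corb.fin_stab K N (\<otimes>\<^bsub>K\<^esub>) kone" by (simp add: corb.fin_stab_def[OF corb_group] topN)
 show "holomorphic_map N M (orbmap k)" by (rule holomorphic_orbmap[OF k])
 show "orbmap k (l \<odot> x) = act (orbmap k l) x" if "l : pts N" "x : carrier K" for l x
  using that k pt by (simp add: orbit_immersion_def act_act topN m_assoc)
 show "orbmap k kone : \<O>" using k by (simp add: orbmap_one)
qed

definition vol\<^sub>G where "vol\<^sub>G = orbvar.vol K N G N (\<otimes>\<^bsub>K\<^esub>) \<D>\<^sub>G"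

lemma orbit_jvol_eq:
 assumes k: "k : carrier K"
 shows "jv k = vol\<^sub>G * sqrt (Hf (act p k))" "0 < vol\<^sub>G"
proof -
 interpret V: orbvar K N G M act g p N "(\<otimes>\<^bsub>K\<^esub>)" kone \<D>\<^sub>G "orbmap k" by (rule orbvar_group[OF k])
 show "jv k = vol\<^sub>G * sqrt (Hf (act p k))"
  using V.jvol_\<iota> unfolding kone_G orbit_jvol_def vol\<^sub>G_def orbmap_one[OF k] .
 show "0 < vol\<^sub>G" using V.vol_pos unfolding vol\<^sub>G_def .
qed

text \<open>The first variation is applied in both settings of \<open>orbvar\<close>: to the
  immersed copy of G and to the orbit as a subset of M.\<close>

lemma jvol_critical_max:
 assumes k: "k : carrier K" and max: "!!m. m : pts M ==> Hf m <= Hf (act p k)"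
 shows "jvol_critical N G M g (orbmap k)" "jvol_critical M (orbmap k ` G) M g id"
proof -
 interpret V: orbvar K N G M act g p N "(\<otimes>\<^bsub>K\<^esub>)" kone \<D>\<^sub>G "orbmap k" by (rule orbvar_group[OF k])
 have "jvol_critical N V.A.L M g (orbmap k)" by (rule V.jvol_critical_\<iota>) (simp add: max orbmap_one[OF k])
 thus "jvol_critical N G M g (orbmap k)" unfolding kone_G .
 have kO: "act p k : \<O>" using k by blast
 interpret W: orbvar K N G M act g p M act "act p k" "SOME \<D>. param_decomposition M (act (act p k) ` G) \<D>" id
  by (rule orbvarI[OF corb_axioms fin_stab_O[OF kO]]) (use cmM kO in "auto simp: complex_manifold_def")
 have "jvol_critical M W.A.L M g id" by (rule W.jvol_critical_\<iota>) (simp add: max)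
 moreover have "W.A.L = orbmap k ` G" using k pt G_carrier by (auto simp: orbit_immersion_def act_act image_iff)
 ultimately show "jvol_critical M (orbmap k ` G) M g id" by simp
qed

text \<open>A priori the maximum of H on M could lie outside the open orbit. But H > 0 makes the
  infinitesimal action at m invertible, so the points m exp Z fill a neighbourhood of m. It meets
  the dense orbit, which therefore contains m.\<close>

lemma max_in_O:
 assumes m: "m : pts M" and pos: "0 < Hf m"
 shows "m : \<O>"
proof -
 obtain c where c: "c : atlas M" "m : fst c" using charted_chart_at[OF chM m] by blast
 let ?f = "%Z. snd c (act m (Exp Z))" and ?A = "Am c (snd c m)"
 have F: "mhol M UNIV (%Z. act m (Exp Z))" by (intro mhol_act mhol_const mhol_Exp) (auto simp: m)
 define S where "S = {Z : UNIV. act m (Exp Z) : fst c}"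
 have S: "open S" unfolding S_def by (rule mhol_open_preimage[OF F chart_openin[OF chM c(1)]])
 have S0: "0 : S" using c(2) by (simp add: S_def act_one[OF m])
 have cd: "cdiff_at ?f Z" if "Z : S" for Z by (rule mhol_cdiff[OF F c(1)]) (use that in "auto simp: S_def")
 have A: "complex_linear ?A" by (rule Am_linear[OF c(1) chart_mem_image[OF chM c]])
 have inj: "?A X = 0 ==> X = 0" for X using pos Hf_pos_iff[OF c] complex_linear_det_inj[OF A] by (auto simp: dA_def)
 have bij: "bij ?A" by (rule complex_linear_bij[OF A inj])
 have dA: "fd ?f 0 v = ?A v" for v
 proof -
  have "hasD (%t. t *R v) (%t. t *R v) (0::real)" by (intro derivative_eq_intros) auto
  moreover have "hasD ?f (fd ?f 0) (0 *R v)" using cdiff_fd(1)[OF cd[OF S0]] by simp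
  ultimately have "hasD (%t. snd c (act m (Exp (t *R v)))) (%t. fd ?f 0 (t *R v)) 0"
   using hasD_chain unfolding o_def by blast
  from has_derivative_unique[OF this act_tang[OF c tang_Exp], THEN fun_cong, of 1] show ?thesis by simp
 qed
 hence D: "hasD ?f ?A 0" using cdiff_fd(1)[OF cd[OF S0]] by (metis ext)
 let ?g = "inv_into UNIV ?A"
 have lg: "linear ?g"
 proof -
  have Ag: "?A (?g v) = v" for v using bij by (simp add: f_inv_into_f bij_is_surj)
  have "linear ?A" using A by (simp add: clin_def)
  note L = linear_add[OF this] linear_scale[OF this]
  show ?thesis by (rule linearI; rule injD[OF bij_is_inj[OF bij]]) (simp_all add: Ag L)
 qed
 have "?f 0 : interior (?f ` S)"
 proof (rule sussmann_open_mapping[OF S _ S0 D])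
  show "continuous_on S ?f" by (intro cont_at_on ballI cdiff_at_isCont cd)
  show "bounded_linear ?g" using lg by (simp add: linear_conv_bounded_linear)
  show "?A \<circ> ?g = id" using bij by (auto simp: f_inv_into_f bij_is_surj)
 qed (use S S0 in "auto simp: interior_open")
 hence "snd c m : interior (?f ` S)" by (simp add: act_one[OF m])
 moreover have "openin (mtop M) {z : pts M \<inter> fst c. snd c z : interior (?f ` S)}"
  using openin_continuous_map_preimage[OF continuous_map_chart[OF chM c(1)], of "interior (?f ` S)"] openin_trans_full chart_openin[OF chM c(1)] by auto
 moreover have "m : mtop M closure_of \<O>" using m denseO by simp
 ultimately obtain z where z: "z : \<O>" "z : fst c" "snd c z : interior (?f ` S)"
  using m c(2) unfolding in_closure_of by (metis (no_types, lifting) IntI mem_Collect_eq IntE)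
 then obtain Z where Z: "Z : S" "snd c z = ?f Z" using interior_subset by blast
 have "chart_inv c (?f Z) = act m (Exp Z)" using chart_inv_chart[OF chM c(1)] Z(1) by (simp add: S_def)
 with chart_inv_chart[OF chM c(1) z(2), unfolded Z(2), symmetric] have "z = act m (Exp Z)" by (rule trans)
 hence "act z (kinv (Exp Z)) = m" using m by (simp add: act_act act_one)
 thus ?thesis using act_O[OF z(1), of "kinv (Exp Z)"] by simp
qed

text \<open>\<open>second_variation\<close> only speaks about parameters near 0. It is applied at
  every point of the curve and translated back by Exp (s + t) = Exp t Exp s.\<close>

lemma geodesic_log:
 assumes ric: "ricci_positive M g" and m: "m : \<O>" and X: "X : \<gg>" "X ~= 0"
 shows "EX f. ALL t. hasR (%t. ln (Hf (act m (Exp (t *R imul X))))) (f t) t &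
  (EX c<0. hasR f c t)"
proof -
 let ?h = "%t. ln (Hf (act m (Exp (t *R imul X))))"
 have mt: "m : pts M" using fin_stab_O[OF m] by (simp add: fin_stab_def)
 have loc: "EX \<delta>>0. EX d e. (ALL s. \<bar>s\<bar> < \<delta> --> hasR ?h (d s) (s + t)) & hasR d e 0 & e < 0" for t
 proof -
  let ?n = "act m (Exp (t *R imul X))"
  have n: "?n : \<O>" by (rule act_O[OF m Exp_carrier])
  have nt: "?n : pts M" using fin_stab_O[OF n] by (simp add: fin_stab_def)
  obtain c where c: "c : atlas M" "?n : fst c" using charted_chart_at[OF chM nt] by blast
  have yc: "snd c ?n : chart_image c" by (rule chart_mem_image[OF chM c])
  define v where "v = Am c (snd c ?n) X"
  obtain \<delta> d1 d2 e1 e2 where s: "0 < (\<delta>::real)"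
   "!!t. \<bar>t\<bar> < \<delta> ==> hasR (%t. ln (Hf (act ?n (Exp (t *R X))))) (d1 t) t"
   "!!t. \<bar>t\<bar> < \<delta> ==> hasR (%t. ln (Hf (act ?n (Exp (t *R imul X))))) (d2 t) t"
   "hasR d1 e1 0" "hasR d2 e2 0"
   "e1 + e2 = - (ricci (g c) (snd c ?n) v v + ricci (g c) (snd c ?n) (imul v) (imul v))"
   by (rule second_variation[OF c Hf_pos[OF fin_stab_O[OF n]] v_def]) blast
  have "d1 t = 0" if "\<bar>t\<bar> < \<delta>" for t
   using DERIV_unique[OF s(2)[OF that], of 0] Hf_G[OF nt Exp_G[OF X(1)]] by simp
  hence "hasR (%t. 0) e1 0" using s(4) unfolding has_field_derivative_def
   by (elim hasD_transform[OF _ open_ball[of 0 \<delta>]]) (use s(1) in \<open>auto simp: dist_real_def\<close>)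
  \<comment> \<open>H is constant along exp (tX) with X in the Lie algebra of G, so the whole of
    minus the Ricci sum falls to the direction iX.\<close>
  hence e1: "e1 = 0" using DERIV_unique[OF _ DERIV_const] by blast
  have v0: "v ~= 0" using Am_inj'[OF fin_stab_O[OF n] c] X(2) by (auto simp: v_def)
  hence "imul v ~= 0" by (metis norm_eq_zero norm_imul)
  hence "0 < ricci (g c) (snd c ?n) v v" "0 < ricci (g c) (snd c ?n) (imul v) (imul v)"
   using ric c(1) yc v0 unfolding ricci_positive_def by blast+
  hence "e2 < 0" using s(6) by (simp add: e1)
  moreover have "hasR ?h (d2 s) (s + t)" if "\<bar>s\<bar> < \<delta>" for s
  proof -
   have "act ?n (Exp (s *R imul X)) = act m (Exp ((s + t) *R imul X))" for s
    using Exp_add[of t s "imul X"] by (simp add: act_act[OF mt] add.commute)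
   hence "hasR (%s. ?h (s + t)) (d2 s) s" using s(3)[OF that] by simp
   thus ?thesis by (simp only: DERIV_shift)
  qed
  ultimately show ?thesis using s(1,5) by blast
 qed
 \<comment> \<open>The local derivatives depend on the base point; \<open>deriv\<close> joins them
   into one function on the line.\<close>
 have D: "hasR ?h (deriv ?h t) t" for t
 proof -
  obtain \<delta> d where "0 < (\<delta>::real)" "ALL s. \<bar>s\<bar> < \<delta> --> hasR ?h (d s) (s + t)" using loc by blast
  hence "hasR ?h (d 0) t" by (metis abs_zero add_0)
  thus ?thesis by (simp add: DERIV_imp_deriv)
 qed
 have "EX c<0. hasR (deriv ?h) c t" for t
 proof -
  obtain \<delta> d e where d: "0 < (\<delta>::real)" "!!s. \<bar>s\<bar> < \<delta> ==> hasR ?h (d s) (s + t)"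
   "hasR d e 0" "e < 0" using loc by metis
  have "hasD (%s. deriv ?h (s + t)) ((*) e) 0"
   by (rule hasD_transform[OF d(3)[unfolded has_field_derivative_def] open_ball[of 0 \<delta>]])
    (use d(1) DERIV_imp_deriv[OF d(2)] in \<open>auto simp: dist_real_def\<close>)
  hence "hasR (%s. deriv ?h (s + t)) e 0" unfolding has_field_derivative_def .
  hence "hasR (deriv ?h) e (0 + t)" unfolding DERIV_shift .
  thus ?thesis using d(4) by auto
 qed
 with D show ?thesis by blast
qed

lemma orbit_jvol_geodesic:
 assumes k: "k : carrier K"
 shows "jv (k \<odot> lie_exp K N (t *R imul X)) = vol\<^sub>G * sqrt (Hf (act (act p k) (Exp (t *R imul X))))"
 using k pt by (simp add: lie_exp_Exp orbit_jvol_eq act_act)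

lemma Hf_O: "k : carrier K ==> 0 < Hf (act p k)" by (rule Hf_pos[OF fin_stab_O]) blast

lemma orbit_jvol_pos: "k : carrier K ==> 0 < jv k"
 using orbit_jvol_eq Hf_O by simp

lemma geodesically_strictly_convex_log:
 assumes ric: "ricci_positive M g"
 shows "geodesically_strictly_convex K N G (%k. - ln (jv k))"
 unfolding geodesically_strictly_convex_def
proof (intro ballI impI)
 fix k X assume k: "k : carrier K" and X: "X : \<gg>" "X ~= 0"
 have kO: "act p k : \<O>" using k by blast
 obtain f where f: "!!t. hasR (%t. ln (Hf (act (act p k) (Exp (t *R imul X))))) (f t) t"
  "!!t. EX c<0. hasR f c t" using geodesic_log[OF ric kO X] by blast
 have eq: "- ln (jv (k \<odot> lie_exp K N (t *R imul X))) =
   - ln vol\<^sub>G - ln (Hf (act (act p k) (Exp (t *R imul X)))) / 2" for t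
  using orbit_jvol_eq(2)[OF k] Hf_pos[OF fin_stab_O[OF act_O[OF kO Exp_carrier]], of "t *R imul X"]
  by (simp add: orbit_jvol_geodesic[OF k] ln_mult ln_sqrt)
 show "strictly_convex_on_line (%t. - ln (jv (k \<odot> lie_exp K N (t *R imul X))))"
  unfolding eq
 proof (rule strictly_convex_on_line_second_derivative)
  fix t
  show "hasR (%t. - ln vol\<^sub>G - ln (Hf (act (act p k) (Exp (t *R imul X)))) / 2) (- f t / 2) t"
   using DERIV_diff[OF DERIV_const DERIV_cdivide[OF f(1)]] by simp
  obtain e where e: "e < 0" "hasR f e t" using f(2) by blast
  thus "EX c>0. hasR (%t. - f t / 2) c t"
   using DERIV_cdivide[OF DERIV_minus[OF e(2)], where c = 2] e(1) by (intro exI[of _ "- e / 2"]) simp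
 qed
qed

text \<open>1/V is the exponential of -log V.\<close>

lemma geodesically_strictly_convex_inverse:
 assumes ric: "ricci_positive M g"
 shows "geodesically_strictly_convex K N G (%k. 1 / jv k)"
 unfolding geodesically_strictly_convex_def
proof (intro ballI impI)
 fix k X assume a: "k : carrier K" "X : \<gg>" "X ~= 0"
 have "exp (- ln (jv (k \<odot> lie_exp K N (t *R imul X)))) = 1 / jv (k \<odot> lie_exp K N (t *R imul X))" for t
  using orbit_jvol_pos[of "k \<odot> lie_exp K N (t *R imul X)"] a(1) by (simp add: lie_exp_Exp exp_minus inverse_eq_divide)
 moreover have "strictly_convex_on_line (%t. - ln (jv (k \<odot> lie_exp K N (t *R imul X))))"
  using geodesically_strictly_convex_log[OF ric] a unfolding geodesically_strictly_convex_def by blast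
 ultimately show "strictly_convex_on_line (%t. 1 / jv (k \<odot> lie_exp K N (t *R imul X)))"
  using strictly_convex_on_line_exp[of "%t. - ln (jv (k \<odot> lie_exp K N (t *R imul X)))"] by simp
qed

lemma orbit_jvol_coset: "k : carrier K ==> x : G ==> jv (k \<odot> x) = jv k"
 using Hf_G[of "act p k" x] G_carrier pt by (simp add: orbit_jvol_eq act_act act_closed)

lemma orbit_jvol_derivative:
 assumes l: "l : carrier K" and c: "c : atlas N" "l : fst c"
 shows "(jv \<circ> chart_inv c) differentiable (at (snd c l))"
proof -
 have cN: "complex_manifold N" using lie by (simp add: complex_lie_group_def)
 have lc: "snd c l : chart_image c" by (rule chart_mem_image[OF chN c])
 let ?f = "%y. act p (chart_inv c y)"
 have h: "mhol M (chart_image c) ?f"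
  by (intro mhol_act mhol_const mhol_chart_inv cN mdl c chart_image_open[OF chN]) (simp add: pt)
 note o = mhol_open[OF h]
 have "cont_diff (Suc 0) (chart_image c) (%y. Hf (?f y))"
 proof (rule Hf_smooth[OF o mhol_continuous[OF h]])
  fix c' assume c': "c' : atlas M"
  show "smooth_on {y : chart_image c. ?f y : fst c'} (%y. snd c' (?f y))"
   by (rule cdiff_smooth[OF mhol_open_preimage[OF h chart_openin[OF chM c']] mhol_cdiff[OF h c']]) auto
 qed
 from cd_SucD(1)[OF this lc]
 have "hasD (%y. Hf (?f y)) (fd (%y. Hf (?f y)) (snd c l)) (snd c l)" .
 moreover have "0 < Hf (?f (snd c l))" using Hf_O[OF l] by (simp add: chart_inv_chart[OF chN c])
 ultimately obtain D where "hasD (%y. vol\<^sub>G * sqrt (Hf (?f y))) D (snd c l)"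
  using has_derivative_mult_right[OF has_derivative_real_sqrt, of "%y. Hf (?f y)" "snd c l"] by blast
 hence "hasD (jv \<circ> chart_inv c) D (snd c l)"
  by (rule hasD_transform[OF _ o lc])
   (use mhol_topspace[OF mhol_chart_inv[OF cN mdl c(1)]] in \<open>simp add: topN orbit_jvol_eq\<close>)
 thus ?thesis unfolding differentiable_def by blast
qed

lemma critical_point_of_max:
 assumes l: "l : carrier K" and max: "!!x. x : carrier K ==> jv x <= jv l"
 shows "critical_point N (jv) l" unfolding critical_point_def
proof (intro conjI ballI impI)
 show "l : pts N" using l by (simp add: topN)
 fix c assume c: "c : atlas N" "l : fst c"
 have cN: "complex_manifold N" using lie by (simp add: complex_lie_group_def)
 let ?v = "jv \<circ> chart_inv c"
 obtain D where D: "hasD ?v D (snd c l)" using orbit_jvol_derivative[OF l c] unfolding differentiable_def by blast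
 have "D = (%v. 0)"
  by (rule differential_zero_maxmin[OF chart_mem_image[OF chN c] chart_image_open[OF chN c(1)] D])
   (use max mhol_topspace[OF mhol_chart_inv[OF cN mdl c(1)]] in \<open>auto simp: chart_inv_chart[OF chN c] topN\<close>)
 thus "hasD ?v (%_. 0) (snd c l)" using D by simp
qed

text \<open>By the polar decomposition k and l are joined by the curve k exp (tiX), up to a factor
  from G. If X were nonzero, log H would be strictly concave along it with derivative 0 at t = 1,
  and so larger at l than at k.\<close>

lemma critical_point_unique:
 assumes ric: "ricci_positive M g" and k: "k : carrier K" and l: "l : carrier K"
  and max: "!!x. x : carrier K ==> jv x <= jv k"
  and crit: "critical_point N (jv) l"
 shows "l : k <#\<^bsub>K\<^esub> G"
proof -
 let ?v = "jv"
 obtain X x where X: "X : \<gg>" "x : G" "kinv k \<odot> l = Exp (imul X) \<odot> x" using polar_surj[of "kinv k \<odot> l"] k l by auto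
 have xK: "x : carrier K" using X(2) G_carrier by blast
 have "l = k \<odot> (kinv k \<odot> l)" using k l by (simp add: m_assoc[symmetric])
 hence lx: "l = k \<odot> (Exp (imul X) \<odot> x)" by (simp only: X(3))
 have "X = 0"
 proof (rule ccontr)
  assume X0: "X ~= 0"
  have kO: "act p k : \<O>" using k by blast
  let ?h = "%t. ln (Hf (act (act p k) (Exp (t *R imul X))))"
  obtain f where f: "!!t. hasR ?h (f t) t" "!!t. EX c<0. hasR f c t"
   using geodesic_log[OF ric kO X(1) X0] by blast
  \<comment> \<open>The factor x makes the curve end exactly at l, where criticality is assumed; the
    functional does not see x, by invariance on cosets.\<close>
  let ?\<gamma> = "%t. k \<odot> (Exp (t *R imul X) \<odot> x)"
  obtain c where c: "c : atlas N" "l : fst c" using charted_chart_at[OF chN, of l] l unfolding topN by blast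
  have m: "mhol N UNIV (%Z. k \<odot> (Exp Z \<odot> x))" by (intro mhol_kmul mhol_const mhol_Exp) (use k xK in "auto simp: topN")
  have "cdiff_at (%Z. snd c (k \<odot> (Exp Z \<odot> x))) (1 *R imul X)" by (rule mhol_cdiff[OF m c(1)]) (use c(2) lx in auto)
  note cd = cdiff_fd(1)[OF this]
  have "hasD (%t. t *R imul X) (%t. t *R imul X) (1::real)" by (intro derivative_eq_intros) auto
  from hasD_chain[OF this cd, unfolded o_def]
  obtain D where D: "hasD (%t. snd c (?\<gamma> t)) D 1" by blast
  have \<gamma>1: "?\<gamma> 1 = l" using lx by simp
  have "hasD (?v \<circ> chart_inv c) (%_. 0) (snd c (?\<gamma> 1))"
   unfolding \<gamma>1 using crit c by (simp add: critical_point_def)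
  from hasD_chain[OF D this] have 0: "hasD (%t. ?v (chart_inv c (snd c (?\<gamma> t)))) (%_. 0) 1" by (simp add: o_def)
  have vt: "?v (?\<gamma> t) = vol\<^sub>G * sqrt (Hf (act (act p k) (Exp (t *R imul X))))" for t
   using orbit_jvol_coset[OF _ X(2), of "k \<odot> Exp (t *R imul X)"] k xK pt by (simp add: m_assoc orbit_jvol_eq act_act)
  have "continuous_map (top_of_set UNIV) (mtop N) ?\<gamma>"
   using cm_compose[OF _ mhol_continuous[OF m], of euclidean "%t. t *R imul X"] by (simp add: o_def continuous_intros)
  from open_preimage[OF this open_UNIV chart_openin[OF chN c(1)]] have o: "open {t. ?\<gamma> t : fst c}" by simp
  have "hasD (%t. ?v (?\<gamma> t)) (%_. 0) 1"
   by (rule hasD_transform[OF 0 o]) (use c(2) \<gamma>1 chart_inv_chart[OF chN c(1)] in auto)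
  hence w: "hasR (%t. vol\<^sub>G * sqrt (Hf (act (act p k) (Exp (t *R imul X))))) 0 1"
   unfolding vt has_field_derivative_def by (rule has_derivative_eq_rhs) (simp add: fun_eq_iff)
  have Hp: "0 < Hf (act (act p k) (Exp (t *R imul X)))" for t by (rule Hf_pos[OF fin_stab_O[OF act_O[OF kO Exp_carrier]]])
  have "0 < vol\<^sub>G * sqrt (Hf (act (act p k) (Exp (1 *R imul X))))"
   by (rule mult_pos_pos[OF orbit_jvol_eq(2)[OF k] real_sqrt_gt_zero[OF Hp]])
  \<comment> \<open>log H is recovered from the volume as 2 (log V - log
    \<open>vol\<^sub>G\<close>), so its derivative at t = 1 is zero as well.\<close>
  from DERIV_cmult[OF DERIV_diff[OF DERIV_chain2[OF DERIV_ln[OF this] w] DERIV_const[of "ln vol\<^sub>G"]], of 2]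
  have "hasR (%t. 2 * (ln (vol\<^sub>G * sqrt (Hf (act (act p k) (Exp (t *R imul X))))) - ln vol\<^sub>G)) 0 1"
   by simp
  moreover have "2 * (ln (vol\<^sub>G * sqrt (Hf (act (act p k) (Exp (t *R imul X))))) - ln vol\<^sub>G) = ?h t" for t
   using Hp[of t] orbit_jvol_eq(2)[OF k] by (simp add: ln_mult ln_sqrt)
  ultimately have f1: "f 1 = 0" using DERIV_unique[OF f(1)[of 1], of 0] by simp
  obtain u where u: "0 < u" "u < 1" "?h 1 - ?h 0 = (1 - 0) * f u" using MVT2[of 0 1 ?h f] f(1) by auto
  have "f 1 < f u" by (rule DERIV_neg_imp_decreasing[OF u(2)]) (use f(2) in blast)
  hence "?h 0 < ?h 1" using u(3) f1 by simp
  hence "Hf (act p k) < Hf (act (act p k) (Exp (1 *R imul X)))"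
   using Hp[of 0] Hp[of 1] act_closed[OF pt k] by (simp add: act_one)
  moreover have "?v (?\<gamma> 1) <= ?v k" using max l \<gamma>1 by simp
  ultimately show False using vt[of 1] orbit_jvol_eq[OF k] by simp
 qed
 hence "l = k \<odot> x" using lx xK by (simp add: linear_0[OF linear_imul])
 thus ?thesis using X(2) by (auto simp: l_coset_def)
qed

theorem ricci_positive_conclusions:
 assumes ric: "ricci_positive M g"
 shows "EX k:carrier K.
  (ALL l:carrier K. critical_point N (jv) l \<longleftrightarrow> l : k <#\<^bsub>K\<^esub> G) &
  (ALL l:carrier K. jv l <= jv k) &
  jvol_critical N G M g (orbmap k) & jvol_critical M (orbmap k ` G) M g id"
proof -
 obtain m where m: "m : pts M" "!!x. x : pts M ==> Hf x <= Hf m"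
  using Hf_max[OF cptM] pt by blast
 have "m : \<O>" by (rule max_in_O[OF m(1)]) (use m(2)[OF pt] Hf_pos[OF fsp] in simp)
 then obtain k where k: "k : carrier K" "m = act p k" by blast
 have maxk: "jv l <= jv k" if "l : carrier K" for l
  using m(2)[OF act_closed[OF pt that]] orbit_jvol_eq(2)[OF k(1)] by (simp add: orbit_jvol_eq(1) that k)
 have "critical_point N (jv) l \<longleftrightarrow> l : k <#\<^bsub>K\<^esub> G" if l: "l : carrier K" for l
 proof
  assume "l : k <#\<^bsub>K\<^esub> G"
  then obtain x where "x : G" "l = k \<odot> x" by (auto simp: l_coset_def)
  thus "critical_point N (jv) l"
   using critical_point_of_max[OF l] maxk orbit_jvol_coset[OF k(1)] by simp
 qed (rule critical_point_unique[OF ric k(1) l maxk])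
 moreover have "Hf x <= Hf (act p k)" if "x : pts M" for x using m(2)[OF that] k(2) by simp
 ultimately show ?thesis using k(1) maxk jvol_critical_max[OF k(1)] by blast
qed

end

lemma khom_of_compactification:
 assumes c: "complexification K N G" and m: "compactification K N M act p" and g: "kaehler_metric M g"
  and iso: "ALL x:G. preserves_metric M g (%m. act m x)"
 shows "khom K N G M act g p"
proof -
 have clg: "clg K N" using c by unfold_locales (auto simp: complexification_def)
 then interpret clg K N .
 have cr: "creal K N G"
 proof (intro creal.intro clg creal_axioms.intro)
  note c' = c[unfolded complexification_def polar_diffeo_def]
  show "subgroup G K" "compactin (mtop N) G" "subspace (lie_algebra K N G)" using c' by blast+
  show "EX! (X, Y). X : lie_algebra K N G & Y : lie_algebra K N G & Z = X + imul Y" for Z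
   using c unfolding complexification_def by (elim conjE) (erule spec)
  have GK: "x : carrier K" if "x : G" for x using c' that by (meson subgroup.mem_carrier)
  have h: "homeomorphic_map (prod_topology (top_of_set (lie_algebra K N G)) (subtopology (mtop N) G)) (mtop N) (polar_map K N)"
   using c' by blast
  have top: "topspace (prod_topology (top_of_set (lie_algebra K N G)) (subtopology (mtop N) G)) = lie_algebra K N G \<times> G"
   using GK by (auto simp: topN)
  have pm: "polar_map K N (X, x) = Exp (imul X) \<odot> x" for X x by (simp add: polar_map_def lie_exp_Exp)
  show "X = X' & x = x'" if "X : lie_algebra K N G" "X' : lie_algebra K N G" "x : G" "x' : G"
   "Exp (imul X) \<odot> x = Exp (imul X') \<odot> x'" for X X' x x'
   using inj_onD[OF homeomorphic_imp_injective_map[OF h], of "(X, x)" "(X', x')"] that unfolding top pm by blast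
  show "EX X:lie_algebra K N G. EX x:G. k = Exp (imul X) \<odot> x" if "k : carrier K" for k
   using homeomorphic_imp_surjective_map[OF h] that unfolding top topN by (force simp: pm)
 qed
 have km: "kact K N M act" using m by unfold_locales (auto simp: compactification_def)
 hence cb: "corb K N G M act" using cr by (simp add: corb_def)
 then interpret corb K N G M act .
 have "kmet K N M act g" using km g by (simp add: kmet_def kmet_axioms_def)
 moreover have "khom_axioms K G M act g p"
  using m iso by unfold_locales (auto simp: compactification_def fin_stab_def)
 ultimately show ?thesis using cb by (simp add: khom_def)
qed
theorem theorem4p2:
  fixes K :: "'k monoid" and N :: "('k, complex ^ 'n) cmfd" and G :: "'k set"
    and M :: "('m, complex ^ 'n) cmfd" and act :: "'m \<Rightarrow> 'k \<Rightarrow> 'm" and p :: 'm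
    and g :: "('m, 'n) metric"
  assumes "complexification K N G"
    and "compactification K N M act p"
    and "kaehler_metric M g"
    and "\<forall>x\<in>G. preserves_metric M g (\<lambda>m. act m x)"
  shows "\<not> ricci_negative M g \<and>
    (ricci_positive M g \<longrightarrow>
      coset_invariant K G (orbit_jvol K N G M g act p) \<and>
      geodesically_strictly_convex K N G (\<lambda>k. - ln (orbit_jvol K N G M g act p k)) \<and>
      geodesically_strictly_convex K N G (\<lambda>k. 1 / orbit_jvol K N G M g act p k) \<and>
      (\<exists>k\<in>carrier K.
        (\<forall>l\<in>carrier K. critical_point N (orbit_jvol K N G M g act p) l \<longleftrightarrow> l \<in> k <#\<^bsub>K\<^esub> G) \<and>
        (\<forall>l\<in>carrier K. orbit_jvol K N G M g act p l \<le> orbit_jvol K N G M g act p k) \<and>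
        jvol_critical N G M g (orbit_immersion K act p k) \<and>
        jvol_critical M (orbit_immersion K act p k ` G) M g id))"
proof -
  interpret khom K N G M act g p by (rule khom_of_compactification[OF assms])
  have "\<not> ricci_negative M g" by (rule not_ricci_negative[OF cptM pt Hf_pos[OF fsp]])
  moreover have "coset_invariant K G (orbit_jvol K N G M g act p)"
    unfolding coset_invariant_def using orbit_jvol_coset by blast
  ultimately show ?thesis
    using geodesically_strictly_convex_log geodesically_strictly_convex_inverse ricci_positive_conclusions by blast
qed

end
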